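(* Suppose that $m_0\in L^2(\Omega)$ is nonnegative a.e. in $\Omega$, that $G$ is nonnegative in the sense of distributions in $L^2(0,T;H^{-1}(\Omega))$, that $F$ is strictly monotone on $X$, and that $S$ is monotone on $L^2(\Omega)$. Then there is at most one weak solution $(u,m)\in X\times Y$, i.e. at most one pair $(u,m)\in X\times Y$ such that $m(0)=m_0$ in $L^2(\Omega)$ and such that there exists $\tilde b_*\in\mathcal{D}_pH[u]$ with, for all $\psi\in Y_0$ and all $\phi\in X$, $$\int_0^T \langle\partial_t\psi,u\rangle+\nu(\nabla u,\nabla\psi)_\Omega+(H[\nabla u],\psi)_\Omega\,\mathrm{d}t=\int_0^T\langle F[m],\psi\rangle\,\mathrm{d}t+(S[m(T)],\psi(T))_\Omega,$$ $$\int_0^T\langle\partial_t m,\phi\rangle+\nu(\nabla m,\nabla\phi)_\Omega+(m\tilde b_*,\nabla\phi)_\Omega\,\mathrm{d}t=\int_0^T\langle G,\phi\rangle\,\mathrm{d}t.$$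
   Context: Spaces. Let $d\ge 2$, let $\Omega\subset\mathbb{R}^d$ be a bounded, open, connected set with Lipschitz boundary, let $T>0$, let $\nu>0$ be constant, and $Q_T=(0,T)\times\Omega$. $\|\cdot\|_\Omega$ and $(\cdot,\cdot)_\Omega$ denote the $L^2(\Omega)$ norm and inner product (scalar- or vector-valued), $\|\cdot\|_{Q_T}$ the norm of $L^2(0,T;L^2(\Omega))$, and $\langle\cdot,\cdot\rangle$ the duality pairing between $H^{-1}(\Omega)$ and $H^1_0(\Omega)$. Set $X=L^2(0,T;H^1_0(\Omega))$, $Y=L^2(0,T;H^1_0(\Omega))\cap H^1(0,T;H^{-1}(\Omega))$ (which embeds continuously in $C([0,T];L^2(\Omega))$), and $Y_0=\{v\in Y: v(0)=0\}$. Hamiltonian. $\mathcal{A}$ is a (nonempty) compact metric space, $b:[0,T]\times\overline\Omega\times\mathcal{A}\to\mathbb{R}^d$ and $f:[0,T]\times\overline\Omega\times\mathcal{A}\to\mathbb{R}$ are uniformly continuous, and $H(t,x,p)=\sup_{\alpha\in\mathcal{A}}(b(t,x,\alpha)\cdot p-f(t,x,\alpha))$. The subdifferential is $\partial_pH(t,x,p)=\{z\in\mathbb{R}^d: H(t,x,q)\ge H(t,x,p)+z\cdot(q-p)\ \forall q\in\mathbb{R}^d\}$. For $w\in L^1(0,T;W^{1,1}(\Omega))$, $\mathcal{D}_pH[w]$ is the set of $\tilde b\in L^\infty(Q_T;\mathbb{R}^d)$ with $\tilde b(t,x)\in\partial_pH(t,x,\nabla w(t,x))$ for a.e. $(t,x)\in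 Q_T$, and $H[\nabla w](t,x)=H(t,x,\nabla w(t,x))$. Data. $G\in L^2(0,T;H^{-1}(\Omega))$, $m_0\in L^2(\Omega)$. $F:L^2(0,T;L^2(\Omega))\to L^2(0,T;H^{-1}(\Omega))$ is continuous and there is $C_F>0$ with $\|F[v]\|_{L^2(0,T;H^{-1}(\Omega))}\le C_F(\|v\|_{Q_T}+1)$ for all $v$. $S:L^2(\Omega)\to L^2(\Omega)$ is continuous and there is $C_S\ge0$ with $\|S[v]\|_\Omega\le C_S(\|v\|_\Omega+1)$ for all $v$. Monotonicity and sign conditions. $G$ is nonnegative in the sense of distributions if $\int_0^T\langle G,v\rangle\,\mathrm{d}t\ge0$ for all $v\in X$ with $v\ge0$ a.e. in $Q_T$. $F$ is strictly monotone on $X$ if for $w,v\in X$, $\int_0^T\langle F[w]-F[v],w-v\rangle\,\mathrm{d}t\le0$ implies $w=v$ in $X$. $S$ is monotone on $L^2(\Omega)$ if $(S[w]-S[v],w-v)_\Omega\ge0$ for all $w,v\in L^2(\Omega)$. *)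

theory Defs
  imports "HOL-Analysis.Analysis"
begin

(* Elements of L^2(Omega), H^1_0(Omega), L^2(0,T;V), ... are represented by functions.
   Equality in these spaces is equality almost everywhere, and is written out as such. *)

section \<open>Domains and test functions\<close>

definition lipschitz_boundary :: "'a::euclidean_space set \<Rightarrow> bool" where
  "lipschitz_boundary \<Omega> \<longleftrightarrow>
     (\<forall>z\<in>frontier \<Omega>. \<exists>e r \<gamma> L. norm e = 1 \<and> r > 0 \<and>
        L-lipschitz_on {y. y \<bullet> e = 0} (\<gamma> :: 'a \<Rightarrow> real) \<and>
        \<Omega> \<inter> ball z r = {x \<in> ball z r. \<gamma> (x - (x \<bullet> e) *\<^sub>R e) < x \<bullet> e})"

definition partial_deriv :: "('a::euclidean_space \<Rightarrow> real) \<Rightarrow> 'a \<Rightarrow> 'a \<Rightarrow> real" where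
  "partial_deriv \<phi> i x = frechet_derivative \<phi> (at x) i"

primrec Ck :: "nat \<Rightarrow> ('a::euclidean_space \<Rightarrow> real) \<Rightarrow> bool" where
  "Ck 0 \<phi> \<longleftrightarrow> continuous_on UNIV \<phi>"
| "Ck (Suc k) \<phi> \<longleftrightarrow> (\<forall>x. \<phi> differentiable (at x)) \<and> (\<forall>i\<in>Basis. Ck k (partial_deriv \<phi> i))"

definition test_functions :: "'a::euclidean_space set \<Rightarrow> ('a \<Rightarrow> real) set" where
  "test_functions U =
     {\<phi>. (\<forall>k. Ck k \<phi>) \<and> compact (closure {x. \<phi> x \<noteq> 0}) \<and> closure {x. \<phi> x \<noteq> 0} \<subseteq> U}"


section \<open>Spaces on the spatial domain\<close>

definition L2 :: "'a::euclidean_space set \<Rightarrow> ('a \<Rightarrow> 'b::euclidean_space) set" where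
  "L2 \<Omega> = {v. v \<in> borel_measurable (lebesgue_on \<Omega>) \<and>
              integrable (lebesgue_on \<Omega>) (\<lambda>x. (norm (v x))\<^sup>2)}"

definition L2_inner ::
  "'a::euclidean_space set \<Rightarrow> ('a \<Rightarrow> 'b::euclidean_space) \<Rightarrow> ('a \<Rightarrow> 'b) \<Rightarrow> real" where
  "L2_inner \<Omega> v w = (LINT x|lebesgue_on \<Omega>. v x \<bullet> w x)"

definition L2_norm :: "'a::euclidean_space set \<Rightarrow> ('a \<Rightarrow> 'b::euclidean_space) \<Rightarrow> real" where
  "L2_norm \<Omega> v = sqrt (L2_inner \<Omega> v v)"

definition is_weak_grad ::
  "'a::euclidean_space set \<Rightarrow> ('a \<Rightarrow> real) \<Rightarrow> ('a \<Rightarrow> 'a) \<Rightarrow> bool" where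
  "is_weak_grad \<Omega> v g \<longleftrightarrow>
     (\<forall>K. compact K \<and> K \<subseteq> \<Omega> \<longrightarrow> v absolutely_integrable_on K \<and> g absolutely_integrable_on K) \<and>
     (\<forall>\<phi>\<in>test_functions \<Omega>. \<forall>i\<in>Basis.
        (LINT x|lebesgue_on \<Omega>. v x * partial_deriv \<phi> i x) =
        - (LINT x|lebesgue_on \<Omega>. (g x \<bullet> i) * \<phi> x))"

(* The weak gradient is unique up to a null set; this is an arbitrary representative. *)
definition weak_grad :: "'a::euclidean_space set \<Rightarrow> ('a \<Rightarrow> real) \<Rightarrow> 'a \<Rightarrow> 'a" where
  "weak_grad \<Omega> v = (SOME g. is_weak_grad \<Omega> v g)"

definition H1 :: "'a::euclidean_space set \<Rightarrow> ('a \<Rightarrow> real) set" where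
  "H1 \<Omega> = {v \<in> L2 \<Omega>. \<exists>g\<in>L2 \<Omega>. is_weak_grad \<Omega> v g}"

definition H1_norm :: "'a::euclidean_space set \<Rightarrow> ('a \<Rightarrow> real) \<Rightarrow> real" where
  "H1_norm \<Omega> v = sqrt ((L2_norm \<Omega> v)\<^sup>2 + (L2_norm \<Omega> (weak_grad \<Omega> v))\<^sup>2)"

(* The closure of the test functions in H^1. *)
definition H10 :: "'a::euclidean_space set \<Rightarrow> ('a \<Rightarrow> real) set" where
  "H10 \<Omega> = {v \<in> H1 \<Omega>. \<forall>\<epsilon>>0. \<exists>\<phi>\<in>test_functions \<Omega>. H1_norm \<Omega> (v - \<phi>) < \<epsilon>}"

(* The dual of H^1_0; the duality pairing of l and v is l v, and only the values of l on
   H10 matter. Boundedness makes l v independent of the representative v. *)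
definition Hm1 :: "'a::euclidean_space set \<Rightarrow> (('a \<Rightarrow> real) \<Rightarrow> real) set" where
  "Hm1 \<Omega> = {l. (\<forall>v\<in>H10 \<Omega>. \<forall>w\<in>H10 \<Omega>. l (\<lambda>x. v x + w x) = l v + l w) \<and>
               (\<forall>c. \<forall>v\<in>H10 \<Omega>. l (\<lambda>x. c * v x) = c * l v) \<and>
               (\<exists>C. \<forall>v\<in>H10 \<Omega>. \<bar>l v\<bar> \<le> C * H1_norm \<Omega> v)}"

definition Hm1_norm :: "'a::euclidean_space set \<Rightarrow> (('a \<Rightarrow> real) \<Rightarrow> real) \<Rightarrow> real" where
  "Hm1_norm \<Omega> l = (SUP v\<in>{v \<in> H10 \<Omega>. H1_norm \<Omega> v \<le> 1}. \<bar>l v\<bar>)"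


section \<open>Bochner spaces\<close>

(* L^2(0,T;V) for a (semi)normed function space with carrier V and norm N: the strongly
   measurable maps with square integrable norm. *)
definition strongly_measurable ::
  "real \<Rightarrow> 'b::minus set \<Rightarrow> ('b \<Rightarrow> real) \<Rightarrow> (real \<Rightarrow> 'b) \<Rightarrow> bool" where
  "strongly_measurable T V N u \<longleftrightarrow>
     (\<exists>s. (\<forall>n. simple_function (lebesgue_on {0<..<T}) (s n) \<and> s n ` {0<..<T} \<subseteq> V) \<and>
          (AE t in lebesgue_on {0<..<T}. (\<lambda>n. N (s n t - u t)) \<longlonglongrightarrow> 0))"

definition bochner_L2 ::
  "real \<Rightarrow> 'b::minus set \<Rightarrow> ('b \<Rightarrow> real) \<Rightarrow> (real \<Rightarrow> 'b) set" where
  "bochner_L2 T V N = {u. (AE t in lebesgue_on {0<..<T}. u t \<in> V) \<and>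
                          strongly_measurable T V N u \<and>
                          integrable (lebesgue_on {0<..<T}) (\<lambda>t. (N (u t))\<^sup>2)}"

definition bochner_norm :: "real \<Rightarrow> ('b \<Rightarrow> real) \<Rightarrow> (real \<Rightarrow> 'b) \<Rightarrow> real" where
  "bochner_norm T N u = sqrt (LINT t|lebesgue_on {0<..<T}. (N (u t))\<^sup>2)"

definition L2_L2 :: "real \<Rightarrow> 'a::euclidean_space set \<Rightarrow> (real \<Rightarrow> 'a \<Rightarrow> real) set" where
  "L2_L2 T \<Omega> = bochner_L2 T (L2 \<Omega>) (L2_norm \<Omega>)"

definition L2_Hm1 ::
  "real \<Rightarrow> 'a::euclidean_space set \<Rightarrow> (real \<Rightarrow> ('a \<Rightarrow> real) \<Rightarrow> real) set" where
  "L2_Hm1 T \<Omega> = bochner_L2 T (Hm1 \<Omega>) (Hm1_norm \<Omega>)"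

definition X_space :: "real \<Rightarrow> 'a::euclidean_space set \<Rightarrow> (real \<Rightarrow> 'a \<Rightarrow> real) set" where
  "X_space T \<Omega> = bochner_L2 T (H10 \<Omega>) (H1_norm \<Omega>)"

(* Equality almost everywhere; the iterated form refers only to the classes of the values
   v t, w t in L^2(Omega), so no jointly measurable representative has to be selected. *)
definition ae_eq ::
  "real \<Rightarrow> 'a::euclidean_space set \<Rightarrow> (real \<Rightarrow> 'a \<Rightarrow> real) \<Rightarrow> (real \<Rightarrow> 'a \<Rightarrow> real) \<Rightarrow> bool" where
  "ae_eq T \<Omega> v w \<longleftrightarrow> (AE t in lebesgue_on {0<..<T}. AE x in lebesgue_on \<Omega>. v t x = w t x)"

(* The identity  int phi' z dt = - int phi w dt  of Bochner integrals in H^-1,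
   evaluated at every v in H^1_0. *)
definition is_time_deriv ::
  "real \<Rightarrow> 'a::euclidean_space set \<Rightarrow>
   (real \<Rightarrow> ('a \<Rightarrow> real) \<Rightarrow> real) \<Rightarrow> (real \<Rightarrow> ('a \<Rightarrow> real) \<Rightarrow> real) \<Rightarrow> bool" where
  "is_time_deriv T \<Omega> z w \<longleftrightarrow>
     (\<forall>\<phi>\<in>test_functions {0<..<T}. \<forall>v\<in>H10 \<Omega>.
        (LINT t|lebesgue_on {0<..<T}. deriv \<phi> t * z t v) =
        - (LINT t|lebesgue_on {0<..<T}. \<phi> t * w t v))"

definition H1_Hm1 ::
  "real \<Rightarrow> 'a::euclidean_space set \<Rightarrow> (real \<Rightarrow> ('a \<Rightarrow> real) \<Rightarrow> real) set" where
  "H1_Hm1 T \<Omega> = {z \<in> L2_Hm1 T \<Omega>. \<exists>w\<in>L2_Hm1 T \<Omega>. is_time_deriv T \<Omega> z w}"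

(* L^2(Omega) is embedded in H^-1(Omega) by the L^2 inner product. *)
definition Y_space :: "real \<Rightarrow> 'a::euclidean_space set \<Rightarrow> (real \<Rightarrow> 'a \<Rightarrow> real) set" where
  "Y_space T \<Omega> = {m \<in> X_space T \<Omega>. (\<lambda>t. L2_inner \<Omega> (m t)) \<in> H1_Hm1 T \<Omega>}"

(* An arbitrary representative of the class, which is unique in L^2(0,T;H^-1). *)
definition time_deriv ::
  "real \<Rightarrow> 'a::euclidean_space set \<Rightarrow> (real \<Rightarrow> 'a \<Rightarrow> real) \<Rightarrow> real \<Rightarrow> ('a \<Rightarrow> real) \<Rightarrow> real" where
  "time_deriv T \<Omega> m =
     (SOME w. w \<in> L2_Hm1 T \<Omega> \<and> is_time_deriv T \<Omega> (\<lambda>t. L2_inner \<Omega> (m t)) w)"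

definition continuous_rep ::
  "real \<Rightarrow> 'a::euclidean_space set \<Rightarrow> (real \<Rightarrow> 'a \<Rightarrow> real) \<Rightarrow> (real \<Rightarrow> 'a \<Rightarrow> real) \<Rightarrow> bool" where
  "continuous_rep T \<Omega> m c \<longleftrightarrow>
     (\<forall>t\<in>{0..T}. c t \<in> L2 \<Omega>) \<and>
     (\<forall>t\<in>{0..T}. ((\<lambda>s. L2_norm \<Omega> (c s - c t)) \<longlongrightarrow> 0) (at t within {0..T})) \<and>
     ae_eq T \<Omega> m c"

(* m(t) for m in Y and t in [0,T]: the value of the continuous representative of m in
   C([0,T]; L^2(Omega)). *)
definition at_time ::
  "real \<Rightarrow> 'a::euclidean_space set \<Rightarrow> (real \<Rightarrow> 'a \<Rightarrow> real) \<Rightarrow> real \<Rightarrow> 'a \<Rightarrow> real" where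
  "at_time T \<Omega> m = (SOME c. continuous_rep T \<Omega> m c)"

definition Y0_space :: "real \<Rightarrow> 'a::euclidean_space set \<Rightarrow> (real \<Rightarrow> 'a \<Rightarrow> real) set" where
  "Y0_space T \<Omega> = {v \<in> Y_space T \<Omega>. AE x in lebesgue_on \<Omega>. at_time T \<Omega> v 0 x = 0}"


section \<open>Hamiltonian\<close>

definition hamiltonian ::
  "'c set \<Rightarrow> (real \<times> 'a \<times> 'c \<Rightarrow> 'a::euclidean_space) \<Rightarrow> (real \<times> 'a \<times> 'c \<Rightarrow> real) \<Rightarrow>
   real \<Rightarrow> 'a \<Rightarrow> 'a \<Rightarrow> real" where
  "hamiltonian A b f t x p = (SUP \<alpha>\<in>A. b (t, x, \<alpha>) \<bullet> p - f (t, x, \<alpha>))"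

definition subdiff ::
  "(real \<Rightarrow> 'a \<Rightarrow> 'a \<Rightarrow> real) \<Rightarrow> real \<Rightarrow> 'a \<Rightarrow> 'a \<Rightarrow> 'a::euclidean_space set" where
  "subdiff H t x p = {z. \<forall>q. H t x q \<ge> H t x p + z \<bullet> (q - p)}"

definition Linf :: "'a::euclidean_space set \<Rightarrow> ('a \<Rightarrow> 'b::euclidean_space) set" where
  "Linf Q = {v. v \<in> borel_measurable (lebesgue_on Q) \<and>
               (\<exists>C. AE x in lebesgue_on Q. norm (v x) \<le> C)}"

(* g is the jointly measurable representative of the spatial gradient of w (unique up to
   null sets of Q_T), through which L^p(0,T;L^p(Omega)) is identified with L^p(Q_T). *)
definition DpH ::
  "real \<Rightarrow> 'a::euclidean_space set \<Rightarrow> (real \<Rightarrow> 'a \<Rightarrow> 'a \<Rightarrow> real) \<Rightarrow> (real \<Rightarrow> 'a \<Rightarrow> real) \<Rightarrow>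
   (real \<times> 'a \<Rightarrow> 'a) set" where
  "DpH T \<Omega> H w =
     {\<beta> \<in> Linf ({0<..<T} \<times> \<Omega>).
        \<exists>g \<in> borel_measurable (lebesgue_on ({0<..<T} \<times> \<Omega>)).
          (AE t in lebesgue_on {0<..<T}. AE x in lebesgue_on \<Omega>. g (t, x) = weak_grad \<Omega> (w t) x) \<and>
          (AE (t, x) in lebesgue_on ({0<..<T} \<times> \<Omega>). \<beta> (t, x) \<in> subdiff H t x (g (t, x)))}"

definition H_grad ::
  "'a::euclidean_space set \<Rightarrow> (real \<Rightarrow> 'a \<Rightarrow> 'a \<Rightarrow> real) \<Rightarrow> (real \<Rightarrow> 'a \<Rightarrow> real) \<Rightarrow>
   real \<Rightarrow> 'a \<Rightarrow> real" where
  "H_grad \<Omega> H w t x = H t x (weak_grad \<Omega> (w t) x)"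


section \<open>Conditions on the data\<close>

(* Since the norms are seminorms on representatives, continuity includes that P respects
   equality almost everywhere. *)
definition continuous_operator ::
  "'b::minus set \<Rightarrow> ('b \<Rightarrow> real) \<Rightarrow> 'c::minus set \<Rightarrow> ('c \<Rightarrow> real) \<Rightarrow> ('b \<Rightarrow> 'c) \<Rightarrow> bool" where
  "continuous_operator V N W M P \<longleftrightarrow>
     (\<forall>v\<in>V. P v \<in> W) \<and>
     (\<forall>v\<in>V. \<forall>\<epsilon>>0. \<exists>\<delta>>0. \<forall>w\<in>V. N (w - v) < \<delta> \<longrightarrow> M (P w - P v) < \<epsilon>)"

definition nonneg_distribution ::
  "real \<Rightarrow> 'a::euclidean_space set \<Rightarrow> (real \<Rightarrow> ('a \<Rightarrow> real) \<Rightarrow> real) \<Rightarrow> bool" where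
  "nonneg_distribution T \<Omega> G \<longleftrightarrow>
     (\<forall>v\<in>X_space T \<Omega>.
        (AE t in lebesgue_on {0<..<T}. AE x in lebesgue_on \<Omega>. v t x \<ge> 0) \<longrightarrow>
        (LINT t|lebesgue_on {0<..<T}. G t (v t)) \<ge> 0)"

definition strictly_monotone_on_X ::
  "real \<Rightarrow> 'a::euclidean_space set \<Rightarrow>
   ((real \<Rightarrow> 'a \<Rightarrow> real) \<Rightarrow> real \<Rightarrow> ('a \<Rightarrow> real) \<Rightarrow> real) \<Rightarrow> bool" where
  "strictly_monotone_on_X T \<Omega> F \<longleftrightarrow>
     (\<forall>w\<in>X_space T \<Omega>. \<forall>v\<in>X_space T \<Omega>.
        (LINT t|lebesgue_on {0<..<T}. (F w t - F v t) (w t - v t)) \<le> 0 \<longrightarrow> ae_eq T \<Omega> w v)"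

definition monotone_on_L2 ::
  "'a::euclidean_space set \<Rightarrow> (('a \<Rightarrow> real) \<Rightarrow> 'a \<Rightarrow> real) \<Rightarrow> bool" where
  "monotone_on_L2 \<Omega> S \<longleftrightarrow>
     (\<forall>w\<in>L2 \<Omega>. \<forall>v\<in>L2 \<Omega>. L2_inner \<Omega> (S w - S v) (w - v) \<ge> 0)"


section \<open>Weak solutions\<close>

definition weak_solution ::
  "real \<Rightarrow> 'a::euclidean_space set \<Rightarrow> real \<Rightarrow> (real \<Rightarrow> 'a \<Rightarrow> 'a \<Rightarrow> real) \<Rightarrow>
   ((real \<Rightarrow> 'a \<Rightarrow> real) \<Rightarrow> real \<Rightarrow> ('a \<Rightarrow> real) \<Rightarrow> real) \<Rightarrow> (('a \<Rightarrow> real) \<Rightarrow> 'a \<Rightarrow> real) \<Rightarrow>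
   (real \<Rightarrow> ('a \<Rightarrow> real) \<Rightarrow> real) \<Rightarrow> ('a \<Rightarrow> real) \<Rightarrow>
   (real \<Rightarrow> 'a \<Rightarrow> real) \<Rightarrow> (real \<Rightarrow> 'a \<Rightarrow> real) \<Rightarrow> bool" where
  "weak_solution T \<Omega> \<nu> H F S G m\<^sub>0 u m \<longleftrightarrow>
     u \<in> X_space T \<Omega> \<and> m \<in> Y_space T \<Omega> \<and>
     (AE x in lebesgue_on \<Omega>. at_time T \<Omega> m 0 x = m\<^sub>0 x) \<and>
     (\<exists>\<beta>\<in>DpH T \<Omega> H u.
        \<forall>\<psi>\<in>Y0_space T \<Omega>. \<forall>\<phi>\<in>X_space T \<Omega>.
          (LINT t|lebesgue_on {0<..<T}.
             time_deriv T \<Omega> \<psi> t (u t)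
             + \<nu> * L2_inner \<Omega> (weak_grad \<Omega> (u t)) (weak_grad \<Omega> (\<psi> t))
             + L2_inner \<Omega> (H_grad \<Omega> H u t) (\<psi> t))
          = (LINT t|lebesgue_on {0<..<T}. F m t (\<psi> t))
            + L2_inner \<Omega> (S (at_time T \<Omega> m T)) (at_time T \<Omega> \<psi> T) \<and>
          (LINT t|lebesgue_on {0<..<T}.
             time_deriv T \<Omega> m t (\<phi> t)
             + \<nu> * L2_inner \<Omega> (weak_grad \<Omega> (m t)) (weak_grad \<Omega> (\<phi> t))
             + L2_inner \<Omega> (\<lambda>x. m t x *\<^sub>R \<beta> (t, x)) (weak_grad \<Omega> (\<phi> t)))
          = (LINT t|lebesgue_on {0<..<T}. G t (\<phi> t)))"

end

theory Submission imports Defs begin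

text \<open>
 The densities are nonnegative, by testing the Fokker--Planck equation with a smooth substitute for
 the negative part of the density and Gronwall's inequality. Testing the difference of the
 Hamilton--Jacobi--Bellman equations with \<open>m\<^sub>1 - m\<^sub>2\<close> and the difference of the Fokker--Planck equations with
 \<open>u\<^sub>1 - u\<^sub>2\<close>, the diffusion and time derivative terms cancel; since the drift of \<open>m\<^sub>i\<close> is a subgradient of
 the Hamiltonian at \<open>\<nabla>u\<^sub>i\<close> and \<open>m\<^sub>i \<ge> 0\<close>, the remaining terms have a sign, and strict monotonicity gives
 \<open>m\<^sub>1 = m\<^sub>2\<close>. Then \<open>u\<^sub>1 - u\<^sub>2\<close> solves a backward heat equation with zero final value whose right hand
 side is bounded by its gradient, so a second Gronwall argument gives \<open>u\<^sub>1 = u\<^sub>2\<close>.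

 Time regularity is handled without mollifying functions with values in \<open>H\<^sup>-\<^sup>1\<close>: pairing with a fixed \<open>v\<close>
 reduces the equation to a primitive of an integrable function, and the increments
 \<open>w(t + h) - w(t)\<close>, tested with a convex potential of \<open>w\<close>, give the energy identity in the limit.
\<close>

section \<open>Smooth functions\<close>

text \<open>The value functions have no time regularity beyond X. Their difference may be tested
  because it lies in X, that of the densities because the common initial value puts it in Y_0. The
  final condition for the difference of the value functions is hidden in the Hamilton-Jacobi-Bellman
  equation; it is recovered from the test functions t v(x), which vanish at 0 but not at T. The
  substitute for the negative part is smooth because \<open>H10\<close> is a closure of smooth
  functions, so composition has to map test functions to test functions. The price is a defect of
  order \<delta> squared, which Gronwall preserves; since \<open>npot 1 \<le> npot \<delta>\<close>
  for \<delta> at most 1, letting \<delta> tend to 0 removes it. An increment tested with a convex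
  potential gives only an inequality; forward and backward increments give opposite ones, hence an
  identity in the limit. Null sets in time depend on the spatial test function; strong measurability
  confines almost all values of a Bochner function to the closure of a countable set, so that one
  null set suffices.\<close>

lemma partial_deriv_eq:
 "(\<phi> has_derivative D) (at x) \<Longrightarrow> partial_deriv \<phi> i x = D i"
 by (simp add: partial_deriv_def frechet_derivative_at[symmetric])

lemma has_derivative_partial_deriv:
 assumes "\<phi> differentiable (at x)"
 shows "(\<phi> has_derivative (\<lambda>h. \<Sum>i\<in>Basis. (h \<bullet> i) * partial_deriv \<phi> i x)) (at x)"
proof -
 have D: "(\<phi> has_derivative frechet_derivative \<phi> (at x)) (at x)"
  using assms frechet_derivative_works by blast
 then interpret linear "frechet_derivative \<phi> (at x)"
  by (rule has_derivative_linear)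
 have "frechet_derivative \<phi> (at x) h = (\<Sum>i\<in>Basis. (h \<bullet> i) * partial_deriv \<phi> i x)" for h
 proof -
  have "frechet_derivative \<phi> (at x) h = frechet_derivative \<phi> (at x) (\<Sum>i\<in>Basis. (h \<bullet> i) *\<^sub>R i)"
   by (simp add: euclidean_representation)
  then show ?thesis by (simp add: sum scale partial_deriv_def)
 qed
 then show ?thesis using D by (metis (no_types, lifting) ext)
qed

text \<open>Lets an induction on \<open>k\<close> run over an explicit derivative \<open>D\<close>
  instead of the choice behind \<open>frechet_derivative\<close>; the closure properties below rest
  on it.\<close>

lemma Ck_SucI:
 assumes "\<And>x. (\<phi> has_derivative D x) (at x)" "\<And>i. i \<in> Basis \<Longrightarrow> Ck k (\<lambda>x. D x i)"
 shows "Ck (Suc k) \<phi>"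
proof -
 have "partial_deriv \<phi> i = (\<lambda>x. D x i)" for i
  using partial_deriv_eq[OF assms(1)] by blast
 moreover have "\<phi> differentiable (at x)" for x
  using assms(1) by (rule differentiableI)
 ultimately show ?thesis using assms by simp
qed

lemma Ck_SucD: "Ck (Suc k) \<phi> \<Longrightarrow> Ck k \<phi>"
proof (induction k arbitrary: \<phi>)
 case 0
 then show ?case
  by (auto intro!: continuous_at_imp_continuous_on differentiable_imp_continuous_within)
qed auto

lemma Ck_const: "Ck k (\<lambda>x. c)"
proof (induction k arbitrary: c)
 case (Suc k)
 show ?case by (rule Ck_SucI[where D = "\<lambda>_ _. 0"]) (simp_all add: Suc)
qed simp

lemma Ck_inner: "Ck k (\<lambda>x. x \<bullet> a)"
proof (rule Ck_SucD, rule Ck_SucI[where D = "\<lambda>_ h. h \<bullet> a"])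
 show "((\<lambda>x. x \<bullet> a) has_derivative (\<lambda>h. h \<bullet> a)) (at x)" for x
  by (rule bounded_linear_imp_has_derivative[OF bounded_linear_inner_left])
 show "Ck k (\<lambda>x. i \<bullet> a)" for i by (rule Ck_const)
qed

lemma Ck_add: "Ck k f \<Longrightarrow> Ck k g \<Longrightarrow> Ck k (\<lambda>x. f x + g x)"
proof (induction k arbitrary: f g)
 case (Suc k)
 show ?case
  by (rule Ck_SucI[where D = "\<lambda>x h. frechet_derivative f (at x) h + frechet_derivative g (at x) h"])
    (use Suc in \<open>auto intro!: has_derivative_add simp: frechet_derivative_works[symmetric] partial_deriv_def[abs_def]\<close>)
qed (auto intro!: continuous_intros)

lemma Ck_mult: "Ck k f \<Longrightarrow> Ck k g \<Longrightarrow> Ck k (\<lambda>x. f x * g x)"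
proof (induction k arbitrary: f g)
 case (Suc k)
 show ?case
 proof (rule Ck_SucI[where D = "\<lambda>x h. f x * frechet_derivative g (at x) h + frechet_derivative f (at x) h * g x"])
  show "((\<lambda>x. f x * g x) has_derivative (\<lambda>h. f x * frechet_derivative g (at x) h + frechet_derivative f (at x) h * g x)) (at x)" for x
   using Suc.prems by (intro has_derivative_mult) (auto simp: frechet_derivative_works[symmetric])
  show "Ck k (\<lambda>x. f x * frechet_derivative g (at x) i + frechet_derivative f (at x) i * g x)" if "i \<in> Basis" for i
   using Suc.prems Suc.IH that Ck_SucD[OF Suc.prems(1)] Ck_SucD[OF Suc.prems(2)]
   by (auto intro!: Ck_add simp: partial_deriv_def[abs_def])
 qed
qed (auto intro!: continuous_intros)

lemma Ck_cmult: "Ck k f \<Longrightarrow> Ck k (\<lambda>x. c * f x)"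
 using Ck_mult[OF Ck_const] .

lemma Ck_diff: "Ck k f \<Longrightarrow> Ck k g \<Longrightarrow> Ck k (\<lambda>x. f x - g x)"
 using Ck_add[of k f "\<lambda>x. (-1) * g x"] Ck_cmult[of k g "-1"] by simp

lemma Ck_prod: "(\<And>i. i \<in> I \<Longrightarrow> Ck k (f i)) \<Longrightarrow> Ck k (\<lambda>x. \<Prod>i\<in>I. f i x)"
 by (induction I rule: infinite_finite_induct) (auto intro: Ck_const Ck_mult)

text \<open>Makes the polynomials of Stone-Weierstrass available as smooth factors of a bump
  function.\<close>

lemma Ck_real_polynomial: "real_polynomial_function p \<Longrightarrow> Ck k p"
proof (induction p rule: real_polynomial_function.induct)
 case (linear f)
 then have D: "(f has_derivative f) (at x)" for x by (rule bounded_linear_imp_has_derivative)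
 have "Ck k (\<lambda>x. f i)" for i by (rule Ck_const)
 then have "Ck (Suc k) f" by (intro Ck_SucI[of f "\<lambda>_. f"] D)
 then show ?case by (rule Ck_SucD)
qed (auto intro: Ck_const Ck_add Ck_mult)

text \<open>The classical function vanishing to infinite order at 0. Powers of \<open>1 / s\<close>
  are included because differentiation produces them: each derivative is a linear combination of
  members of the family indexed by \<open>n\<close>.\<close>

definition flat :: "real \<Rightarrow> nat \<Rightarrow> real \<Rightarrow> real" where
 "flat \<delta> n s = (if s > 0 then (1 / s) ^ n * exp (- \<delta> / s) else 0)"

lemma flat_nonneg: "flat \<delta> n s \<ge> 0"
 by (simp add: flat_def)

text \<open>With \<open>x = 1 / s\<close> this says that \<open>exp (\<delta> * x)\<close> grows
  faster than any power of \<open>x\<close>; to the left of 0 the function is constant.\<close>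

lemma flat_tendsto_0: assumes "\<delta> > 0" shows "(flat \<delta> n \<longlongrightarrow> 0) (at 0)"
proof -
 have "((\<lambda>x. (1/\<delta>)^n * ((\<delta> * x) ^ n / exp (\<delta> * x))) \<longlongrightarrow> (1/\<delta>)^n * 0) at_top"
  by (intro tendsto_intros filterlim_compose[OF tendsto_power_div_exp_0]
    filterlim_tendsto_pos_mult_at_top[OF tendsto_const assms filterlim_ident])
 then have "((\<lambda>x. x ^ n * exp (- \<delta> * x)) \<longlongrightarrow> 0) at_top"
  using assms by (simp add: power_mult_distrib exp_minus field_simps)
 then have "((\<lambda>s. (1 / s) ^ n * exp (- \<delta> / s)) \<longlongrightarrow> 0) (at_right 0)"
  using filterlim_at_top_to_right[of "\<lambda>x. x ^ n * exp (- \<delta> * x)" "nhds 0"]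
  by (simp add: field_simps)
 then have "(flat \<delta> n \<longlongrightarrow> 0) (at_right 0)"
  by (rule Lim_transform_eventually) (auto simp: flat_def eventually_at_right_less eventually_at intro!: exI[of _ 1])
 moreover have "(flat \<delta> n \<longlongrightarrow> 0) (at_left 0)"
  by (rule tendsto_eventually) (auto simp: flat_def eventually_at intro!: exI[of _ 1])
 ultimately show ?thesis by (simp add: filterlim_split_at)
qed

lemma flat_has_derivative:
 assumes "\<delta> > 0"
 shows "(flat \<delta> n has_real_derivative (\<delta> * flat \<delta> (n+2) s - n * flat \<delta> (n+1) s)) (at s)"
proof -
 consider "s > 0" | "s < 0" | "s = 0" by linarith
 then show ?thesis
 proof cases
  case 1
  have "((\<lambda>s. (1 / s) ^ n * exp (- \<delta> / s)) has_real_derivative (\<delta> * flat \<delta> (n+2) s - n * flat \<delta> (n+1) s)) (at s)"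
  proof -
   have "((\<lambda>s. 1 / s) has_real_derivative - ((1 / s)\<^sup>2)) (at s)"
    using 1 by (auto intro!: derivative_eq_intros simp: power2_eq_square)
   then have "((\<lambda>s. (1 / s) ^ n) has_real_derivative of_nat n * (- ((1 / s)\<^sup>2) * (1 / s) ^ (n - Suc 0))) (at s)"
    by (rule DERIV_power)
   moreover have "((\<lambda>s. exp (- \<delta> / s)) has_real_derivative exp (- \<delta> / s) * (\<delta> * (1 / s)\<^sup>2)) (at s)"
    using 1 by (auto intro!: derivative_eq_intros simp: power2_eq_square)
   ultimately have "((\<lambda>s. (1 / s) ^ n * exp (- \<delta> / s)) has_real_derivative
     of_nat n * (- ((1 / s)\<^sup>2) * (1 / s) ^ (n - Suc 0)) * exp (- \<delta> / s)
     + exp (- \<delta> / s) * (\<delta> * (1 / s)\<^sup>2) * (1 / s) ^ n) (at s)"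
    by (rule DERIV_mult)
   moreover have "of_nat n * (- ((1 / s)\<^sup>2) * (1 / s) ^ (n - Suc 0)) * exp (- \<delta> / s)
     + exp (- \<delta> / s) * (\<delta> * (1 / s)\<^sup>2) * (1 / s) ^ n = \<delta> * flat \<delta> (n+2) s - n * flat \<delta> (n+1) s"
    using 1 by (cases n) (simp_all add: flat_def power2_eq_square algebra_simps)
   ultimately show ?thesis by simp
  qed
  moreover have "\<forall>\<^sub>F x in nhds s. (1 / x) ^ n * exp (- \<delta> / x) = flat \<delta> n x"
   using eventually_nhds_in_open[of "{0<..}" s] 1 by (auto elim!: eventually_mono simp: flat_def)
  ultimately show ?thesis
   by (subst (asm) DERIV_cong_ev[OF refl _ refl]) auto
 next
  case 2
  have "\<forall>\<^sub>F x in nhds s. 0 = flat \<delta> n x"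
   using eventually_nhds_in_open[of "{..<0}" s] 2 by (auto elim!: eventually_mono simp: flat_def)
  then show ?thesis
   using DERIV_cong_ev[OF refl, of "\<lambda>_. 0" "flat \<delta> n" s 0 0] 2 by (simp add: flat_def)
 next
  case 3
  \<comment> \<open>At the origin the difference quotient of \<open>flat \<delta> n\<close> is
    \<open>flat \<delta> (n + 1)\<close>, so \<open>flat_tendsto_0\<close> gives the
    derivative.\<close>
  have "((\<lambda>h. (flat \<delta> n (0 + h) - flat \<delta> n 0) / h) \<longlongrightarrow> 0) (at 0)"
   by (rule Lim_transform_eventually[OF flat_tendsto_0[OF assms, of "n+1"]])
     (auto simp: flat_def eventually_at intro!: exI[of _ 1])
  then show ?thesis using 3 by (simp add: DERIV_def flat_def)
 qed
qed

lemma continuous_flat: "\<delta> > 0 \<Longrightarrow> continuous_on S (flat \<delta> n)"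
 by (meson DERIV_isCont continuous_at_imp_continuous_on flat_has_derivative)

text \<open>One derivative raises the index by 1 and by 2, which is why the induction on
  \<open>k\<close> keeps \<open>n\<close> arbitrary.\<close>

lemma Ck_flat_compose:
 assumes "\<delta> > 0" "\<And>k. Ck k \<phi>"
 shows "Ck k (\<lambda>x. flat \<delta> n (\<phi> x))"
proof (induction k arbitrary: n)
 case 0
 then show ?case
  using assms(2)[of 0] continuous_on_compose2[OF continuous_flat[OF assms(1), of UNIV n], of UNIV \<phi>] by simp
next
 case (Suc k)
 have d: "\<phi> differentiable (at x)" for x using assms(2)[of "Suc 0"] by simp
 show ?case
 proof (rule Ck_SucI)
  show "((\<lambda>x. flat \<delta> n (\<phi> x)) has_derivative
   (\<lambda>h. frechet_derivative \<phi> (at x) h * (\<delta> * flat \<delta> (n+2) (\<phi> x) - n * flat \<delta> (n+1) (\<phi> x)))) (at x)" for x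
   using DERIV_compose_FDERIV[OF flat_has_derivative[OF assms(1)] iffD1[OF frechet_derivative_works d]] .
  show "Ck k (\<lambda>x. frechet_derivative \<phi> (at x) i * (\<delta> * flat \<delta> (n+2) (\<phi> x) - n * flat \<delta> (n+1) (\<phi> x)))"
   if "i \<in> Basis" for i
   using that assms(2)[of "Suc k"] by (intro Ck_mult Ck_diff Ck_cmult Suc) (auto simp: partial_deriv_def[abs_def])
 qed
qed

section \<open>Test functions\<close>

lemma test_functionsI:
 assumes "\<And>k. Ck k \<phi>" "compact K" "K \<subseteq> U" "\<And>x. x \<notin> K \<Longrightarrow> \<phi> x = 0"
 shows "\<phi> \<in> test_functions U"
proof -
 have "closure {x. \<phi> x \<noteq> 0} \<subseteq> K"
  using assms by (intro closure_minimal) (auto simp: compact_imp_closed)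
 moreover have "compact (closure {x. \<phi> x \<noteq> 0})"
  using calculation assms(2) by (meson bounded_subset closed_closure compact_eq_bounded_closed)
 ultimately show ?thesis
  using assms unfolding test_functions_def by auto
qed

text \<open>The complement of the support is open and the function vanishes identically on it, so
  its derivatives vanish there as well.\<close>

lemma test_functionsE:
 assumes "\<phi> \<in> test_functions U"
 obtains K where "compact K" "K \<subseteq> U" "\<And>x. x \<notin> K \<Longrightarrow> \<phi> x = 0" "\<And>x i. x \<notin> K \<Longrightarrow> partial_deriv \<phi> i x = 0"
proof -
 let ?K = "closure {x. \<phi> x \<noteq> 0}"
 have K: "compact ?K" "?K \<subseteq> U" using assms unfolding test_functions_def by simp_all
 have 0: "\<phi> x = 0" if "x \<notin> ?K" for x
 proof (rule ccontr)
  assume "\<phi> x \<noteq> 0"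
  then have "x \<in> {x. \<phi> x \<noteq> 0}" by simp
  then have "x \<in> ?K" by (rule subsetD[OF closure_subset])
  then show False using that by simp
 qed
 have 1: "partial_deriv \<phi> i x = 0" if "x \<notin> ?K" for x i
 proof -
  have "open (- ?K)" by (intro open_Compl closed_closure)
  moreover have "x \<in> - ?K" using that by simp
  moreover have "0 = \<phi> y" if "y \<in> - ?K" for y using 0[of y] ComplD[OF that] by simp
  ultimately have "(\<phi> has_derivative (\<lambda>_. 0)) (at x)"
   by (rule has_derivative_transform_within_open[OF has_derivative_const])
  from partial_deriv_eq[OF this] show ?thesis .
 qed
 show thesis by (rule that[of ?K, OF K 0 1])
qed

lemma test_functions_Ck: "\<phi> \<in> test_functions U \<Longrightarrow> Ck k \<phi>"
 by (simp add: test_functions_def)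

lemma test_functions_partial_deriv:
 assumes "\<phi> \<in> test_functions U" "i \<in> Basis"
 shows "partial_deriv \<phi> i \<in> test_functions U"
proof -
 obtain K where K: "compact K" "K \<subseteq> U" "\<And>x i. x \<notin> K \<Longrightarrow> partial_deriv \<phi> i x = 0"
  by (rule test_functionsE[OF assms(1)]) blast
 show ?thesis
  using test_functions_Ck[OF assms(1), of "Suc _"] assms(2) K by (intro test_functionsI[of _ K]) auto
qed

lemma test_functions_mult:
 assumes "\<phi> \<in> test_functions U" "\<And>k. Ck k \<psi>"
 shows "(\<lambda>x. \<phi> x * \<psi> x) \<in> test_functions U"
proof -
 obtain K where K: "compact K" "K \<subseteq> U" "\<And>x. x \<notin> K \<Longrightarrow> \<phi> x = 0"
  by (rule test_functionsE[OF assms(1)]) blast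
 then show ?thesis
  by (intro test_functionsI[of _ K] Ck_mult test_functions_Ck[OF assms(1)] assms(2)) auto
qed

lemma test_functions_cmult:
 assumes "\<phi> \<in> test_functions U" shows "(\<lambda>x. c * \<phi> x) \<in> test_functions U"
 using test_functions_mult[OF assms Ck_const, of c] by (simp add: mult.commute)

lemma test_functions_diff:
 assumes "\<phi> \<in> test_functions U" "\<psi> \<in> test_functions U"
 shows "(\<lambda>x. \<phi> x - \<psi> x) \<in> test_functions U"
proof -
 obtain K where K: "compact K" "K \<subseteq> U" "\<And>x. x \<notin> K \<Longrightarrow> \<phi> x = 0"
  by (rule test_functionsE[OF assms(1)]) blast
 obtain L where L: "compact L" "L \<subseteq> U" "\<And>x. x \<notin> L \<Longrightarrow> \<psi> x = 0"
  by (rule test_functionsE[OF assms(2)]) blast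
 show ?thesis
  using K L by (intro test_functionsI[of _ "K \<union> L"] Ck_diff test_functions_Ck[OF assms(1)] test_functions_Ck[OF assms(2)]) auto
qed

lemma test_functions_continuous: "\<phi> \<in> test_functions U \<Longrightarrow> continuous_on S \<phi>"
 using test_functions_Ck[of \<phi> U 0] continuous_on_subset by auto

lemma test_functions_measurable: "\<phi> \<in> test_functions U \<Longrightarrow> \<phi> \<in> borel_measurable borel"
 by (simp add: borel_measurable_continuous_onI test_functions_continuous)

lemma test_functions_bounded:
 assumes "\<phi> \<in> test_functions U" obtains B where "\<And>x. \<bar>\<phi> x\<bar> \<le> B" "B > 0"
proof -
 obtain K where K: "compact K" "\<And>x. x \<notin> K \<Longrightarrow> \<phi> x = 0"
  by (rule test_functionsE[OF assms]) blast
 have "bounded (\<phi> ` K)"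
  using K(1) test_functions_continuous[OF assms] compact_continuous_image compact_imp_bounded by blast
 then obtain B where B: "B > 0" "\<And>x. x \<in> K \<Longrightarrow> \<bar>\<phi> x\<bar> \<le> B"
  unfolding bounded_pos by auto
 have "\<bar>\<phi> x\<bar> \<le> B" for x using B K(2)[of x] by (cases "x \<in> K") auto
 then show ?thesis using that B(1) by blast
qed

lemma continuous_compact_support_integrable:
 fixes f :: "'a::euclidean_space \<Rightarrow> real"
 assumes "continuous_on UNIV f" "compact K" "\<And>x. x \<notin> K \<Longrightarrow> f x = 0"
 shows "integrable lborel f"
proof -
 have "integrable lborel (\<lambda>x. indicator K x *\<^sub>R f x)"
  using assms by (intro borel_integrable_compact) (auto intro: continuous_on_subset)
 moreover have "(\<lambda>x. indicator K x *\<^sub>R f x) = f" using assms(3) by (force simp: indicator_def)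
 ultimately show ?thesis by simp
qed

text \<open>By translation invariance every difference quotient in direction \<open>i\<close> has
  integral 0, and dominated convergence passes this to the derivative. It is the source of
  integration by parts for test functions.\<close>

lemma integral_partial_deriv_eq_0:
 fixes f :: "'a::euclidean_space \<Rightarrow> real"
 assumes f: "f \<in> test_functions U" and i: "i \<in> Basis"
 shows "(LINT x|lborel. partial_deriv f i x) = 0"
proof -
 obtain K where K: "compact K" "\<And>x. x \<notin> K \<Longrightarrow> f x = 0" "\<And>x i. x \<notin> K \<Longrightarrow> partial_deriv f i x = 0"
  by (rule test_functionsE[OF f]) blast
 note pf = test_functions_partial_deriv[OF f i]
 obtain B where B: "\<And>x. \<bar>partial_deriv f i x\<bar> \<le> B" "B > 0"
  using test_functions_bounded[OF pf] by metis
 have fd: "f differentiable (at x)" for x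
  using test_functions_Ck[OF f, of "Suc 0"] by simp
 have D: "((\<lambda>s. f (x + s *\<^sub>R i)) has_real_derivative partial_deriv f i (x + s *\<^sub>R i)) (at s)" for x s
 proof -
  have "((\<lambda>s. f (x + s *\<^sub>R i)) has_derivative (\<lambda>h. \<Sum>j\<in>Basis. ((h *\<^sub>R i) \<bullet> j) * partial_deriv f j (x + s *\<^sub>R i))) (at s)"
   by (rule has_derivative_compose[OF _ has_derivative_partial_deriv[OF fd], of "\<lambda>s. x + s *\<^sub>R i"])
     (auto intro!: derivative_eq_intros)
  moreover have "(\<Sum>j\<in>Basis. ((h *\<^sub>R i) \<bullet> j) * partial_deriv f j (x + s *\<^sub>R i)) = partial_deriv f i (x + s *\<^sub>R i) * h" for h
  proof -
   have "(\<Sum>j\<in>Basis. ((h *\<^sub>R i) \<bullet> j) * partial_deriv f j (x + s *\<^sub>R i))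
     = (\<Sum>j\<in>Basis. if j = i then h * partial_deriv f j (x + s *\<^sub>R i) else 0)"
    using i by (intro sum.cong) (auto simp: inner_Basis)
   then show ?thesis using i by (simp add: sum.delta)
  qed
  ultimately show ?thesis by (simp add: has_field_derivative_def)
 qed
 define g where "g n x = real (Suc n) * (f (x + (1 / real (Suc n)) *\<^sub>R i) - f x)" for n x
 have fi: "integrable lborel f"
  using K test_functions_continuous[OF f] by (intro continuous_compact_support_integrable)
 have [measurable]: "f \<in> borel_measurable borel" "partial_deriv f i \<in> borel_measurable borel"
  using test_functions_measurable f pf by auto
 have shift: "integrable lborel (\<lambda>x. f (x + c))" "(LINT x|lborel. f (x + c)) = (LINT x|lborel. f x)" for c
 proof -
  have "(\<lambda>x. x + c) = (+) c" by auto
  then have d: "distr lborel borel (\<lambda>x. x + c) = lborel" using lborel_distr_plus by metis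
  show "integrable lborel (\<lambda>x. f (x + c))"
   using integrable_distr_eq[of "\<lambda>x. x + c" lborel borel f] fi unfolding d by simp
  show "(LINT x|lborel. f (x + c)) = (LINT x|lborel. f x)"
   using integral_distr[of "\<lambda>x. x + c" lborel borel f] unfolding d by simp
 qed
 have g0: "(LINT x|lborel. g n x) = 0" for n
  unfolding g_def using shift fi by simp
 obtain R where R: "\<And>x. x \<in> K \<Longrightarrow> norm x \<le> R" using compact_imp_bounded[OF K(1)] unfolding bounded_iff by blast
 have lim: "(\<lambda>n. LINT x|lborel. g n x) \<longlonglongrightarrow> (LINT x|lborel. partial_deriv f i x)"
 proof (rule integral_dominated_convergence[where w = "\<lambda>x. B * indicator (cball 0 (R + 1)) x"])
  show "AE x in lborel. (\<lambda>n. g n x) \<longlonglongrightarrow> partial_deriv f i x"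
  proof (rule AE_I2)
   fix x
   have "((\<lambda>h. (f (x + h *\<^sub>R i) - f x) / h) \<longlongrightarrow> partial_deriv f i x) (at 0)"
    using D[of x 0] by (simp add: DERIV_def)
   moreover have "filterlim (\<lambda>n. 1 / real (Suc n)) (at 0) sequentially"
    using LIMSEQ_Suc[OF lim_1_over_n] by (intro filterlim_atI) auto
   ultimately have "(\<lambda>n. (f (x + (1 / real (Suc n)) *\<^sub>R i) - f x) / (1 / real (Suc n))) \<longlonglongrightarrow> partial_deriv f i x"
    by (rule filterlim_compose)
   then show "(\<lambda>n. g n x) \<longlonglongrightarrow> partial_deriv f i x"
    unfolding g_def by (simp add: mult.commute)
  qed
  \<comment> \<open>The steps have length at most 1, so outside the ball of radius
    \<open>R + 1\<close> both points of the quotient miss the support; inside, the mean value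
    theorem applies.\<close>
  show "AE x in lborel. norm (g n x) \<le> B * indicator (cball 0 (R + 1)) x" for n
  proof (rule AE_I2)
   fix x
   let ?h = "1 / real (Suc n)"
   show "norm (g n x) \<le> B * indicator (cball 0 (R + 1)) x"
   proof (cases "norm x \<le> R + 1")
    case True
    obtain z where z: "f (x + ?h *\<^sub>R i) - f (x + 0 *\<^sub>R i) = (?h - 0) * partial_deriv f i (x + z *\<^sub>R i)"
     using MVT2[of 0 ?h "\<lambda>s. f (x + s *\<^sub>R i)" "\<lambda>s. partial_deriv f i (x + s *\<^sub>R i)"] D by auto
    then have "g n x = partial_deriv f i (x + z *\<^sub>R i)" unfolding g_def by simp
    then show ?thesis using B True by simp
   next
    case False
    have 1: "norm x \<le> norm (x + ?h *\<^sub>R i) + norm (?h *\<^sub>R i)"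
     by (metis add_diff_cancel_right' norm_triangle_ineq4)
    have 2: "norm (?h *\<^sub>R i) \<le> 1" using i by simp
    have "x \<notin> K" using False R[of x] by linarith
    moreover have "x + ?h *\<^sub>R i \<notin> K" using 1 2 False R[of "x + ?h *\<^sub>R i"] by linarith
    ultimately have "x \<notin> K" "x + ?h *\<^sub>R i \<notin> K" by auto
    then show ?thesis using K(2) False by (simp add: g_def)
   qed
  qed
  show "integrable lborel (\<lambda>x. B * indicator (cball 0 (R + 1)) x :: real)"
   using emeasure_lborel_cball_finite[of 0 "R + 1"]
   by (intro integrable_mult_right integrable_real_indicator) (auto simp: top.not_eq_extremum)
 qed (auto simp: g_def)
 show ?thesis using lim unfolding g0 by (simp add: LIMSEQ_const_iff)
qed

lemma test_functions_lebesgue_on: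
 assumes "\<phi> \<in> test_functions U" "U \<in> sets lebesgue"
 shows "integrable (lebesgue_on U) \<phi>" "(LINT x|lebesgue_on U. \<phi> x) = (LINT x|lborel. \<phi> x)"
proof -
 obtain K where K: "compact K" "K \<subseteq> U" "\<And>x. x \<notin> K \<Longrightarrow> \<phi> x = 0"
  by (rule test_functionsE[OF assms(1)]) blast
 have *: "(\<lambda>x. if x \<in> U then \<phi> x else 0) = \<phi>" using K by (auto simp: fun_eq_iff)
 have i: "integrable lborel \<phi>"
  using K test_functions_continuous[OF assms(1)] by (intro continuous_compact_support_integrable)
 then have "integrable lebesgue \<phi>" by (simp add: integrable_completion)
 then show "integrable (lebesgue_on U) \<phi>" using Lebesgue_Measure.integrable_restrict_UNIV[OF assms(2), of \<phi>] * by simp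
 show "(LINT x|lebesgue_on U. \<phi> x) = (LINT x|lborel. \<phi> x)"
  using Lebesgue_Measure.integral_restrict_UNIV[OF assms(2), of \<phi>] * i
  by (simp add: integral_completion)
qed

text \<open>A product over the coordinates of two flat factors, one for each face of the box; both
  are positive exactly between the faces.\<close>

lemma bump_exists:
 fixes a b :: "'a::euclidean_space"
 obtains B where "\<And>k. Ck k B" "\<And>x. x \<in> box a b \<Longrightarrow> B x > 0" "\<And>x. x \<notin> box a b \<Longrightarrow> B x = 0"
proof
 let ?B = "\<lambda>x. \<Prod>i\<in>Basis. flat 1 0 (x \<bullet> i - a \<bullet> i) * flat 1 0 (b \<bullet> i - x \<bullet> i)"
 show "Ck k ?B" for k
  by (intro Ck_prod Ck_mult Ck_flat_compose Ck_diff Ck_inner Ck_const) auto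
 show "?B x > 0" if "x \<in> box a b" for x
  using that by (auto intro!: prod_pos simp: flat_def mem_box)
 show "?B x = 0" if "x \<notin> box a b" for x
  using that by (auto simp: flat_def mem_box prod_zero_iff)
qed

section \<open>Integration on the line\<close>

lemma measurable_id_lebesgue_on [measurable]: "(\<lambda>x. x) \<in> borel_measurable (lebesgue_on S)"
 using id_borel_measurable_lebesgue_on[of S] by (simp add: id_def)

lemma finite_measure_interval: "finite_measure (lebesgue_on {0<..<T::real})"
 by (intro finite_measure_lebesgue_on) simp

text \<open>Measurability in the sense of \<open>measurable_on\<close> supplies continuous functions
  converging off a null set; clipping them at \<open>\<bar>B\<bar>\<close> keeps the limit. The
  absolute value covers an empty \<open>S\<close>, where \<open>B\<close> may be negative.\<close>

lemma continuous_bounded_approx: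
 fixes q :: "'a::euclidean_space \<Rightarrow> real"
 assumes q: "q \<in> borel_measurable (lebesgue_on S)" and S: "S \<in> sets lebesgue" and B: "\<And>x. x \<in> S \<Longrightarrow> \<bar>q x\<bar> \<le> B"
 obtains c where "\<And>n. continuous_on UNIV (c n)" "\<And>n x. \<bar>c n x\<bar> \<le> \<bar>B\<bar>"
  "AE x in lebesgue_on S. (\<lambda>n. c n x) \<longlonglongrightarrow> q x"
proof -
 have "q measurable_on S"
  using q S by (simp add: measurable_on_iff_borel_measurable)
 then obtain N g where N: "negligible N" and g: "\<And>n. continuous_on UNIV (g n)"
  and lim: "\<And>x. x \<notin> N \<Longrightarrow> (\<lambda>n. g n x) \<longlonglongrightarrow> (if x \<in> S then q x else 0)"
  unfolding measurable_on_def by blast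
 define c where "c n x = max (- \<bar>B\<bar>) (min \<bar>B\<bar> (g n x))" for n x
 have "continuous_on UNIV (c n)" for n
  unfolding c_def by (intro continuous_intros g)
 moreover have "\<bar>c n x\<bar> \<le> \<bar>B\<bar>" for n x unfolding c_def by auto
 moreover have "AE x in lebesgue_on S. (\<lambda>n. c n x) \<longlonglongrightarrow> q x"
 proof -
  have "AE x in lebesgue. x \<notin> N"
   using N AE_not_in negligible_iff_null_sets by blast
  then have "AE x in lebesgue. x \<in> S \<longrightarrow> (\<lambda>n. c n x) \<longlonglongrightarrow> q x"
  proof (rule AE_mp, intro AE_I2 impI)
   fix x assume x: "x \<notin> N" "x \<in> S"
   have "(\<lambda>n. c n x) \<longlonglongrightarrow> max (- \<bar>B\<bar>) (min \<bar>B\<bar> (q x))"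
    unfolding c_def using lim[OF x(1)] x(2) by (intro tendsto_intros) simp
   then show "(\<lambda>n. c n x) \<longlonglongrightarrow> q x" using B[OF x(2)] by (simp add: min_def max_def split: if_splits)
  qed
  then show ?thesis using S by (simp add: AE_restrict_space_iff)
 qed
 ultimately show ?thesis using that by blast
qed

text \<open>Continuous functions approximating the sign of \<open>f\<close> turn the hypothesis into
  the vanishing of the L1 norm.\<close>

lemma AE_eq_0_if_continuous:
 fixes f :: "'a::euclidean_space \<Rightarrow> real"
 assumes f: "integrable lebesgue f"
  and 0: "\<And>g. continuous_on UNIV g \<Longrightarrow> (\<And>x. \<bar>g x\<bar> \<le> 1) \<Longrightarrow> (LINT x|lebesgue. f x * g x) = 0"
 shows "AE x in lebesgue. f x = 0"
proof -
 have [measurable]: "f \<in> borel_measurable lebesgue" using f by simp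
 have "(\<lambda>x. sgn (f x)) \<in> borel_measurable lebesgue" by measurable
 then obtain c where c: "\<And>n. continuous_on UNIV (c n)" "\<And>n x. \<bar>c n x\<bar> \<le> \<bar>1\<bar>"
  "AE x in lebesgue_on UNIV. (\<lambda>n. c n x) \<longlonglongrightarrow> sgn (f x)"
  using continuous_bounded_approx[of "\<lambda>x. sgn (f x)" UNIV 1] unfolding lebesgue_on_UNIV_eq
  by (auto simp: abs_sgn_eq)
 have [measurable]: "c n \<in> borel_measurable lebesgue" for n
  using borel_measurable_continuous_onI[OF c(1)] by (simp add: measurable_completion)
 have "(\<lambda>n. LINT x|lebesgue. f x * c n x) \<longlonglongrightarrow> (LINT x|lebesgue. f x * sgn (f x))"
 proof (rule integral_dominated_convergence[where w = "\<lambda>x. \<bar>f x\<bar>"])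
  show "AE x in lebesgue. (\<lambda>n. f x * c n x) \<longlonglongrightarrow> f x * sgn (f x)"
   using c(3) unfolding lebesgue_on_UNIV_eq by eventually_elim (intro tendsto_intros)
  show "AE x in lebesgue. norm (f x * c n x) \<le> \<bar>f x\<bar>" for n
   using c(2) by (auto simp: abs_mult intro!: mult_left_le)
 qed (use f in auto)
 moreover have "(LINT x|lebesgue. f x * c n x) = 0" for n
  using 0[OF c(1)] c(2) by simp
 ultimately have "(LINT x|lebesgue. \<bar>f x\<bar>) = 0"
  by (simp add: LIMSEQ_const_iff abs_sgn[symmetric])
 then show ?thesis
  using integral_nonneg_eq_0_iff_AE[of lebesgue "\<lambda>x. \<bar>f x\<bar>"] f by simp
qed

lemma integrable_lebesgue_on_iff:
 "S \<in> sets lebesgue \<Longrightarrow> integrable (lebesgue_on S) f \<longleftrightarrow> f absolutely_integrable_on S"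
 for f :: "'a::euclidean_space \<Rightarrow> 'b::euclidean_space"
 by (simp add: set_integrable_def integrable_restrict_space)

text \<open>Polynomials stand in for mollifiers: a bump on a box in \<open>U\<close> times a
  polynomial is a test function, so \<open>f\<close> times the bump annihilates polynomials and, by
  Stone-Weierstrass, continuous functions. Countably many boxes cover \<open>U\<close>.\<close>

lemma AE_eq_0_if_test:
 fixes f :: "'a::euclidean_space \<Rightarrow> real"
 assumes U: "open U"
  and f: "\<And>K. compact K \<Longrightarrow> K \<subseteq> U \<Longrightarrow> f absolutely_integrable_on K"
  and 0: "\<And>\<phi>. \<phi> \<in> test_functions U \<Longrightarrow> (LINT x|lebesgue_on U. f x * \<phi> x) = 0"
 shows "AE x in lebesgue_on U. f x = 0"
proof -
 have box: "AE x in lebesgue. x \<in> cbox a b \<longrightarrow> f x = 0" if ab: "cbox a b \<subseteq> U" for a b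
 proof -
  obtain B :: "'a \<Rightarrow> real" where B: "\<And>k. Ck k B" "\<And>x. x \<in> box a b \<Longrightarrow> B x > 0" "\<And>x. x \<notin> box a b \<Longrightarrow> B x = 0"
   using bump_exists[of a b] by blast
  have B0: "B x = 0" if "x \<notin> cbox a b" for x using B(3)[of x] that box_subset_cbox[of a b] by blast
  have Bt: "(\<lambda>x. B x * p x) \<in> test_functions U" if "real_polynomial_function p" for p
   using B0 ab
   by (intro test_functionsI[of _ "cbox a b"] Ck_mult Ck_real_polynomial[OF that] B(1)) auto
  have Bc: "continuous_on S B" for S using B(1)[of 0] continuous_on_subset by auto
  define F where "F x = (if x \<in> cbox a b then f x * B x else 0)" for x
  have "(\<lambda>x. f x * B x) absolutely_integrable_on cbox a b"
  proof -
   have "bounded (B ` cbox a b)"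
    by (intro compact_imp_bounded compact_continuous_image Bc compact_cbox)
   then show ?thesis
    using absolutely_integrable_bounded_measurable_product[of times B "cbox a b" f] f[OF _ ab]
     continuous_imp_measurable_on_sets_lebesgue[OF Bc, of "cbox a b"]
    by (simp add: mult.commute bilinear_times)
  qed
  moreover have "F = (\<lambda>x. indicator (cbox a b) x *\<^sub>R (f x * B x))"
   by (auto simp: F_def fun_eq_iff)
  ultimately have Fi: "integrable lebesgue F"
   unfolding set_integrable_def by simp
  have Fp: "(LINT x|lebesgue. F x * p x) = 0" if "real_polynomial_function p" for p
  proof -
   have "(LINT x|lebesgue. F x * p x) = (LINT x|lebesgue. (if x \<in> U then f x * (B x * p x) else 0))"
    unfolding F_def using B(3) ab box_subset_cbox[of a b] by (intro Bochner_Integration.integral_cong) auto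
   also have "\<dots> = (LINT x|lebesgue_on U. f x * (B x * p x))"
    using U by (intro Lebesgue_Measure.integral_restrict_UNIV) simp
   finally show ?thesis using 0[OF Bt[OF that]] by simp
  qed
  have "AE x in lebesgue. F x = 0"
  proof (rule AE_eq_0_if_continuous[OF Fi])
   fix g :: "'a \<Rightarrow> real" assume g: "continuous_on UNIV g" "\<And>x. \<bar>g x\<bar> \<le> 1"
   have gm: "g \<in> borel_measurable lebesgue"
    using borel_measurable_continuous_onI[OF g(1)] by (simp add: measurable_completion)
   have Fg: "integrable lebesgue (\<lambda>x. F x * g x)"
    using Fi gm g(2) by (intro Bochner_Integration.integrable_bound[OF Fi]) (auto simp: abs_mult intro!: mult_left_le)
   \<comment> \<open>Replacing \<open>g\<close> by a polynomial within \<open>e\<close> on the box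
     costs at most \<open>e\<close> times the L1 norm of \<open>F\<close>, and \<open>F\<close>
     annihilates polynomials.\<close>
   have bd: "\<bar>LINT x|lebesgue. F x * g x\<bar> \<le> e * (LINT x|lebesgue. \<bar>F x\<bar>)" if e: "e > 0" for e
   proof -
    obtain p where p: "real_polynomial_function p" "\<And>x. x \<in> cbox a b \<Longrightarrow> \<bar>g x - p x\<bar> < e"
     by (rule Stone_Weierstrass_real_polynomial_function[of "cbox a b" g e])
       (use e continuous_on_subset[OF g(1)] in auto)
    have le: "\<bar>F x * g x - F x * p x\<bar> \<le> e * \<bar>F x\<bar>" for x
    proof (cases "x \<in> cbox a b")
     case True
     then have "\<bar>F x\<bar> * \<bar>g x - p x\<bar> \<le> \<bar>F x\<bar> * e"
      using p(2)[of x] by (intro mult_left_mono) auto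
     moreover have "F x * g x - F x * p x = F x * (g x - p x)" by (rule right_diff_distrib[symmetric])
     ultimately show ?thesis by (simp only: abs_mult mult.commute[of e])
    qed (simp add: F_def)
    have pm: "p \<in> borel_measurable lebesgue"
     using borel_measurable_continuous_onI[OF continuous_on_polymonial_function[OF p(1)[unfolded real_polynomial_function_eq]]]
     by (simp add: measurable_completion)
    have dd: "integrable lebesgue (\<lambda>x. F x * g x - F x * p x)"
    proof (rule Bochner_Integration.integrable_bound)
     show "integrable lebesgue (\<lambda>x. e * F x)" using Fi by simp
     have [measurable]: "F \<in> borel_measurable lebesgue" using Fi by simp
     show "(\<lambda>x. F x * g x - F x * p x) \<in> borel_measurable lebesgue" using gm pm by measurable
     show "AE x in lebesgue. norm (F x * g x - F x * p x) \<le> norm (e * F x)"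
      using le e by (intro AE_I2) (simp add: abs_mult[of e])
    qed
    then have Fpi: "integrable lebesgue (\<lambda>x. F x * p x)"
     using Bochner_Integration.integrable_diff[OF Fg dd] by simp
    have "\<bar>LINT x|lebesgue. F x * g x\<bar> = \<bar>LINT x|lebesgue. (F x * g x - F x * p x)\<bar>"
     using Fp[OF p(1)] Fg Fpi by simp
    also have "\<dots> \<le> (LINT x|lebesgue. \<bar>F x * g x - F x * p x\<bar>)"
     by (rule integral_abs_bound)
    also have "\<dots> \<le> (LINT x|lebesgue. e * \<bar>F x\<bar>)"
     using Fg Fpi Fi le by (intro integral_mono) auto
    finally show ?thesis by simp
   qed
   have "\<bar>LINT x|lebesgue. F x * g x\<bar> \<le> 0"
   proof (rule field_le_epsilon)
    fix e :: real assume "e > 0"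
    define I where "I = (LINT x|lebesgue. \<bar>F x\<bar>)"
    have I: "I \<ge> 0" unfolding I_def by simp
    have "\<bar>LINT x|lebesgue. F x * g x\<bar> \<le> (e / (I + 1)) * I"
     unfolding I_def[symmetric] using bd[of "e / (I + 1)"] \<open>e > 0\<close> I by (simp add: I_def[symmetric])
    also have "\<dots> \<le> e" using I \<open>e > 0\<close> by (simp add: field_simps)
    finally show "\<bar>LINT x|lebesgue. F x * g x\<bar> \<le> 0 + e" by simp
   qed
   then show "(LINT x|lebesgue. F x * g x) = 0" by simp
  qed
  \<comment> \<open>The bump vanishes on the faces of the box, which form a null set; in the
    interior it is positive and can be divided out.\<close>
  moreover have "AE x in lebesgue. x \<notin> cbox a b - box a b"
   using negligible_frontier_interval[of a b] by (intro AE_not_in) (simp add: negligible_iff_null_sets)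
  ultimately show ?thesis
  proof eventually_elim
   case (elim x)
   show ?case
   proof
    assume x: "x \<in> cbox a b"
    then have "B x > 0" using elim(2) B(2)[of x] by simp
    then show "f x = 0" using elim(1) x by (simp add: F_def)
   qed
  qed
 qed
 obtain \<D> where D: "countable \<D>" "\<D> \<subseteq> Pow U" "\<And>X. X \<in> \<D> \<Longrightarrow> \<exists>a b. X = cbox a b" "\<Union>\<D> = U"
  using open_countable_Union_open_cbox[OF U] by blast
 have "AE x in lebesgue. \<forall>X\<in>\<D>. x \<in> X \<longrightarrow> f x = 0"
 proof (subst AE_ball_countable[OF D(1)], rule ballI)
  fix X assume X: "X \<in> \<D>"
  then obtain a b where ab: "X = cbox a b" using D(3) by blast
  moreover have "X \<subseteq> U" using D(2) X by auto
  ultimately show "AE x in lebesgue. x \<in> X \<longrightarrow> f x = 0" using box[of a b] by simp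
 qed
 then have "AE x in lebesgue. x \<in> U \<longrightarrow> f x = 0"
 proof eventually_elim
  case (elim x)
  show ?case
  proof
   assume "x \<in> U"
   then have "x \<in> \<Union>\<D>" by (simp only: D(4))
   then obtain X where "X \<in> \<D>" "x \<in> X" by (elim UnionE)
   then show "f x = 0" using elim by blast
  qed
 qed
 then show ?thesis using U by (simp add: AE_restrict_space_iff)
qed

section \<open>Weak derivatives on an interval and the lemma of du Bois-Reymond\<close>

lemma partial_deriv_real:
 assumes "\<phi> differentiable (at (x::real))"
 shows "partial_deriv \<phi> 1 x = deriv \<phi> x" "(\<phi> has_real_derivative deriv \<phi> x) (at x)"
proof -
 show D: "(\<phi> has_real_derivative deriv \<phi> x) (at x)"
  using assms by (simp add: DERIV_deriv_iff_real_differentiable)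
 show "partial_deriv \<phi> 1 x = deriv \<phi> x"
  using partial_deriv_eq[OF D[unfolded has_field_derivative_def], of 1] by simp
qed

lemma test_functions_deriv:
 assumes "\<phi> \<in> test_functions (U::real set)"
 shows "(\<phi> has_real_derivative deriv \<phi> x) (at x)" "deriv \<phi> \<in> test_functions U" "partial_deriv \<phi> 1 = deriv \<phi>"
proof -
 have d: "\<phi> differentiable (at x)" for x using test_functions_Ck[OF assms, of "Suc 0"] by simp
 show "(\<phi> has_real_derivative deriv \<phi> x) (at x)" using partial_deriv_real(2)[OF d] .
 show *: "partial_deriv \<phi> 1 = deriv \<phi>" using partial_deriv_real(1)[OF d] by blast
 show "deriv \<phi> \<in> test_functions U" using test_functions_partial_deriv[OF assms, of 1] * by simp
qed

text \<open>The primitive vanishes to the left of the support by its normalisation at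
  \<open>a\<close>, and to the right because \<rho> has integral 0.\<close>

lemma test_functions_antiderivative:
 assumes \<rho>: "\<rho> \<in> test_functions {0<..<T::real}" and 0: "(LINT t|lebesgue_on {0<..<T}. \<rho> t) = 0"
 obtains \<phi> where "\<phi> \<in> test_functions {0<..<T}" "deriv \<phi> = \<rho>"
proof -
 obtain K where K: "compact K" "K \<subseteq> {0<..<T}" "\<And>x. x \<notin> K \<Longrightarrow> \<rho> x = 0"
  by (rule test_functionsE[OF \<rho>]) blast
 \<comment> \<open>For \<open>T \<le> 0\<close> the support is empty and the interval is a mere
   placeholder.\<close>
 obtain a b where ab: "K \<subseteq> {a..b}" "0 < a" "a < b" "b < T \<or> T \<le> 0"
 proof (cases "T > 0 \<and> K \<noteq> {}")
  case True
  then obtain l u where lu: "l \<in> K" "u \<in> K" "\<And>x. x \<in> K \<Longrightarrow> l \<le> x \<and> x \<le> u"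
   using compact_attains_inf[OF K(1)] compact_attains_sup[OF K(1)] by metis
  then have "0 < l" "u < T" "l \<le> u" using K(2) by auto
  then show ?thesis using lu(3) that[of "l/2" "(u+T)/2"] by (force simp: field_simps)
 next
  case False
  then have "K = {}" using K(2) by auto
  then show ?thesis using that[of "T/3" "T/2"] that[of 1 2] by (cases "T > 0") auto
 qed
 have \<rho>c: "isCont \<rho> x" for x
  using test_functions_continuous[OF \<rho>, of UNIV] by (simp add: continuous_on_eq_continuous_at)
 obtain F where F: "\<And>x. (F has_vector_derivative \<rho> x) (at x)"
  using einterval_antiderivative[of "-\<infinity>" \<infinity> \<rho>] \<rho>c by auto
 have F': "(F has_real_derivative \<rho> x) (at x)" for x
  using F by (simp add: has_real_derivative_iff_has_vector_derivative)
 define \<phi> where "\<phi> x = F x - F a" for x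
 have D: "(\<phi> has_real_derivative \<rho> x) (at x)" for x
  unfolding \<phi>_def using F' by (auto intro!: derivative_eq_intros)
 have der: "deriv \<phi> = \<rho>" using DERIV_imp_deriv[OF D] by blast
 have left: "\<phi> x = 0" if "x \<le> a" for x
 proof (cases "x < a")
  case True
  obtain z where "x < z" "z < a" "F a - F x = (a - x) * \<rho> z"
   using MVT2[OF True, of F \<rho>] F' by blast
  moreover have "\<rho> z = 0" using K(3) ab(1) \<open>z < a\<close> by (metis atLeastAtMost_iff not_less subsetD)
  ultimately show ?thesis by (simp add: \<phi>_def)
 qed (use that in \<open>auto simp: \<phi>_def\<close>)
 have "(LINT t|lborel. \<rho> t) = F b - F a"
 proof -
  have "(LBINT t:{a..b}. \<rho> t) = F b - F a"
   using ab(3) F \<rho>c by (intro integral_FTC_Icc_real[unfolded set_lebesgue_integral_def] integral_FTC_atLeastAtMost[folded set_lebesgue_integral_def] )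
     (auto simp: set_lebesgue_integral_def has_vector_derivative_at_within intro!: continuous_at_imp_continuous_on)
  moreover have "(LBINT t:{a..b}. \<rho> t) = (LINT t|lborel. \<rho> t)"
   unfolding set_lebesgue_integral_def using K(3) ab(1)
   by (intro Bochner_Integration.integral_cong) (auto simp: indicator_def subset_iff)
  ultimately show ?thesis by simp
 qed
 then have Fb: "F b = F a" using 0 test_functions_lebesgue_on(2)[OF \<rho>] by simp
 have right: "\<phi> x = 0" if "x \<ge> b" for x
 proof (cases "x > b")
  case True
  obtain z where "b < z" "z < x" "F x - F b = (x - b) * \<rho> z"
   using MVT2[OF True, of F \<rho>] F' by blast
  moreover have "\<rho> z = 0" using K(3) ab(1) \<open>b < z\<close> by (metis atLeastAtMost_iff not_less subsetD)
  ultimately show ?thesis by (simp add: \<phi>_def Fb)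
 qed (use that Fb in \<open>auto simp: \<phi>_def\<close>)
 have "\<phi> \<in> test_functions {0<..<T}"
 proof (cases "T > 0")
  case True
  have ck: "Ck (Suc k) \<phi>" for k
  proof (rule Ck_SucI)
   show "(\<phi> has_derivative (\<lambda>h. h * \<rho> x)) (at x)" for x
    using D[of x] by (simp add: has_field_derivative_def mult.commute[of _ "\<rho> x"])
   show "Ck k (\<lambda>x. i * \<rho> x)" for i using Ck_cmult[OF test_functions_Ck[OF \<rho>]] .
  qed
  show ?thesis
  proof (rule test_functionsI[of _ "{a..b}"])
   show "Ck k \<phi>" for k using Ck_SucD[OF ck] .
   show "\<phi> x = 0" if "x \<notin> {a..b}" for x using left[of x] right[of x] that by force
  qed (use ab True in auto)
 next
  case False
  then have "\<rho> = (\<lambda>_. 0)" using K by force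
  then have "F x = F a" for x
   using F' DERIV_isconst_all[of F] by metis
  then have "\<phi> = (\<lambda>_. 0)" by (auto simp: \<phi>_def)
  then show ?thesis by (intro test_functionsI[of _ "{}"]) (auto intro: Ck_const)
 qed
 then show ?thesis using that der by blast
qed

text \<open>Subtracting a multiple of a fixed bump gives a test function mean zero and hence makes
  it a derivative; the constant \<open>c\<close> is the mean of \<open>f\<close> weighted by that
  bump.\<close>

lemma du_bois_reymond:
 fixes T :: real
 assumes T: "T > 0" and f: "integrable (lebesgue_on {0<..<T}) f"
  and 0: "\<And>\<phi>. \<phi> \<in> test_functions {0<..<T} \<Longrightarrow> (LINT t|lebesgue_on {0<..<T}. deriv \<phi> t * f t) = 0"
 obtains c where "AE t in lebesgue_on {0<..<T}. f t = c"
proof -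
 let ?M = "lebesgue_on {0<..<T}"
 interpret finite_measure ?M by (rule finite_measure_interval)
 obtain B where B: "\<And>k. Ck k B" "\<And>x. x \<in> box (T/4) (T/2) \<Longrightarrow> B x > 0" "\<And>x. x \<notin> box (T/4) (T/2) \<Longrightarrow> B x = (0::real)"
  using bump_exists by blast
 have Bt: "B \<in> test_functions {0<..<T}"
  using B(1,3) T by (intro test_functionsI[of _ "{T/4..T/2}"]) auto
 note Bi = test_functions_lebesgue_on[OF Bt, simplified]
 define J where "J = (LINT t|?M. B t)"
 have J: "J > 0"
 proof -
  have nn: "B x \<ge> 0" for x using B(2)[of x] B(3)[of x] by (cases "x \<in> box (T/4) (T/2)") auto
  have "J \<noteq> 0"
  proof
   assume "J = 0"
   then have "AE x in ?M. B x = 0"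
    using integral_nonneg_eq_0_iff_AE[OF Bi(1)] nn by (simp add: J_def)
   then have "AE x in lebesgue. \<not> (x \<in> {T/4<..<T/2})"
   proof (subst (asm) AE_restrict_space_iff, simp, elim AE_mp, intro AE_I2 impI)
    fix x assume "x \<in> {0<..<T} \<longrightarrow> B x = 0"
    then show "x \<notin> {T/4<..<T/2}" using B(2)[of x] T by (auto simp: box_real)
   qed
   then have "{T/4<..<T/2} \<in> null_sets lebesgue"
    by (subst (asm) AE_iff_null_sets[symmetric]) auto
   then show False using T by (auto simp: null_sets_def)
  qed
  moreover have "J \<ge> 0" unfolding J_def using nn by simp
  ultimately show ?thesis by simp
 qed
 define c where "c = (LINT t|?M. B t * f t) / J"
 have bi: "integrable ?M (\<lambda>t. \<rho> t * f t)" if "\<rho> \<in> test_functions {0<..<T}" for \<rho>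
 proof -
  note \<rho> = that
  obtain C where C: "\<And>x. \<bar>\<rho> x\<bar> \<le> C" "C > 0" by (rule test_functions_bounded[OF \<rho>]) blast
  have "\<rho> \<in> borel_measurable ?M"
   using test_functions_lebesgue_on(1)[OF \<rho>] by auto
  then show ?thesis
   using f C by (intro Bochner_Integration.integrable_bound[of _ "\<lambda>t. C * f t" "\<lambda>t. \<rho> t * f t"])
    (auto simp: abs_mult intro!: mult_right_mono)
 qed
 have "AE t in ?M. f t - c = 0"
 proof (rule AE_eq_0_if_test)
  show "(\<lambda>t. f t - c) absolutely_integrable_on K" if "compact K" "K \<subseteq> {0<..<T}" for K
  proof -
   have "integrable ?M (\<lambda>t. f t - c)" using f by simp
   then have "(\<lambda>t. f t - c) absolutely_integrable_on {0<..<T}" by (simp add: integrable_lebesgue_on_iff)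
   then show ?thesis using that lmeasurable_compact[of K] by (rule_tac set_integrable_subset) auto
  qed
  fix \<rho> assume \<rho>: "\<rho> \<in> test_functions {0<..<T}"
  note \<rho>i = test_functions_lebesgue_on[OF \<rho>, simplified]
  define r where "r = (LINT t|?M. \<rho> t) / J"
  define \<sigma> where "\<sigma> t = \<rho> t - r * B t" for t
  have \<sigma>: "\<sigma> \<in> test_functions {0<..<T}"
   unfolding \<sigma>_def by (intro test_functions_diff \<rho> test_functions_cmult Bt)
  have "(LINT t|?M. \<sigma> t) = 0"
   unfolding \<sigma>_def using \<rho>i(1) Bi(1) J by (simp add: r_def J_def[symmetric])
  then obtain \<phi> where "\<phi> \<in> test_functions {0<..<T}" "deriv \<phi> = \<sigma>"
   using test_functions_antiderivative[OF \<sigma>] by blast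
  then have "0 = (LINT t|?M. \<sigma> t * f t)" using 0 by metis
  also have "\<dots> = (LINT t|?M. \<rho> t * f t - r * (B t * f t))" unfolding \<sigma>_def by (simp add: algebra_simps)
  also have "\<dots> = (LINT t|?M. \<rho> t * f t) - r * (LINT t|?M. B t * f t)" using bi[OF \<rho>] bi[OF Bt] by simp
  also have "\<dots> = (LINT t|?M. \<rho> t * f t) - (LINT t|?M. c * \<rho> t)" by (simp add: r_def c_def)
  also have "\<dots> = (LINT t|?M. (f t - c) * \<rho> t)" using bi[OF \<rho>] \<rho>i(1) by (simp add: algebra_simps)
  finally show "(LINT t|?M. (f t - c) * \<rho> t) = 0" by simp
 qed simp
 then show ?thesis using that[of c] by simp
qed

section \<open>The time interval: L1 approximation, Fubini for bounded kernels, Steklov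
  averages\<close>

abbreviation time_measure :: "real \<Rightarrow> real measure" ("\<mu>") where
 "\<mu> T \<equiv> lebesgue_on {0<..<T}"

interpretation time: finite_measure "\<mu> T" for T
 by (rule finite_measure_interval)

lemma AE_time_measure: "(AE t in \<mu> T. P t) \<longleftrightarrow> (AE t in lebesgue. 0 < t \<longrightarrow> t < T \<longrightarrow> P t)"
 by (subst AE_restrict_space_iff) (auto intro!: AE_cong)

text \<open>Truncate \<open>p\<close> at a height \<open>k\<close>, then approximate the bounded
  function by continuous ones; dominated convergence controls both errors.\<close>

lemma L1_continuous_approx:
 fixes p :: "'a::euclidean_space \<Rightarrow> real"
 assumes S: "S \<in> lmeasurable" and p: "integrable (lebesgue_on S) p" and e: "e > 0"
 obtains c C where "continuous_on UNIV c" "\<And>x. \<bar>c x\<bar> \<le> C" "(LINT x|lebesgue_on S. \<bar>p x - c x\<bar>) < e"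
proof -
 let ?M = "lebesgue_on S"
 interpret finite_measure ?M by (rule finite_measure_lebesgue_on[OF S])
 have [measurable]: "p \<in> borel_measurable ?M" using p by simp
 define r where "r k x = max (- real k) (min (real k) (p x))" for k :: nat and x
 have rm [measurable]: "r k \<in> borel_measurable ?M" for k unfolding r_def by measurable
 have "(\<lambda>k. LINT x|?M. \<bar>p x - r k x\<bar>) \<longlonglongrightarrow> (LINT x|?M. 0)"
 proof (rule integral_dominated_convergence[where w = "\<lambda>x. \<bar>p x\<bar>"])
  show "AE x in ?M. (\<lambda>k. \<bar>p x - r k x\<bar>) \<longlonglongrightarrow> 0"
  proof (rule AE_I2)
   fix x
   obtain k0 where "\<bar>p x\<bar> \<le> real k0" using real_arch_simple by blast
   then have "eventually (\<lambda>k. \<bar>p x - r k x\<bar> = 0) sequentially"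
    unfolding eventually_sequentially r_def by (intro exI[of _ k0]) auto
   then show "(\<lambda>k. \<bar>p x - r k x\<bar>) \<longlonglongrightarrow> 0" by (rule tendsto_eventually)
  qed
  show "AE x in ?M. norm \<bar>p x - r k x\<bar> \<le> \<bar>p x\<bar>" for k
   by (rule AE_I2) (auto simp: r_def)
 qed (use p in auto)
 then have "eventually (\<lambda>k. (LINT x|?M. \<bar>p x - r k x\<bar>) < e / 2) sequentially"
  using e by (intro order_tendstoD(2)[where y = 0]) auto
 then obtain k where k: "(LINT x|?M. \<bar>p x - r k x\<bar>) < e / 2"
  using eventually_happens'[OF sequentially_bot] by blast
 obtain c where c: "\<And>n. continuous_on UNIV (c n)" "\<And>n x. \<bar>c n x\<bar> \<le> \<bar>real k\<bar>"
  "AE x in ?M. (\<lambda>n. c n x) \<longlonglongrightarrow> r k x"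
  by (rule continuous_bounded_approx[OF rm[of k], of "real k"]) (use S in \<open>auto simp: r_def\<close>)
 have cm [measurable]: "c n \<in> borel_measurable ?M" for n
  using c(1) S by (intro continuous_imp_measurable_on_sets_lebesgue) (auto intro: continuous_on_subset)
 have "(\<lambda>n. LINT x|?M. \<bar>r k x - c n x\<bar>) \<longlonglongrightarrow> (LINT x|?M. 0)"
 proof (rule integral_dominated_convergence[where w = "\<lambda>x. 2 * real k"])
  show "AE x in ?M. (\<lambda>n. \<bar>r k x - c n x\<bar>) \<longlonglongrightarrow> 0"
   using c(3)
  proof eventually_elim
   case (elim x)
   then have "(\<lambda>n. \<bar>r k x - c n x\<bar>) \<longlonglongrightarrow> \<bar>r k x - r k x\<bar>" by (intro tendsto_intros)
   then show ?case by simp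
  qed
  show "AE x in ?M. norm \<bar>r k x - c n x\<bar> \<le> 2 * real k" for n
  proof (rule AE_I2)
   fix x
   have "\<bar>r k x\<bar> \<le> real k" by (auto simp: r_def)
   then show "norm \<bar>r k x - c n x\<bar> \<le> 2 * real k" using c(2)[of n x] by simp
  qed
 qed auto
 then have "eventually (\<lambda>n. (LINT x|?M. \<bar>r k x - c n x\<bar>) < e / 2) sequentially"
  using e by (intro order_tendstoD(2)[where y = 0]) auto
 then obtain n where n: "(LINT x|?M. \<bar>r k x - c n x\<bar>) < e / 2"
  using eventually_happens'[OF sequentially_bot] by blast
 have ri: "integrable ?M (r k)"
  by (rule integrable_const_bound[of _ "real k"]) (auto simp: r_def)
 have ci: "integrable ?M (c n)"
  by (rule integrable_const_bound[of _ "\<bar>real k\<bar>"]) (use c in auto)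
 have "(LINT x|?M. \<bar>p x - c n x\<bar>) \<le> (LINT x|?M. \<bar>p x - r k x\<bar> + \<bar>r k x - c n x\<bar>)"
  by (rule integral_mono) (use p ri ci in auto)
 also have "\<dots> = (LINT x|?M. \<bar>p x - r k x\<bar>) + (LINT x|?M. \<bar>r k x - c n x\<bar>)"
  using p ri ci by simp
 finally have "(LINT x|?M. \<bar>p x - c n x\<bar>) < e" using k n by simp
 then show ?thesis using that[of "c n" "\<bar>real k\<bar>"] c by blast
qed

text \<open>The product \<open>q t * w s\<close> is integrable on the square and, times
  \<open>B\<close>, dominates the integrand. Stated for a general bounded kernel because it serves
  Steklov averages, primitives and the Gronwall lemmas alike.\<close>

lemma Fubini_kernel:
 fixes q w :: "real \<Rightarrow> real" and k :: "real \<Rightarrow> real \<Rightarrow> real"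
 assumes q: "integrable (\<mu> T) q" and w: "integrable (\<mu> T) w"
  and k [measurable]: "case_prod k \<in> borel_measurable (\<mu> T \<Otimes>\<^sub>M \<mu> T)" and B: "\<And>t s. \<bar>k t s\<bar> \<le> B"
 shows "(LINT t|\<mu> T. q t * (LINT s|\<mu> T. k t s * w s)) = (LINT s|\<mu> T. w s * (LINT t|\<mu> T. k t s * q t))"
  "integrable (\<mu> T) (\<lambda>t. q t * (LINT s|\<mu> T. k t s * w s))"
  "(\<lambda>t. LINT s|\<mu> T. k t s * w s) \<in> borel_measurable (\<mu> T)"
proof -
 interpret P: pair_sigma_finite "\<mu> T" "\<mu> T" ..
 have [measurable]: "q \<in> borel_measurable (\<mu> T)" "w \<in> borel_measurable (\<mu> T)" using q w by auto
 have 1: "integrable (\<mu> T \<Otimes>\<^sub>M \<mu> T) (\<lambda>(t,s). q t * w s)"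
 proof (rule P.Fubini_integrable)
  show "integrable (\<mu> T) (\<lambda>t. LINT s|\<mu> T. norm (case (t, s) of (t, s) \<Rightarrow> q t * w s))"
   using q by (simp add: abs_mult)
  show "AE x in \<mu> T. integrable (\<mu> T) (\<lambda>y. case (x, y) of (t, s) \<Rightarrow> q t * w s)" using w by simp
 qed measurable
 have 2: "integrable (\<mu> T \<Otimes>\<^sub>M \<mu> T) (\<lambda>(t,s). q t * (k t s * w s))"
 proof (rule Bochner_Integration.integrable_bound)
  show "integrable (\<mu> T \<Otimes>\<^sub>M \<mu> T) (\<lambda>p. B * (case p of (t,s) \<Rightarrow> q t * w s))" using 1 by simp
  have "\<bar>q t * (k t s * w s)\<bar> \<le> \<bar>B * (q t * w s)\<bar>" for t s
  proof -
   have "\<bar>k t s\<bar> * \<bar>q t * w s\<bar> \<le> \<bar>B\<bar> * \<bar>q t * w s\<bar>" using B[of t s] by (intro mult_right_mono) auto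
   then show ?thesis by (simp add: abs_mult ac_simps)
  qed
  then show "AE x in \<mu> T \<Otimes>\<^sub>M \<mu> T. norm (case x of (t, s) \<Rightarrow> q t * (k t s * w s)) \<le> norm (B * (case x of (t,s) \<Rightarrow> q t * w s))"
   by (intro AE_I2) (simp add: split_beta)
 qed measurable
 have "(LINT s|\<mu> T. (LINT t|\<mu> T. q t * (k t s * w s))) = (LINT t|\<mu> T. (LINT s|\<mu> T. q t * (k t s * w s)))"
  by (rule P.Fubini_integral[OF 2])
 moreover have "(LINT t|\<mu> T. q t * (k t s * w s)) = w s * (LINT t|\<mu> T. k t s * q t)" for s
  by (subst integral_mult_right_zero[symmetric]) (simp add: ac_simps)
 ultimately show "(LINT t|\<mu> T. q t * (LINT s|\<mu> T. k t s * w s)) = (LINT s|\<mu> T. w s * (LINT t|\<mu> T. k t s * q t))"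
  by simp
 show "integrable (\<mu> T) (\<lambda>t. q t * (LINT s|\<mu> T. k t s * w s))"
  using P.integrable_fst[OF 2] by simp
 show "(\<lambda>t. LINT s|\<mu> T. k t s * w s) \<in> borel_measurable (\<mu> T)" by measurable
qed

text \<open>The kernel of the Steklov averages; \<open>a = 0\<close> looks forward in time and \<open>a = 1\<close> backward.\<close>

definition kern :: "real \<Rightarrow> real \<Rightarrow> real \<Rightarrow> real \<Rightarrow> real" where
 "kern a h t s = (if t - a * h < s \<and> s < t - a * h + h then 1 / h else 0)"

lemma kern_bounds: "h > 0 \<Longrightarrow> 0 \<le> kern a h t s" "h > 0 \<Longrightarrow> \<bar>kern a h t s\<bar> \<le> 1 / h"
 by (auto simp: kern_def)

lemma kern_measurable [measurable]: "case_prod (kern a h) \<in> borel_measurable (\<mu> T \<Otimes>\<^sub>M \<mu> T)"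
 unfolding kern_def[abs_def] split_beta by measurable

lemma kern_measurable1 [measurable]: "kern a h t \<in> borel_measurable (\<mu> T)" "(\<lambda>t. kern a h t s) \<in> borel_measurable (\<mu> T)"
 unfolding kern_def[abs_def] by measurable

lemma integrable_interval_bounded:
 assumes "f \<in> borel_measurable (\<mu> T)" "\<And>t. t \<in> {0<..<T} \<Longrightarrow> \<bar>f t :: real\<bar> \<le> B"
 shows "integrable (\<mu> T) f"
proof -
 show ?thesis by (rule time.integrable_const_bound[of _ B]) (use assms in auto)
qed

lemma integral_box_indicator_le:
 assumes "a \<le> b"
 shows "(LINT s|\<mu> T. indicator {a<..<b} s) \<le> (b - a :: real)"
  "{a<..<b} \<subseteq> {0<..<T} \<Longrightarrow> (LINT s|\<mu> T. indicator {a<..<b} s) = (b - a :: real)"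
proof -
 have "(LINT s|\<mu> T. indicator {a<..<b} s :: real) = measure (\<mu> T) ({a<..<b} \<inter> {0<..<T})"
  using Bochner_Integration.integral_indicator[of "\<mu> T" "{a<..<b}"] by simp
 also have "\<dots> = measure lebesgue ({a<..<b} \<inter> {0<..<T})"
  by (subst measure_restrict_space) auto
 finally have *: "(LINT s|\<mu> T. indicator {a<..<b} s :: real) = measure lebesgue ({a<..<b} \<inter> {0<..<T})" .
 also have "\<dots> \<le> measure lebesgue {a<..<b}"
  by (intro measure_mono_fmeasurable) auto
 finally show "(LINT s|\<mu> T. indicator {a<..<b} s) \<le> (b - a :: real)" using assms by simp
 show "(LINT s|\<mu> T. indicator {a<..<b} s) = (b - a :: real)" if "{a<..<b} \<subseteq> {0<..<T}"
 proof -
  have "{a<..<b} \<inter> {0<..<T} = {a<..<b}" using that by blast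
  then show ?thesis unfolding * using assms by simp
 qed
qed

text \<open>The window has length \<open>h\<close> and height \<open>1 / h\<close>; near the ends of
  the interval it is cut off, so in general the mass is only bounded by 1.\<close>

lemma kern_integral:
 assumes h: "h > 0"
 shows "(LINT s|\<mu> T. kern a h t s) \<le> 1" "(LINT t|\<mu> T. kern a h t s) \<le> 1"
  "0 < t - a * h \<Longrightarrow> t - a * h + h < T \<Longrightarrow> (LINT s|\<mu> T. kern a h t s) = 1"
proof -
 have 1: "kern a h t s = (1 / h) * indicator {t - a * h<..<t - a * h + h} s" for t s
  by (auto simp: kern_def indicator_def)
 have 2: "kern a h t s = (1 / h) * indicator {s + a * h - h<..<s + a * h} t" for t s
  by (auto simp: kern_def indicator_def)
 show "(LINT s|\<mu> T. kern a h t s) \<le> 1"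
  unfolding 1 using integral_box_indicator_le(1)[of "t - a * h" "t - a * h + h" T] h by (simp add: field_simps)
 show "(LINT t|\<mu> T. kern a h t s) \<le> 1"
  unfolding 2 using integral_box_indicator_le(1)[of "s + a * h - h" "s + a * h" T] h by (simp add: field_simps)
 show "(LINT s|\<mu> T. kern a h t s) = 1" if "0 < t - a * h" "t - a * h + h < T"
 proof -
  have "{t - a * h<..<t - a * h + h} \<subseteq> {0<..<T}" using that by auto
  then show ?thesis unfolding 1 using integral_box_indicator_le(2)[of "t - a * h" "t - a * h + h" T] h
   by (simp del: Bochner_Integration.integral_indicator)
 qed
qed

text \<open>Averaging does not increase the L1 norm, uniformly in \<open>h\<close>: after Fubini the
  kernel is integrated over its first variable, where its mass is at most 1 as well.\<close>

lemma kern_bound: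
 assumes h: "h > 0" and p: "integrable (\<mu> T) p" and q: "q \<in> borel_measurable (\<mu> T)"
  and B: "\<And>t. t \<in> {0<..<T} \<Longrightarrow> \<bar>q t\<bar> \<le> B" "B \<ge> 0"
 shows "\<bar>LINT t|\<mu> T. q t * (LINT s|\<mu> T. kern a h t s * p s)\<bar> \<le> B * (LINT s|\<mu> T. \<bar>p s\<bar>)"
proof -
 have qi: "integrable (\<mu> T) q" using integrable_interval_bounded[OF q B(1)] .
 have Bi: "integrable (\<mu> T) (\<lambda>_. B)" by simp
 note F = Fubini_kernel[OF _ _ kern_measurable kern_bounds(2)[OF h]]
 have "\<bar>LINT t|\<mu> T. q t * (LINT s|\<mu> T. kern a h t s * p s)\<bar> \<le> (LINT t|\<mu> T. \<bar>q t * (LINT s|\<mu> T. kern a h t s * p s)\<bar>)"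
  by (rule integral_abs_bound)
 also have "\<dots> \<le> (LINT t|\<mu> T. B * (LINT s|\<mu> T. kern a h t s * \<bar>p s\<bar>))"
 proof (rule integral_mono)
  show "integrable (\<mu> T) (\<lambda>t. \<bar>q t * (LINT s|\<mu> T. kern a h t s * p s)\<bar>)"
   using F(2)[OF qi p] by simp
  show "integrable (\<mu> T) (\<lambda>t. B * (LINT s|\<mu> T. kern a h t s * \<bar>p s\<bar>))"
   using p by (intro F(2)[OF Bi]) simp
  fix t assume "t \<in> space (\<mu> T)"
  then have "\<bar>q t\<bar> \<le> B" using B by simp
  moreover have "\<bar>LINT s|\<mu> T. kern a h t s * p s\<bar> \<le> (LINT s|\<mu> T. kern a h t s * \<bar>p s\<bar>)"
   using integral_abs_bound[of "\<mu> T" "\<lambda>s. kern a h t s * p s"] kern_bounds(1)[OF h] by (simp add: abs_mult)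
  ultimately show "\<bar>q t * (LINT s|\<mu> T. kern a h t s * p s)\<bar> \<le> B * (LINT s|\<mu> T. kern a h t s * \<bar>p s\<bar>)"
   unfolding abs_mult by (intro mult_mono) (use B in auto)
 qed
 also have "\<dots> = (LINT s|\<mu> T. \<bar>p s\<bar> * (LINT t|\<mu> T. kern a h t s * B))"
  using p by (intro F(1)[OF Bi]) simp
 also have "\<dots> = B * (LINT s|\<mu> T. \<bar>p s\<bar> * (LINT t|\<mu> T. kern a h t s))"
  by (simp add: ac_simps)
 also have "\<dots> \<le> B * (LINT s|\<mu> T. \<bar>p s\<bar>)"
 proof (intro mult_left_mono integral_mono)
  have "integrable (\<mu> T) (\<lambda>s. \<bar>p s\<bar> * (LINT t|\<mu> T. kern a h t s * 1))"
   using Fubini_kernel(2)[of T "\<lambda>s. \<bar>p s\<bar>" "\<lambda>_. 1" "\<lambda>s t. kern a h t s" "1/h"] p kern_bounds(2)[OF h]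
    measurable_pair_swap[OF kern_measurable[of a h T]] by (simp add: split_beta case_prod_unfold)
  then show "integrable (\<mu> T) (\<lambda>s. \<bar>p s\<bar> * (LINT t|\<mu> T. kern a h t s))" by simp
  show "\<bar>p s\<bar> * (LINT t|\<mu> T. kern a h t s) \<le> \<bar>p s\<bar>" for s
   using kern_integral(2)[OF h, of T a s] by (simp add: mult_left_le)
 qed (use p B in auto)
 finally show ?thesis .
qed

lemma kern_tendsto_continuous:
 assumes c: "continuous_on UNIV c" "\<And>x. \<bar>c x\<bar> \<le> C" and a: "0 \<le> a" "a \<le> 1"
  and h: "\<And>n. h n > 0" "h \<longlonglongrightarrow> 0" and t: "0 < t" "t < T"
 shows "(\<lambda>n. LINT s|\<mu> T. kern a (h n) t s * c s) \<longlonglongrightarrow> (c t :: real)"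
proof (rule LIMSEQ_I)
 fix e :: real assume e: "e > 0"
 have cm [measurable]: "c \<in> borel_measurable (\<mu> T)"
  using c(1) by (intro continuous_imp_measurable_on_sets_lebesgue) (auto intro: continuous_on_subset)
 have "isCont c t" using c(1) by (simp add: continuous_on_eq_continuous_at)
 then obtain d where d: "d > 0" "\<And>s. \<bar>s - t\<bar> < d \<Longrightarrow> \<bar>c s - c t\<bar> < e / 2"
  using e unfolding continuous_at_eps_delta dist_real_def by (meson half_gt_zero)
 \<comment> \<open>For steps below \<open>d'\<close> the averaging window lies in (0, T), where the
   kernel has mass exactly 1, and in the neighbourhood given by continuity.\<close>
 define d' where "d' = Min {d, t, T - t}"
 have d': "d' > 0" "d' \<le> d" "d' \<le> t" "d' \<le> T - t" using d t by (auto simp: d'_def)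
 obtain N where N: "\<And>n. n \<ge> N \<Longrightarrow> h n < d'"
  using LIMSEQ_D[OF h(2) d'(1)] h(1) by force
 show "\<exists>N. \<forall>n\<ge>N. norm ((LINT s|\<mu> T. kern a (h n) t s * c s) - c t) < e"
 proof (intro exI[of _ N] allI impI)
  fix n assume n: "n \<ge> N"
  have hn: "h n > 0" "h n < d'" using h N n by auto
  have ah: "a * h n \<le> h n" "0 \<le> a * h n" using a hn by (auto simp: mult_left_le_one_le)
  have k1: "(LINT s|\<mu> T. kern a (h n) t s) = 1"
   by (rule kern_integral(3)) (use ah hn d' in linarith)+
  have ki: "integrable (\<mu> T) (kern a (h n) t)"
   using kern_bounds(2)[OF hn(1)] by (intro integrable_interval_bounded) auto
  have kc: "integrable (\<mu> T) (\<lambda>s. kern a (h n) t s * c s)"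
  proof (rule integrable_interval_bounded)
   fix s show "\<bar>kern a (h n) t s * c s\<bar> \<le> (1 / h n) * C"
    unfolding abs_mult using kern_bounds(2)[OF hn(1)] c(2) by (intro mult_mono) (auto simp: hn less_imp_le)
  qed measurable
  have "(LINT s|\<mu> T. kern a (h n) t s * c s - kern a (h n) t s * c t) = (LINT s|\<mu> T. kern a (h n) t s * c s) - c t"
   using kc ki k1 by simp
  then have "norm ((LINT s|\<mu> T. kern a (h n) t s * c s) - c t) \<le> (LINT s|\<mu> T. \<bar>kern a (h n) t s * c s - kern a (h n) t s * c t\<bar>)"
   using integral_abs_bound[of "\<mu> T" "\<lambda>s. kern a (h n) t s * c s - kern a (h n) t s * c t"] by simp
  also have "\<dots> \<le> (LINT s|\<mu> T. kern a (h n) t s * (e / 2))"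
  proof (rule integral_mono)
   fix s
   show "\<bar>kern a (h n) t s * c s - kern a (h n) t s * c t\<bar> \<le> kern a (h n) t s * (e / 2)"
   proof (cases "t - a * h n < s \<and> s < t - a * h n + h n")
    case True
    then have "\<bar>s - t\<bar> < d" using ah hn d' by linarith
    then have "\<bar>c s - c t\<bar> \<le> e / 2" using d(2)[of s] by simp
    then have "kern a (h n) t s * \<bar>c s - c t\<bar> \<le> kern a (h n) t s * (e / 2)"
     using kern_bounds(1)[OF hn(1)] by (intro mult_left_mono)
    moreover have "\<bar>kern a (h n) t s * c s - kern a (h n) t s * c t\<bar> = kern a (h n) t s * \<bar>c s - c t\<bar>"
     using kern_bounds(1)[OF hn(1), of a t s] by (metis abs_mult abs_of_nonneg right_diff_distrib)
    ultimately show ?thesis by simp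
   qed (auto simp: kern_def)
  qed (use kc ki in auto)
  also have "\<dots> = e / 2" using k1 by simp
  finally show "norm ((LINT s|\<mu> T. kern a (h n) t s * c s) - c t) < e" using e by simp
 qed
qed

text \<open>Density: for continuous \<open>c\<close> the averages converge pointwise, and
  \<open>kern_bound\<close> controls the replacement of \<open>p\<close> by \<open>c\<close>
  uniformly in the step.\<close>

lemma kern_tendsto:
 assumes p: "integrable (\<mu> T) p" and q [measurable]: "q \<in> borel_measurable (\<mu> T)"
  and B: "\<And>t. t \<in> {0<..<T} \<Longrightarrow> \<bar>q t\<bar> \<le> B" "B \<ge> 0" and a: "0 \<le> a" "a \<le> 1"
  and h: "\<And>n. h n > 0" "h \<longlonglongrightarrow> 0"
 shows "(\<lambda>n. LINT t|\<mu> T. q t * (LINT s|\<mu> T. kern a (h n) t s * p s)) \<longlonglongrightarrow> (LINT t|\<mu> T. q t * p t)"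
proof (rule LIMSEQ_I)
 fix r :: real assume r: "r > 0"
 \<comment> \<open>Two of the three errors are bounded by \<open>B * e\<close>, which this makes
   less than \<open>r / 3\<close>; the \<open>+ 1\<close> covers \<open>B = 0\<close>.\<close>
 define e where "e = r / (3 * (B + 1))"
 have e: "e > 0" using r B by (simp add: e_def)
 have Be: "B * e < r / 3"
 proof -
  have "B * e < (B + 1) * e" using e by simp
  also have "\<dots> = r / 3" using B(2) by (simp add: e_def field_simps)
  finally show ?thesis .
 qed
 obtain c C where c: "continuous_on UNIV c" "\<And>x. \<bar>c x\<bar> \<le> C" "(LINT x|\<mu> T. \<bar>p x - c x\<bar>) < e"
  by (rule L1_continuous_approx[OF _ p e]) (use lmeasurable_interval in auto)
 have cm [measurable]: "c \<in> borel_measurable (\<mu> T)"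
  using c(1) by (intro continuous_imp_measurable_on_sets_lebesgue) (auto intro: continuous_on_subset)
 have ci: "integrable (\<mu> T) c" using integrable_interval_bounded[OF cm c(2)] .
 have qi: "integrable (\<mu> T) q" using integrable_interval_bounded[OF q B(1)] .
 have C0: "C \<ge> 0" using c(2)[of 0] by linarith
 have qci: "integrable (\<mu> T) (\<lambda>t. q t * c t)"
  using B c(2) by (intro integrable_interval_bounded[where B = "B * C"]) (auto simp: abs_mult intro!: mult_mono)
 have qpi: "integrable (\<mu> T) (\<lambda>t. q t * p t)"
  using p B by (intro Bochner_Integration.integrable_bound[of _ "\<lambda>t. B * p t" "\<lambda>t. q t * p t"])
   (auto simp: abs_mult intro!: mult_right_mono AE_I2)
 note F = Fubini_kernel[OF qi _ kern_measurable kern_bounds(2)[OF h(1)]]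
 have kib: "\<bar>LINT s|\<mu> T. kern a (h n) t s * c s\<bar> \<le> C" for n t
 proof -
  have ki: "integrable (\<mu> T) (kern a (h n) t)"
   using kern_bounds(2)[OF h(1)] by (intro integrable_interval_bounded) auto
  have kc: "integrable (\<mu> T) (\<lambda>s. kern a (h n) t s * c s)"
  proof (rule integrable_interval_bounded)
   fix s show "\<bar>kern a (h n) t s * c s\<bar> \<le> (1 / h n) * C"
    unfolding abs_mult using kern_bounds(2)[OF h(1)] c(2) by (intro mult_mono) (auto simp: h less_imp_le)
  qed measurable
  have "\<bar>LINT s|\<mu> T. kern a (h n) t s * c s\<bar> \<le> (LINT s|\<mu> T. \<bar>kern a (h n) t s * c s\<bar>)" by (rule integral_abs_bound)
  also have "\<dots> \<le> (LINT s|\<mu> T. kern a (h n) t s * C)"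
  proof (intro integral_mono integrable_abs kc)
   show "\<bar>kern a (h n) t s * c s\<bar> \<le> kern a (h n) t s * C" for s
    using c(2)[of s] kern_bounds(1)[OF h(1)] by (simp add: abs_mult mult_left_mono)
  qed (use ki in simp)
  also have "\<dots> = (LINT s|\<mu> T. kern a (h n) t s) * C" by simp
  also have "\<dots> \<le> 1 * C" by (rule mult_right_mono[OF kern_integral(1)[OF h(1)] C0])
  finally show ?thesis by simp
 qed
 have "(\<lambda>n. LINT t|\<mu> T. q t * (LINT s|\<mu> T. kern a (h n) t s * c s)) \<longlonglongrightarrow> (LINT t|\<mu> T. q t * c t)"
 proof (rule integral_dominated_convergence[where w = "\<lambda>_. B * C"])
  show "(\<lambda>t. q t * (LINT s|\<mu> T. kern a (h n) t s * c s)) \<in> borel_measurable (\<mu> T)" for n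
   using F(2)[OF ci] by (rule borel_measurable_integrable)
  show "AE t in \<mu> T. (\<lambda>n. q t * (LINT s|\<mu> T. kern a (h n) t s * c s)) \<longlonglongrightarrow> q t * c t"
   by (intro AE_I2 tendsto_mult tendsto_const kern_tendsto_continuous[OF c(1,2) a h]) auto
  show "AE t in \<mu> T. norm (q t * (LINT s|\<mu> T. kern a (h n) t s * c s)) \<le> B * C" for n
  proof (rule AE_I2)
   fix t assume "t \<in> space (\<mu> T)"
   then have "\<bar>q t\<bar> * \<bar>LINT s|\<mu> T. kern a (h n) t s * c s\<bar> \<le> B * C"
    by (intro mult_mono kib B) (use B in auto)
   then show "norm (q t * (LINT s|\<mu> T. kern a (h n) t s * c s)) \<le> B * C" by (simp add: abs_mult)
  qed
 qed auto
 then obtain N where N: "\<And>n. n \<ge> N \<Longrightarrow>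
   \<bar>(LINT t|\<mu> T. q t * (LINT s|\<mu> T. kern a (h n) t s * c s)) - (LINT t|\<mu> T. q t * c t)\<bar> < r / 3"
  using LIMSEQ_D[of "\<lambda>n. LINT t|\<mu> T. q t * (LINT s|\<mu> T. kern a (h n) t s * c s)" "LINT t|\<mu> T. q t * c t" "r / 3"] r
  by auto
 have pc: "\<bar>(LINT t|\<mu> T. q t * c t) - (LINT t|\<mu> T. q t * p t)\<bar> \<le> B * e"
 proof -
  have "\<bar>(LINT t|\<mu> T. q t * c t) - (LINT t|\<mu> T. q t * p t)\<bar> = \<bar>LINT t|\<mu> T. q t * c t - q t * p t\<bar>"
   using qci qpi by simp
  also have "\<dots> \<le> (LINT t|\<mu> T. \<bar>q t * c t - q t * p t\<bar>)" by (rule integral_abs_bound)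
  also have "\<dots> \<le> (LINT t|\<mu> T. B * \<bar>p t - c t\<bar>)"
  proof (rule integral_mono)
   fix t assume "t \<in> space (\<mu> T)"
   then have "\<bar>q t\<bar> * \<bar>p t - c t\<bar> \<le> B * \<bar>p t - c t\<bar>" using B(1) by (intro mult_right_mono) auto
   moreover have "\<bar>q t * c t - q t * p t\<bar> = \<bar>q t\<bar> * \<bar>p t - c t\<bar>"
    by (metis abs_minus_commute abs_mult right_diff_distrib)
   ultimately show "\<bar>q t * c t - q t * p t\<bar> \<le> B * \<bar>p t - c t\<bar>" by simp
  qed (use qci qpi p ci in auto)
  also have "\<dots> \<le> B * e" using c(3) B(2) by (simp add: mult_left_mono)
  finally show ?thesis .
 qed
 show "\<exists>N. \<forall>n\<ge>N. norm ((LINT t|\<mu> T. q t * (LINT s|\<mu> T. kern a (h n) t s * p s)) - (LINT t|\<mu> T. q t * p t)) < r"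
 proof (intro exI[of _ N] allI impI)
  fix n assume n: "n \<ge> N"
  have pci: "integrable (\<mu> T) (\<lambda>s. p s - c s)" using p ci by simp
  have ki: "integrable (\<mu> T) (\<lambda>s. kern a (h n) t s * f s)" if f: "integrable (\<mu> T) f" for f t
  proof (rule Bochner_Integration.integrable_bound)
   show "integrable (\<mu> T) (\<lambda>s. (1 / h n) * f s)" using f by simp
   show "AE s in \<mu> T. norm (kern a (h n) t s * f s) \<le> norm ((1 / h n) * f s)"
    unfolding norm_mult using kern_bounds(2)[OF h(1)] h(1)[of n] by (intro AE_I2 mult_right_mono) auto
  qed (use f in measurable)
  have "(LINT t|\<mu> T. q t * (LINT s|\<mu> T. kern a (h n) t s * (p s - c s)))
    = (LINT t|\<mu> T. q t * (LINT s|\<mu> T. kern a (h n) t s * p s) - q t * (LINT s|\<mu> T. kern a (h n) t s * c s))"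
   using ki[OF p] ki[OF ci] by (simp add: right_diff_distrib)
  also have "\<dots> = (LINT t|\<mu> T. q t * (LINT s|\<mu> T. kern a (h n) t s * p s)) - (LINT t|\<mu> T. q t * (LINT s|\<mu> T. kern a (h n) t s * c s))"
   using F(2)[OF p] F(2)[OF ci] by simp
  finally have eq: "(LINT t|\<mu> T. q t * (LINT s|\<mu> T. kern a (h n) t s * p s)) = (LINT t|\<mu> T. q t * (LINT s|\<mu> T. kern a (h n) t s * c s))
    + (LINT t|\<mu> T. q t * (LINT s|\<mu> T. kern a (h n) t s * (p s - c s)))" by simp
  have "\<bar>LINT t|\<mu> T. q t * (LINT s|\<mu> T. kern a (h n) t s * (p s - c s))\<bar> \<le> B * (LINT s|\<mu> T. \<bar>p s - c s\<bar>)"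
   by (rule kern_bound[OF h(1) pci q B])
  also have "\<dots> \<le> B * e" using c(3) B(2) by (intro mult_left_mono) auto
  finally show "norm ((LINT t|\<mu> T. q t * (LINT s|\<mu> T. kern a (h n) t s * p s)) - (LINT t|\<mu> T. q t * p t)) < r"
   using N[OF n] pc Be unfolding eq real_norm_def by linarith
 qed
qed

section \<open>Primitives of integrable functions\<close>

definition prim :: "real \<Rightarrow> (real \<Rightarrow> real) \<Rightarrow> real \<Rightarrow> real" where
 "prim T w t = (LINT s|\<mu> T. indicator {..t} s * w s)"

lemma prim_integrable:
 fixes w :: "real \<Rightarrow> real"
 assumes "integrable (\<mu> T) w" "A \<in> sets borel"
 shows "integrable (\<mu> T) (\<lambda>s. indicator A s * w s)"
proof -
 have "(indicator A :: real \<Rightarrow> real) \<in> borel_measurable (\<mu> T)"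
  using measurable_compose[OF measurable_id_lebesgue_on, of "indicator A" borel] assms(2) by simp
 then have "(\<lambda>s. indicator A s * w s) \<in> borel_measurable (\<mu> T)"
  using assms(1) by (intro borel_measurable_times) auto
 then show ?thesis
  by (rule Bochner_Integration.integrable_bound[OF assms(1)]) (auto simp: indicator_def)
qed

lemma AE_neq_time_measure: "AE s in \<mu> T. s \<noteq> a"
 unfolding AE_time_measure by (rule AE_mp[OF AE_completion[OF AE_lborel_singleton[of a]]]) simp

text \<open>Dominated convergence: the indicators converge except at \<open>s = t\<close>, a null
  set.\<close>

lemma prim_continuous:
 assumes w: "integrable (\<mu> T) w"
 shows "continuous_on S (prim T w)"
proof (intro continuous_at_imp_continuous_on ballI continuous_at_sequentiallyI)
 fix u t assume u: "u \<longlonglongrightarrow> (t::real)"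
 show "(\<lambda>n. prim T w (u n)) \<longlonglongrightarrow> prim T w t"
  unfolding prim_def
 proof (rule integral_dominated_convergence[where w = "\<lambda>s. \<bar>w s\<bar>"])
  show "(\<lambda>s. indicator {..t} s * w s) \<in> borel_measurable (\<mu> T)"
   "(\<lambda>s. indicator {..u n} s * w s) \<in> borel_measurable (\<mu> T)" for n
   using prim_integrable[OF w] by auto
  show "AE s in \<mu> T. (\<lambda>n. indicator {..u n} s * w s) \<longlonglongrightarrow> indicator {..t} s * w s"
   using AE_neq_time_measure[of t T]
  proof eventually_elim
   case (elim s)
   have "eventually (\<lambda>n. indicator {..u n} s * w s = indicator {..t} s * w s) sequentially"
   proof (cases "s < t")
    case True
    then have "eventually (\<lambda>n. s < u n) sequentially" using order_tendstoD(1)[OF u] by blast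
    then show ?thesis by eventually_elim (use True in auto)
   next
    case False
    then have "eventually (\<lambda>n. u n < s) sequentially" using order_tendstoD(2)[OF u, of s] elim by simp
    then show ?thesis by eventually_elim (use False elim in auto)
   qed
   then show ?case by (rule tendsto_eventually)
  qed
  show "AE s in \<mu> T. norm (indicator {..u n} s * w s) \<le> \<bar>w s\<bar>" for n
   by (rule AE_I2) (simp add: indicator_def)
 qed (use w in simp)
qed

lemma prim_diff:
 assumes "integrable (\<mu> T) w" "r \<le> t"
 shows "prim T w t - prim T w r = (LINT s|\<mu> T. indicator {r<..<t} s * w s)"
proof -
 have "prim T w t - prim T w r = (LINT s|\<mu> T. indicator {..t} s * w s - indicator {..r} s * w s)"
  unfolding prim_def using prim_integrable[OF assms(1)] by simp
 also have "\<dots> = (LINT s|\<mu> T. indicator {r<..<t} s * w s)"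
 proof (rule integral_cong_AE)
  show "AE s in \<mu> T. indicator {..t} s * w s - indicator {..r} s * w s = indicator {r<..<t} s * w s"
   using AE_neq_time_measure[of t T]
   by eventually_elim (use assms(2) in \<open>auto simp: indicator_def\<close>)
 qed (use prim_integrable[OF assms(1)] in auto)
 finally show ?thesis .
qed

lemma prim_0: "t \<le> 0 \<Longrightarrow> prim T w t = 0"
proof -
 assume "t \<le> 0"
 then have "prim T w t = (LINT s|\<mu> T. 0)"
  unfolding prim_def by (intro Bochner_Integration.integral_cong) auto
 then show ?thesis by simp
qed

lemma prim_T: "prim T w T = (LINT s|\<mu> T. w s)"
 unfolding prim_def by (intro Bochner_Integration.integral_cong) auto

text \<open>Turns increments in time of a primitive into Steklov averages, the form in which the
  energy argument can let \<open>h\<close> tend to 0.\<close>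

lemma prim_kern:
 assumes "integrable (\<mu> T) w" "h > 0"
 shows "prim T w (t - a * h + h) - prim T w (t - a * h) = h * (LINT s|\<mu> T. kern a h t s * w s)"
proof -
 have "h * (kern a h t s * w s) = indicator {t - a * h<..<t - a * h + h} s * w s" for s
  using assms(2) by (simp add: kern_def indicator_def)
 then have "(LINT s|\<mu> T. h * (kern a h t s * w s)) = (LINT s|\<mu> T. indicator {t - a * h<..<t - a * h + h} s * w s)"
  by (simp only:)
 then show ?thesis
  using prim_diff[OF assms(1), of "t - a * h" "t - a * h + h"] assms(2)
  by (simp only: integral_mult_right_zero)
qed

text \<open>By Fubini and the fundamental theorem of calculus \<open>prim T w\<close> has the weak
  derivative \<open>w\<close>, so \<open>z - prim T w\<close> is orthogonal to all derivatives of
  test functions, and the lemma of du Bois-Reymond makes it constant.\<close>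

lemma weak_deriv_primitive:
 fixes T :: real
 assumes T: "T > 0" and z: "integrable (\<mu> T) z" and w: "integrable (\<mu> T) w"
  and 0: "\<And>\<phi>. \<phi> \<in> test_functions {0<..<T} \<Longrightarrow>
   (LINT t|\<mu> T. deriv \<phi> t * z t) = - (LINT t|\<mu> T. \<phi> t * w t)"
 obtains c where "AE t in \<mu> T. z t = c + prim T w t"
proof -
 have pm [measurable]: "prim T w \<in> borel_measurable (\<mu> T)"
  by (intro continuous_imp_measurable_on_sets_lebesgue prim_continuous w) simp
 have pb: "\<bar>prim T w t\<bar> \<le> (LINT s|\<mu> T. \<bar>w s\<bar>)" for t
 proof -
  have "\<bar>prim T w t\<bar> \<le> (LINT s|\<mu> T. \<bar>indicator {..t} s * w s\<bar>)" unfolding prim_def by (rule integral_abs_bound)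
  also have "\<dots> \<le> (LINT s|\<mu> T. \<bar>w s\<bar>)"
  proof (intro integral_mono integrable_abs w)
   show "integrable (\<mu> T) (\<lambda>s. indicator {..t} s * w s)" by (rule prim_integrable[OF w]) simp
  qed (simp add: indicator_def)
  finally show ?thesis .
 qed
 have pi: "integrable (\<mu> T) (prim T w)" using integrable_interval_bounded[OF pm pb] .
 have "\<exists>c. AE t in \<mu> T. z t - prim T w t = c"
 proof (rule du_bois_reymond[OF T])
  show "integrable (\<mu> T) (\<lambda>t. z t - prim T w t)" using z pi by simp
  fix \<phi> assume \<phi>: "\<phi> \<in> test_functions {0<..<T}"
  note \<phi>' = test_functions_deriv[OF \<phi>]
  note i = test_functions_lebesgue_on[OF \<phi>'(2), simplified]
  obtain C where C: "\<And>x. \<bar>deriv \<phi> x\<bar> \<le> C" "C > 0" by (rule test_functions_bounded[OF \<phi>'(2)]) blast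
  have bi: "integrable (\<mu> T) (\<lambda>t. deriv \<phi> t * f t)" if f: "integrable (\<mu> T) f" for f
  proof (rule Bochner_Integration.integrable_bound)
   show "integrable (\<mu> T) (\<lambda>t. C * f t)" using f by simp
   show "AE t in \<mu> T. norm (deriv \<phi> t * f t) \<le> norm (C * f t)"
    unfolding norm_mult using C by (intro AE_I2 mult_right_mono) auto
  qed (use f i(1) in measurable)
  obtain K where K: "compact K" "K \<subseteq> {0<..<T}" "\<And>x. x \<notin> K \<Longrightarrow> \<phi> x = 0"
   by (rule test_functionsE[OF \<phi>]) blast
  obtain L where L: "L \<subseteq> {0<..<T}" "\<And>x. x \<notin> L \<Longrightarrow> deriv \<phi> x = 0"
   by (rule test_functionsE[OF \<phi>'(2)]) blast
  have \<phi>T: "\<phi> T = 0" using K(2,3) by (metis greaterThanLessThan_iff less_irrefl subsetD)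
  have d0: "deriv \<phi> x = 0" if "x \<notin> {0<..<T}" for x using L that by blast
  have int: "(LINT t|\<mu> T. indicator {..t} s * deriv \<phi> t) = - \<phi> s" if s: "s \<in> {0<..<T}" for s
  proof -
   have "(LINT t|\<mu> T. indicator {..t} s * deriv \<phi> t) = (LINT t|lebesgue. (if t \<in> {0<..<T} then indicator {..t} s * deriv \<phi> t else 0))"
    by (rule Lebesgue_Measure.integral_restrict_UNIV[symmetric]) simp
   also have "\<dots> = (LINT t|lebesgue. indicator {s..T} t *\<^sub>R deriv \<phi> t)"
    using s d0[of T] by (intro Bochner_Integration.integral_cong) (auto simp: indicator_def)
   also have "\<dots> = (LINT t|lborel. indicator {s..T} t *\<^sub>R deriv \<phi> t)"
    using test_functions_measurable[OF \<phi>'(2)] by (intro integral_completion) auto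
   also have "\<dots> = \<phi> T - \<phi> s"
    using s test_functions_continuous[OF \<phi>'(2), of "{s..T}"]
     has_vector_derivative_at_within[OF \<phi>'(1)[unfolded has_real_derivative_iff_has_vector_derivative]]
    by (intro integral_FTC_atLeastAtMost) auto
   finally show ?thesis using \<phi>T by simp
  qed
  have km: "(\<lambda>(t,s). indicator {..t} s :: real) \<in> borel_measurable (\<mu> T \<Otimes>\<^sub>M \<mu> T)"
   unfolding indicator_def split_beta of_bool_def atMost_iff by measurable
  have "(LINT t|\<mu> T. deriv \<phi> t * prim T w t) = (LINT s|\<mu> T. w s * (LINT t|\<mu> T. indicator {..t} s * deriv \<phi> t))"
   unfolding prim_def by (rule Fubini_kernel(1)[OF i(1) w km, of 1]) (simp add: indicator_def)
  also have "\<dots> = (LINT s|\<mu> T. - (\<phi> s * w s))"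
   by (intro Bochner_Integration.integral_cong) (auto simp: int)
  finally have "(LINT t|\<mu> T. deriv \<phi> t * prim T w t) = (LINT t|\<mu> T. deriv \<phi> t * z t)" using 0[OF \<phi>] by simp
  then show "(LINT t|\<mu> T. deriv \<phi> t * (z t - prim T w t)) = 0"
   using bi[OF z] bi[OF pi] by (simp add: right_diff_distrib)
 qed blast
 then obtain c where "AE t in \<mu> T. z t - prim T w t = c" by blast
 then have "AE t in \<mu> T. z t = c + prim T w t" by eventually_elim simp
 then show ?thesis by (rule that)
qed

section \<open>Translations in time and inequalities of Gronwall type\<close>

lemma AE_lebesgue_shift:
 fixes Q :: "real \<Rightarrow> bool"
 assumes "AE t in lebesgue. Q t" shows "AE t in lebesgue. Q (t + c)"
proof -
 have "AE t in lborel. Q t" using assms by (simp add: AE_completion_iff)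
 then obtain N where N: "N \<in> null_sets lborel" "{t. \<not> Q t} \<subseteq> N"
  by (auto elim!: AE_E simp: null_sets_def)
 have "{x. x - (- c) \<in> N} \<in> null_sets lborel" using null_sets_translation[OF N(1)] .
 then have "AE t in lborel. Q (t + c)"
  by (rule AE_I') (use N(2) in auto)
 then show ?thesis by (rule AE_completion)
qed

lemma AE_time_shift:
 assumes "AE t in \<mu> T. P t"
 shows "AE t in \<mu> T. 0 < t + c \<longrightarrow> t + c < T \<longrightarrow> P (t + c)"
 using AE_lebesgue_shift[OF assms[unfolded AE_time_measure], of c] unfolding AE_time_measure
 by eventually_elim auto

text \<open>The conditions keep the support and its translate inside (0, T), so both integrals are
  integrals over the line, where translation invariance applies.\<close>

lemma integral_time_shift:
 fixes f :: "real \<Rightarrow> real"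
 assumes "\<And>t. f t \<noteq> 0 \<Longrightarrow> 0 < t \<and> t < T" "\<And>t. f t \<noteq> 0 \<Longrightarrow> 0 < t + h \<and> t + h < T"
 shows "(LINT t|\<mu> T. f (t - h)) = (LINT t|\<mu> T. f t)"
  "integrable (\<mu> T) (\<lambda>t. f (t - h)) \<longleftrightarrow> integrable (\<mu> T) f"
proof -
 have 1: "(\<lambda>t. if t \<in> {0<..<T} then f (t - h) else 0) = (\<lambda>t. f (- h + 1 * t))"
 proof
  fix t show "(if t \<in> {0<..<T} then f (t - h) else 0) = f (- h + 1 * t)"
   using assms(2)[of "t - h"] by auto
 qed
 have 2: "(\<lambda>t. if t \<in> {0<..<T} then f t else 0) = f"
  using assms(1) by (auto simp: fun_eq_iff)
 show "(LINT t|\<mu> T. f (t - h)) = (LINT t|\<mu> T. f t)"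
  using Lebesgue_Measure.integral_restrict_UNIV[of "{0<..<T}" "\<lambda>t. f (t - h)"]
   Lebesgue_Measure.integral_restrict_UNIV[of "{0<..<T}" f] lebesgue_integral_real_affine[of 1 f "- h"]
  unfolding 1 2 by simp
 show "integrable (\<mu> T) (\<lambda>t. f (t - h)) \<longleftrightarrow> integrable (\<mu> T) f"
  using Lebesgue_Measure.integrable_restrict_UNIV[of "{0<..<T}" "\<lambda>t. f (t - h)"]
   Lebesgue_Measure.integrable_restrict_UNIV[of "{0<..<T}" f] lebesgue_integrable_real_affine_iff[of 1 f "- h"]
  unfolding 1 2 by simp
qed

text \<open>The weight \<open>q\<close> is such that \<open>C\<close> times the adjoint kernel
  operator maps it below \<open>q / 2\<close>: after Fubini half of the left side is absorbed,
  whence the factor 2. Kernel and weight decide between the forward and the backward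
  inequality.\<close>

lemma gronwall_kernel:
 assumes y: "integrable (\<mu> T) y" "AE t in \<mu> T. 0 \<le> y t"
  and q: "integrable (\<mu> T) q" "\<And>t. 0 \<le> q t" "\<And>t. t \<in> {0<..<T} \<Longrightarrow> q t \<le> B"
  and k [measurable]: "case_prod k \<in> borel_measurable (\<mu> T \<Otimes>\<^sub>M \<mu> T)" and K: "\<And>t s. \<bar>k t s :: real\<bar> \<le> 1"
  and C: "C > 0" and le: "AE t in \<mu> T. y t \<le> e + C * (LINT s|\<mu> T. k t s * y s)"
  and kq: "\<And>s. s \<in> {0<..<T} \<Longrightarrow> C * (LINT t|\<mu> T. k t s * q t) \<le> q s / 2"
 shows "(LINT t|\<mu> T. q t * y t) \<le> 2 * e * (LINT t|\<mu> T. q t)"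
proof -
 note F = Fubini_kernel[OF q(1) y(1) k K]
 have [measurable]: "q \<in> borel_measurable (\<mu> T)" "y \<in> borel_measurable (\<mu> T)" using q y by auto
 have qy: "integrable (\<mu> T) (\<lambda>t. q t * y t)"
 proof (rule Bochner_Integration.integrable_bound)
  show "integrable (\<mu> T) (\<lambda>t. B * y t)" using y by simp
  show "AE t in \<mu> T. norm (q t * y t) \<le> norm (B * y t)"
  proof (rule AE_I2)
   fix t assume "t \<in> space (\<mu> T)"
   then have "\<bar>q t\<bar> \<le> \<bar>B\<bar>" using q(2)[of t] q(3)[of t] by simp
   then show "norm (q t * y t) \<le> norm (B * y t)" unfolding real_norm_def abs_mult by (rule mult_right_mono) simp
  qed
 qed measurable
 have "(LINT t|\<mu> T. q t * y t) \<le> (LINT t|\<mu> T. e * q t + C * (q t * (LINT s|\<mu> T. k t s * y s)))"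
 proof (rule integral_mono_AE)
  show "AE t in \<mu> T. q t * y t \<le> e * q t + C * (q t * (LINT s|\<mu> T. k t s * y s))"
   using le
  proof eventually_elim
   case (elim t)
   then have "q t * y t \<le> q t * (e + C * (LINT s|\<mu> T. k t s * y s))" using q(2) by (intro mult_left_mono)
   then show ?case by (simp add: algebra_simps)
  qed
 qed (use qy q F(2) in auto)
 also have "\<dots> = e * (LINT t|\<mu> T. q t) + C * (LINT t|\<mu> T. q t * (LINT s|\<mu> T. k t s * y s))"
  using q F(2) by simp
 also have "(LINT t|\<mu> T. q t * (LINT s|\<mu> T. k t s * y s)) = (LINT s|\<mu> T. y s * (LINT t|\<mu> T. k t s * q t))"
  by (rule F(1))
 also have "C * \<dots> \<le> (LINT s|\<mu> T. q s * y s) / 2"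
 proof -
  have i: "integrable (\<mu> T) (\<lambda>s. y s * (LINT t|\<mu> T. k t s * q t))"
   using Fubini_kernel(2)[OF y(1) q(1), of "\<lambda>s t. k t s" 1] K measurable_pair_swap[OF k]
   by (simp add: split_beta case_prod_unfold)
  have "(LINT s|\<mu> T. C * (y s * (LINT t|\<mu> T. k t s * q t))) \<le> (LINT s|\<mu> T. (q s * y s) / 2)"
  proof (rule integral_mono_AE)
   show "AE s in \<mu> T. C * (y s * (LINT t|\<mu> T. k t s * q t)) \<le> (q s * y s) / 2"
    using y(2) AE_space
   proof eventually_elim
    case (elim s)
    then have "y s * (C * (LINT t|\<mu> T. k t s * q t)) \<le> y s * (q s / 2)" using kq by (intro mult_left_mono) auto
    then show ?case by (simp add: ac_simps)
   qed
  qed (use i qy in auto)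
  then show ?thesis by simp
 qed
 finally show ?thesis by simp
qed

lemma exp_integral_le:
 assumes c: "c \<noteq> 0" and ab: "a \<le> b" "{a..b} \<inter> {0<..<T} = A \<inter> {0<..<T}"
 shows "(LINT t|\<mu> T. indicator A t * exp (c * t)) \<le> (exp (c * b) - exp (c * a)) / c"
proof -
 have "(LINT t|\<mu> T. indicator A t * exp (c * t)) = (LINT t|lebesgue. (if t \<in> {0<..<T} then indicator A t * exp (c * t) else 0))"
  by (rule Lebesgue_Measure.integral_restrict_UNIV[symmetric]) simp
 also have "\<dots> = (LINT t|lebesgue. indicator ({a..b} \<inter> {0<..<T}) t *\<^sub>R exp (c * t))"
  using ab(2) by (intro Bochner_Integration.integral_cong) (auto simp: indicator_def)
 also have "\<dots> = (LINT t|lborel. indicator ({a..b} \<inter> {0<..<T}) t *\<^sub>R exp (c * t))"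
  by (intro integral_completion) auto
 also have "\<dots> \<le> (LINT t|lborel. indicator {a..b} t *\<^sub>R exp (c * t))"
 proof (rule integral_mono)
  show i: "integrable lborel (\<lambda>t. indicator {a..b} t *\<^sub>R exp (c * t))"
   by (intro borel_integrable_compact continuous_intros) auto
  show "integrable lborel (\<lambda>t. indicator ({a..b} \<inter> {0<..<T}) t *\<^sub>R exp (c * t))"
   by (rule Bochner_Integration.integrable_bound[OF i]) (auto simp: indicator_def)
 qed (auto simp: indicator_def)
 also have "\<dots> = exp (c * b) / c - exp (c * a) / c"
 proof (rule integral_FTC_atLeastAtMost[OF ab(1)])
  show "((\<lambda>t. exp (c * t) / c) has_vector_derivative exp (c * x)) (at x within {a..b})" for x
   using c by (auto intro!: derivative_eq_intros simp flip: has_real_derivative_iff_has_vector_derivative)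
 qed (intro continuous_intros)
 finally show ?thesis by (simp add: diff_divide_distrib)
qed

text \<open>The weight \<open>exp (- (2 * C) * t)\<close> allows the absorption because its integral
  over the times after \<open>s\<close> is at most \<open>exp (- (2 * C) * s) / (2 * C)\<close>.
  Removing the weight costs \<open>exp (2 * C * T)\<close>.\<close>

lemma gronwall_forward:
 assumes y: "integrable (\<mu> T) y" "AE t in \<mu> T. 0 \<le> y t" and C: "C > 0" and T: "T > 0" and e: "e \<ge> 0"
  and le: "AE t in \<mu> T. y t \<le> e + C * prim T y t"
 shows "(LINT t|\<mu> T. y t) \<le> 2 * e * T * exp (2 * C * T)"
proof -
 have mm: "(\<lambda>t. exp (- (2 * C) * t)) \<in> borel_measurable (\<mu> T)" by measurable
 have b1: "exp (- (2 * C) * t) \<le> 1" if "t \<in> {0<..<T}" for t using that C by simp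
 have qi: "integrable (\<mu> T) (\<lambda>t. exp (- (2 * C) * t))"
  using b1 by (intro integrable_interval_bounded[OF mm, of 1]) auto
 have km: "(\<lambda>(t,s). indicator {..t} s :: real) \<in> borel_measurable (\<mu> T \<Otimes>\<^sub>M \<mu> T)"
  unfolding indicator_def split_beta of_bool_def atMost_iff by measurable
 have G: "(LINT t|\<mu> T. exp (- (2 * C) * t) * y t) \<le> 2 * e * (LINT t|\<mu> T. exp (- (2 * C) * t))"
 proof (rule gronwall_kernel[OF y qi _ b1 km _ C le[unfolded prim_def]])
  fix s assume s: "s \<in> {0<..<T}"
  have "(LINT t|\<mu> T. indicator {..t} s * exp (- (2 * C) * t)) = (LINT t|\<mu> T. indicator {s..T} t * exp (- (2 * C) * t))"
   by (intro Bochner_Integration.integral_cong) (auto simp: indicator_def)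
  also have "\<dots> \<le> (exp (- (2 * C) * T) - exp (- (2 * C) * s)) / (- (2 * C))"
   using C s by (intro exp_integral_le) auto
  also have "\<dots> \<le> exp (- (2 * C) * s) / (2 * C)"
   using C by (simp add: field_simps)
  finally show "C * (LINT t|\<mu> T. indicator {..t} s * exp (- (2 * C) * t)) \<le> exp (- (2 * C) * s) / 2"
   using C by (simp add: field_simps)
 qed (auto simp: indicator_def)
 have "(LINT t|\<mu> T. exp (- (2 * C) * t)) \<le> (LINT t|\<mu> T. 1)"
  using b1 qi by (intro integral_mono) auto
 also have "\<dots> = T" using T by (simp add: measure_restrict_space)
 finally have qT: "(LINT t|\<mu> T. exp (- (2 * C) * t)) \<le> T" .
 have "exp (- (2 * C) * T) * (LINT t|\<mu> T. y t) = (LINT t|\<mu> T. exp (- (2 * C) * T) * y t)" by simp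
 also have "\<dots> \<le> (LINT t|\<mu> T. exp (- (2 * C) * t) * y t)"
 proof (rule integral_mono_AE)
  show "integrable (\<mu> T) (\<lambda>t. exp (- (2 * C) * t) * y t)"
  proof (rule Bochner_Integration.integrable_bound[OF y(1)])
   show "AE t in \<mu> T. norm (exp (- (2 * C) * t) * y t) \<le> norm (y t)"
    unfolding norm_mult using b1 by (intro AE_I2 mult_left_le_one_le) auto
  qed (use y(1) mm in measurable)
  show "AE t in \<mu> T. exp (- (2 * C) * T) * y t \<le> exp (- (2 * C) * t) * y t"
   using y(2) AE_space by eventually_elim (use C in \<open>auto intro!: mult_right_mono\<close>)
 qed (use y in simp)
 also have "\<dots> \<le> 2 * e * T" using G qT e by (smt (verit) mult_left_mono)
 finally show ?thesis by (simp add: exp_minus field_simps)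
qed

text \<open>The mirrored weight \<open>exp (2 * C * t)\<close> suits a kernel that looks at later
  times. As there is no inhomogeneous term, the weighted integral vanishes.\<close>

lemma gronwall_backward:
 fixes C :: real
 assumes y: "integrable (\<mu> T) y" "AE t in \<mu> T. 0 \<le> y t" and C: "C > 0"
  and le: "AE t in \<mu> T. y t \<le> C * (LINT s|\<mu> T. indicator {t..} s * y s)"
 shows "AE t in \<mu> T. y t = 0"
proof -
 have mm: "(\<lambda>t. exp (2 * C * t)) \<in> borel_measurable (\<mu> T)" by measurable
 have b1: "exp (2 * C * t) \<le> exp (2 * C * T)" if "t \<in> {0<..<T}" for t using that C by simp
 have qi: "integrable (\<mu> T) (\<lambda>t. exp (2 * C * t))"
  using b1 by (intro integrable_interval_bounded[OF mm, of "exp (2 * C * T)"]) auto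
 have km: "(\<lambda>(t,s). indicator {t..} s :: real) \<in> borel_measurable (\<mu> T \<Otimes>\<^sub>M \<mu> T)"
  unfolding indicator_def split_beta of_bool_def atLeast_iff by measurable
 have le': "AE t in \<mu> T. y t \<le> 0 + C * (LINT s|\<mu> T. indicator {t..} s * y s)" using le by simp
 have G: "(LINT t|\<mu> T. exp (2 * C * t) * y t) \<le> 2 * 0 * (LINT t|\<mu> T. exp (2 * C * t))"
 proof (rule gronwall_kernel[OF y qi _ b1 km _ C le'])
  fix s assume s: "s \<in> {0<..<T}"
  have "(LINT t|\<mu> T. indicator {t..} s * exp (2 * C * t)) = (LINT t|\<mu> T. indicator {0..s} t * exp (2 * C * t))"
   by (intro Bochner_Integration.integral_cong) (auto simp: indicator_def)
  also have "\<dots> \<le> (exp (2 * C * s) - exp (2 * C * 0)) / (2 * C)"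
   using C s by (intro exp_integral_le) auto
  finally show "C * (LINT t|\<mu> T. indicator {t..} s * exp (2 * C * t)) \<le> exp (2 * C * s) / 2"
   using C by (simp add: field_simps)
 qed (auto simp: indicator_def)
 have i: "integrable (\<mu> T) (\<lambda>t. exp (2 * C * t) * y t)"
 proof (rule Bochner_Integration.integrable_bound)
  show "integrable (\<mu> T) (\<lambda>t. exp (2 * C * T) * y t)" using y by simp
  show "AE t in \<mu> T. norm (exp (2 * C * t) * y t) \<le> norm (exp (2 * C * T) * y t)"
   unfolding norm_mult using b1 by (intro AE_I2 mult_right_mono) auto
 qed (use y(1) mm in measurable)
 have nn: "AE t in \<mu> T. 0 \<le> exp (2 * C * t) * y t" using y(2) by eventually_elim simp
 have "(LINT t|\<mu> T. exp (2 * C * t) * y t) = 0"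
  using G integral_nonneg_AE[OF nn] by simp
 then have "AE t in \<mu> T. exp (2 * C * t) * y t = 0"
  using integral_nonneg_eq_0_iff_AE[OF i nn] by simp
 then show ?thesis by eventually_elim simp
qed

section \<open>Square integrable functions\<close>

lemma L2_D:
 assumes "v \<in> L2 U"
 shows "v \<in> borel_measurable (lebesgue_on U)" "integrable (lebesgue_on U) (\<lambda>x. (norm (v x))\<^sup>2)"
 using assms by (auto simp: L2_def)

lemma L2_inner_integrable:
 assumes v: "v \<in> L2 U" and w: "w \<in> L2 U"
 shows "integrable (lebesgue_on U) (\<lambda>x. v x \<bullet> w x)" "integrable (lebesgue_on U) (\<lambda>x. norm (v x) * norm (w x))"
proof -
 note [measurable] = L2_D(1)[OF v] L2_D(1)[OF w]
 have i: "integrable (lebesgue_on U) (\<lambda>x. (norm (v x))\<^sup>2 + (norm (w x))\<^sup>2)"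
  using L2_D[OF v] L2_D[OF w] by simp
 have am: "norm (v x) * norm (w x) \<le> (norm (v x))\<^sup>2 + (norm (w x))\<^sup>2" for x
 proof -
  have "2 * norm (v x) * norm (w x) \<le> (norm (v x))\<^sup>2 + (norm (w x))\<^sup>2" by (rule sum_squares_bound)
  moreover have "0 \<le> norm (v x) * norm (w x)" by simp
  ultimately show ?thesis by linarith
 qed
 show "integrable (lebesgue_on U) (\<lambda>x. v x \<bullet> w x)"
 proof (rule Bochner_Integration.integrable_bound[OF i])
  show "AE x in lebesgue_on U. norm (v x \<bullet> w x) \<le> norm ((norm (v x))\<^sup>2 + (norm (w x))\<^sup>2)"
  proof (rule AE_I2)
   fix x show "norm (v x \<bullet> w x) \<le> norm ((norm (v x))\<^sup>2 + (norm (w x))\<^sup>2)"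
    using Cauchy_Schwarz_ineq2[of "v x" "w x"] am[of x] by simp
  qed
 qed measurable
 show "integrable (lebesgue_on U) (\<lambda>x. norm (v x) * norm (w x))"
 proof (rule Bochner_Integration.integrable_bound[OF i])
  show "AE x in lebesgue_on U. norm (norm (v x) * norm (w x)) \<le> norm ((norm (v x))\<^sup>2 + (norm (w x))\<^sup>2)"
   using am by (intro AE_I2) simp
 qed measurable
qed

lemma L2_bound:
 assumes g: "g \<in> L2 U" and f: "f \<in> borel_measurable (lebesgue_on U)" and C: "C \<ge> 0"
  and le: "AE x in lebesgue_on U. norm (f x) \<le> C * norm (g x)"
 shows "f \<in> L2 U" "L2_norm U f \<le> C * L2_norm U g"
proof -
 note [measurable] = f L2_D(1)[OF g]
 have le2: "AE x in lebesgue_on U. (norm (f x))\<^sup>2 \<le> C\<^sup>2 * (norm (g x))\<^sup>2"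
  using le
 proof eventually_elim
  case (elim x)
  then have "(norm (f x))\<^sup>2 \<le> (C * norm (g x))\<^sup>2" by (intro power_mono) auto
  then show ?case by (simp add: power_mult_distrib)
 qed
 have fi: "integrable (lebesgue_on U) (\<lambda>x. (norm (f x))\<^sup>2)"
 proof (rule Bochner_Integration.integrable_bound)
  show "integrable (lebesgue_on U) (\<lambda>x. C\<^sup>2 * (norm (g x))\<^sup>2)" using L2_D(2)[OF g] by simp
  show "AE x in lebesgue_on U. norm ((norm (f x))\<^sup>2) \<le> norm (C\<^sup>2 * (norm (g x))\<^sup>2)"
   using le2 by eventually_elim simp
 qed measurable
 then show "f \<in> L2 U" using f by (simp add: L2_def)
 have "(LINT x|lebesgue_on U. (norm (f x))\<^sup>2) \<le> (LINT x|lebesgue_on U. C\<^sup>2 * (norm (g x))\<^sup>2)"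
  using L2_D(2)[OF g] fi le2 by (intro integral_mono_AE) auto
 then have "(LINT x|lebesgue_on U. (norm (f x))\<^sup>2) \<le> C\<^sup>2 * (LINT x|lebesgue_on U. (norm (g x))\<^sup>2)" by simp
 then have "sqrt (LINT x|lebesgue_on U. (norm (f x))\<^sup>2) \<le> sqrt (C\<^sup>2 * (LINT x|lebesgue_on U. (norm (g x))\<^sup>2))"
  by (rule real_sqrt_le_mono)
 then show "L2_norm U f \<le> C * L2_norm U g"
  using C by (simp add: L2_norm_def L2_inner_def power2_norm_eq_inner real_sqrt_mult)
qed

text \<open>Completeness of Lebesgue measure: extended by 0 off \<open>U\<close>, the two functions
  differ on a null set.\<close>

lemma borel_measurable_lebesgue_on_AE:
 fixes f g :: "'a::euclidean_space \<Rightarrow> 'b::euclidean_space"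
 assumes f: "f \<in> borel_measurable (lebesgue_on U)" and ae: "AE x in lebesgue_on U. f x = g x" and U: "U \<in> sets lebesgue"
 shows "g \<in> borel_measurable (lebesgue_on U)"
proof -
 have "(\<lambda>x. if x \<in> U then f x else 0) \<in> borel_measurable lebesgue"
  using f by (rule borel_measurable_if_I) (rule U)
 moreover have "AE x in lebesgue. (if x \<in> U then f x else 0) = (if x \<in> U then g x else 0)"
  using ae U by (simp add: AE_restrict_space_iff) 
 ultimately have "(\<lambda>x. if x \<in> U then g x else 0) \<in> borel_measurable lebesgue"
  by (rule borel_measurable_AE)
 then show ?thesis by (rule borel_measurable_if_D)
qed

lemma L2_cong:
 assumes v: "v \<in> L2 U" and ae: "AE x in lebesgue_on U. w x = v x" and U: "U \<in> sets lebesgue"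
 shows "w \<in> L2 U"
proof -
 have "w \<in> borel_measurable (lebesgue_on U)"
 proof (rule borel_measurable_lebesgue_on_AE[OF L2_D(1)[OF v] _ U])
  show "AE x in lebesgue_on U. v x = w x" using ae by eventually_elim simp
 qed
 then show ?thesis
  by (rule L2_bound(1)[OF v, of _ 1]) (use ae in \<open>auto elim!: AE_mp\<close>)
qed

lemma L2_zero: "(\<lambda>x. 0) \<in> L2 U" by (simp add: L2_def)

lemma L2_scaleR: "v \<in> L2 U \<Longrightarrow> (\<lambda>x. c *\<^sub>R v x) \<in> L2 U"
 by (rule L2_bound(1)[of v _ _ "\<bar>c\<bar>"]) (auto dest: L2_D)

lemma L2_mult: "v \<in> L2 U \<Longrightarrow> (\<lambda>x. c * v x) \<in> L2 U" for v :: "'a::euclidean_space \<Rightarrow> real"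
 using L2_scaleR[of v U c] by simp

lemma L2_add:
 assumes v: "v \<in> L2 U" and w: "w \<in> L2 U"
 shows "(\<lambda>x. v x + w x) \<in> L2 U"
proof -
 note [measurable] = L2_D(1)[OF v] L2_D(1)[OF w]
 have "integrable (lebesgue_on U) (\<lambda>x. (norm (v x + w x))\<^sup>2)"
 proof (rule Bochner_Integration.integrable_bound)
  show "integrable (lebesgue_on U) (\<lambda>x. 2 * (norm (v x))\<^sup>2 + 2 * (norm (w x))\<^sup>2)"
   using L2_D[OF v] L2_D[OF w] by simp
  show "AE x in lebesgue_on U. norm ((norm (v x + w x))\<^sup>2) \<le> norm (2 * (norm (v x))\<^sup>2 + 2 * (norm (w x))\<^sup>2)"
  proof (rule AE_I2)
   fix x
   have "(norm (v x + w x))\<^sup>2 \<le> (norm (v x) + norm (w x))\<^sup>2" by (intro power_mono norm_triangle_ineq) auto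
   also have "\<dots> \<le> 2 * (norm (v x))\<^sup>2 + 2 * (norm (w x))\<^sup>2"
    using sum_squares_bound[of "norm (v x)" "norm (w x)"] by (simp add: power2_sum)
   finally show "norm ((norm (v x + w x))\<^sup>2) \<le> norm (2 * (norm (v x))\<^sup>2 + 2 * (norm (w x))\<^sup>2)" by simp
  qed
 qed measurable
 then show ?thesis by (simp add: L2_def)
qed

lemma L2_diff:
 assumes v: "v \<in> L2 U" and w: "w \<in> L2 U"
 shows "(\<lambda>x. v x - w x) \<in> L2 U"
 using L2_add[OF v L2_scaleR[OF w, of "-1"]] by simp

lemma L2_inner_cong:
 assumes "AE x in lebesgue_on U. v x = v' x" "AE x in lebesgue_on U. w x = w' x"
  and "v \<in> borel_measurable (lebesgue_on U)" "w \<in> borel_measurable (lebesgue_on U)"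
  and U: "U \<in> sets lebesgue"
 shows "L2_inner U v w = L2_inner U v' w'"
proof -
 have [measurable]: "v' \<in> borel_measurable (lebesgue_on U)" "w' \<in> borel_measurable (lebesgue_on U)"
  using borel_measurable_lebesgue_on_AE[OF assms(3,1) U] borel_measurable_lebesgue_on_AE[OF assms(4,2) U] by auto
 note [measurable] = assms(3,4)
 show ?thesis
  unfolding L2_inner_def
  by (rule integral_cong_AE) (use assms(1,2) in \<open>auto elim: AE_mp\<close>)
qed

lemma L2_inner_commute: "L2_inner U v w = L2_inner U w v"
 by (simp add: L2_inner_def inner_commute)

lemma L2_inner_add:
 assumes "v \<in> L2 U" "w \<in> L2 U" "z \<in> L2 U"
 shows "L2_inner U z (\<lambda>x. v x + w x) = L2_inner U z v + L2_inner U z w"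
  "L2_inner U (\<lambda>x. v x + w x) z = L2_inner U v z + L2_inner U w z"
 using L2_inner_integrable(1)[OF assms(3,1)] L2_inner_integrable(1)[OF assms(3,2)]
  L2_inner_integrable(1)[OF assms(1,3)] L2_inner_integrable(1)[OF assms(2,3)]
 by (simp_all add: L2_inner_def inner_add_right inner_add_left)

lemma L2_inner_diff:
 assumes "v \<in> L2 U" "w \<in> L2 U" "z \<in> L2 U"
 shows "L2_inner U z (\<lambda>x. v x - w x) = L2_inner U z v - L2_inner U z w"
  "L2_inner U (\<lambda>x. v x - w x) z = L2_inner U v z - L2_inner U w z"
 using L2_inner_integrable(1)[OF assms(3,1)] L2_inner_integrable(1)[OF assms(3,2)]
  L2_inner_integrable(1)[OF assms(1,3)] L2_inner_integrable(1)[OF assms(2,3)]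
 by (simp_all add: L2_inner_def inner_diff_right inner_diff_left)

lemma L2_inner_scaleR:
 "L2_inner U z (\<lambda>x. c *\<^sub>R v x) = c * L2_inner U z v"
 "L2_inner U (\<lambda>x. c *\<^sub>R v x) z = c * L2_inner U v z"
 by (auto simp: L2_inner_def)

lemma L2_inner_mult:
 fixes v z :: "'a::euclidean_space \<Rightarrow> real"
 shows "L2_inner U z (\<lambda>x. c * v x) = c * L2_inner U z v" "L2_inner U (\<lambda>x. c * v x) z = c * L2_inner U v z"
 by (auto simp: L2_inner_def mult.assoc mult.left_commute)

lemma L2_inner_nonneg: "L2_inner U v v \<ge> 0"
 by (simp add: L2_inner_def)

lemma L2_norm_nonneg: "L2_norm U v \<ge> 0"
 by (simp add: L2_norm_def L2_inner_nonneg)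

lemma L2_norm_square: "(L2_norm U v)\<^sup>2 = L2_inner U v v"
 by (simp add: L2_norm_def L2_inner_nonneg)

lemma L2_norm_cong:
 assumes "AE x in lebesgue_on U. v x = v' x" "v \<in> borel_measurable (lebesgue_on U)" "U \<in> sets lebesgue"
 shows "L2_norm U v = L2_norm U v'"
 unfolding L2_norm_def using L2_inner_cong[OF assms(1,1,2,2,3)] by simp

lemma L2_norm_eq_0:
 assumes v: "v \<in> L2 U"
 shows "L2_norm U v = 0 \<longleftrightarrow> (AE x in lebesgue_on U. v x = 0)"
 unfolding L2_norm_def L2_inner_def
 using integral_nonneg_eq_0_iff_AE[OF L2_inner_integrable(1)[OF v v]] by simp

lemma L2_norm_scaleR: "L2_norm U (\<lambda>x. c *\<^sub>R v x) = \<bar>c\<bar> * L2_norm U v"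
 by (simp add: L2_norm_def L2_inner_scaleR real_sqrt_mult flip: mult.assoc)

lemma L2_norm_mult: "L2_norm U (\<lambda>x. c * v x) = \<bar>c\<bar> * L2_norm U v" for v :: "'a::euclidean_space \<Rightarrow> real"
 using L2_norm_scaleR[of U c v] by simp

text \<open>Integrates \<open>0 \<le> (s * norm (v x) - norm (w x))\<^sup>2\<close> for a well
  chosen \<open>s\<close>. The optimal value is \<open>c / a\<close>; the cases \<open>a = 0\<close>
  and \<open>c = 0\<close> need other choices.\<close>

lemma L2_Cauchy_Schwarz_norm:
 fixes v w :: "'a::euclidean_space \<Rightarrow> 'b::euclidean_space"
 assumes v: "v \<in> L2 U" and w: "w \<in> L2 U"
 shows "(LINT x|lebesgue_on U. norm (v x) * norm (w x)) \<le> L2_norm U v * L2_norm U w"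
proof -
 define a where "a = L2_norm U v"
 define c where "c = L2_norm U w"
 have ac: "a \<ge> 0" "c \<ge> 0" by (auto simp: a_def c_def L2_norm_nonneg)
 have sq: "(LINT x|lebesgue_on U. (norm (z x))\<^sup>2) = (L2_norm U z)\<^sup>2" for z :: "'a \<Rightarrow> 'b"
  unfolding L2_norm_square by (simp add: L2_inner_def power2_norm_eq_inner)
 have *: "2 * s * (LINT x|lebesgue_on U. norm (v x) * norm (w x)) \<le> s\<^sup>2 * a\<^sup>2 + c\<^sup>2" for s
 proof -
  have "(LINT x|lebesgue_on U. 2 * s * (norm (v x) * norm (w x))) \<le> (LINT x|lebesgue_on U. s\<^sup>2 * (norm (v x))\<^sup>2 + (norm (w x))\<^sup>2)"
  proof (rule integral_mono)
   show "2 * s * (norm (v x) * norm (w x)) \<le> s\<^sup>2 * (norm (v x))\<^sup>2 + (norm (w x))\<^sup>2" for x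
    using sum_squares_bound[of "s * norm (v x)" "norm (w x)"] by (simp add: power_mult_distrib mult.assoc)
  qed (use L2_D[OF v] L2_D[OF w] L2_inner_integrable[OF v w] in auto)
  also have "\<dots> = s\<^sup>2 * a\<^sup>2 + c\<^sup>2"
   using L2_D[OF v] L2_D[OF w] sq[of v] sq[of w] by (simp add: a_def c_def)
  finally show ?thesis by simp
 qed
 define I where "I = (LINT x|lebesgue_on U. norm (v x) * norm (w x))"
 show ?thesis
 proof (cases "a = 0")
  case True
  have "I \<le> 0"
  proof (rule ccontr)
   assume "\<not> I \<le> 0"
   \<comment> \<open>For \<open>a = 0\<close> the inequality holds for every \<open>s\<close>; this
     choice turns it into \<open>c\<^sup>2 + 1 \<le> c\<^sup>2\<close>.\<close>
   then show False using *[of "(c\<^sup>2 + 1) / (2 * I)"] True by (simp add: I_def[symmetric])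
  qed
  then show ?thesis using True by (simp add: I_def a_def)
 next
  case False
  then have "a > 0" using ac by simp
  have "2 * (c / a) * I \<le> 2 * c\<^sup>2"
   using *[of "c / a"] \<open>a > 0\<close> by (simp add: I_def power_divide)
  show ?thesis
  proof (cases "c = 0")
   case True
   have "I \<le> 0"
   proof (rule ccontr)
    assume "\<not> I \<le> 0"
    then have I: "I > 0" by simp
    \<comment> \<open>For \<open>c = 0\<close> the choice \<open>I / a\<^sup>2\<close> leads to
      \<open>2 * I\<^sup>2 \<le> I\<^sup>2\<close>.\<close>
    have "2 * (I / a\<^sup>2) * I \<le> (I / a\<^sup>2)\<^sup>2 * a\<^sup>2" using *[of "I / a\<^sup>2"] True by (simp add: I_def[symmetric])
    then have "2 * I\<^sup>2 \<le> I\<^sup>2" using \<open>a > 0\<close> by (simp add: power2_eq_square field_simps)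
    then show False using I by simp
   qed
   then show ?thesis using True by (simp add: I_def c_def)
  next
   case False
   then have "c > 0" using ac by simp
   then have "I \<le> a * c"
    using \<open>2 * (c / a) * I \<le> 2 * c\<^sup>2\<close> \<open>a > 0\<close> by (simp add: power2_eq_square field_simps)
   then show ?thesis by (simp add: I_def a_def c_def)
  qed
 qed
qed

lemma L2_Cauchy_Schwarz:
 assumes v: "v \<in> L2 U" and w: "w \<in> L2 U"
 shows "\<bar>L2_inner U v w\<bar> \<le> L2_norm U v * L2_norm U w"
proof -
 have "\<bar>L2_inner U v w\<bar> \<le> (LINT x|lebesgue_on U. \<bar>v x \<bullet> w x\<bar>)"
  unfolding L2_inner_def by (rule integral_abs_bound)
 also have "\<dots> \<le> (LINT x|lebesgue_on U. norm (v x) * norm (w x))"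
 proof (rule integral_mono)
  show "\<bar>v x \<bullet> w x\<bar> \<le> norm (v x) * norm (w x)" for x by (rule Cauchy_Schwarz_ineq2)
 qed (use L2_inner_integrable[OF v w] in auto)
 finally show ?thesis using L2_Cauchy_Schwarz_norm[OF v w] by simp
qed

lemma L2_norm_triangle:
 assumes v: "v \<in> L2 U" and w: "w \<in> L2 U"
 shows "L2_norm U (\<lambda>x. v x + w x) \<le> L2_norm U v + L2_norm U w"
proof (rule power2_le_imp_le)
 have "(L2_norm U (\<lambda>x. v x + w x))\<^sup>2 = L2_inner U v v + 2 * L2_inner U v w + L2_inner U w w"
  unfolding L2_norm_square using v w L2_inner_commute[of U v w] by (simp add: L2_inner_add L2_add)
 also have "\<dots> \<le> (L2_norm U v)\<^sup>2 + 2 * (L2_norm U v * L2_norm U w) + (L2_norm U w)\<^sup>2"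
  using L2_Cauchy_Schwarz[OF v w] by (simp add: L2_norm_square)
 finally show "(L2_norm U (\<lambda>x. v x + w x))\<^sup>2 \<le> (L2_norm U v + L2_norm U w)\<^sup>2"
  by (simp add: power2_sum)
qed (simp add: L2_norm_nonneg)

lemma L2_norm_diff_commute: "L2_norm U (\<lambda>x. v x - w x) = L2_norm U (\<lambda>x. w x - v x)"
 using L2_norm_scaleR[of U "-1" "\<lambda>x. v x - w x"] by simp

lemma L2_L1:
 fixes v :: "'a::euclidean_space \<Rightarrow> real"
 assumes v: "v \<in> L2 U" and U: "U \<in> lmeasurable"
 shows "integrable (lebesgue_on U) v" "(LINT x|lebesgue_on U. \<bar>v x\<bar>) \<le> sqrt (measure lebesgue U) * L2_norm U v"
proof -
 interpret finite_measure "lebesgue_on U" by (rule finite_measure_lebesgue_on[OF U])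
 have one: "(\<lambda>_. 1::real) \<in> L2 U" by (simp add: L2_def)
 have n1: "L2_norm U (\<lambda>_. 1::real) = sqrt (measure lebesgue U)"
  using U by (simp add: L2_norm_def L2_inner_def measure_restrict_space fmeasurableD)
 show "integrable (lebesgue_on U) v" using L2_inner_integrable(1)[OF one v] by simp
 show "(LINT x|lebesgue_on U. \<bar>v x\<bar>) \<le> sqrt (measure lebesgue U) * L2_norm U v"
  using L2_Cauchy_Schwarz_norm[OF one v] n1 by simp
qed

text \<open>Riesz-Fischer: along a rapidly Cauchy subsequence the increments are summable almost
  everywhere, and Fatou's lemma makes the pointwise limit a limit in L2 of the whole
  sequence.\<close>

lemma L2_complete:
 fixes v :: "nat \<Rightarrow> 'a::euclidean_space \<Rightarrow> real"
 assumes v: "\<And>n. v n \<in> L2 U" and U: "U \<in> lmeasurable"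
  and cauchy: "\<And>e. e > 0 \<Longrightarrow> \<exists>N. \<forall>m\<ge>N. \<forall>n\<ge>N. L2_norm U (\<lambda>x. v m x - v n x) < e"
 obtains w where "w \<in> L2 U" "(\<lambda>n. L2_norm U (\<lambda>x. v n x - w x)) \<longlonglongrightarrow> 0"
proof -
 let ?M = "lebesgue_on U"
 note [measurable] = L2_D(1)[OF v]
 have "\<exists>k>n. \<forall>i\<ge>k. \<forall>j\<ge>k. L2_norm U (\<lambda>x. v i x - v j x) < (1/2)^p" for n p :: nat
 proof -
  obtain N where "\<forall>i\<ge>N. \<forall>j\<ge>N. L2_norm U (\<lambda>x. v i x - v j x) < (1/2)^p"
   using cauchy[of "(1/2)^p"] by auto
  then show ?thesis by (intro exI[of _ "max (Suc n) N"]) auto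
 qed
 then obtain K where K: "\<And>n p. K n p > n" "\<And>n p i j. i \<ge> K n p \<Longrightarrow> j \<ge> K n p \<Longrightarrow> L2_norm U (\<lambda>x. v i x - v j x) < (1/2)^p"
  by metis
 \<comment> \<open>Members with indices from \<open>r p\<close> on are closer than
   \<open>(1/2)^p\<close>, so the increments along \<open>r\<close> are summable in L2 and, as
   \<open>U\<close> has finite measure, in L1.\<close>
 define r where "r = rec_nat (K 0 0) (\<lambda>p k. K k (Suc p))"
 have r0: "r 0 = K 0 0" and rS: "r (Suc p) = K (r p) (Suc p)" for p by (simp_all add: r_def)
 have rc: "i \<ge> r p \<Longrightarrow> j \<ge> r p \<Longrightarrow> L2_norm U (\<lambda>x. v i x - v j x) < (1/2)^p" for p i j
  using K(2)[of 0 0 i j] K(2)[of "r (p - 1)" p i j] by (cases p) (simp_all add: r0 rS del: power_Suc)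
 have rmono: "strict_mono r" by (rule strict_monoI_Suc) (simp add: rS K(1))
 define d where "d p x = v (r (Suc p)) x - v (r p) x" for p x
 have dL: "d p \<in> L2 U" for p unfolding d_def by (intro L2_diff v)
 have di: "integrable ?M (d p)" for p using L2_L1(1)[OF dL U] .
 define c where "c = sqrt (measure lebesgue U)"
 have dn: "(LINT x|?M. norm (d p x)) \<le> c * (1/2)^p" for p
 proof -
  have "L2_norm U (d p) \<le> (1/2)^p"
   using rc[of p "r (Suc p)" "r p"] strict_monoD[OF rmono, of p "Suc p"] unfolding d_def by (simp add: less_imp_le)
  then have "c * L2_norm U (d p) \<le> c * (1/2)^p" by (intro mult_left_mono) (auto simp: c_def)
  then show ?thesis using L2_L1(2)[OF dL U, of p] by (simp add: c_def)
 qed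
 have nn: "(\<integral>\<^sup>+x. (\<Sum>p. ennreal (norm (d p x))) \<partial>?M) < \<infinity>"
 proof -
  have "(\<integral>\<^sup>+x. (\<Sum>p. ennreal (norm (d p x))) \<partial>?M) = (\<Sum>p. \<integral>\<^sup>+x. ennreal (norm (d p x)) \<partial>?M)"
   using di by (intro nn_integral_suminf) auto
  also have "\<dots> = (\<Sum>p. ennreal (LINT x|?M. norm (d p x)))"
   using di by (intro suminf_cong nn_integral_eq_integral) auto
  also have "\<dots> \<le> (\<Sum>p. ennreal (c * (1/2)^p))"
   by (intro suminf_le ennreal_leI dn) auto
  also have "\<dots> = ennreal (\<Sum>p. c * (1/2)^p)"
   by (intro suminf_ennreal2 summable_mult summable_geometric) (auto simp: c_def)
  also have "\<dots> < \<infinity>" by simp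
  finally show ?thesis .
 qed
 have ae: "AE x in ?M. convergent (\<lambda>p. v (r p) x)"
 proof -
  have dm [measurable]: "d p \<in> borel_measurable ?M" for p using di by auto
  have "AE x in ?M. (\<Sum>p. ennreal (norm (d p x))) \<noteq> \<infinity>"
   using nn by (intro nn_integral_PInf_AE) auto
  then show ?thesis
  proof eventually_elim
   case (elim x)
   then have "summable (\<lambda>p. norm (d p x))"
    by (intro summable_suminf_not_top) (auto simp: top_unique)
   then have "summable (\<lambda>p. d p x)" by (rule summable_norm_cancel)
   then have "convergent (\<lambda>n. \<Sum>p<n. d p x)" by (simp add: summable_iff_convergent)
   moreover have "(\<Sum>p<n. d p x) = v (r n) x - v (r 0) x" for n
    unfolding d_def by (rule sum_lessThan_telescope)
   ultimately have "convergent (\<lambda>n. v (r n) x - v (r 0) x)" by simp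
   then have "convergent (\<lambda>n. (v (r n) x - v (r 0) x) + v (r 0) x)" by (intro convergent_add convergent_const)
   then show ?case by simp
  qed
 qed
 define w where "w x = lim (\<lambda>p. v (r p) x)" for x
 have wm [measurable]: "w \<in> borel_measurable ?M"
  unfolding w_def by (intro borel_measurable_lim_metric) simp
 have lim: "AE x in ?M. (\<lambda>p. v (r p) x) \<longlonglongrightarrow> w x"
  using ae unfolding w_def by eventually_elim (simp add: convergent_LIMSEQ_iff)
 have fatou: "(\<lambda>x. v n x - w x) \<in> L2 U \<and> L2_norm U (\<lambda>x. v n x - w x) \<le> (1/2)^p" if n: "n \<ge> r p" for n p
 proof -
  have sq: "(\<integral>\<^sup>+x. ennreal ((v n x - v (r j) x)\<^sup>2) \<partial>?M) \<le> ennreal (((1/2)^p)\<^sup>2)" if j: "j \<ge> p" for j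
  proof -
   have L: "(\<lambda>x. v n x - v (r j) x) \<in> L2 U" by (intro L2_diff v)
   have "r j \<ge> r p" using j rmono by (simp add: strict_mono_less_eq)
   then have "(L2_norm U (\<lambda>x. v n x - v (r j) x))\<^sup>2 \<le> ((1/2)^p)\<^sup>2"
    using rc[OF n, of "r j"] by (intro power_mono) (auto simp: L2_norm_nonneg less_imp_le)
   moreover have "(\<integral>\<^sup>+x. ennreal ((v n x - v (r j) x)\<^sup>2) \<partial>?M) = ennreal ((L2_norm U (\<lambda>x. v n x - v (r j) x))\<^sup>2)"
    unfolding L2_norm_square L2_inner_def using L2_inner_integrable(1)[OF L L]
    by (subst nn_integral_eq_integral[symmetric]) (auto simp: power2_eq_square)
   ultimately show ?thesis by (simp add: ennreal_leI)
  qed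
  have "(\<integral>\<^sup>+x. ennreal ((v n x - w x)\<^sup>2) \<partial>?M) = (\<integral>\<^sup>+x. liminf (\<lambda>j. ennreal ((v n x - v (r j) x)\<^sup>2)) \<partial>?M)"
  proof (rule nn_integral_cong_AE)
   show "AE x in ?M. ennreal ((v n x - w x)\<^sup>2) = liminf (\<lambda>j. ennreal ((v n x - v (r j) x)\<^sup>2))"
    using lim
   proof eventually_elim
    case (elim x)
    have "(\<lambda>j. ennreal ((v n x - v (r j) x)\<^sup>2)) \<longlonglongrightarrow> ennreal ((v n x - w x)\<^sup>2)"
     by (intro tendsto_intros elim)
    then show ?case using lim_imp_Liminf[OF sequentially_bot] by metis
   qed
  qed
  also have "\<dots> \<le> liminf (\<lambda>j. \<integral>\<^sup>+x. ennreal ((v n x - v (r j) x)\<^sup>2) \<partial>?M)"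
   by (intro nn_integral_liminf) measurable
  also have "\<dots> \<le> ennreal (((1/2)^p)\<^sup>2)"
   by (rule Liminf_le) (use sq in \<open>auto simp: eventually_sequentially\<close>)
  finally have le: "(\<integral>\<^sup>+x. ennreal ((v n x - w x)\<^sup>2) \<partial>?M) \<le> ennreal (((1/2)^p)\<^sup>2)" .
  then have i: "integrable ?M (\<lambda>x. (v n x - w x)\<^sup>2)"
   by (intro integrableI_nonneg) (auto simp: le_less_trans)
  then have L: "(\<lambda>x. v n x - w x) \<in> L2 U" by (simp add: L2_def)
  have "ennreal (LINT x|?M. (v n x - w x)\<^sup>2) \<le> ennreal (((1/2)^p)\<^sup>2)"
   using le by (subst (asm) nn_integral_eq_integral[OF i]) auto
  then have "(L2_norm U (\<lambda>x. v n x - w x))\<^sup>2 \<le> ((1/2)^p)\<^sup>2"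
   unfolding L2_norm_square L2_inner_def by (simp add: power2_eq_square)
  then show ?thesis using L by (auto intro: power2_le_imp_le)
 qed
 show ?thesis
 proof (rule that[of w])
  have "(\<lambda>x. v (r 0) x - w x) \<in> L2 U" using fatou[of 0 "r 0"] by simp
  from L2_diff[OF v[of "r 0"] this] show "w \<in> L2 U" by simp
  show "(\<lambda>n. L2_norm U (\<lambda>x. v n x - w x)) \<longlonglongrightarrow> 0"
  proof (rule LIMSEQ_I)
   fix e :: real assume "e > 0"
   then obtain p where p: "(1/2::real)^p < e" using real_arch_pow_inv[of e "1/2"] by auto
   show "\<exists>N. \<forall>n\<ge>N. norm (L2_norm U (\<lambda>x. v n x - w x) - 0) < e"
   proof (intro exI[of _ "r p"] allI impI)
    fix n assume "r p \<le> n"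
    then have "L2_norm U (\<lambda>x. v n x - w x) < e" using fatou[of p n] p by linarith
    then show "norm (L2_norm U (\<lambda>x. v n x - w x) - 0) < e" using L2_norm_nonneg[of U "\<lambda>x. v n x - w x"] by simp
   qed
  qed
 qed
qed

section \<open>Bochner spaces and square integrable functionals\<close>

lemma borel_measurable_AE_limit:
 fixes f :: "nat \<Rightarrow> 'a::euclidean_space \<Rightarrow> 'b::euclidean_space"
 assumes f: "\<And>n. f n \<in> borel_measurable (lebesgue_on S)" and S: "S \<in> sets lebesgue"
  and lim: "AE x in lebesgue_on S. (\<lambda>n. f n x) \<longlonglongrightarrow> g x"
 shows "g \<in> borel_measurable (lebesgue_on S)"
proof (rule borel_measurable_lebesgue_on_AE[OF _ _ S])
 show "(\<lambda>x. lim (\<lambda>n. f n x)) \<in> borel_measurable (lebesgue_on S)"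
  using f by (rule borel_measurable_lim_metric)
 show "AE x in lebesgue_on S. lim (\<lambda>n. f n x) = g x"
  using lim by eventually_elim (rule limI)
qed

text \<open>The values of \<open>s\<close> are typically functions, for which no sigma-algebra is
  fixed; finitely many values allow the discrete one.\<close>

lemma measurable_simple_compose:
 assumes s: "simple_function M s" and f: "\<And>v. v \<in> s ` space M \<Longrightarrow> (\<lambda>t. f v t) \<in> borel_measurable M"
 shows "(\<lambda>t. f (s t) t) \<in> borel_measurable M"
proof (rule measurable_compose_countable'[where I = "s ` space M"])
 show "s \<in> measurable M (count_space (s ` space M))"
  using s by (subst measurable_count_space_eq2) (auto simp: simple_function_def)
 show "countable (s ` space M)"
  using s by (auto simp: simple_function_def intro: countable_finite)
qed (use f in auto)

text \<open>Constrains \<open>l\<close> on \<open>V\<close> only, because elements of a dual space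
  are represented by functionals whose values off \<open>V\<close> are arbitrary.\<close>

definition bdd_linear :: "('b \<Rightarrow> real) set \<Rightarrow> (('b \<Rightarrow> real) \<Rightarrow> real) \<Rightarrow> real \<Rightarrow> (('b \<Rightarrow> real) \<Rightarrow> real) \<Rightarrow> bool" where
 "bdd_linear V N k l \<longleftrightarrow> 0 \<le> k \<and>
   (\<forall>v\<in>V. \<forall>w\<in>V. \<forall>c. l (\<lambda>x. v x + c * w x) = l v + c * l w) \<and> (\<forall>v\<in>V. \<bar>l v\<bar> \<le> k * N v)"

text \<open>A weakly measurable family of functionals on \<open>V\<close> with a square integrable bound \<open>k\<close>. This is
 all that is needed of an element of \<open>L\<^sup>2(0,T;V')\<close>, and it does not require strong measurability.\<close>

definition L2_functional ::
 "real \<Rightarrow> ('b \<Rightarrow> real) set \<Rightarrow> (('b \<Rightarrow> real) \<Rightarrow> real) \<Rightarrow> (real \<Rightarrow> ('b \<Rightarrow> real) \<Rightarrow> real) \<Rightarrow> (real \<Rightarrow> real) \<Rightarrow> bool" where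
 "L2_functional T V N l k \<longleftrightarrow>
   (\<forall>v\<in>V. (\<lambda>t. l t v) \<in> borel_measurable (\<mu> T)) \<and> k \<in> borel_measurable (\<mu> T) \<and>
   integrable (\<mu> T) (\<lambda>t. (k t)\<^sup>2) \<and> (AE t in \<mu> T. bdd_linear V N (k t) (l t))"

text \<open>A locale on carriers, since the norms are only seminorms on representatives. Real
  functions on an arbitrary type cover both function spaces and spaces of functionals; it is
  instantiated for H^1_0, L^2 and H^-1.\<close>

locale seminormed =
 fixes V :: "('b \<Rightarrow> real) set" and N :: "('b \<Rightarrow> real) \<Rightarrow> real"
 assumes zero: "(\<lambda>_. 0) \<in> V"
  and add: "v \<in> V \<Longrightarrow> w \<in> V \<Longrightarrow> (\<lambda>x. v x + w x) \<in> V"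
  and scale: "v \<in> V \<Longrightarrow> (\<lambda>x. c * v x) \<in> V"
  and N_nonneg: "v \<in> V \<Longrightarrow> 0 \<le> N v"
  and N_add: "v \<in> V \<Longrightarrow> w \<in> V \<Longrightarrow> N (\<lambda>x. v x + w x) \<le> N v + N w"
  and N_scale: "v \<in> V \<Longrightarrow> N (\<lambda>x. c * v x) = \<bar>c\<bar> * N v"
begin

lemma diff: "v \<in> V \<Longrightarrow> w \<in> V \<Longrightarrow> (\<lambda>x. v x - w x) \<in> V"
 using add[of v "\<lambda>x. (-1) * w x"] scale[of w "-1"] by simp

lemma N_zero: "N (\<lambda>_. 0) = 0"
 using N_scale[OF zero, of 0] by simp

lemma N_diff_le: "v \<in> V \<Longrightarrow> w \<in> V \<Longrightarrow> N (\<lambda>x. v x - w x) \<le> N v + N w"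
 using N_add[of v "\<lambda>x. (-1) * w x"] scale[of w "-1"] N_scale[of w "-1"] by simp

lemma N_diff_commute: "v \<in> V \<Longrightarrow> w \<in> V \<Longrightarrow> N (\<lambda>x. v x - w x) = N (\<lambda>x. w x - v x)"
 using N_scale[OF diff[of v w], of "-1"] by simp

lemma N_triangle: "v \<in> V \<Longrightarrow> w \<in> V \<Longrightarrow> z \<in> V \<Longrightarrow> N (\<lambda>x. v x - z x) \<le> N (\<lambda>x. v x - w x) + N (\<lambda>x. w x - z x)"
 using N_add[OF diff[of v w] diff[of w z]] by simp

lemma N_abs_diff: "v \<in> V \<Longrightarrow> w \<in> V \<Longrightarrow> \<bar>N v - N w\<bar> \<le> N (\<lambda>x. v x - w x)"
 using N_add[OF diff[of v w], of w] N_add[OF diff[of w v], of v] N_diff_commute[of v w] by simp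

lemma bdd_linear_simps:
 assumes l: "bdd_linear V N k l"
 shows "v \<in> V \<Longrightarrow> w \<in> V \<Longrightarrow> l (\<lambda>x. v x + w x) = l v + l w"
  "v \<in> V \<Longrightarrow> w \<in> V \<Longrightarrow> l (\<lambda>x. v x - w x) = l v - l w"
  "w \<in> V \<Longrightarrow> l (\<lambda>x. c * w x) = c * l w"
  "v \<in> V \<Longrightarrow> \<bar>l v\<bar> \<le> k * N v" "0 \<le> k"
proof -
 have L: "l (\<lambda>x. v x + c * w x) = l v + c * l w" if "v \<in> V" "w \<in> V" for v w c
  using l that by (auto simp: bdd_linear_def)
 show "l (\<lambda>x. v x + w x) = l v + l w" if "v \<in> V" "w \<in> V" using L[OF that, of 1] by simp
 show "l (\<lambda>x. v x - w x) = l v - l w" if "v \<in> V" "w \<in> V" using L[OF that, of "-1"] by simp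
 have 0: "l (\<lambda>x. 0) = 0" using L[OF zero zero, of 1] by simp
 show "l (\<lambda>x. c * w x) = c * l w" if "w \<in> V" using L[OF zero that, of c] 0 by simp
 show "v \<in> V \<Longrightarrow> \<bar>l v\<bar> \<le> k * N v" "0 \<le> k" using l by (auto simp: bdd_linear_def)
qed

lemma bochnerE:
 assumes "u \<in> bochner_L2 T V N"
 obtains s where "\<And>n. simple_function (\<mu> T) (s n)" "\<And>n t. t \<in> {0<..<T} \<Longrightarrow> s n t \<in> V"
  "AE t in \<mu> T. (\<lambda>n. N (\<lambda>x. s n t x - u t x)) \<longlonglongrightarrow> 0"
proof -
 obtain s where s: "\<forall>n. simple_function (\<mu> T) (s n) \<and> s n ` {0<..<T} \<subseteq> V"
  "AE t in \<mu> T. (\<lambda>n. N (s n t - u t)) \<longlonglongrightarrow> 0"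
  using assms unfolding bochner_L2_def strongly_measurable_def by blast
 show ?thesis
 proof (rule that[of s])
  show "AE t in \<mu> T. (\<lambda>n. N (\<lambda>x. s n t x - u t x)) \<longlonglongrightarrow> 0"
   using s(2) by (simp add: fun_diff_def)
 qed (use s(1) in \<open>auto simp: image_subset_iff\<close>)
qed

lemma bochnerD:
 assumes "u \<in> bochner_L2 T V N"
 shows "AE t in \<mu> T. u t \<in> V" "integrable (\<mu> T) (\<lambda>t. (N (u t))\<^sup>2)"
 using assms by (auto simp: bochner_L2_def)

lemma strongly_measurable_norm:
 assumes V: "AE t in \<mu> T. u t \<in> V"
  and s: "\<And>n. simple_function (\<mu> T) (s n)" "\<And>n t. t \<in> {0<..<T} \<Longrightarrow> s n t \<in> V"
  and lim: "AE t in \<mu> T. (\<lambda>n. N (\<lambda>x. s n t x - u t x)) \<longlonglongrightarrow> 0"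
 shows "(\<lambda>t. N (u t)) \<in> borel_measurable (\<mu> T)" "AE t in \<mu> T. (\<lambda>n. N (s n t)) \<longlonglongrightarrow> N (u t)"
proof -
 show *: "AE t in \<mu> T. (\<lambda>n. N (s n t)) \<longlonglongrightarrow> N (u t)"
  using lim V AE_space
 proof eventually_elim
  case (elim t)
  show ?case
  proof (rule LIM_zero_cancel, rule Lim_null_comparison[OF _ elim(1)], rule always_eventually, rule allI)
   show "norm (N (s n t) - N (u t)) \<le> N (\<lambda>x. s n t x - u t x)" for n
    using N_abs_diff[OF s(2) elim(2), of t n] elim(3) by simp
  qed
 qed
 have "(\<lambda>t. N (s n t)) \<in> borel_measurable (\<mu> T)" for n
  by (rule borel_measurable_simple_function[OF simple_function_compose1[OF s(1)]])
 then show "(\<lambda>t. N (u t)) \<in> borel_measurable (\<mu> T)"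
  by (rule borel_measurable_AE_limit[OF _ _ *]) simp
qed

lemma bochner_norm_measurable:
 assumes u: "u \<in> bochner_L2 T V N"
 shows "(\<lambda>t. N (u t)) \<in> borel_measurable (\<mu> T)"
proof -
 obtain s where "\<And>n. simple_function (\<mu> T) (s n)" "\<And>n t. t \<in> {0<..<T} \<Longrightarrow> s n t \<in> V"
  "AE t in \<mu> T. (\<lambda>n. N (\<lambda>x. s n t x - u t x)) \<longlonglongrightarrow> 0"
  by (rule bochnerE[OF u]) blast
 then show ?thesis by (rule strongly_measurable_norm(1)[OF bochnerD(1)[OF u]])
qed

lemma bochnerI:
 assumes V: "AE t in \<mu> T. u t \<in> V"
  and s: "\<And>n. simple_function (\<mu> T) (s n)" "\<And>n t. t \<in> {0<..<T} \<Longrightarrow> s n t \<in> V"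
  and lim: "AE t in \<mu> T. (\<lambda>n. N (\<lambda>x. s n t x - u t x)) \<longlonglongrightarrow> 0"
  and b: "integrable (\<mu> T) b" "AE t in \<mu> T. (N (u t))\<^sup>2 \<le> b t"
 shows "u \<in> bochner_L2 T V N"
proof -
 have [measurable]: "(\<lambda>t. N (u t)) \<in> borel_measurable (\<mu> T)"
  by (rule strongly_measurable_norm(1)[OF V s lim])
 have "integrable (\<mu> T) (\<lambda>t. (N (u t))\<^sup>2)"
  by (rule Bochner_Integration.integrable_bound[OF b(1)]) (use b(2) in \<open>auto elim!: AE_mp\<close>)
 moreover have "strongly_measurable T V N u"
  unfolding strongly_measurable_def using s lim by (intro exI[of _ s]) (auto simp: fun_diff_def)
 ultimately show ?thesis using V by (simp add: bochner_L2_def)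
qed

lemma bochner_simple:
 assumes s: "simple_function (\<mu> T) s" "\<And>t. t \<in> {0<..<T} \<Longrightarrow> s t \<in> V"
 shows "s \<in> bochner_L2 T V N"
proof (rule bochnerI[where s = "\<lambda>_. s" and b = "\<lambda>t. (N (s t))\<^sup>2"])
 have f: "finite ((\<lambda>t. (N (s t))\<^sup>2) ` {0<..<T})"
  using s(1) by (auto simp: simple_function_def image_image[of "\<lambda>v. (N v)\<^sup>2" s, symmetric])
 have "simple_function (\<mu> T) (\<lambda>t. (N (s t))\<^sup>2)" using s(1) by (rule simple_function_compose1)
 then have "(\<lambda>t. (N (s t))\<^sup>2) \<in> borel_measurable (\<mu> T)" by (rule borel_measurable_simple_function)
 then show "integrable (\<mu> T) (\<lambda>t. (N (s t))\<^sup>2)"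
  by (rule integrable_interval_bounded[where B = "Max ((\<lambda>t. (N (s t))\<^sup>2) ` {0<..<T})"])
    (use f in \<open>auto intro!: Max_ge\<close>)
qed (use s in \<open>auto simp: N_zero\<close>)

lemma bochner_add:
 assumes u: "u \<in> bochner_L2 T V N" and w: "w \<in> bochner_L2 T V N"
 shows "(\<lambda>t x. u t x + w t x) \<in> bochner_L2 T V N"
proof -
 obtain s where s: "\<And>n. simple_function (\<mu> T) (s n)" "\<And>n t. t \<in> {0<..<T} \<Longrightarrow> s n t \<in> V"
  "AE t in \<mu> T. (\<lambda>n. N (\<lambda>x. s n t x - u t x)) \<longlonglongrightarrow> 0"
  by (rule bochnerE[OF u]) blast
 obtain r where r: "\<And>n. simple_function (\<mu> T) (r n)" "\<And>n t. t \<in> {0<..<T} \<Longrightarrow> r n t \<in> V"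
  "AE t in \<mu> T. (\<lambda>n. N (\<lambda>x. r n t x - w t x)) \<longlonglongrightarrow> 0"
  by (rule bochnerE[OF w]) blast
 note V = bochnerD(1)[OF u] bochnerD(1)[OF w]
 show ?thesis
 proof (rule bochnerI[where s = "\<lambda>n t x. s n t x + r n t x" and b = "\<lambda>t. 2 * (N (u t))\<^sup>2 + 2 * (N (w t))\<^sup>2"])
  show "AE t in \<mu> T. (\<lambda>x. u t x + w t x) \<in> V" using V by eventually_elim (rule add)
  show "simple_function (\<mu> T) (\<lambda>t x. s n t x + r n t x)" for n
   using simple_function_compose2[OF s(1)[of n] r(1)[of n], of "\<lambda>v w x. v x + w x"] .
  show "(\<lambda>x. s n t x + r n t x) \<in> V" if "t \<in> {0<..<T}" for n t using s(2) r(2) that by (intro add)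
  show "AE t in \<mu> T. (\<lambda>n. N (\<lambda>x. s n t x + r n t x - (u t x + w t x))) \<longlonglongrightarrow> 0"
   using s(3) r(3) V AE_space
  proof eventually_elim
   case (elim t)
   have st: "s n t \<in> V" "r n t \<in> V" for n using s(2) r(2) elim(5) by auto
   have "(\<lambda>n. N (\<lambda>x. s n t x - u t x) + N (\<lambda>x. r n t x - w t x)) \<longlonglongrightarrow> 0 + 0"
    by (intro tendsto_add elim)
   then have lim: "(\<lambda>n. N (\<lambda>x. s n t x - u t x) + N (\<lambda>x. r n t x - w t x)) \<longlonglongrightarrow> 0" by simp
   have eq: "(\<lambda>x. s n t x + r n t x - (u t x + w t x)) = (\<lambda>x. (s n t x - u t x) + (r n t x - w t x))" for n
    by (simp add: fun_eq_iff)
   have "norm (N (\<lambda>x. s n t x + r n t x - (u t x + w t x))) \<le> N (\<lambda>x. s n t x - u t x) + N (\<lambda>x. r n t x - w t x)" for n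
    using N_add[OF diff[OF st(1) elim(3), of n] diff[OF st(2) elim(4), of n]]
     N_nonneg[OF add[OF diff[OF st(1) elim(3), of n] diff[OF st(2) elim(4), of n]]] unfolding eq by simp
   then show ?case by (intro Lim_null_comparison[OF _ lim]) simp
  qed
  show "AE t in \<mu> T. (N (\<lambda>x. u t x + w t x))\<^sup>2 \<le> 2 * (N (u t))\<^sup>2 + 2 * (N (w t))\<^sup>2"
   using V
  proof eventually_elim
   case (elim t)
   have "(N (\<lambda>x. u t x + w t x))\<^sup>2 \<le> (N (u t) + N (w t))\<^sup>2"
    using elim by (intro power_mono N_add N_nonneg add)
   also have "\<dots> \<le> 2 * (N (u t))\<^sup>2 + 2 * (N (w t))\<^sup>2"
    using sum_squares_bound[of "N (u t)" "N (w t)"] by (simp add: power2_sum)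
   finally show ?case .
  qed
 qed (use bochnerD(2)[OF u] bochnerD(2)[OF w] in auto)
qed

lemma bochner_mult:
 assumes u: "u \<in> bochner_L2 T V N" and a: "a \<in> borel_measurable (\<mu> T)" "\<And>t. t \<in> {0<..<T} \<Longrightarrow> \<bar>a t\<bar> \<le> B"
 shows "(\<lambda>t x. a t * u t x) \<in> bochner_L2 T V N"
proof -
 obtain s where s: "\<And>n. simple_function (\<mu> T) (s n)" "\<And>n t. t \<in> {0<..<T} \<Longrightarrow> s n t \<in> V"
  "AE t in \<mu> T. (\<lambda>n. N (\<lambda>x. s n t x - u t x)) \<longlonglongrightarrow> 0"
  by (rule bochnerE[OF u]) blast
 obtain r where r: "\<And>n. simple_function (\<mu> T) (r n)" "\<And>t. t \<in> space (\<mu> T) \<Longrightarrow> (\<lambda>n. r n t) \<longlonglongrightarrow> a t"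
  using borel_measurable_implies_sequence_metric[OF a(1), of 0] by blast
 note V = bochnerD(1)[OF u]
 show ?thesis
 proof (rule bochnerI[where s = "\<lambda>n t x. r n t * s n t x" and b = "\<lambda>t. B\<^sup>2 * (N (u t))\<^sup>2"])
  show "AE t in \<mu> T. (\<lambda>x. a t * u t x) \<in> V" using V by eventually_elim (rule scale)
  show "simple_function (\<mu> T) (\<lambda>t x. r n t * s n t x)" for n
   using simple_function_compose2[OF r(1)[of n] s(1)[of n], of "\<lambda>c w x. c * w x"] .
  show "(\<lambda>x. r n t * s n t x) \<in> V" if "t \<in> {0<..<T}" for n t using s(2) that by (intro scale)
  show "AE t in \<mu> T. (\<lambda>n. N (\<lambda>x. r n t * s n t x - a t * u t x)) \<longlonglongrightarrow> 0"
   using s(3) V AE_space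
  proof eventually_elim
   case (elim t)
   have st: "s n t \<in> V" for n using s(2) elim(3) by auto
   have "(\<lambda>n. \<bar>r n t\<bar> * N (\<lambda>x. s n t x - u t x) + \<bar>r n t - a t\<bar> * N (u t)) \<longlonglongrightarrow> \<bar>a t\<bar> * 0 + \<bar>a t - a t\<bar> * N (u t)"
    by (intro tendsto_intros elim r(2))
   then have lim: "(\<lambda>n. \<bar>r n t\<bar> * N (\<lambda>x. s n t x - u t x) + \<bar>r n t - a t\<bar> * N (u t)) \<longlonglongrightarrow> 0" by simp
   have le: "N (\<lambda>x. r n t * s n t x - a t * u t x) \<le> \<bar>r n t\<bar> * N (\<lambda>x. s n t x - u t x) + \<bar>r n t - a t\<bar> * N (u t)" for n
   proof -
    have "(\<lambda>x. r n t * s n t x - a t * u t x) = (\<lambda>x. r n t * (s n t x - u t x) + (r n t - a t) * u t x)"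
     by (simp add: algebra_simps)
    then show ?thesis
     using N_add[OF scale[OF diff[OF st elim(2)]] scale[OF elim(2)], of "r n t" n "r n t - a t"]
      N_scale[OF diff[OF st elim(2)], of "r n t" n] N_scale[OF elim(2), of "r n t - a t"] by simp
   qed
   have "norm (N (\<lambda>x. r n t * s n t x - a t * u t x)) \<le> \<bar>r n t\<bar> * N (\<lambda>x. s n t x - u t x) + \<bar>r n t - a t\<bar> * N (u t)" for n
    using le[of n] N_nonneg[OF diff[OF scale[OF st] scale[OF elim(2)]], of "r n t" n "a t"] by simp
   then show ?case by (intro Lim_null_comparison[OF _ lim]) simp
  qed
  show "AE t in \<mu> T. (N (\<lambda>x. a t * u t x))\<^sup>2 \<le> B\<^sup>2 * (N (u t))\<^sup>2"
   using V AE_space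
  proof eventually_elim
   case (elim t)
   have "\<bar>a t\<bar> \<le> B" using a(2) elim(2) by simp
   then have "(\<bar>a t\<bar> * N (u t))\<^sup>2 \<le> (B * N (u t))\<^sup>2"
    using N_nonneg[OF elim(1)] by (intro power_mono mult_right_mono) auto
   then show ?case using N_scale[OF elim(1), of "a t"] by (simp add: power_mult_distrib)
  qed
 qed (use bochnerD(2)[OF u] in auto)
qed

lemma bochner_scale: "u \<in> bochner_L2 T V N \<Longrightarrow> (\<lambda>t x. c * u t x) \<in> bochner_L2 T V N"
 by (rule bochner_mult[of u T "\<lambda>_. c" "\<bar>c\<bar>"]) auto

lemma bochner_diff:
 assumes u: "u \<in> bochner_L2 T V N" and w: "w \<in> bochner_L2 T V N"
 shows "(\<lambda>t x. u t x - w t x) \<in> bochner_L2 T V N"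
 using bochner_add[OF u bochner_scale[OF w, of "-1"]] by simp

text \<open>Continuity of \<phi> sends simple approximations of \<open>u\<close> to simple
  approximations of the composition; this covers nonlinear maps such as composition with a scalar
  function.\<close>

lemma bochner_compose:
 assumes u: "u \<in> bochner_L2 T V N"
  and \<phi>: "\<And>v. v \<in> V \<Longrightarrow> \<phi> v \<in> V" "\<And>v. v \<in> V \<Longrightarrow> N (\<phi> v) \<le> C * N v"
  and cont: "\<And>v s. v \<in> V \<Longrightarrow> (\<And>n. s n \<in> V) \<Longrightarrow> (\<lambda>n. N (\<lambda>x. s n x - v x)) \<longlonglongrightarrow> 0 \<Longrightarrow>
   (\<lambda>n. N (\<lambda>x. \<phi> (s n) x - \<phi> v x)) \<longlonglongrightarrow> 0"
 shows "(\<lambda>t. \<phi> (u t)) \<in> bochner_L2 T V N"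
proof -
 obtain s where s: "\<And>n. simple_function (\<mu> T) (s n)" "\<And>n t. t \<in> {0<..<T} \<Longrightarrow> s n t \<in> V"
  "AE t in \<mu> T. (\<lambda>n. N (\<lambda>x. s n t x - u t x)) \<longlonglongrightarrow> 0"
  by (rule bochnerE[OF u]) blast
 note V = bochnerD(1)[OF u]
 show ?thesis
 proof (rule bochnerI[where s = "\<lambda>n t. \<phi> (s n t)" and b = "\<lambda>t. C\<^sup>2 * (N (u t))\<^sup>2"])
  show "AE t in \<mu> T. \<phi> (u t) \<in> V" using V by eventually_elim (rule \<phi>)
  show "simple_function (\<mu> T) (\<lambda>t. \<phi> (s n t))" for n by (rule simple_function_compose1[OF s(1)])
  show "AE t in \<mu> T. (\<lambda>n. N (\<lambda>x. \<phi> (s n t) x - \<phi> (u t) x)) \<longlonglongrightarrow> 0"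
   using s(3) V AE_space by eventually_elim (rule cont, use s(2) in auto)
  show "AE t in \<mu> T. (N (\<phi> (u t)))\<^sup>2 \<le> C\<^sup>2 * (N (u t))\<^sup>2"
   using V
  proof eventually_elim
   case (elim t)
   have "(N (\<phi> (u t)))\<^sup>2 \<le> (C * N (u t))\<^sup>2" using \<phi> N_nonneg elim by (intro power_mono) auto
   then show ?case by (simp add: power_mult_distrib)
  qed
 qed (use \<phi>(1) s(2) bochnerD(2)[OF u] in auto)
qed

text \<open>Almost everywhere convergence of simple functions becomes convergence in the Bochner
  norm once they are dominated by a multiple of the norm of \<open>u\<close>.\<close>

lemma simple_dense:
 assumes u: "u \<in> bochner_L2 T V N" and e: "e > 0"
 obtains s where "simple_function (\<mu> T) s" "\<And>t. t \<in> {0<..<T} \<Longrightarrow> s t \<in> V"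
  "(LINT t|\<mu> T. (N (\<lambda>x. u t x - s t x))\<^sup>2) < e"
proof -
 obtain s where s: "\<And>n. simple_function (\<mu> T) (s n)" "\<And>n t. t \<in> {0<..<T} \<Longrightarrow> s n t \<in> V"
  "AE t in \<mu> T. (\<lambda>n. N (\<lambda>x. s n t x - u t x)) \<longlonglongrightarrow> 0"
  by (rule bochnerE[OF u]) blast
 note V = bochnerD(1)[OF u]
 note [measurable] = bochner_norm_measurable[OF u]
 have sN [measurable]: "(\<lambda>t. N (s n t)) \<in> borel_measurable (\<mu> T)" for n
  by (rule borel_measurable_simple_function[OF simple_function_compose1[OF s(1)]])
 \<comment> \<open>The cut at \<open>2 * N (u t)\<close> gives the bound
   \<open>9 * (N (u t))\<^sup>2\<close> for the squared error. Where the norm of \<open>u t\<close>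
   is positive, the approximants are eventually not cut; where it is zero, only elements of norm
   zero remain.\<close>
 define r where "r n t = (if N (s n t) \<le> 2 * N (u t) then s n t else (\<lambda>_. 0))" for n t
 have r: "simple_function (\<mu> T) (r n)" for n
  unfolding r_def by (intro simple_function_If s(1) simple_function_const) measurable
 have rV: "r n t \<in> V" if "t \<in> {0<..<T}" for n t using s(2)[OF that] zero by (simp add: r_def)
 have rX: "(\<lambda>t x. u t x - r n t x) \<in> bochner_L2 T V N" for n
  by (intro bochner_diff u bochner_simple r rV)
 have "(\<lambda>n. LINT t|\<mu> T. (N (\<lambda>x. u t x - r n t x))\<^sup>2) \<longlonglongrightarrow> (LINT t|\<mu> T. 0)"
 proof (rule integral_dominated_convergence[where w = "\<lambda>t. 9 * (N (u t))\<^sup>2"])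
  show "(\<lambda>t. (N (\<lambda>x. u t x - r n t x))\<^sup>2) \<in> borel_measurable (\<mu> T)" for n
   using bochner_norm_measurable[OF rX[of n]] by measurable
  show "AE t in \<mu> T. (\<lambda>n. (N (\<lambda>x. u t x - r n t x))\<^sup>2) \<longlonglongrightarrow> 0"
  proof -
   have "AE t in \<mu> T. (\<lambda>n. N (s n t)) \<longlonglongrightarrow> N (u t)" by (rule strongly_measurable_norm(2)[OF V s])
   then show ?thesis using s(3) V AE_space
  proof eventually_elim
   case (elim t)
   have st: "s n t \<in> V" "r n t \<in> V" for n using s(2) rV elim(4) by auto
   have "(\<lambda>n. N (\<lambda>x. u t x - r n t x)) \<longlonglongrightarrow> 0"
   proof (cases "N (u t) = 0")
    case True
    have "N (\<lambda>x. u t x - r n t x) = 0" for n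
    proof -
     have "N (r n t) \<le> 0" using True by (auto simp: r_def N_zero)
     then have "N (\<lambda>x. u t x - r n t x) \<le> 0" using N_diff_le[OF elim(3) st(2)[of n]] True by simp
     then show ?thesis using N_nonneg[OF diff[OF elim(3) st(2)[of n]]] by simp
    qed
    then show ?thesis by simp
   next
    case False
    then have "N (u t) < 2 * N (u t)" using N_nonneg[OF elim(3)] by simp
    then have "eventually (\<lambda>n. N (s n t) < 2 * N (u t)) sequentially" by (rule order_tendstoD(2)[OF elim(1)])
    then have "eventually (\<lambda>n. N (\<lambda>x. s n t x - u t x) = N (\<lambda>x. u t x - r n t x)) sequentially"
     by eventually_elim (use N_diff_commute[OF st(1) elim(3)] in \<open>simp add: r_def\<close>)
    then show ?thesis by (rule Lim_transform_eventually[OF elim(2)])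
   qed
   then have "(\<lambda>n. (N (\<lambda>x. u t x - r n t x))\<^sup>2) \<longlonglongrightarrow> 0\<^sup>2" by (rule tendsto_power)
   then show ?case by simp
  qed
  qed
  show "AE t in \<mu> T. norm ((N (\<lambda>x. u t x - r n t x))\<^sup>2) \<le> 9 * (N (u t))\<^sup>2" for n
   using V AE_space
  proof eventually_elim
   case (elim t)
   have rt: "r n t \<in> V" using rV elim by auto
   have "N (r n t) \<le> 2 * N (u t)" using N_nonneg[OF elim(1)] by (auto simp: r_def N_zero)
   then have "N (\<lambda>x. u t x - r n t x) \<le> 3 * N (u t)" using N_diff_le[OF elim(1) rt] by simp
   then have "(N (\<lambda>x. u t x - r n t x))\<^sup>2 \<le> (3 * N (u t))\<^sup>2" using N_nonneg[OF diff[OF elim(1) rt]] by (intro power_mono)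
   then show ?case by (simp add: power_mult_distrib)
  qed
 qed (use bochnerD(2)[OF u] in auto)
 then have "eventually (\<lambda>n. (LINT t|\<mu> T. (N (\<lambda>x. u t x - r n t x))\<^sup>2) < e) sequentially"
  using e by (intro order_tendstoD(2)[where y = 0]) auto
 then obtain n where "(LINT t|\<mu> T. (N (\<lambda>x. u t x - r n t x))\<^sup>2) < e"
  using eventually_happens'[OF sequentially_bot] by blast
 then show ?thesis using that[of "r n"] r rV by blast
qed

lemma L2_functionalD:
 assumes "L2_functional T V N l k"
 shows "\<And>v. v \<in> V \<Longrightarrow> (\<lambda>t. l t v) \<in> borel_measurable (\<mu> T)" "k \<in> borel_measurable (\<mu> T)"
  "integrable (\<mu> T) (\<lambda>t. (k t)\<^sup>2)" "AE t in \<mu> T. bdd_linear V N (k t) (l t)"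
 using assms by (auto simp: L2_functional_def)

text \<open>Along a simple approximation the pairing switches between finitely many functions of
  \<open>t\<close>, measurable by weak measurability; the bound \<open>k t\<close> allows the
  passage to the limit.\<close>

lemma pairing_measurable:
 assumes l: "L2_functional T V N l k" and u: "u \<in> bochner_L2 T V N"
 shows "(\<lambda>t. l t (u t)) \<in> borel_measurable (\<mu> T)"
proof -
 obtain s where s: "\<And>n. simple_function (\<mu> T) (s n)" "\<And>n t. t \<in> {0<..<T} \<Longrightarrow> s n t \<in> V"
  "AE t in \<mu> T. (\<lambda>n. N (\<lambda>x. s n t x - u t x)) \<longlonglongrightarrow> 0"
  by (rule bochnerE[OF u]) blast
 have meas: "(\<lambda>t. l t (s n t)) \<in> borel_measurable (\<mu> T)" for n
 proof (rule measurable_simple_compose[OF s(1), where f = "\<lambda>v t. l t v"])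
  fix v assume "v \<in> s n ` space (\<mu> T)"
  then have "v \<in> V" using s(2) by auto
  then show "(\<lambda>t. l t v) \<in> borel_measurable (\<mu> T)" by (rule L2_functionalD(1)[OF l])
 qed
 have tends: "AE t in \<mu> T. (\<lambda>n. l t (s n t)) \<longlonglongrightarrow> l t (u t)"
  using s(3) L2_functionalD(4)[OF l] bochnerD(1)[OF u] AE_space
 proof eventually_elim
  case (elim t)
  have st: "s n t \<in> V" for n using s(2) elim(4) by auto
  have "(\<lambda>n. k t * N (\<lambda>x. s n t x - u t x)) \<longlonglongrightarrow> k t * 0" by (intro tendsto_intros elim)
  then have lim: "(\<lambda>n. k t * N (\<lambda>x. s n t x - u t x)) \<longlonglongrightarrow> 0" by simp
  have "norm (l t (s n t) - l t (u t)) \<le> k t * N (\<lambda>x. s n t x - u t x)" for n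
   using bdd_linear_simps(4)[OF elim(2) diff[OF st elim(3)], of n] bdd_linear_simps(2)[OF elim(2) st elim(3), of n] by simp
  then show ?case by (rule LIM_zero_cancel[OF Lim_null_comparison[OF always_eventually[OF allI] lim]])
 qed
 show ?thesis by (rule borel_measurable_AE_limit[OF meas _ tends]) simp
qed

lemma pairing_bound:
 assumes l: "L2_functional T V N l k" and u: "u \<in> bochner_L2 T V N"
 shows "AE t in \<mu> T. \<bar>l t (u t)\<bar> \<le> k t * N (u t)"
 using L2_functionalD(4)[OF l] bochnerD(1)[OF u] by eventually_elim (rule bdd_linear_simps(4))

text \<open>Young's inequality with a free weight: in density arguments \<open>e\<close> is small
  against the norm of the functional, and the approximation error is then made small against
  \<open>e\<close>.\<close>

lemma pairing_integrable:
 assumes l: "L2_functional T V N l k" and u: "u \<in> bochner_L2 T V N"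
 shows "integrable (\<mu> T) (\<lambda>t. l t (u t))"
  "e > 0 \<Longrightarrow> \<bar>LINT t|\<mu> T. l t (u t)\<bar> \<le> e * (LINT t|\<mu> T. (k t)\<^sup>2) + (1 / e) * (LINT t|\<mu> T. (N (u t))\<^sup>2)"
proof -
 note i = L2_functionalD(3)[OF l] bochnerD(2)[OF u]
 have le: "AE t in \<mu> T. \<bar>l t (u t)\<bar> \<le> e * (k t)\<^sup>2 + (1 / e) * (N (u t))\<^sup>2" if e: "e > 0" for e
  using pairing_bound[OF l u]
 proof eventually_elim
  case (elim t)
  have "2 * (sqrt e * k t) * (N (u t) / sqrt e) \<le> (sqrt e * k t)\<^sup>2 + (N (u t) / sqrt e)\<^sup>2"
   by (rule sum_squares_bound)
  then have "2 * (k t * N (u t)) \<le> e * (k t)\<^sup>2 + (1 / e) * (N (u t))\<^sup>2"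
   using e by (simp add: power_mult_distrib power_divide)
  moreover have "0 \<le> e * (k t)\<^sup>2 + (1 / e) * (N (u t))\<^sup>2" using e by simp
  ultimately show ?case using elim by linarith
 qed
 show li: "integrable (\<mu> T) (\<lambda>t. l t (u t))"
 proof (rule Bochner_Integration.integrable_bound)
  show "integrable (\<mu> T) (\<lambda>t. 1 * (k t)\<^sup>2 + (1 / 1) * (N (u t))\<^sup>2)" using i by simp
  show "AE t in \<mu> T. norm (l t (u t)) \<le> norm (1 * (k t)\<^sup>2 + (1 / 1) * (N (u t))\<^sup>2)"
   using le[of 1, simplified] by eventually_elim simp
 qed (rule pairing_measurable[OF l u])
 assume e: "e > 0"
 have "\<bar>LINT t|\<mu> T. l t (u t)\<bar> \<le> (LINT t|\<mu> T. \<bar>l t (u t)\<bar>)" by (rule integral_abs_bound)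
 also have "\<dots> \<le> (LINT t|\<mu> T. e * (k t)\<^sup>2 + (1 / e) * (N (u t))\<^sup>2)"
  using li i le[OF e] by (intro integral_mono_AE) auto
 also have "\<dots> = e * (LINT t|\<mu> T. (k t)\<^sup>2) + (1 / e) * (LINT t|\<mu> T. (N (u t))\<^sup>2)" using i by simp
 finally show "\<bar>LINT t|\<mu> T. l t (u t)\<bar> \<le> e * (LINT t|\<mu> T. (k t)\<^sup>2) + (1 / e) * (LINT t|\<mu> T. (N (u t))\<^sup>2)" .
qed

lemma pairing_diff:
 assumes l: "L2_functional T V N l k" and u: "u \<in> bochner_L2 T V N" and w: "w \<in> bochner_L2 T V N"
 shows "AE t in \<mu> T. l t (\<lambda>x. u t x - w t x) = l t (u t) - l t (w t)"
  "(LINT t|\<mu> T. l t (\<lambda>x. u t x - w t x)) = (LINT t|\<mu> T. l t (u t)) - (LINT t|\<mu> T. l t (w t))"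
proof -
 show ae: "AE t in \<mu> T. l t (\<lambda>x. u t x - w t x) = l t (u t) - l t (w t)"
  using L2_functionalD(4)[OF l] bochnerD(1)[OF u] bochnerD(1)[OF w]
  by eventually_elim (rule bdd_linear_simps(2))
 have "(LINT t|\<mu> T. l t (\<lambda>x. u t x - w t x)) = (LINT t|\<mu> T. l t (u t) - l t (w t))"
  using pairing_measurable[OF l bochner_diff[OF u w]] pairing_measurable[OF l u] pairing_measurable[OF l w] ae
  by (intro integral_cong_AE) auto
 then show "(LINT t|\<mu> T. l t (\<lambda>x. u t x - w t x)) = (LINT t|\<mu> T. l t (u t)) - (LINT t|\<mu> T. l t (w t))"
  using pairing_integrable(1)[OF l u] pairing_integrable(1)[OF l w] by simp
qed

lemma L2_functional_lin:
 assumes l: "L2_functional T V N l k" and l': "L2_functional T V N l' k'"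
 shows "L2_functional T V N (\<lambda>t v. l t v + c * l' t v) (\<lambda>t. k t + \<bar>c\<bar> * k' t)"
 unfolding L2_functional_def
proof (intro conjI ballI)
 note [measurable] = L2_functionalD(2)[OF l] L2_functionalD(2)[OF l']
 show "(\<lambda>t. l t v + c * l' t v) \<in> borel_measurable (\<mu> T)" if "v \<in> V" for v
  using L2_functionalD(1)[OF l that] L2_functionalD(1)[OF l' that] by measurable
 show "(\<lambda>t. k t + \<bar>c\<bar> * k' t) \<in> borel_measurable (\<mu> T)" by measurable
 show "integrable (\<mu> T) (\<lambda>t. (k t + \<bar>c\<bar> * k' t)\<^sup>2)"
 proof (rule Bochner_Integration.integrable_bound)
  show "integrable (\<mu> T) (\<lambda>t. 2 * (k t)\<^sup>2 + 2 * c\<^sup>2 * (k' t)\<^sup>2)"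
   using L2_functionalD(3)[OF l] L2_functionalD(3)[OF l'] by simp
  have "(k t + \<bar>c\<bar> * k' t)\<^sup>2 \<le> 2 * (k t)\<^sup>2 + 2 * c\<^sup>2 * (k' t)\<^sup>2" for t
   using sum_squares_bound[of "k t" "\<bar>c\<bar> * k' t"] by (simp add: power2_sum power_mult_distrib)
  then show "AE t in \<mu> T. norm ((k t + \<bar>c\<bar> * k' t)\<^sup>2) \<le> norm (2 * (k t)\<^sup>2 + 2 * c\<^sup>2 * (k' t)\<^sup>2)"
   by (intro AE_I2) simp
 qed measurable
 show "AE t in \<mu> T. bdd_linear V N (k t + \<bar>c\<bar> * k' t) (\<lambda>v. l t v + c * l' t v)"
  using L2_functionalD(4)[OF l] L2_functionalD(4)[OF l']
 proof eventually_elim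
  case (elim t)
  show ?case
   unfolding bdd_linear_def
  proof (intro conjI ballI allI)
   show "0 \<le> k t + \<bar>c\<bar> * k' t" using elim by (auto simp: bdd_linear_def)
   show "l t (\<lambda>x. v x + d * w x) + c * l' t (\<lambda>x. v x + d * w x) = l t v + c * l' t v + d * (l t w + c * l' t w)"
    if "v \<in> V" "w \<in> V" for v w d
    using elim that by (simp add: bdd_linear_def algebra_simps)
   show "\<bar>l t v + c * l' t v\<bar> \<le> (k t + \<bar>c\<bar> * k' t) * N v" if "v \<in> V" for v
   proof -
    have "\<bar>c * l' t v\<bar> \<le> \<bar>c\<bar> * (k' t * N v)"
     unfolding abs_mult using bdd_linear_simps(4)[OF elim(2) that] by (intro mult_left_mono) auto
    then show ?thesis using bdd_linear_simps(4)[OF elim(1) that] by (simp add: algebra_simps)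
   qed
  qed
 qed
qed

end

section \<open>Weak convergence of functionals, their Steklov averages, and extension from countable
  sets\<close>

lemma kern_mult_integrable:
 assumes h: "h > 0" and f: "integrable (\<mu> T) f"
 shows "integrable (\<mu> T) (\<lambda>s. kern a h t s * f s)"
proof (rule Bochner_Integration.integrable_bound)
 show "integrable (\<mu> T) (\<lambda>s. (1 / h) * f s)" using f by simp
 show "AE s in \<mu> T. norm (kern a h t s * f s) \<le> norm ((1 / h) * f s)"
  unfolding norm_mult using kern_bounds(2)[OF h] h by (intro AE_I2 mult_right_mono) auto
qed (use f in measurable)

context seminormed begin

lemma functional_integrable:
 assumes l: "L2_functional T V N l k" and v: "v \<in> V"
 shows "integrable (\<mu> T) (\<lambda>t. l t v)"
 using pairing_integrable(1)[OF l bochner_simple[of T "\<lambda>_. v"]] v by simp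

lemma functional_bound_integrable:
 assumes l: "L2_functional T V N l k"
 shows "integrable (\<mu> T) k"
proof (rule Bochner_Integration.integrable_bound)
 show "integrable (\<mu> T) (\<lambda>t. 1 + (k t)\<^sup>2)" using L2_functionalD(3)[OF l] by simp
 have "\<bar>k t\<bar> \<le> 1 + (k t)\<^sup>2" for t
  using sum_squares_bound[of "\<bar>k t\<bar>" 1] by simp
 then show "AE t in \<mu> T. norm (k t) \<le> norm (1 + (k t)\<^sup>2)" by (intro AE_I2) (simp add: add_nonneg_nonneg)
qed (rule L2_functionalD(2)[OF l])

text \<open>The uniform bound on the norms of the functionals reduces the claim to simple
  \<open>u\<close>, for which the pairing is a finite sum of the terms in
  \<open>conv\<close>.\<close>

lemma L2_functional_weak_conv:
 assumes l: "\<And>n. L2_functional T V N (l n) (k n)" and l0: "L2_functional T V N l0 k0"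
  and K: "\<And>n. (LINT t|\<mu> T. (k n t)\<^sup>2) \<le> K"
  and conv: "\<And>v A. v \<in> V \<Longrightarrow> A \<in> sets (\<mu> T) \<Longrightarrow>
   (\<lambda>n. LINT t|\<mu> T. indicator A t * l n t v) \<longlonglongrightarrow> (LINT t|\<mu> T. indicator A t * l0 t v)"
  and u: "u \<in> bochner_L2 T V N"
 shows "(\<lambda>n. LINT t|\<mu> T. l n t (u t)) \<longlonglongrightarrow> (LINT t|\<mu> T. l0 t (u t))"
proof (rule LIMSEQ_I)
 fix r :: real assume r: "r > 0"
 define K' where "K' = \<bar>K\<bar> + (LINT t|\<mu> T. (k0 t)\<^sup>2) + 1"
 have K0: "0 \<le> (LINT t|\<mu> T. (k0 t)\<^sup>2)" by simp
 have K': "K' > 0" "\<And>n. (LINT t|\<mu> T. (k n t)\<^sup>2) \<le> K'" "(LINT t|\<mu> T. (k0 t)\<^sup>2) \<le> K'"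
 proof -
  show "K' > 0" "(LINT t|\<mu> T. (k0 t)\<^sup>2) \<le> K'" using K0 unfolding K'_def by linarith+
  show "(LINT t|\<mu> T. (k n t)\<^sup>2) \<le> K'" for n using K[of n] K0 unfolding K'_def by linarith
 qed
 \<comment> \<open>Young's inequality with weight \<open>e\<close> splits the error into two terms
   of size at most \<open>r / 8\<close>, which stays below \<open>r / 3\<close>.\<close>
 define e where "e = r / (8 * K')"
 have e: "e > 0" "e * K' = r / 8" using r K' by (auto simp: e_def)
 obtain s where s: "simple_function (\<mu> T) s" "\<And>t. t \<in> {0<..<T} \<Longrightarrow> s t \<in> V"
  "(LINT t|\<mu> T. (N (\<lambda>x. u t x - s t x))\<^sup>2) < e * (r / 8)"
  by (rule simple_dense[OF u, of "e * (r / 8)"]) (use e r in auto)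
 have sX: "s \<in> bochner_L2 T V N" using bochner_simple s by blast
 have dX: "(\<lambda>t x. u t x - s t x) \<in> bochner_L2 T V N" by (intro bochner_diff u sX)
 have err: "\<bar>(LINT t|\<mu> T. m t (u t)) - (LINT t|\<mu> T. m t (s t))\<bar> < r / 3"
  if m: "L2_functional T V N m j" "(LINT t|\<mu> T. (j t)\<^sup>2) \<le> K'" for m j
 proof -
  have "\<bar>LINT t|\<mu> T. m t (\<lambda>x. u t x - s t x)\<bar> \<le> e * (LINT t|\<mu> T. (j t)\<^sup>2) + (1 / e) * (LINT t|\<mu> T. (N (\<lambda>x. u t x - s t x))\<^sup>2)"
   by (rule pairing_integrable(2)[OF m(1) dX e(1)])
  also have "\<dots> \<le> e * K' + (1 / e) * (e * (r / 8))"
   using s(3) m(2) e by (intro add_mono mult_left_mono) auto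
  also have "\<dots> < r / 3" using e r by simp
  finally show ?thesis using pairing_diff(2)[OF m(1) u sX] by simp
 qed
 define I where "I = s ` {0<..<T}"
 define A where "A v = s -` {v} \<inter> {0<..<T}" for v
 have I: "finite I" "I \<subseteq> V" "\<And>v. v \<in> I \<Longrightarrow> A v \<in> sets (\<mu> T)"
  using s by (auto simp: I_def A_def simple_function_def)
 have simple: "(LINT t|\<mu> T. m t (s t)) = (\<Sum>v\<in>I. LINT t|\<mu> T. indicator (A v) t * m t v)"
  if m: "L2_functional T V N m j" for m j
 proof -
  have "(LINT t|\<mu> T. m t (s t)) = (LINT t|\<mu> T. (\<Sum>v\<in>I. indicator (A v) t * m t v))"
  proof (rule Bochner_Integration.integral_cong[OF refl])
   fix t assume t: "t \<in> space (\<mu> T)"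
   have "(\<Sum>v\<in>I. indicator (A v) t * m t v) = (\<Sum>v\<in>I. if v = s t then m t v else 0)"
    using t by (intro sum.cong) (auto simp: A_def)
   also have "\<dots> = m t (s t)" using t I(1) by (simp add: sum.delta I_def)
   finally show "m t (s t) = (\<Sum>v\<in>I. indicator (A v) t * m t v)" by simp
  qed
  also have "\<dots> = (\<Sum>v\<in>I. LINT t|\<mu> T. indicator (A v) t * m t v)"
  proof (rule Bochner_Integration.integral_sum)
   fix v assume "v \<in> I"
   then show "integrable (\<mu> T) (\<lambda>t. indicator (A v) t * m t v)"
    using integrable_mult_indicator[OF I(3) functional_integrable[OF m]] I(2) by auto
  qed
  finally show ?thesis .
 qed
 have "(\<lambda>n. LINT t|\<mu> T. l n t (s t)) \<longlonglongrightarrow> (LINT t|\<mu> T. l0 t (s t))"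
  unfolding simple[OF l] simple[OF l0] using I by (intro tendsto_sum conv) auto
 then obtain n0 where n0: "\<And>n. n \<ge> n0 \<Longrightarrow> \<bar>(LINT t|\<mu> T. l n t (s t)) - (LINT t|\<mu> T. l0 t (s t))\<bar> < r / 3"
  using LIMSEQ_D[of "\<lambda>n. LINT t|\<mu> T. l n t (s t)" "LINT t|\<mu> T. l0 t (s t)" "r / 3"] r by auto
 show "\<exists>n0. \<forall>n\<ge>n0. norm ((LINT t|\<mu> T. l n t (u t)) - (LINT t|\<mu> T. l0 t (u t))) < r"
 proof (intro exI[of _ n0] allI impI)
  fix n assume "n \<ge> n0"
  then show "norm ((LINT t|\<mu> T. l n t (u t)) - (LINT t|\<mu> T. l0 t (u t))) < r"
   using n0[of n] err[OF l K'(2), of n] err[OF l0 K'(3)] unfolding real_norm_def by linarith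
 qed
qed

text \<open>The average of \<open>k\<close> bounds the averaged functional, and its L2 norm does not
  grow: Jensen's inequality for a kernel of mass at most 1, followed by the mass bound in the other
  variable.\<close>

lemma steklov_functional:
 assumes l: "L2_functional T V N l k" and h: "h > 0"
 shows "L2_functional T V N (\<lambda>t v. LINT s|\<mu> T. kern a h t s * l s v) (\<lambda>t. LINT s|\<mu> T. kern a h t s * k s)"
  "(LINT t|\<mu> T. (LINT s|\<mu> T. kern a h t s * k s)\<^sup>2) \<le> (LINT t|\<mu> T. (k t)\<^sup>2)"
proof -
 note F = Fubini_kernel[OF _ _ kern_measurable kern_bounds(2)[OF h]]
 have one: "integrable (\<mu> T) (\<lambda>_. 1::real)" by simp
 note ki = functional_bound_integrable[OF l]
 note k2 = L2_functionalD(3)[OF l]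
 have [measurable]: "(\<lambda>t. LINT s|\<mu> T. kern a h t s * k s) \<in> borel_measurable (\<mu> T)"
  by (rule F(3)[OF one ki])
 have sq: "(LINT s|\<mu> T. kern a h t s * k s)\<^sup>2 \<le> (LINT s|\<mu> T. kern a h t s * (k s)\<^sup>2)" for t
 proof -
  define c where "c = (LINT s|\<mu> T. kern a h t s * k s)"
  define m where "m = (LINT s|\<mu> T. kern a h t s)"
  have kni: "integrable (\<mu> T) (kern a h t)" using kern_mult_integrable[OF h one, of a t] by simp
  \<comment> \<open>The variance about the average \<open>c\<close>; as the mass \<open>m\<close> of
    the kernel is at most 1, expanding it gives Jensen's inequality.\<close>
  have "0 \<le> (LINT s|\<mu> T. kern a h t s * (k s - c)\<^sup>2)"
   using kern_bounds(1)[OF h] by (intro integral_nonneg_AE AE_I2) simp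
  also have "\<dots> = (LINT s|\<mu> T. kern a h t s * (k s)\<^sup>2 - 2 * c * (kern a h t s * k s) + c\<^sup>2 * kern a h t s)"
   by (intro Bochner_Integration.integral_cong) (simp_all add: power2_diff algebra_simps)
  also have "\<dots> = (LINT s|\<mu> T. kern a h t s * (k s)\<^sup>2) - 2 * c * c + c\<^sup>2 * m"
   using kern_mult_integrable[OF h k2] kern_mult_integrable[OF h ki] kni by (simp add: c_def m_def)
  also have "c\<^sup>2 * m \<le> c\<^sup>2 * 1"
   using kern_integral(1)[OF h] unfolding m_def by (intro mult_left_mono) auto
  finally show ?thesis unfolding c_def[symmetric] by (simp add: power2_eq_square)
 qed
 have Fi: "integrable (\<mu> T) (\<lambda>t. 1 * (LINT s|\<mu> T. kern a h t s * (k s)\<^sup>2))" by (rule F(2)[OF one k2])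
 have khi: "integrable (\<mu> T) (\<lambda>t. (LINT s|\<mu> T. kern a h t s * k s)\<^sup>2)"
 proof (rule Bochner_Integration.integrable_bound[OF Fi])
  show "AE t in \<mu> T. norm ((LINT s|\<mu> T. kern a h t s * k s)\<^sup>2) \<le> norm (1 * (LINT s|\<mu> T. kern a h t s * (k s)\<^sup>2))"
   using sq by (intro AE_I2) (simp add: order_trans[OF sq abs_ge_self])
 qed measurable
 have "(LINT t|\<mu> T. (LINT s|\<mu> T. kern a h t s * k s)\<^sup>2) \<le> (LINT t|\<mu> T. 1 * (LINT s|\<mu> T. kern a h t s * (k s)\<^sup>2))"
  using khi Fi sq by (intro integral_mono) auto
 also have "\<dots> \<le> 1 * (LINT s|\<mu> T. \<bar>(k s)\<^sup>2\<bar>)"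
  using kern_bound[OF h k2, of "\<lambda>_. 1" 1 a] by (auto intro: order_trans[OF abs_ge_self])
 finally show "(LINT t|\<mu> T. (LINT s|\<mu> T. kern a h t s * k s)\<^sup>2) \<le> (LINT t|\<mu> T. (k t)\<^sup>2)" by simp
 show "L2_functional T V N (\<lambda>t v. LINT s|\<mu> T. kern a h t s * l s v) (\<lambda>t. LINT s|\<mu> T. kern a h t s * k s)"
  unfolding L2_functional_def
 proof (intro conjI ballI AE_I2)
  show "(\<lambda>t. LINT s|\<mu> T. kern a h t s * l s v) \<in> borel_measurable (\<mu> T)" if "v \<in> V" for v
   by (rule F(3)[OF one functional_integrable[OF l that]])
  fix t
  have il: "integrable (\<mu> T) (\<lambda>s. kern a h t s * l s v)" if "v \<in> V" for v
   using kern_mult_integrable[OF h functional_integrable[OF l that]] .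
  show "bdd_linear V N (LINT s|\<mu> T. kern a h t s * k s) (\<lambda>v. LINT s|\<mu> T. kern a h t s * l s v)"
   unfolding bdd_linear_def
  proof (intro conjI ballI allI)
   show "0 \<le> (LINT s|\<mu> T. kern a h t s * k s)"
    using L2_functionalD(4)[OF l]
    by (intro integral_nonneg_AE) (auto elim!: AE_mp simp: bdd_linear_def kern_bounds(1)[OF h])
   fix v w c assume v: "v \<in> V" and w: "w \<in> V"
   have vw: "(\<lambda>x. v x + c * w x) \<in> V" by (intro add scale v w)
   have "(LINT s|\<mu> T. kern a h t s * l s (\<lambda>x. v x + c * w x)) = (LINT s|\<mu> T. kern a h t s * l s v + c * (kern a h t s * l s w))"
   proof (rule integral_cong_AE)
    show "AE s in \<mu> T. kern a h t s * l s (\<lambda>x. v x + c * w x) = kern a h t s * l s v + c * (kern a h t s * l s w)"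
     using L2_functionalD(4)[OF l] by eventually_elim (use v w in \<open>simp add: bdd_linear_def algebra_simps\<close>)
   qed (use il[OF v] il[OF w] il[OF vw] in auto)
   then show "(LINT s|\<mu> T. kern a h t s * l s (\<lambda>x. v x + c * w x)) = (LINT s|\<mu> T. kern a h t s * l s v) + c * (LINT s|\<mu> T. kern a h t s * l s w)"
    using il[OF v] il[OF w] by simp
  next
   fix v assume v: "v \<in> V"
   have "\<bar>LINT s|\<mu> T. kern a h t s * l s v\<bar> \<le> (LINT s|\<mu> T. \<bar>kern a h t s * l s v\<bar>)" by (rule integral_abs_bound)
   also have "\<dots> \<le> (LINT s|\<mu> T. (kern a h t s * k s) * N v)"
   proof (rule integral_mono_AE)
    show "AE s in \<mu> T. \<bar>kern a h t s * l s v\<bar> \<le> (kern a h t s * k s) * N v"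
     using L2_functionalD(4)[OF l]
    proof eventually_elim
     case (elim s)
     have "kern a h t s * \<bar>l s v\<bar> \<le> kern a h t s * (k s * N v)"
      using bdd_linear_simps(4)[OF elim v] kern_bounds(1)[OF h] by (intro mult_left_mono)
     then show ?case using kern_bounds(1)[OF h, of a t s] by (simp add: abs_mult mult.assoc)
    qed
   qed (use il[OF v] kern_mult_integrable[OF h ki] in auto)
   finally show "\<bar>LINT s|\<mu> T. kern a h t s * l s v\<bar> \<le> (LINT s|\<mu> T. kern a h t s * k s) * N v" by simp
  qed
 qed (use khi in auto)
qed

text \<open>The average acts on the functional alone and its argument stays at time
  \<open>t\<close>. Weak convergence reduces the claim to a fixed \<open>v\<close> and a measurable
  set of times, which is the scalar \<open>kern_tendsto\<close>.\<close>

lemma steklov_tendsto: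
 assumes l: "L2_functional T V N l k" and u: "u \<in> bochner_L2 T V N" and a: "0 \<le> a" "a \<le> 1"
  and h: "\<And>n. h n > 0" "h \<longlonglongrightarrow> 0"
 shows "(\<lambda>n. LINT t|\<mu> T. (LINT s|\<mu> T. kern a (h n) t s * l s (u t))) \<longlonglongrightarrow> (LINT t|\<mu> T. l t (u t))"
proof (rule L2_functional_weak_conv[OF steklov_functional(1)[OF l h(1)] l steklov_functional(2)[OF l h(1)] _ u])
 fix v and A :: "real set" assume v: "v \<in> V" and A: "A \<in> sets (\<mu> T)"
 show "(\<lambda>n. LINT t|\<mu> T. indicator A t * (LINT s|\<mu> T. kern a (h n) t s * l s v)) \<longlonglongrightarrow> (LINT t|\<mu> T. indicator A t * l t v)"
  by (rule kern_tendsto[OF functional_integrable[OF l v] _ _ _ a h, where B = 1]) (use A in \<open>auto simp: indicator_def\<close>)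
qed

text \<open>All values of the approximating simple functions together form a countable set. It
  serves to merge null sets that depend on the element of \<open>V\<close>.\<close>

lemma separable_values:
 assumes u: "u \<in> bochner_L2 T V N"
 obtains D where "countable D" "D \<subseteq> V"
  "AE t in \<mu> T. \<exists>d. (\<forall>n. d n \<in> D) \<and> (\<lambda>n. N (\<lambda>x. d n x - u t x)) \<longlonglongrightarrow> 0"
proof -
 obtain s where s: "\<And>n. simple_function (\<mu> T) (s n)" "\<And>n t. t \<in> {0<..<T} \<Longrightarrow> s n t \<in> V"
  "AE t in \<mu> T. (\<lambda>n. N (\<lambda>x. s n t x - u t x)) \<longlonglongrightarrow> 0"
  by (rule bochnerE[OF u]) blast
 show ?thesis
 proof (rule that[of "\<Union>n::nat. s n ` {0<..<T}"])
  have "countable (s n ` {0<..<T})" for n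
   using s(1)[of n] by (auto simp: simple_function_def intro: countable_finite)
  then show "countable (\<Union>n::nat. s n ` {0<..<T})" by (intro countable_UN) auto
  show "(\<Union>n::nat. s n ` {0<..<T}) \<subseteq> V" using s(2) by auto
  show "AE t in \<mu> T. \<exists>d. (\<forall>n. d n \<in> (\<Union>n::nat. s n ` {0<..<T})) \<and> (\<lambda>n. N (\<lambda>x. d n x - u t x)) \<longlonglongrightarrow> 0"
   using s(3) AE_space
  proof eventually_elim
   case (elim t)
   have "s n t \<in> (\<Union>n. s n ` {0<..<T})" for n using elim(2) by (intro UN_I[of n] imageI) auto
   then show ?case using elim(1) by (intro exI[of _ "\<lambda>n. s n t"]) simp
  qed
 qed
qed

lemma bdd_linear_tendsto:
 assumes l: "bdd_linear V N k l" and v: "v \<in> V" and d: "\<And>n. d n \<in> V" "(\<lambda>n. N (\<lambda>x. d n x - v x)) \<longlonglongrightarrow> 0"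
 shows "(\<lambda>n. l (d n)) \<longlonglongrightarrow> l v"
proof -
 have "(\<lambda>n. k * N (\<lambda>x. d n x - v x)) \<longlonglongrightarrow> k * 0" by (intro tendsto_intros d)
 then have lim: "(\<lambda>n. k * N (\<lambda>x. d n x - v x)) \<longlonglongrightarrow> 0" by simp
 have "norm (l (d n) - l v) \<le> k * N (\<lambda>x. d n x - v x)" for n
  using bdd_linear_simps(4)[OF l diff[OF d(1) v], of n] bdd_linear_simps(2)[OF l d(1) v, of n] by simp
 then show ?thesis by (rule LIM_zero_cancel[OF Lim_null_comparison[OF always_eventually[OF allI] lim]])
qed

lemma bdd_linear_eq_extend:
 assumes "bdd_linear V N k l" "bdd_linear V N k' l'" and v: "v \<in> V"
  and d: "\<And>n. d n \<in> D" "D \<subseteq> V" "(\<lambda>n. N (\<lambda>x. d n x - v x)) \<longlonglongrightarrow> 0"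
  and eq: "\<And>w. w \<in> D \<Longrightarrow> l w = l' w"
 shows "l v = l' v"
proof (rule LIMSEQ_unique)
 have dV: "d n \<in> V" for n using d(1,2) by blast
 show "(\<lambda>n. l (d n)) \<longlonglongrightarrow> l v" by (rule bdd_linear_tendsto[OF assms(1) v dV d(3)])
 have "(\<lambda>n. l' (d n)) \<longlonglongrightarrow> l' v" by (rule bdd_linear_tendsto[OF assms(2) v dV d(3)])
 then show "(\<lambda>n. l (d n)) \<longlonglongrightarrow> l' v" using eq[OF d(1)] by simp
qed

text \<open>The exceptional null set depends on \<open>v\<close>; taking the union over a countable
  set and extending by continuity gives one that works at the varying argument
  \<open>u t\<close>.\<close>

lemma functional_eq_extend:
 assumes l: "L2_functional T V N l k" and l': "L2_functional T V N l' k'"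
  and eq: "\<And>v. v \<in> V \<Longrightarrow> AE t in \<mu> T. l t v = l' t v" and u: "u \<in> bochner_L2 T V N"
 shows "AE t in \<mu> T. l t (u t) = l' t (u t)" "(LINT t|\<mu> T. l t (u t)) = (LINT t|\<mu> T. l' t (u t))"
proof -
 obtain D where D: "countable D" "D \<subseteq> V"
  "AE t in \<mu> T. \<exists>d. (\<forall>n. d n \<in> D) \<and> (\<lambda>n. N (\<lambda>x. d n x - u t x)) \<longlonglongrightarrow> 0"
  by (rule separable_values[OF u]) blast
 have "AE t in \<mu> T. \<forall>v\<in>D. l t v = l' t v"
  by (subst AE_ball_countable[OF D(1)]) (use D(2) eq in blast)
 then show *: "AE t in \<mu> T. l t (u t) = l' t (u t)"
  using D(3) L2_functionalD(4)[OF l] L2_functionalD(4)[OF l'] bochnerD(1)[OF u]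
 proof eventually_elim
  case (elim t)
  then obtain d where d: "\<And>n. d n \<in> D" "(\<lambda>n. N (\<lambda>x. d n x - u t x)) \<longlonglongrightarrow> 0" by blast
  show ?case by (rule bdd_linear_eq_extend[OF elim(3,4,5) d(1) D(2) d(2)]) (use elim(1) in blast)
 qed
 show "(LINT t|\<mu> T. l t (u t)) = (LINT t|\<mu> T. l' t (u t))"
  by (rule integral_cong_AE) (use pairing_measurable[OF l u] pairing_measurable[OF l' u] * in auto)
qed

lemma functional_prim:
 assumes l: "L2_functional T V N l k" and A: "A \<in> sets borel"
 shows "bdd_linear V N (LINT s|\<mu> T. indicator A s * k s) (\<lambda>v. LINT s|\<mu> T. indicator A s * l s v)"
proof -
 note i = prim_integrable[OF functional_integrable[OF l] A]
 note ki = prim_integrable[OF functional_bound_integrable[OF l] A]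
 show ?thesis
  unfolding bdd_linear_def
 proof (intro conjI ballI allI)
  show "0 \<le> (LINT s|\<mu> T. indicator A s * k s)"
   using L2_functionalD(4)[OF l]
   by (intro integral_nonneg_AE) (auto elim!: AE_mp simp: bdd_linear_def indicator_def)
  fix v w c assume v: "v \<in> V" and w: "w \<in> V"
  have vw: "(\<lambda>x. v x + c * w x) \<in> V" by (intro add scale v w)
  have "(LINT s|\<mu> T. indicator A s * l s (\<lambda>x. v x + c * w x)) = (LINT s|\<mu> T. indicator A s * l s v + c * (indicator A s * l s w))"
  proof (rule integral_cong_AE)
   show "AE s in \<mu> T. indicator A s * l s (\<lambda>x. v x + c * w x) = indicator A s * l s v + c * (indicator A s * l s w)"
    using L2_functionalD(4)[OF l] by eventually_elim (use v w in \<open>simp add: bdd_linear_def algebra_simps\<close>)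
  qed (use i[OF v] i[OF w] i[OF vw] in auto)
  then show "(LINT s|\<mu> T. indicator A s * l s (\<lambda>x. v x + c * w x)) = (LINT s|\<mu> T. indicator A s * l s v) + c * (LINT s|\<mu> T. indicator A s * l s w)"
   using i[OF v] i[OF w] by simp
 next
  fix v assume v: "v \<in> V"
  have "\<bar>LINT s|\<mu> T. indicator A s * l s v\<bar> \<le> (LINT s|\<mu> T. \<bar>indicator A s * l s v\<bar>)" by (rule integral_abs_bound)
  also have "\<dots> \<le> (LINT s|\<mu> T. (indicator A s * k s) * N v)"
  proof (rule integral_mono_AE)
   show "AE s in \<mu> T. \<bar>indicator A s * l s v\<bar> \<le> (indicator A s * k s) * N v"
    using L2_functionalD(4)[OF l]
   proof eventually_elim
    case (elim s)
    then show ?case using bdd_linear_simps(4)[OF elim v] by (simp add: indicator_def)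
   qed
  qed (use i[OF v] ki in auto)
  finally show "\<bar>LINT s|\<mu> T. indicator A s * l s v\<bar> \<le> (LINT s|\<mu> T. indicator A s * k s) * N v" by simp
 qed
qed

end

section \<open>Weak gradients\<close>

definition grad :: "('a::euclidean_space \<Rightarrow> real) \<Rightarrow> 'a \<Rightarrow> 'a" where
 "grad \<phi> x = (\<Sum>i\<in>Basis. partial_deriv \<phi> i x *\<^sub>R i)"

lemma grad_inner: "i \<in> Basis \<Longrightarrow> grad \<phi> x \<bullet> i = partial_deriv \<phi> i x"
 by (simp add: grad_def)

locale bounded_domain =
 fixes U :: "'a::euclidean_space set"
 assumes open_U: "open U" and bounded_U: "bounded U"
begin

abbreviation \<mu>U :: "'a measure" where "\<mu>U \<equiv> lebesgue_on U"

lemma sets_U: "U \<in> sets lebesgue" using open_U by simp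

lemma lmeasurable_U: "U \<in> lmeasurable"
 using bounded_U open_U by (intro bounded_set_imp_lmeasurable) auto

sublocale space: finite_measure \<mu>U
 by (rule finite_measure_lebesgue_on[OF lmeasurable_U])

abbreviation "X_functional T \<equiv> L2_functional T (H10 U) (H1_norm U)"

abbreviation "H10_linear \<equiv> bdd_linear (H10 U) (H1_norm U)"

lemma L2_integrable:
 fixes g :: "'a \<Rightarrow> 'b::euclidean_space"
 assumes g: "g \<in> L2 U" shows "integrable \<mu>U g"
proof -
 show ?thesis
 proof (rule Bochner_Integration.integrable_bound)
  show "integrable \<mu>U (\<lambda>x. 1 + (norm (g x))\<^sup>2)" using L2_D(2)[OF g] by simp
  have "norm (g x) \<le> 1 + (norm (g x))\<^sup>2" for x
  proof -
   have "2 * norm (g x) \<le> (norm (g x))\<^sup>2 + 1" using sum_squares_bound[of "norm (g x)" 1] by simp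
   moreover have "0 \<le> (norm (g x))\<^sup>2" by simp
   ultimately show ?thesis by linarith
  qed
  then show "AE x in \<mu>U. norm (g x) \<le> norm (1 + (norm (g x))\<^sup>2)" by (intro AE_I2) simp
 qed (rule L2_D(1)[OF g])
qed

lemma L2_locally_integrable:
 fixes g :: "'a \<Rightarrow> 'b::euclidean_space"
 assumes g: "g \<in> L2 U" and K: "compact K" "K \<subseteq> U"
 shows "g absolutely_integrable_on K"
proof -
 have "g absolutely_integrable_on U"
  using L2_integrable[OF g] by (simp add: integrable_lebesgue_on_iff[OF sets_U])
 then show ?thesis using K lmeasurable_compact[of K] by (rule_tac set_integrable_subset) auto
qed

lemma bounded_L2:
 fixes f :: "'a \<Rightarrow> 'b::euclidean_space"
 assumes "f \<in> borel_measurable \<mu>U" "\<And>x. norm (f x) \<le> B"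
 shows "f \<in> L2 U"
proof -
 note [measurable] = assms(1)
 have "norm ((norm (f x))\<^sup>2) \<le> B\<^sup>2" for x using assms(2)[of x] by (simp add: power_mono)
 then have "integrable \<mu>U (\<lambda>x. (norm (f x))\<^sup>2)"
  by (intro space.integrable_const_bound[of _ "B\<^sup>2"]) auto
 then show ?thesis using assms(1) by (simp add: L2_def)
qed

lemma test_measurable_U: "\<phi> \<in> test_functions V \<Longrightarrow> \<phi> \<in> borel_measurable \<mu>U"
 using sets_U test_functions_continuous by (rule_tac continuous_imp_measurable_on_sets_lebesgue) auto

lemma test_L2:
 assumes "\<phi> \<in> test_functions U" shows "\<phi> \<in> L2 U"
proof -
 obtain B where B: "\<And>x. \<bar>\<phi> x\<bar> \<le> B" "B > 0" by (rule test_functions_bounded[OF assms]) blast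
 show ?thesis by (rule bounded_L2[OF test_measurable_U[OF assms], of B]) (simp add: B)
qed

lemma test_product_integrable:
 assumes f: "\<And>K. compact K \<Longrightarrow> K \<subseteq> U \<Longrightarrow> f absolutely_integrable_on K"
  and \<phi>: "\<phi> \<in> test_functions U"
 shows "integrable \<mu>U (\<lambda>x. f x * \<phi> x :: real)"
proof -
 obtain K where K: "compact K" "K \<subseteq> U" "\<And>x. x \<notin> K \<Longrightarrow> \<phi> x = 0"
  by (rule test_functionsE[OF \<phi>]) blast
 have "(\<lambda>x. \<phi> x * f x) absolutely_integrable_on K"
 proof (rule absolutely_integrable_bounded_measurable_product[OF bilinear_times])
  show "\<phi> \<in> borel_measurable (lebesgue_on K)"
   using fmeasurableD[OF lmeasurable_compact[OF K(1)]] test_functions_continuous[OF \<phi>]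
   by (intro continuous_imp_measurable_on_sets_lebesgue)
  show "bounded (\<phi> ` K)"
   using K(1) test_functions_continuous[OF \<phi>] by (intro compact_imp_bounded compact_continuous_image)
 qed (use K f lmeasurable_compact[of K] in auto)
 then have "integrable lebesgue (\<lambda>x. indicator K x *\<^sub>R (\<phi> x * f x))" by (simp add: set_integrable_def)
 moreover have "(\<lambda>x. indicator K x *\<^sub>R (\<phi> x * f x)) = (\<lambda>x. if x \<in> U then f x * \<phi> x else 0)"
  using K(2,3) by (auto simp: indicator_def fun_eq_iff)
 ultimately have "integrable lebesgue (\<lambda>x. if x \<in> U then f x * \<phi> x else 0)" by simp
 then show ?thesis using Lebesgue_Measure.integrable_restrict_UNIV[OF sets_U] by blast
qed

lemma is_weak_gradD:
 assumes "is_weak_grad U v g"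
 shows "\<And>K. compact K \<Longrightarrow> K \<subseteq> U \<Longrightarrow> v absolutely_integrable_on K"
  "\<And>K. compact K \<Longrightarrow> K \<subseteq> U \<Longrightarrow> g absolutely_integrable_on K"
  "\<And>K i. compact K \<Longrightarrow> K \<subseteq> U \<Longrightarrow> (\<lambda>x. g x \<bullet> i) absolutely_integrable_on K"
  "\<And>\<phi> i. \<phi> \<in> test_functions U \<Longrightarrow> i \<in> Basis \<Longrightarrow>
    (LINT x|\<mu>U. v x * partial_deriv \<phi> i x) = - (LINT x|\<mu>U. (g x \<bullet> i) * \<phi> x)"
proof -
 show "v absolutely_integrable_on K" if "compact K" "K \<subseteq> U" for K
  using assms that by (auto simp: is_weak_grad_def)
 show g: "g absolutely_integrable_on K" if "compact K" "K \<subseteq> U" for K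
  using assms that by (auto simp: is_weak_grad_def)
 show "(\<lambda>x. g x \<bullet> i) absolutely_integrable_on K" if "compact K" "K \<subseteq> U" for K i
  using absolutely_integrable_linear[OF g[OF that] bounded_linear_inner_left[of i]] by (simp add: o_def)
 show "(LINT x|\<mu>U. v x * partial_deriv \<phi> i x) = - (LINT x|\<mu>U. (g x \<bullet> i) * \<phi> x)"
  if "\<phi> \<in> test_functions U" "i \<in> Basis" for \<phi> i
  using assms that unfolding is_weak_grad_def by blast
qed

lemma is_weak_grad_unique:
 assumes g: "is_weak_grad U v g" and g': "is_weak_grad U v g'"
 shows "AE x in \<mu>U. g x = g' x"
proof -
 have "AE x in \<mu>U. g x \<bullet> i - g' x \<bullet> i = 0" if i: "i \<in> Basis" for i
 proof (rule AE_eq_0_if_test[OF open_U])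
  show "(\<lambda>x. g x \<bullet> i - g' x \<bullet> i) absolutely_integrable_on K" if "compact K" "K \<subseteq> U" for K
   using is_weak_gradD(3)[OF g that] is_weak_gradD(3)[OF g' that] by (rule set_integral_diff(1))
  show "(LINT x|\<mu>U. (g x \<bullet> i - g' x \<bullet> i) * \<phi> x) = 0" if \<phi>: "\<phi> \<in> test_functions U" for \<phi>
   using is_weak_gradD(4)[OF g \<phi> i] is_weak_gradD(4)[OF g' \<phi> i]
    test_product_integrable[OF is_weak_gradD(3)[OF g] \<phi>, of i]
    test_product_integrable[OF is_weak_gradD(3)[OF g'] \<phi>, of i]
   by (simp add: left_diff_distrib)
 qed
 then have "AE x in \<mu>U. \<forall>i\<in>Basis. g x \<bullet> i - g' x \<bullet> i = 0"
  by (subst AE_ball_countable) (auto intro: countable_finite)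
 then show ?thesis by eventually_elim (auto simp: euclidean_eq_iff[where 'a='a])
qed

lemma is_weak_grad_lin:
 assumes v: "is_weak_grad U v g" and w: "is_weak_grad U w h"
 shows "is_weak_grad U (\<lambda>x. v x + c * w x) (\<lambda>x. g x + c *\<^sub>R h x)"
 unfolding is_weak_grad_def
proof (intro conjI allI impI ballI)
 fix K assume K: "compact K \<and> K \<subseteq> U"
 then show "(\<lambda>x. v x + c * w x) absolutely_integrable_on K"
  using is_weak_gradD(1)[OF v, of K] is_weak_gradD(1)[OF w, of K] by (intro set_integral_add(1) set_integrable_mult_right) auto
 show "(\<lambda>x. g x + c *\<^sub>R h x) absolutely_integrable_on K"
  using K is_weak_gradD(2)[OF v, of K] is_weak_gradD(2)[OF w, of K] by (intro set_integral_add(1) set_integrable_scaleR_right) auto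
next
 fix \<phi> and i :: 'a assume \<phi>: "\<phi> \<in> test_functions U" and i: "i \<in> Basis"
 note p = test_functions_partial_deriv[OF \<phi> i]
 note 1 = test_product_integrable[OF is_weak_gradD(1)[OF v] p] test_product_integrable[OF is_weak_gradD(1)[OF w] p]
 note 2 = test_product_integrable[OF is_weak_gradD(3)[OF v] \<phi>, of i] test_product_integrable[OF is_weak_gradD(3)[OF w] \<phi>, of i]
 have "(LINT x|\<mu>U. (v x + c * w x) * partial_deriv \<phi> i x) = (LINT x|\<mu>U. v x * partial_deriv \<phi> i x) + c * (LINT x|\<mu>U. w x * partial_deriv \<phi> i x)"
  using 1 by (simp add: distrib_right mult.assoc)
 moreover have "(LINT x|\<mu>U. ((g x + c *\<^sub>R h x) \<bullet> i) * \<phi> x) = (LINT x|\<mu>U. (g x \<bullet> i) * \<phi> x) + c * (LINT x|\<mu>U. (h x \<bullet> i) * \<phi> x)"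
  using 2 by (simp add: inner_add_left distrib_right mult.assoc)
 ultimately show "(LINT x|\<mu>U. (v x + c * w x) * partial_deriv \<phi> i x) = - (LINT x|\<mu>U. ((g x + c *\<^sub>R h x) \<bullet> i) * \<phi> x)"
  using is_weak_gradD(4)[OF v \<phi> i] is_weak_gradD(4)[OF w \<phi> i] by (simp add: algebra_simps)
qed

lemma H1I: "v \<in> L2 U \<Longrightarrow> g \<in> L2 U \<Longrightarrow> is_weak_grad U v g \<Longrightarrow> v \<in> H1 U"
 by (auto simp: H1_def)

text \<open>The choice in \<open>weak_grad\<close> need not pick the square integrable witness;
  uniqueness up to null sets carries integrability over.\<close>

lemma H1D:
 assumes "v \<in> H1 U"
 shows "v \<in> L2 U" "is_weak_grad U v (weak_grad U v)" "weak_grad U v \<in> L2 U"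
proof -
 show "v \<in> L2 U" using assms by (simp add: H1_def)
 obtain g where g: "g \<in> L2 U" "is_weak_grad U v g" using assms by (auto simp: H1_def)
 show w: "is_weak_grad U v (weak_grad U v)" unfolding weak_grad_def by (rule someI[where P = "is_weak_grad U v", OF g(2)])
 show "weak_grad U v \<in> L2 U" by (rule L2_cong[OF g(1) is_weak_grad_unique[OF w g(2)] sets_U])
qed

lemma weak_grad_eq:
 assumes "is_weak_grad U v g"
 shows "AE x in \<mu>U. weak_grad U v x = g x"
 by (rule is_weak_grad_unique[OF someI[where P = "is_weak_grad U v", OF assms, folded weak_grad_def] assms])

text \<open>Lets any convenient weak gradient compute the norm in place of the chosen
  \<open>weak_grad\<close>.\<close>

lemma H1_norm_eq:
 assumes v: "v \<in> L2 U" and g: "g \<in> L2 U" "is_weak_grad U v g"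
 shows "H1_norm U v = sqrt ((L2_norm U v)\<^sup>2 + (L2_norm U g)\<^sup>2)"
proof -
 have "L2_norm U (weak_grad U v) = L2_norm U g"
  using H1D(3)[OF H1I[OF v g]] by (intro L2_norm_cong weak_grad_eq g(2) sets_U L2_D(1))
 then show ?thesis by (simp add: H1_norm_def)
qed

lemma H1_norm_ge: "L2_norm U v \<le> H1_norm U v" "L2_norm U (weak_grad U v) \<le> H1_norm U v" "0 \<le> H1_norm U v"
 by (auto simp: H1_norm_def intro: real_le_rsqrt)

lemma H1_norm_le:
 assumes v: "v \<in> L2 U" and g: "g \<in> L2 U" "is_weak_grad U v g"
 shows "H1_norm U v \<le> L2_norm U v + L2_norm U g"
 unfolding H1_norm_eq[OF assms] using sqrt_sum_squares_le_sum[of "L2_norm U v" "L2_norm U g"] by (simp add: L2_norm_nonneg)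

lemma H1_lin:
 assumes v: "v \<in> H1 U" and w: "w \<in> H1 U"
 shows "(\<lambda>x. v x + c * w x) \<in> H1 U"
  "AE x in \<mu>U. weak_grad U (\<lambda>x. v x + c * w x) x = weak_grad U v x + c *\<^sub>R weak_grad U w x"
proof -
 note g = is_weak_grad_lin[OF H1D(2)[OF v] H1D(2)[OF w], of c]
 show "(\<lambda>x. v x + c * w x) \<in> H1 U"
  by (rule H1I[OF _ _ g]) (intro L2_add L2_mult L2_scaleR H1D[OF v] H1D[OF w])+
 show "AE x in \<mu>U. weak_grad U (\<lambda>x. v x + c * w x) x = weak_grad U v x + c *\<^sub>R weak_grad U w x"
  by (rule weak_grad_eq[OF g])
qed

lemma weak_grad_zero: "is_weak_grad U (\<lambda>x. 0) (\<lambda>x. 0)"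
 by (simp add: is_weak_grad_def set_integrable_def)

lemma H1_zero: "(\<lambda>x. 0) \<in> H1 U" "H1_norm U (\<lambda>x. 0) = 0"
proof -
 show "(\<lambda>x. 0) \<in> H1 U" by (rule H1I[OF L2_zero L2_zero weak_grad_zero])
 show "H1_norm U (\<lambda>x. 0) = 0"
  using H1_norm_eq[OF L2_zero L2_zero weak_grad_zero] by (simp add: L2_norm_def L2_inner_def)
qed

lemma H1_mult:
 assumes v: "v \<in> H1 U"
 shows "(\<lambda>x. c * v x) \<in> H1 U" "AE x in \<mu>U. weak_grad U (\<lambda>x. c * v x) x = c *\<^sub>R weak_grad U v x"
  "H1_norm U (\<lambda>x. c * v x) = \<bar>c\<bar> * H1_norm U v"
proof -
 have g: "is_weak_grad U (\<lambda>x. c * v x) (\<lambda>x. c *\<^sub>R weak_grad U v x)"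
  using is_weak_grad_lin[OF weak_grad_zero H1D(2)[OF v], of c] by simp
 note L = L2_mult[OF H1D(1)[OF v], of c] L2_scaleR[OF H1D(3)[OF v], of c]
 show "(\<lambda>x. c * v x) \<in> H1 U" by (rule H1I[OF L g])
 show "AE x in \<mu>U. weak_grad U (\<lambda>x. c * v x) x = c *\<^sub>R weak_grad U v x" by (rule weak_grad_eq[OF g])
 show "H1_norm U (\<lambda>x. c * v x) = \<bar>c\<bar> * H1_norm U v"
  unfolding H1_norm_eq[OF L g] L2_norm_mult L2_norm_scaleR
  by (simp add: H1_norm_def power_mult_distrib real_sqrt_mult flip: distrib_left)
qed

lemma H1_norm_triangle:
 assumes v: "v \<in> H1 U" and w: "w \<in> H1 U"
 shows "H1_norm U (\<lambda>x. v x + w x) \<le> H1_norm U v + H1_norm U w"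
proof -
 have g: "is_weak_grad U (\<lambda>x. v x + w x) (\<lambda>x. weak_grad U v x + weak_grad U w x)"
  using is_weak_grad_lin[OF H1D(2)[OF v] H1D(2)[OF w], of 1] by simp
 note L = L2_add[OF H1D(1)[OF v] H1D(1)[OF w]] L2_add[OF H1D(3)[OF v] H1D(3)[OF w]]
 have "H1_norm U (\<lambda>x. v x + w x) \<le> sqrt ((L2_norm U v + L2_norm U w)\<^sup>2 + (L2_norm U (weak_grad U v) + L2_norm U (weak_grad U w))\<^sup>2)"
  unfolding H1_norm_eq[OF L g]
  by (intro real_sqrt_le_mono add_mono power_mono L2_norm_triangle H1D[OF v] H1D[OF w] L2_norm_nonneg)
 also have "\<dots> \<le> H1_norm U v + H1_norm U w"
  unfolding H1_norm_def by (rule real_sqrt_sum_squares_triangle_ineq)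
 finally show ?thesis .
qed

text \<open>The product of two test functions is a test function, and the integral of its derivative
  vanishes.\<close>

lemma test_weak_grad:
 assumes \<phi>: "\<phi> \<in> test_functions U"
 shows "is_weak_grad U \<phi> (grad \<phi>)" "grad \<phi> \<in> L2 U"
proof -
 show gL: "grad \<phi> \<in> L2 U"
 proof -
  have "(\<lambda>x. \<Sum>i\<in>F. partial_deriv \<phi> i x *\<^sub>R i) \<in> L2 U" if "F \<subseteq> Basis" for F
   using finite_subset[OF that finite_Basis] that
  proof (induction F rule: finite_induct)
   case empty
   show ?case by (simp add: L2_zero)
  next
   case (insert i F)
   then have i: "i \<in> Basis" by simp
   note p = test_functions_partial_deriv[OF \<phi> i]
   note [measurable] = test_measurable_U[OF p]
   have "(\<lambda>x. partial_deriv \<phi> i x *\<^sub>R i) \<in> L2 U"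
    by (rule L2_bound(1)[OF test_L2[OF p], of _ 1]) (use i in auto)
   then show ?case using insert by (simp add: L2_add)
  qed
  then show ?thesis by (simp add: grad_def[abs_def])
 qed
 show "is_weak_grad U \<phi> (grad \<phi>)"
  unfolding is_weak_grad_def
 proof (intro conjI allI impI ballI)
  fix K assume "compact K \<and> K \<subseteq> U"
  then show "\<phi> absolutely_integrable_on K" "grad \<phi> absolutely_integrable_on K"
   using L2_locally_integrable[OF test_L2[OF \<phi>]] L2_locally_integrable[OF gL] by auto
 next
  fix \<psi> and i :: 'a assume \<psi>: "\<psi> \<in> test_functions U" and i: "i \<in> Basis"
  note p\<phi> = test_functions_partial_deriv[OF \<phi> i] and p\<psi> = test_functions_partial_deriv[OF \<psi> i]
  have t: "(\<lambda>x. \<phi> x * \<psi> x) \<in> test_functions U"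
   by (rule test_functions_mult[OF \<phi> test_functions_Ck[OF \<psi>]])
  have d: "\<phi> differentiable (at x)" "\<psi> differentiable (at x)" for x
   using test_functions_Ck[OF \<phi>, of "Suc 0"] test_functions_Ck[OF \<psi>, of "Suc 0"] by auto
  have eq: "partial_deriv (\<lambda>x. \<phi> x * \<psi> x) i x = \<phi> x * partial_deriv \<psi> i x + partial_deriv \<phi> i x * \<psi> x" for x
   unfolding partial_deriv_def[of \<phi>] partial_deriv_def[of \<psi>]
   by (rule partial_deriv_eq, rule has_derivative_mult) (use d frechet_derivative_works in blast)+
  have t1: "(\<lambda>x. \<phi> x * partial_deriv \<psi> i x) \<in> test_functions U" "(\<lambda>x. partial_deriv \<phi> i x * \<psi> x) \<in> test_functions U"
   using test_functions_mult[OF \<phi> test_functions_Ck[OF p\<psi>]] test_functions_mult[OF p\<phi> test_functions_Ck[OF \<psi>]] by auto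
  have "(LINT x|\<mu>U. partial_deriv (\<lambda>x. \<phi> x * \<psi> x) i x) = 0"
   using test_functions_lebesgue_on(2)[OF test_functions_partial_deriv[OF t i] sets_U] integral_partial_deriv_eq_0[OF t i] by simp
  then have "(LINT x|\<mu>U. \<phi> x * partial_deriv \<psi> i x) + (LINT x|\<mu>U. partial_deriv \<phi> i x * \<psi> x) = 0"
   unfolding eq using test_functions_lebesgue_on(1)[OF t1(1) sets_U] test_functions_lebesgue_on(1)[OF t1(2) sets_U] by simp
  then show "(LINT x|\<mu>U. \<phi> x * partial_deriv \<psi> i x) = - (LINT x|\<mu>U. (grad \<phi> x \<bullet> i) * \<psi> x)"
   using i by (simp add: grad_inner)
 qed
qed

end

section \<open>A smooth substitute for the negative part\<close>

text \<open>For \<open>s < 0\<close> this is \<open>s\<^sup>2 / 2 * exp (\<delta> / s)\<close> and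
  otherwise 0: a smooth convex version of half the squared negative part, to which it increases as
  \<delta> decreases to 0. \<open>nfun\<close> and \<open>nder\<close> are its first two
  derivatives.\<close>

definition npot :: "real \<Rightarrow> real \<Rightarrow> real" where
 "npot \<delta> s = s\<^sup>2 / 2 * flat \<delta> 0 (- s)"

definition nfun :: "real \<Rightarrow> real \<Rightarrow> real" where
 "nfun \<delta> s = (s - \<delta> / 2) * flat \<delta> 0 (- s)"

definition nder :: "real \<Rightarrow> real \<Rightarrow> real" where
 "nder \<delta> s = flat \<delta> 0 (- s) - (s - \<delta> / 2) * (\<delta> * flat \<delta> 2 (- s))"

lemma flat_minus_derivative:
 assumes "\<delta> > 0"
 shows "((\<lambda>s. flat \<delta> n (- s)) has_real_derivative (n * flat \<delta> (n+1) (- s) - \<delta> * flat \<delta> (n+2) (- s))) (at s)"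
proof -
 have "((\<lambda>s. flat \<delta> n (- s)) has_real_derivative (\<delta> * flat \<delta> (n+2) (- s) - n * flat \<delta> (n+1) (- s)) * (- 1)) (at s)"
  by (rule DERIV_chain2[OF flat_has_derivative[OF assms]]) (auto intro!: derivative_eq_intros)
 then show ?thesis by (simp add: algebra_simps)
qed

lemma flat_power: "s < 0 \<Longrightarrow> flat \<delta> n (- s) = (- 1 / s) ^ n * exp (\<delta> / s)"
 by (simp add: flat_def)

lemma npot_derivative:
 assumes "\<delta> > 0" shows "(npot \<delta> has_real_derivative nfun \<delta> s) (at s)"
proof -
 have "(npot \<delta> has_real_derivative (s * flat \<delta> 0 (- s) + (- (\<delta> * flat \<delta> 2 (- s))) * (s\<^sup>2 / 2))) (at s)"
  unfolding npot_def[abs_def] using flat_minus_derivative[OF assms, of 0 s]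
  by (auto intro!: derivative_eq_intros simp: numeral_2_eq_2)
 moreover have "s * flat \<delta> 0 (- s) + (- (\<delta> * flat \<delta> 2 (- s))) * (s\<^sup>2 / 2) = nfun \<delta> s"
 proof (cases "s < 0")
  case True
  then show ?thesis by (simp add: nfun_def flat_power power_divide field_simps)
 qed (simp add: nfun_def flat_def)
 ultimately show ?thesis by simp
qed

lemma nfun_derivative:
 assumes "\<delta> > 0" shows "(nfun \<delta> has_real_derivative nder \<delta> s) (at s)"
 unfolding nfun_def[abs_def] nder_def using flat_minus_derivative[OF assms, of 0 s]
 by (auto intro!: derivative_eq_intros simp: numeral_2_eq_2)

lemma nder_eq:
 assumes "s < 0"
 shows "nder \<delta> s = exp (- (- \<delta> / s)) * (1 + (- \<delta> / s) + (- \<delta> / s)\<^sup>2 / 2)"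
 using assms by (simp add: nder_def flat_power power2_eq_square field_simps)

text \<open>For \<open>s < 0\<close> and \<open>y = - \<delta> / s\<close> the value is
  \<open>exp (- y)\<close> times the quadratic Taylor polynomial of \<open>exp y\<close>. The bounds
  give convexity of \<open>npot \<delta>\<close> and Lipschitz constant 1 for
  \<open>nfun \<delta>\<close>.\<close>

lemma nder_bounds:
 assumes "\<delta> > 0" shows "0 \<le> nder \<delta> s" "nder \<delta> s \<le> 1"
proof -
 have "0 \<le> nder \<delta> s \<and> nder \<delta> s \<le> 1"
 proof (cases "s < 0")
  case True
  define y where "y = - \<delta> / s"
  have y: "y \<ge> 0" using True assms by (simp add: y_def divide_nonneg_neg)
  have "1 + y + y\<^sup>2 / 2 \<le> exp y" using exp_lower_Taylor_quadratic[OF y] .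
  then have "exp (- y) * (1 + y + y\<^sup>2 / 2) \<le> exp (- y) * exp y" by (intro mult_left_mono) auto
  moreover have "0 \<le> exp (- y) * (1 + y + y\<^sup>2 / 2)" using y by simp
  ultimately show ?thesis unfolding nder_eq[OF True] y_def[symmetric] by (simp add: exp_minus)
 qed (simp add: nder_def flat_def)
 then show "0 \<le> nder \<delta> s" "nder \<delta> s \<le> 1" by auto
qed

text \<open>With \<open>y = - \<delta> / s\<close> the derivative has modulus
  \<open>y ^ 4 * exp (- y) / (2 * \<delta>)\<close>. From \<open>y / 4 \<le> exp (y / 4)\<close> the
  numerator is at most \<open>4 ^ 4 = 256\<close>, whence 128.\<close>

lemma nder_lipschitz:
 assumes \<delta>: "\<delta> > 0" shows "\<bar>nder \<delta> a - nder \<delta> b\<bar> \<le> 128 / \<delta> * \<bar>a - b\<bar>"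
proof -
 define d where "d s = - (2 * \<delta> * flat \<delta> 2 (- s)) + (s - \<delta> / 2) * (\<delta> * (\<delta> * flat \<delta> 4 (- s) - 2 * flat \<delta> 3 (- s)))" for s
 have D: "(nder \<delta> has_real_derivative d s) (at s)" for s
  unfolding nder_def[abs_def] d_def using flat_minus_derivative[OF \<delta>, of 0 s] flat_minus_derivative[OF \<delta>, of 2 s]
  by (auto intro!: derivative_eq_intros simp: numeral_2_eq_2 eval_nat_numeral field_simps)
 have "\<bar>d s\<bar> \<le> 128 / \<delta>" for s
 proof (cases "s < 0")
  case True
  define y where "y = - \<delta> / s"
  have y: "y \<ge> 0" using True \<delta> by (simp add: y_def divide_nonneg_neg)
  have sy: "s = - \<delta> / y" "y > 0" using True \<delta> by (auto simp: y_def field_simps divide_pos_neg)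
  have fl: "flat \<delta> n (- s) = (y / \<delta>) ^ n * exp (- y)" for n
   unfolding flat_power[OF True] using \<delta> True by (simp add: y_def)
  have "d s = - (y ^ 4 / (2 * \<delta>)) * exp (- y)"
   unfolding d_def fl using \<delta> sy(2) by (simp add: sy(1) field_simps power2_eq_square power3_eq_cube power4_eq_xxxx)
  then have ds: "\<bar>d s\<bar> = y ^ 4 * exp (- y) / (2 * \<delta>)" using \<delta> by (simp add: abs_mult)
  have "(y / 4) ^ 4 \<le> exp (y / 4) ^ 4"
  proof (rule power_mono)
   show "y / 4 \<le> exp (y / 4)" using exp_ge_add_one_self[of "y / 4"] by linarith
  qed (use y in simp)
  also have "\<dots> = exp y" by (simp flip: exp_of_nat_mult)
  finally have "y ^ 4 * exp (- y) \<le> 256" by (simp add: exp_minus field_simps)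
  then have "y ^ 4 * exp (- y) / (2 * \<delta>) \<le> 256 / (2 * \<delta>)" using \<delta> by (intro divide_right_mono) auto
  then show ?thesis unfolding ds by simp
 qed (use \<delta> in \<open>simp add: d_def flat_def\<close>)
 then show ?thesis
  using field_differentiable_bound[of UNIV "nder \<delta>" d "128 / \<delta>" a b] D by simp
qed

lemma nfun_nonpos: "\<delta> > 0 \<Longrightarrow> nfun \<delta> s \<le> 0"
 by (simp add: nfun_def flat_def mult_nonpos_nonneg)

lemma nfun_0: "nfun \<delta> 0 = 0" "npot \<delta> 0 = 0"
 by (simp_all add: nfun_def npot_def flat_def)

lemma npot_nonneg: "npot \<delta> s \<ge> 0"
 by (simp add: npot_def flat_nonneg)

lemma npot_tangent:
 assumes "\<delta> > 0" shows "npot \<delta> b - npot \<delta> a \<le> nfun \<delta> b * (b - a)"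
proof -
 have "convex_on UNIV (npot \<delta>)"
  by (rule f''_ge0_imp_convex[of UNIV "npot \<delta>" "nfun \<delta>" "nder \<delta>"])
    (use npot_derivative[OF assms] nfun_derivative[OF assms] nder_bounds[OF assms] in auto)
 then have "npot \<delta> a - npot \<delta> b \<ge> nfun \<delta> b * (a - b)"
  by (rule convex_on_imp_above_tangent) (use npot_derivative[OF assms] in auto)
 then show ?thesis by (simp add: algebra_simps)
qed

text \<open>Transfers a bound that tends to 0 with \<delta> to the fixed potential
  \<open>npot 1\<close>.\<close>

lemma npot_antimono:
 assumes "0 < \<delta>" "\<delta> \<le> 1" shows "npot 1 s \<le> npot \<delta> s"
proof (cases "s < 0")
 case True
 then have "1 / s \<le> \<delta> / s" using assms by (simp add: field_simps)
 then show ?thesis using True by (simp add: npot_def flat_power mult_left_mono)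
qed (simp add: npot_def flat_def)

lemma npot_eq_0_imp: "npot \<delta> s = 0 \<Longrightarrow> s \<ge> 0"
 by (rule ccontr) (simp add: npot_def flat_def)

text \<open>Gronwall requires the quadratic term left by the drift to be bounded by the potential
  itself. The mixed term \<open>- \<delta> * s\<close> is absorbed at the cost of
  \<open>s\<^sup>2 / 2 + \<delta>\<^sup>2 / 2\<close>, which produces the factor 3 and the
  defect.\<close>

lemma square_nder_le:
 assumes "\<delta> > 0" shows "s\<^sup>2 * nder \<delta> s \<le> 3 * npot \<delta> s + \<delta>\<^sup>2"
proof (cases "s < 0")
 case True
 define E where "E = exp (\<delta> / s)"
 have E: "0 \<le> E" "E \<le> 1" using True assms by (auto simp: E_def divide_pos_neg less_imp_le)
 have "s\<^sup>2 * nder \<delta> s = E * (s\<^sup>2 - \<delta> * s + \<delta>\<^sup>2 / 2)"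
  unfolding nder_eq[OF True] E_def using True by (simp add: power2_eq_square field_simps)
 also have "\<dots> \<le> E * (3 * (s\<^sup>2 / 2) + \<delta>\<^sup>2)"
  using sum_squares_bound[of \<delta> "- s"] E by (intro mult_left_mono) auto
 also have "\<dots> \<le> 3 * npot \<delta> s + \<delta>\<^sup>2"
  using E mult_right_mono[OF E(2), of "\<delta>\<^sup>2"] by (simp add: npot_def flat_power[OF True] E_def algebra_simps)
 finally show ?thesis .
qed (use assms in \<open>simp add: nder_def npot_def flat_def\<close>)

lemma Ck_nfun_compose:
 assumes "\<delta> > 0" "\<And>k. Ck k \<phi>" shows "Ck k (\<lambda>x. nfun \<delta> (\<phi> x))"
proof -
 have "Ck k (\<lambda>x. - \<phi> x)" for k using Ck_cmult[OF assms(2), of k "-1"] by simp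
 then show ?thesis
  unfolding nfun_def by (intro Ck_mult Ck_diff Ck_const Ck_flat_compose assms)
qed

section \<open>The spaces on the domain\<close>

context bounded_domain begin

lemma H10I:
 assumes "v \<in> H1 U" "\<And>e. e > 0 \<Longrightarrow> \<exists>\<phi>\<in>test_functions U. H1_norm U (\<lambda>x. v x - \<phi> x) < e"
 shows "v \<in> H10 U"
 using assms by (auto simp: H10_def fun_diff_def)

lemma H10_H1: "v \<in> H10 U \<Longrightarrow> v \<in> H1 U"
 by (simp add: H10_def)

lemma H10_approx:
 assumes "v \<in> H10 U" "e > 0"
 obtains \<phi> where "\<phi> \<in> test_functions U" "H1_norm U (\<lambda>x. v x - \<phi> x) < e"
 using assms unfolding H10_def fun_diff_def by blast

lemma test_H1: "\<phi> \<in> test_functions U \<Longrightarrow> \<phi> \<in> H1 U"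
 by (rule H1I[OF test_L2 test_weak_grad(2,1)])

lemma test_H10: "\<phi> \<in> test_functions U \<Longrightarrow> \<phi> \<in> H10 U"
 by (rule H10I[OF test_H1]) (auto intro!: bexI[of _ \<phi>] simp: H1_zero)

lemma test_zero: "(\<lambda>_. 0) \<in> test_functions U"
 by (rule test_functionsI[of _ "{}"]) (auto intro: Ck_const)

lemma test_functions_add:
 assumes "\<phi> \<in> test_functions U" "\<psi> \<in> test_functions U"
 shows "(\<lambda>x. \<phi> x + \<psi> x) \<in> test_functions U"
 using test_functions_diff[OF assms(1) test_functions_cmult[OF assms(2), of "-1"]] by simp

lemma H1_add: "v \<in> H1 U \<Longrightarrow> w \<in> H1 U \<Longrightarrow> (\<lambda>x. v x + w x) \<in> H1 U"
 using H1_lin(1)[of v w 1] by simp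

lemma H1_diff: "v \<in> H1 U \<Longrightarrow> w \<in> H1 U \<Longrightarrow> (\<lambda>x. v x - w x) \<in> H1 U"
 using H1_lin(1)[of v w "-1"] by simp

lemma H10_add:
 assumes v: "v \<in> H10 U" and w: "w \<in> H10 U"
 shows "(\<lambda>x. v x + w x) \<in> H10 U"
proof (rule H10I[OF H1_add[OF H10_H1[OF v] H10_H1[OF w]]])
 fix e :: real assume e: "e > 0"
 then have e2: "e / 2 > 0" by simp
 obtain \<phi> where \<phi>: "\<phi> \<in> test_functions U" "H1_norm U (\<lambda>x. v x - \<phi> x) < e / 2" by (rule H10_approx[OF v e2])
 obtain \<psi> where \<psi>: "\<psi> \<in> test_functions U" "H1_norm U (\<lambda>x. w x - \<psi> x) < e / 2" by (rule H10_approx[OF w e2])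
 have "H1_norm U (\<lambda>x. (v x - \<phi> x) + (w x - \<psi> x)) \<le> H1_norm U (\<lambda>x. v x - \<phi> x) + H1_norm U (\<lambda>x. w x - \<psi> x)"
  by (intro H1_norm_triangle H1_diff H10_H1 v w test_H1 \<phi> \<psi>)
 moreover have "(\<lambda>x. (v x - \<phi> x) + (w x - \<psi> x)) = (\<lambda>x. v x + w x - (\<phi> x + \<psi> x))" by (simp add: fun_eq_iff)
 ultimately show "\<exists>\<phi>\<in>test_functions U. H1_norm U (\<lambda>x. v x + w x - \<phi> x) < e"
  using \<phi> \<psi> by (intro bexI[OF _ test_functions_add[OF \<phi>(1) \<psi>(1)]]) auto
qed

lemma H10_mult:
 assumes v: "v \<in> H10 U" shows "(\<lambda>x. c * v x) \<in> H10 U"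
proof (rule H10I[OF H1_mult(1)[OF H10_H1[OF v]]])
 fix e :: real assume e: "e > 0"
 then have e2: "e / (\<bar>c\<bar> + 1) > 0" by simp
 obtain \<phi> where \<phi>: "\<phi> \<in> test_functions U" "H1_norm U (\<lambda>x. v x - \<phi> x) < e / (\<bar>c\<bar> + 1)" by (rule H10_approx[OF v e2])
 have "H1_norm U (\<lambda>x. c * (v x - \<phi> x)) = \<bar>c\<bar> * H1_norm U (\<lambda>x. v x - \<phi> x)"
  by (intro H1_mult(3) H1_diff H10_H1 v test_H1 \<phi>)
 also have "\<dots> \<le> (\<bar>c\<bar> + 1) * H1_norm U (\<lambda>x. v x - \<phi> x)"
  using H1_norm_ge(3) by (intro mult_right_mono) auto
 also have "\<dots> < e" using \<phi>(2) by (simp add: field_simps)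
 finally show "\<exists>\<phi>\<in>test_functions U. H1_norm U (\<lambda>x. c * v x - \<phi> x) < e"
  by (intro bexI[OF _ test_functions_cmult[OF \<phi>(1), of c]]) (simp add: right_diff_distrib)
qed

sublocale H: seminormed "H10 U" "H1_norm U"
proof
 show "(\<lambda>_. 0) \<in> H10 U" by (rule test_H10[OF test_zero])
qed (auto intro: H10_add H10_mult H1_norm_ge(3) H1_norm_triangle H1_mult(3) H10_H1)

sublocale L: seminormed "L2 U" "L2_norm U :: ('a \<Rightarrow> real) \<Rightarrow> real"
 by unfold_locales (auto intro: L2_zero L2_add L2_mult L2_norm_nonneg L2_norm_triangle L2_norm_mult)

lemma Hm1_iff: "l \<in> Hm1 U \<longleftrightarrow> (\<exists>k. H10_linear k l)"
proof
 assume l: "l \<in> Hm1 U"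
 then obtain C where C: "\<And>v. v \<in> H10 U \<Longrightarrow> \<bar>l v\<bar> \<le> C * H1_norm U v" unfolding Hm1_def by blast
 have "H10_linear \<bar>C\<bar> l"
  unfolding bdd_linear_def
 proof (intro conjI ballI allI)
  show "l (\<lambda>x. v x + c * w x) = l v + c * l w" if "v \<in> H10 U" "w \<in> H10 U" for v w c
   using l that H10_mult[OF that(2), of c] by (simp add: Hm1_def)
  show "\<bar>l v\<bar> \<le> \<bar>C\<bar> * H1_norm U v" if "v \<in> H10 U" for v
   using C[OF that] mult_right_mono[OF abs_ge_self[of C] H1_norm_ge(3)[of v]] by simp
 qed simp
 then show "\<exists>k. H10_linear k l" by blast
next
 assume "\<exists>k. H10_linear k l"
 then obtain k where k: "H10_linear k l" by blast
 show "l \<in> Hm1 U"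
  unfolding Hm1_def using H.bdd_linear_simps[OF k] by blast
qed

text \<open>The supremum is the least admissible bound: scaling to norm 1 shows that it is
  admissible, and where the H^1 norm vanishes the given bound \<open>k\<close> forces
  \<open>l v = 0\<close>.\<close>

lemma Hm1_norm_le:
 assumes k: "H10_linear k l"
 shows "Hm1_norm U l \<le> k" "H10_linear (Hm1_norm U l) l"
proof -
 let ?S = "{v \<in> H10 U. H1_norm U v \<le> 1}"
 have 0: "(\<lambda>_. 0) \<in> ?S" using H.zero H1_zero by simp
 have le: "\<bar>l v\<bar> \<le> k" if "v \<in> ?S" for v
 proof -
  have "\<bar>l v\<bar> \<le> k * H1_norm U v" using H.bdd_linear_simps(4)[OF k] that by simp
  also have "\<dots> \<le> k * 1" using that H.bdd_linear_simps(5)[OF k] by (intro mult_left_mono) auto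
  finally show ?thesis by simp
 qed
 show "Hm1_norm U l \<le> k" unfolding Hm1_norm_def using 0 le by (intro cSUP_least) auto
 have bdd: "bdd_above ((\<lambda>v. \<bar>l v\<bar>) ` ?S)" using le by (intro bdd_aboveI2)
 have up: "\<bar>l v\<bar> \<le> Hm1_norm U l" if "v \<in> ?S" for v
  unfolding Hm1_norm_def by (rule cSUP_upper[OF that bdd])
 have nn: "0 \<le> Hm1_norm U l" using up[OF 0] by simp
 show "H10_linear (Hm1_norm U l) l"
  unfolding bdd_linear_def
 proof (intro conjI ballI allI nn)
  show "l (\<lambda>x. v x + c * w x) = l v + c * l w" if "v \<in> H10 U" "w \<in> H10 U" for v w c
   using k that by (simp add: bdd_linear_def)
  show "\<bar>l v\<bar> \<le> Hm1_norm U l * H1_norm U v" if v: "v \<in> H10 U" for v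
  proof (cases "H1_norm U v = 0")
   case True
   then show ?thesis using H.bdd_linear_simps(4)[OF k v] by simp
  next
   case False
   then have p: "H1_norm U v > 0" using H1_norm_ge(3)[of v] by simp
   define c where "c = 1 / H1_norm U v"
   have "H1_norm U (\<lambda>x. c * v x) = 1" using H.N_scale[OF v, of c] p by (simp add: c_def)
   then have "\<bar>l (\<lambda>x. c * v x)\<bar> \<le> Hm1_norm U l" using H10_mult[OF v] by (intro up) simp
   then have "c * \<bar>l v\<bar> \<le> Hm1_norm U l"
    using H.bdd_linear_simps(3)[OF k v, of c] p by (simp add: abs_mult c_def)
   then show ?thesis using p by (simp add: c_def field_simps)
  qed
 qed
qed

lemma Hm1D: "l \<in> Hm1 U \<Longrightarrow> H10_linear (Hm1_norm U l) l"
 using Hm1_norm_le(2) by (auto simp: Hm1_iff)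

lemma bdd_linear_comb:
 assumes l: "H10_linear k l" and l': "H10_linear k' l'"
 shows "H10_linear (k + \<bar>c\<bar> * k') (\<lambda>v. l v + c * l' v)"
 unfolding bdd_linear_def
proof (intro conjI ballI allI)
 show "0 \<le> k + \<bar>c\<bar> * k'" using l l' by (auto simp: bdd_linear_def)
 show "l (\<lambda>x. v x + d * w x) + c * l' (\<lambda>x. v x + d * w x) = l v + c * l' v + d * (l w + c * l' w)"
  if "v \<in> H10 U" "w \<in> H10 U" for v w d
  using l l' that by (simp add: bdd_linear_def algebra_simps)
 show "\<bar>l v + c * l' v\<bar> \<le> (k + \<bar>c\<bar> * k') * H1_norm U v" if v: "v \<in> H10 U" for v
 proof -
  have "\<bar>c * l' v\<bar> \<le> \<bar>c\<bar> * (k' * H1_norm U v)"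
   unfolding abs_mult using H.bdd_linear_simps(4)[OF l' v] by (intro mult_left_mono) auto
  then show ?thesis using H.bdd_linear_simps(4)[OF l v] by (simp add: algebra_simps)
 qed
qed

lemma bdd_linear_zero: "H10_linear 0 (\<lambda>_. 0)"
 by (simp add: bdd_linear_def)

sublocale M: seminormed "Hm1 U" "Hm1_norm U"
proof
 show z: "(\<lambda>_. 0) \<in> Hm1 U" using bdd_linear_zero Hm1_iff by blast
 fix l l' and c :: real assume l: "l \<in> Hm1 U"
 show "0 \<le> Hm1_norm U l" using Hm1D[OF l] by (simp add: bdd_linear_def)
 have s: "H10_linear (\<bar>c\<bar> * Hm1_norm U l) (\<lambda>v. c * l v)"
  if "l \<in> Hm1 U" for c l using bdd_linear_comb[OF bdd_linear_zero Hm1D[OF that], of c] by simp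
 then show sc: "(\<lambda>v. c * l v) \<in> Hm1 U" using Hm1_iff l by blast
 show "Hm1_norm U (\<lambda>v. c * l v) = \<bar>c\<bar> * Hm1_norm U l"
 proof (rule antisym)
  show "Hm1_norm U (\<lambda>v. c * l v) \<le> \<bar>c\<bar> * Hm1_norm U l" by (rule Hm1_norm_le(1)[OF s[OF l]])
  show "\<bar>c\<bar> * Hm1_norm U l \<le> Hm1_norm U (\<lambda>v. c * l v)"
  proof (cases "c = 0")
   case True
   then show ?thesis using Hm1D[OF z] by (simp add: bdd_linear_def)
  next
   case False
   \<comment> \<open>The reverse inequality is the first one applied with the factor
     \<open>1 / c\<close>.\<close>
   have "Hm1_norm U (\<lambda>v. (1 / c) * (c * l v)) \<le> \<bar>1 / c\<bar> * Hm1_norm U (\<lambda>v. c * l v)"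
    by (rule Hm1_norm_le(1)[OF s[OF sc]])
   then show ?thesis using False by (simp add: field_simps)
  qed
 qed
 assume l': "l' \<in> Hm1 U"
 have a: "H10_linear (Hm1_norm U l + Hm1_norm U l') (\<lambda>v. l v + l' v)"
  using bdd_linear_comb[OF Hm1D[OF l] Hm1D[OF l'], of 1] by simp
 then show "(\<lambda>v. l v + l' v) \<in> Hm1 U" using Hm1_iff by blast
 show "Hm1_norm U (\<lambda>v. l v + l' v) \<le> Hm1_norm U l + Hm1_norm U l'" by (rule Hm1_norm_le(1)[OF a])
qed

lemma L2_bdd_linear:
 assumes "k \<in> L2 U" shows "H10_linear (L2_norm U k) (L2_inner U k)"
 unfolding bdd_linear_def
proof (intro conjI ballI allI)
 fix v w c assume v: "v \<in> H10 U" and w: "w \<in> H10 U"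
 show "L2_inner U k (\<lambda>x. v x + c * w x) = L2_inner U k v + c * L2_inner U k w"
  using H1D(1)[OF H10_H1[OF v]] H1D(1)[OF H10_H1[OF w]] assms by (simp add: L2_inner_add L2_mult L2_inner_mult)
next
 fix v assume v: "v \<in> H10 U"
 have "\<bar>L2_inner U k v\<bar> \<le> L2_norm U k * L2_norm U v" by (rule L2_Cauchy_Schwarz[OF assms H1D(1)[OF H10_H1[OF v]]])
 also have "\<dots> \<le> L2_norm U k * H1_norm U v" by (intro mult_left_mono H1_norm_ge L2_norm_nonneg)
 finally show "\<bar>L2_inner U k v\<bar> \<le> L2_norm U k * H1_norm U v" .
qed (rule L2_norm_nonneg)

lemma grad_bdd_linear:
 assumes k: "k \<in> L2 U"
 shows "H10_linear (L2_norm U k) (\<lambda>v. L2_inner U k (weak_grad U v))"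
 unfolding bdd_linear_def
proof (intro conjI ballI allI)
 fix v w c assume v: "v \<in> H10 U" and w: "w \<in> H10 U"
 note g = H1D(3)[OF H10_H1[OF v]] H1D(3)[OF H10_H1[OF w]]
 have "L2_inner U k (weak_grad U (\<lambda>x. v x + c * w x)) = L2_inner U k (\<lambda>x. weak_grad U v x + c *\<^sub>R weak_grad U w x)"
  by (rule L2_inner_cong[OF _ H1_lin(2)[OF H10_H1[OF v] H10_H1[OF w]] L2_D(1)[OF k] L2_D(1)[OF H1D(3)[OF H1_lin(1)[OF H10_H1[OF v] H10_H1[OF w]]]] sets_U]) simp
 then show "L2_inner U k (weak_grad U (\<lambda>x. v x + c * w x)) = L2_inner U k (weak_grad U v) + c * L2_inner U k (weak_grad U w)"
  using g k by (simp add: L2_inner_add L2_scaleR L2_inner_scaleR)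
next
 fix v assume v: "v \<in> H10 U"
 have "\<bar>L2_inner U k (weak_grad U v)\<bar> \<le> L2_norm U k * L2_norm U (weak_grad U v)" by (rule L2_Cauchy_Schwarz[OF k H1D(3)[OF H10_H1[OF v]]])
 also have "\<dots> \<le> L2_norm U k * H1_norm U v" by (intro mult_left_mono H1_norm_ge L2_norm_nonneg)
 finally show "\<bar>L2_inner U k (weak_grad U v)\<bar> \<le> L2_norm U k * H1_norm U v" .
qed (rule L2_norm_nonneg)

text \<open>Evaluating strong approximations at a fixed \<open>v\<close> gives weak measurability:
  the passage from L2(0,T;H^-1) to the functionals used in the estimates.\<close>

lemma L2_Hm1_functional:
 assumes g: "g \<in> L2_Hm1 T U"
 shows "X_functional T g (\<lambda>t. Hm1_norm U (g t))"
 unfolding L2_functional_def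
proof (intro conjI ballI)
 note g' = g[unfolded L2_Hm1_def]
 show "(\<lambda>t. Hm1_norm U (g t)) \<in> borel_measurable (\<mu> T)" by (rule M.bochner_norm_measurable[OF g'])
 show "integrable (\<mu> T) (\<lambda>t. (Hm1_norm U (g t))\<^sup>2)" by (rule M.bochnerD(2)[OF g'])
 show "AE t in \<mu> T. H10_linear (Hm1_norm U (g t)) (g t)"
  using M.bochnerD(1)[OF g'] by eventually_elim (rule Hm1D)
 fix v assume v: "v \<in> H10 U"
 obtain s where s: "\<And>n. simple_function (\<mu> T) (s n)" "\<And>n t. t \<in> {0<..<T} \<Longrightarrow> s n t \<in> Hm1 U"
  "AE t in \<mu> T. (\<lambda>n. Hm1_norm U (\<lambda>x. s n t x - g t x)) \<longlonglongrightarrow> 0"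
  by (rule M.bochnerE[OF g']) blast
 have meas: "(\<lambda>t. s n t v) \<in> borel_measurable (\<mu> T)" for n
  by (rule borel_measurable_simple_function[OF simple_function_compose1[OF s(1)]])
 have tends: "AE t in \<mu> T. (\<lambda>n. s n t v) \<longlonglongrightarrow> g t v"
  using s(3) M.bochnerD(1)[OF g'] AE_space
 proof eventually_elim
  case (elim t)
  have st: "s n t \<in> Hm1 U" for n using s(2) elim(3) by auto
  have "(\<lambda>n. Hm1_norm U (\<lambda>x. s n t x - g t x) * H1_norm U v) \<longlonglongrightarrow> 0 * H1_norm U v" by (intro tendsto_intros elim)
  then have lim: "(\<lambda>n. Hm1_norm U (\<lambda>x. s n t x - g t x) * H1_norm U v) \<longlonglongrightarrow> 0" by simp
  have le: "norm (s n t v - g t v) \<le> Hm1_norm U (\<lambda>x. s n t x - g t x) * H1_norm U v" for n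
   using H.bdd_linear_simps(4)[OF Hm1D[OF M.diff[OF st elim(2)]] v, of n] by simp
  show ?case by (rule LIM_zero_cancel[OF Lim_null_comparison[OF always_eventually[OF allI[OF le]] lim]])
 qed
 show "(\<lambda>t. g t v) \<in> borel_measurable (\<mu> T)"
  by (rule borel_measurable_AE_limit[OF meas _ tends]) simp
qed

lemma const_functional:
 assumes "H10_linear k l"
 shows "X_functional T (\<lambda>_. l) (\<lambda>_. k)"
proof -
 show ?thesis using assms by (simp add: L2_functional_def)
qed

lemma X_L2_L2:
 assumes u: "u \<in> X_space T U" shows "u \<in> L2_L2 T U"
proof -
 note u' = u[unfolded X_space_def]
 obtain s where s: "\<And>n. simple_function (\<mu> T) (s n)" "\<And>n t. t \<in> {0<..<T} \<Longrightarrow> s n t \<in> H10 U"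
  "AE t in \<mu> T. (\<lambda>n. H1_norm U (\<lambda>x. s n t x - u t x)) \<longlonglongrightarrow> 0"
  by (rule H.bochnerE[OF u']) blast
 show ?thesis
  unfolding L2_L2_def
 proof (rule L.bochnerI[OF _ s(1)])
  show "AE t in \<mu> T. u t \<in> L2 U"
   using H.bochnerD(1)[OF u'] by eventually_elim (rule H1D(1)[OF H10_H1])
  show "s n t \<in> L2 U" if "t \<in> {0<..<T}" for n t using H1D(1)[OF H10_H1[OF s(2)[OF that]]] .
  show "AE t in \<mu> T. (\<lambda>n. L2_norm U (\<lambda>x. s n t x - u t x)) \<longlonglongrightarrow> 0"
   using s(3)
  proof eventually_elim
   case (elim t)
   have le: "norm (L2_norm U (\<lambda>x. s n t x - u t x)) \<le> H1_norm U (\<lambda>x. s n t x - u t x)" for n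
    using H1_norm_ge(1)[of "\<lambda>x. s n t x - u t x"] L2_norm_nonneg[of U "\<lambda>x. s n t x - u t x"] by simp
   show ?case by (rule Lim_null_comparison[OF always_eventually[OF allI[OF le]] elim])
  qed
  show "AE t in \<mu> T. (L2_norm U (u t))\<^sup>2 \<le> (H1_norm U (u t))\<^sup>2"
   by (intro AE_I2 power_mono H1_norm_ge L2_norm_nonneg)
 qed (rule H.bochnerD(2)[OF u'])
qed

end

section \<open>The chain rule\<close>

text \<open>\<open>\<theta>_test\<close> keeps approximations by test functions inside the class, so
  that compositions stay in \<open>H10\<close>; \<open>der_lip\<close> drives the convergence of the
  factor in front of the gradient.\<close>

locale lipschitz_chain = bounded_domain U for U :: "'a::euclidean_space set" +
 fixes \<theta> \<theta>' :: "real \<Rightarrow> real" and L :: real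
 assumes der: "(\<theta> has_real_derivative \<theta>' s) (at s)"
  and der_le: "\<bar>\<theta>' s\<bar> \<le> 1"
  and der_lip: "\<bar>\<theta>' a - \<theta>' b\<bar> \<le> L * \<bar>a - b\<bar>"
  and \<theta>_zero: "\<theta> 0 = 0"
  and \<theta>_test: "\<phi> \<in> test_functions U \<Longrightarrow> (\<lambda>x. \<theta> (\<phi> x)) \<in> test_functions U"
begin

lemma L_nonneg: "0 \<le> L"
 using order_trans[OF abs_ge_zero der_lip[of 1 0]] by simp

lemma \<theta>_lip: "\<bar>\<theta> a - \<theta> b\<bar> \<le> \<bar>a - b\<bar>"
 using field_differentiable_bound[of UNIV \<theta> \<theta>' 1 a b] der der_le by simp

lemma \<theta>_le: "\<bar>\<theta> a\<bar> \<le> \<bar>a\<bar>"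
 using \<theta>_lip[of a 0] by (simp add: \<theta>_zero)

lemma \<theta>_measurable [measurable]: "\<theta> \<in> borel_measurable borel" "\<theta>' \<in> borel_measurable borel"
proof -
 show "\<theta> \<in> borel_measurable borel"
  by (rule borel_measurable_continuous_onI) (meson DERIV_isCont continuous_at_imp_continuous_on der)
 have "L-lipschitz_on UNIV \<theta>'"
  using der_lip L_nonneg by (intro lipschitz_onI) (auto simp: dist_real_def)
 then show "\<theta>' \<in> borel_measurable borel"
  by (intro borel_measurable_continuous_onI lipschitz_on_continuous_on)
qed

lemma comp_L2:
 assumes v: "v \<in> L2 U"
 shows "(\<lambda>x. \<theta> (v x)) \<in> L2 U" "L2_norm U (\<lambda>x. \<theta> (v x)) \<le> L2_norm U v"
proof -
 note [measurable] = L2_D(1)[OF v]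
 have m: "(\<lambda>x. \<theta> (v x)) \<in> borel_measurable \<mu>U" by measurable
 show "(\<lambda>x. \<theta> (v x)) \<in> L2 U" "L2_norm U (\<lambda>x. \<theta> (v x)) \<le> L2_norm U v"
  using L2_bound[OF v m, of 1] \<theta>_le by auto
qed

lemma comp_L2_diff:
 assumes v: "v \<in> L2 U" and w: "w \<in> L2 U"
 shows "L2_norm U (\<lambda>x. \<theta> (v x) - \<theta> (w x)) \<le> L2_norm U (\<lambda>x. v x - w x)"
proof -
 note [measurable] = L2_D(1)[OF v] L2_D(1)[OF w]
 have m: "(\<lambda>x. \<theta> (v x) - \<theta> (w x)) \<in> borel_measurable \<mu>U" by measurable
 show ?thesis using L2_bound(2)[OF L2_diff[OF v w] m, of 1] \<theta>_lip by auto
qed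

lemma mult_L2:
 fixes g :: "'a \<Rightarrow> 'b::euclidean_space"
 assumes v: "v \<in> borel_measurable \<mu>U" and g: "g \<in> L2 U"
 shows "(\<lambda>x. \<theta>' (v x) *\<^sub>R g x) \<in> L2 U" "L2_norm U (\<lambda>x. \<theta>' (v x) *\<^sub>R g x) \<le> L2_norm U g"
proof -
 note [measurable] = v L2_D(1)[OF g]
 have m: "(\<lambda>x. \<theta>' (v x) *\<^sub>R g x) \<in> borel_measurable \<mu>U" by measurable
 have "AE x in \<mu>U. norm (\<theta>' (v x) *\<^sub>R g x) \<le> 1 * norm (g x)"
  using der_le by (intro AE_I2) (simp add: mult_left_le_one_le)
 then show "(\<lambda>x. \<theta>' (v x) *\<^sub>R g x) \<in> L2 U" "L2_norm U (\<lambda>x. \<theta>' (v x) *\<^sub>R g x) \<le> L2_norm U g"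
  using L2_bound[OF g m, of 1] by auto
qed

text \<open>Split \<open>g\<close> at height \<open>M\<close>: the factor is Lipschitz where \<open>g\<close> is bounded, and it is bounded
 where \<open>g\<close> is large, on a set that contributes little.\<close>

lemma mult_tendsto:
 fixes g :: "'a \<Rightarrow> 'b::euclidean_space"
 assumes s: "\<And>n. s n \<in> L2 U" and v: "v \<in> L2 U" and g: "g \<in> L2 U"
  and lim: "(\<lambda>n. L2_norm U (\<lambda>x. s n x - v x)) \<longlonglongrightarrow> 0"
 shows "(\<lambda>n. L2_norm U (\<lambda>x. (\<theta>' (s n x) - \<theta>' (v x)) *\<^sub>R g x)) \<longlonglongrightarrow> 0"
proof -
 note [measurable] = L2_D(1)[OF s] L2_D(1)[OF v] L2_D(1)[OF g]
 define f where "f n x = (norm ((\<theta>' (s n x) - \<theta>' (v x)) *\<^sub>R g x))\<^sup>2" for n x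
 have fm [measurable]: "f n \<in> borel_measurable \<mu>U" for n unfolding f_def by measurable
 have sq: "(L2_norm U (\<lambda>x. (\<theta>' (s n x) - \<theta>' (v x)) *\<^sub>R g x))\<^sup>2 = (LINT x|\<mu>U. f n x)" for n
  unfolding L2_norm_square L2_inner_def f_def power2_norm_eq_inner ..
 have f_le: "f n x \<le> 4 * (norm (g x))\<^sup>2" for n x
 proof -
  have "\<bar>\<theta>' (s n x) - \<theta>' (v x)\<bar> \<le> 2" using der_le[of "s n x"] der_le[of "v x"] by linarith
  then have "(\<bar>\<theta>' (s n x) - \<theta>' (v x)\<bar> * norm (g x))\<^sup>2 \<le> (2 * norm (g x))\<^sup>2"
   by (intro power_mono mult_right_mono) auto
  then show ?thesis by (simp add: f_def power_mult_distrib)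
 qed
 have fi: "integrable \<mu>U (f n)" for n
 proof (rule Bochner_Integration.integrable_bound)
  show "integrable \<mu>U (\<lambda>x. 4 * (norm (g x))\<^sup>2)" using L2_D(2)[OF g] by simp
  show "AE x in \<mu>U. norm (f n x) \<le> norm (4 * (norm (g x))\<^sup>2)"
   using f_le[of n] by (intro AE_I2) (simp add: f_def)
 qed measurable
 have "(\<lambda>n. LINT x|\<mu>U. f n x) \<longlonglongrightarrow> 0"
 proof (rule LIMSEQ_I)
  fix r :: real assume r: "r > 0"
  define h where "h M x = (if norm (g x) \<le> real M then 0 else 4 * (norm (g x))\<^sup>2)" for M :: nat and x
  have hm [measurable]: "h M \<in> borel_measurable \<mu>U" for M unfolding h_def by measurable
  have "(\<lambda>M. LINT x|\<mu>U. h M x) \<longlonglongrightarrow> (LINT x|\<mu>U. 0)"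
  proof (rule integral_dominated_convergence[where w = "\<lambda>x. 4 * (norm (g x))\<^sup>2"])
   show "AE x in \<mu>U. (\<lambda>M. h M x) \<longlonglongrightarrow> 0"
   proof (rule AE_I2)
    fix x
    obtain M0 where "norm (g x) \<le> real M0" using real_arch_simple by blast
    then have "eventually (\<lambda>M. h M x = 0) sequentially"
     unfolding eventually_sequentially h_def by (intro exI[of _ M0]) auto
    then show "(\<lambda>M. h M x) \<longlonglongrightarrow> 0" by (rule tendsto_eventually)
   qed
  qed (use L2_D(2)[OF g] in \<open>auto simp: h_def\<close>)
  then have "eventually (\<lambda>M. (LINT x|\<mu>U. h M x) < r / 2) sequentially"
   using r by (intro order_tendstoD(2)[where y = 0]) auto
  then obtain M where M: "(LINT x|\<mu>U. h M x) < r / 2"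
   using eventually_happens'[OF sequentially_bot] by blast
  have hi: "integrable \<mu>U (h M)"
  proof (rule Bochner_Integration.integrable_bound)
   show "integrable \<mu>U (\<lambda>x. 4 * (norm (g x))\<^sup>2)" using L2_D(2)[OF g] by simp
  qed (auto simp: h_def)
  define c where "c = L\<^sup>2 * (real M)\<^sup>2"
  have le: "f n x \<le> h M x + c * (s n x - v x)\<^sup>2" for n x
  proof (cases "norm (g x) \<le> real M")
   case True
   have "\<bar>\<theta>' (s n x) - \<theta>' (v x)\<bar> * norm (g x) \<le> (L * \<bar>s n x - v x\<bar>) * real M"
    using True der_lip L_nonneg by (intro mult_mono) auto
   then have "(\<bar>\<theta>' (s n x) - \<theta>' (v x)\<bar> * norm (g x))\<^sup>2 \<le> ((L * \<bar>s n x - v x\<bar>) * real M)\<^sup>2"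
    by (intro power_mono) auto
   then show ?thesis using True by (simp add: f_def h_def c_def power_mult_distrib mult.commute mult.left_commute)
  next
   case False
   then show ?thesis using f_le[of n x] by (simp add: h_def c_def add_increasing2)
  qed
  have di: "integrable \<mu>U (\<lambda>x. (s n x - v x)\<^sup>2)" for n
   using L2_D(2)[OF L2_diff[OF s v], of n] by simp
  have "(\<lambda>n. c * (L2_norm U (\<lambda>x. s n x - v x))\<^sup>2) \<longlonglongrightarrow> c * 0\<^sup>2" by (intro tendsto_intros lim)
  then have "eventually (\<lambda>n. c * (L2_norm U (\<lambda>x. s n x - v x))\<^sup>2 < r / 2) sequentially"
   using r by (intro order_tendstoD(2)[where y = "c * 0\<^sup>2"]) auto
  then obtain n0 where n0: "\<And>n. n \<ge> n0 \<Longrightarrow> c * (L2_norm U (\<lambda>x. s n x - v x))\<^sup>2 < r / 2"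
   unfolding eventually_sequentially by blast
  show "\<exists>n0. \<forall>n\<ge>n0. norm ((LINT x|\<mu>U. f n x) - 0) < r"
  proof (intro exI[of _ n0] allI impI)
   fix n assume n: "n \<ge> n0"
   have "(LINT x|\<mu>U. f n x) \<le> (LINT x|\<mu>U. h M x + c * (s n x - v x)\<^sup>2)"
    using fi hi di le by (intro integral_mono) auto
   also have "\<dots> = (LINT x|\<mu>U. h M x) + c * (L2_norm U (\<lambda>x. s n x - v x))\<^sup>2"
    using hi di unfolding L2_norm_square L2_inner_def by (simp add: power2_eq_square)
   also have "\<dots> < r" using M n0[OF n] by simp
   finally have "(LINT x|\<mu>U. f n x) < r" .
   moreover have "0 \<le> (LINT x|\<mu>U. f n x)" by (simp add: f_def)
   ultimately show "norm ((LINT x|\<mu>U. f n x) - 0) < r" by simp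
  qed
 qed
 then have "(\<lambda>n. sqrt (LINT x|\<mu>U. f n x)) \<longlonglongrightarrow> sqrt 0" by (rule tendsto_real_sqrt)
 moreover have "sqrt (LINT x|\<mu>U. f n x) = L2_norm U (\<lambda>x. (\<theta>' (s n x) - \<theta>' (v x)) *\<^sub>R g x)" for n
  unfolding sq[symmetric] by (simp add: L2_norm_nonneg)
 ultimately show ?thesis by simp
qed

text \<open>Splits the difference into \<open>\<theta>' (s n x)\<close> times the error of the
  gradients, bounded by \<open>der_le\<close>, and the error of the factor times the fixed
  \<open>g\<close>, which is \<open>mult_tendsto\<close>.\<close>

lemma gradient_tendsto:
 fixes g :: "'a \<Rightarrow> 'b::euclidean_space"
 assumes s: "\<And>n. s n \<in> L2 U" and v: "v \<in> L2 U" and g: "g \<in> L2 U" and h: "\<And>n. h n \<in> L2 U"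
  and lim: "(\<lambda>n. L2_norm U (\<lambda>x. s n x - v x)) \<longlonglongrightarrow> 0" "(\<lambda>n. L2_norm U (\<lambda>x. h n x - g x)) \<longlonglongrightarrow> 0"
 shows "(\<lambda>n. L2_norm U (\<lambda>x. \<theta>' (s n x) *\<^sub>R h n x - \<theta>' (v x) *\<^sub>R g x)) \<longlonglongrightarrow> 0"
proof -
 have "(\<lambda>n. L2_norm U (\<lambda>x. h n x - g x) + L2_norm U (\<lambda>x. (\<theta>' (s n x) - \<theta>' (v x)) *\<^sub>R g x)) \<longlonglongrightarrow> 0 + 0"
  by (intro tendsto_add lim mult_tendsto[OF s v g lim(1)])
 then have l: "(\<lambda>n. L2_norm U (\<lambda>x. h n x - g x) + L2_norm U (\<lambda>x. (\<theta>' (s n x) - \<theta>' (v x)) *\<^sub>R g x)) \<longlonglongrightarrow> 0" by simp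
 have le: "norm (L2_norm U (\<lambda>x. \<theta>' (s n x) *\<^sub>R h n x - \<theta>' (v x) *\<^sub>R g x))
   \<le> L2_norm U (\<lambda>x. h n x - g x) + L2_norm U (\<lambda>x. (\<theta>' (s n x) - \<theta>' (v x)) *\<^sub>R g x)" for n
 proof -
  have eq: "(\<lambda>x. \<theta>' (s n x) *\<^sub>R h n x - \<theta>' (v x) *\<^sub>R g x) = (\<lambda>x. \<theta>' (s n x) *\<^sub>R (h n x - g x) + (\<theta>' (s n x) - \<theta>' (v x)) *\<^sub>R g x)"
   by (simp add: fun_eq_iff scaleR_diff_right scaleR_diff_left)
  note m = L2_D(1)[OF s] L2_D(1)[OF v]
  have 1: "(\<lambda>x. \<theta>' (s n x) *\<^sub>R (h n x - g x)) \<in> L2 U" by (rule mult_L2(1)[OF m(1) L2_diff[OF h g]])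
  have 2: "(\<lambda>x. (\<theta>' (s n x) - \<theta>' (v x)) *\<^sub>R g x) \<in> L2 U"
   using L2_diff[OF mult_L2(1)[OF m(1) g] mult_L2(1)[OF m(2) g], of n] by (simp add: scaleR_diff_left)
  show ?thesis
   unfolding eq using L2_norm_triangle[OF 1 2] mult_L2(2)[OF m(1) L2_diff[OF h g], of n n] L2_norm_nonneg
   by (simp add: L2_norm_nonneg)
 qed
 show ?thesis by (rule Lim_null_comparison[OF always_eventually[OF allI[OF le]] l])
qed

lemma is_weak_grad_closed:
 assumes s: "\<And>n. s n \<in> L2 U" and v: "v \<in> L2 U" and g: "g \<in> L2 U" and h: "\<And>n. h n \<in> L2 U"
  and lim: "(\<lambda>n. L2_norm U (\<lambda>x. s n x - v x)) \<longlonglongrightarrow> 0" "(\<lambda>n. L2_norm U (\<lambda>x. h n x - g x)) \<longlonglongrightarrow> 0"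
  and wg: "\<And>n. is_weak_grad U (s n) (h n)"
 shows "is_weak_grad U v g"
 unfolding is_weak_grad_def
proof (intro conjI allI impI ballI)
 fix K assume "compact K \<and> K \<subseteq> U"
 then show "v absolutely_integrable_on K" "g absolutely_integrable_on K"
  using L2_locally_integrable[OF v] L2_locally_integrable[OF g] by auto
next
 fix \<phi> and i :: 'a assume \<phi>: "\<phi> \<in> test_functions U" and i: "i \<in> Basis"
 have conv: "(\<lambda>n. L2_inner U k (f n)) \<longlonglongrightarrow> L2_inner U k z"
  if k: "k \<in> L2 U" and f: "\<And>n. f n \<in> L2 U" and z: "z \<in> L2 U"
   and l: "(\<lambda>n. L2_norm U (\<lambda>x. f n x - z x)) \<longlonglongrightarrow> 0" for k z :: "'a \<Rightarrow> 'b::euclidean_space" and f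
 proof -
  have "(\<lambda>n. L2_norm U k * L2_norm U (\<lambda>x. f n x - z x)) \<longlonglongrightarrow> L2_norm U k * 0" by (intro tendsto_intros l)
  then have l': "(\<lambda>n. L2_norm U k * L2_norm U (\<lambda>x. f n x - z x)) \<longlonglongrightarrow> 0" by simp
  have le: "norm (L2_inner U k (f n) - L2_inner U k z) \<le> L2_norm U k * L2_norm U (\<lambda>x. f n x - z x)" for n
   using L2_Cauchy_Schwarz[OF k L2_diff[OF f z], of n] L2_inner_diff(1)[OF f z k, of n] by simp
  show ?thesis by (rule LIM_zero_cancel[OF Lim_null_comparison[OF always_eventually[OF allI[OF le]] l']])
 qed
 note p = test_L2[OF test_functions_partial_deriv[OF \<phi> i]]
 have \<phi>i: "(\<lambda>x. \<phi> x *\<^sub>R i) \<in> L2 U"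
 proof (rule L2_bound(1)[OF test_L2[OF \<phi>], of _ 1])
  show "(\<lambda>x. \<phi> x *\<^sub>R i) \<in> borel_measurable \<mu>U" using test_measurable_U[OF \<phi>] by measurable
 qed (use i in auto)
 have 1: "(\<lambda>n. LINT x|\<mu>U. s n x * partial_deriv \<phi> i x) \<longlonglongrightarrow> (LINT x|\<mu>U. v x * partial_deriv \<phi> i x)"
  using conv[OF p s v lim(1)] by (simp add: L2_inner_def mult.commute)
 have 2: "(\<lambda>n. LINT x|\<mu>U. (h n x \<bullet> i) * \<phi> x) \<longlonglongrightarrow> (LINT x|\<mu>U. (g x \<bullet> i) * \<phi> x)"
  using conv[OF \<phi>i h g lim(2)] by (simp add: L2_inner_def mult.commute inner_commute[of i])
 have "(\<lambda>n. LINT x|\<mu>U. s n x * partial_deriv \<phi> i x) \<longlonglongrightarrow> - (LINT x|\<mu>U. (g x \<bullet> i) * \<phi> x)"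
  using tendsto_minus[OF 2] is_weak_gradD(4)[OF wg \<phi> i] by simp
 then show "(LINT x|\<mu>U. v x * partial_deriv \<phi> i x) = - (LINT x|\<mu>U. (g x \<bullet> i) * \<phi> x)"
  by (rule LIMSEQ_unique[OF 1])
qed

lemma test_chain:
 assumes \<phi>: "\<phi> \<in> test_functions U"
 shows "grad (\<lambda>x. \<theta> (\<phi> x)) = (\<lambda>x. \<theta>' (\<phi> x) *\<^sub>R grad \<phi> x)"
proof -
 have d: "\<phi> differentiable (at x)" for x using test_functions_Ck[OF \<phi>, of "Suc 0"] by simp
 have "partial_deriv (\<lambda>x. \<theta> (\<phi> x)) i x = \<theta>' (\<phi> x) * partial_deriv \<phi> i x" for i x
 proof -
  have "((\<lambda>x. \<theta> (\<phi> x)) has_derivative (\<lambda>h. frechet_derivative \<phi> (at x) h * \<theta>' (\<phi> x))) (at x)"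
   by (rule DERIV_compose_FDERIV[OF der iffD1[OF frechet_derivative_works d]])
  from partial_deriv_eq[OF this] show ?thesis by (simp add: partial_deriv_def)
 qed
 then show ?thesis by (simp add: grad_def fun_eq_iff scaleR_sum_right)
qed

lemma H10_seq:
 assumes "v \<in> H10 U"
 obtains \<phi> where "\<And>n::nat. \<phi> n \<in> test_functions U" "(\<lambda>n. H1_norm U (\<lambda>x. \<phi> n x - v x)) \<longlonglongrightarrow> 0"
proof -
 have "\<exists>\<phi>\<in>test_functions U. H1_norm U (\<lambda>x. v x - \<phi> x) < 1 / real (Suc n)" for n
  using H10_approx[OF assms, of "1 / real (Suc n)"] by (metis of_nat_0_less_iff zero_less_Suc zero_less_divide_1_iff)
 then obtain \<phi> where \<phi>: "\<And>n. \<phi> n \<in> test_functions U" "\<And>n. H1_norm U (\<lambda>x. v x - \<phi> n x) < 1 / real (Suc n)"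
  by metis
 have le: "norm (H1_norm U (\<lambda>x. \<phi> n x - v x)) \<le> 1 / real (Suc n)" for n
  using \<phi>(2)[of n] H.N_diff_commute[OF assms test_H10[OF \<phi>(1)], of n] H1_norm_ge(3)[of "\<lambda>x. \<phi> n x - v x"] by simp
 have "(\<lambda>n. H1_norm U (\<lambda>x. \<phi> n x - v x)) \<longlonglongrightarrow> 0"
  by (rule Lim_null_comparison[OF always_eventually[OF allI[OF le]] LIMSEQ_Suc[OF lim_1_over_n]])
 then show ?thesis using that[of \<phi>] \<phi>(1) by blast
qed

lemma H1_tendstoD:
 assumes s: "\<And>n. s n \<in> H1 U" and v: "v \<in> H1 U" and lim: "(\<lambda>n. H1_norm U (\<lambda>x. s n x - v x)) \<longlonglongrightarrow> 0"
 shows "(\<lambda>n. L2_norm U (\<lambda>x. s n x - v x)) \<longlonglongrightarrow> 0"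
  "(\<lambda>n. L2_norm U (\<lambda>x. weak_grad U (s n) x - weak_grad U v x)) \<longlonglongrightarrow> 0"
proof -
 have 1: "norm (L2_norm U (\<lambda>x. s n x - v x)) \<le> H1_norm U (\<lambda>x. s n x - v x)" for n
  using H1_norm_ge(1)[of "\<lambda>x. s n x - v x"] L2_norm_nonneg[of U "\<lambda>x. s n x - v x"] by simp
 show "(\<lambda>n. L2_norm U (\<lambda>x. s n x - v x)) \<longlonglongrightarrow> 0"
  by (rule Lim_null_comparison[OF always_eventually[OF allI[OF 1]] lim])
 have 2: "norm (L2_norm U (\<lambda>x. weak_grad U (s n) x - weak_grad U v x)) \<le> H1_norm U (\<lambda>x. s n x - v x)" for n
 proof -
  have "AE x in \<mu>U. weak_grad U (\<lambda>x. s n x - v x) x = weak_grad U (s n) x - weak_grad U v x"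
   using H1_lin(2)[OF s v, of n "-1"] by simp
  then have "L2_norm U (weak_grad U (\<lambda>x. s n x - v x)) = L2_norm U (\<lambda>x. weak_grad U (s n) x - weak_grad U v x)"
   by (rule L2_norm_cong[OF _ L2_D(1)[OF H1D(3)[OF H1_diff[OF s v]]] sets_U])
  then show ?thesis
   using H1_norm_ge(2)[of "\<lambda>x. s n x - v x"] L2_norm_nonneg[of U "\<lambda>x. weak_grad U (s n) x - weak_grad U v x"] by simp
 qed
 show "(\<lambda>n. L2_norm U (\<lambda>x. weak_grad U (s n) x - weak_grad U v x)) \<longlonglongrightarrow> 0"
  by (rule Lim_null_comparison[OF always_eventually[OF allI[OF 2]] lim])
qed

text \<open>Classical for test functions; weak gradients are closed under joint L2 convergence, and
  \<open>gradient_tendsto\<close> provides the convergence of the gradients.\<close>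

lemma chain_rule:
 assumes v: "v \<in> H10 U"
 shows "is_weak_grad U (\<lambda>x. \<theta> (v x)) (\<lambda>x. \<theta>' (v x) *\<^sub>R weak_grad U v x)"
proof -
 obtain \<phi> where \<phi>: "\<And>n::nat. \<phi> n \<in> test_functions U" "(\<lambda>n. H1_norm U (\<lambda>x. \<phi> n x - v x)) \<longlonglongrightarrow> 0"
  by (rule H10_seq[OF v]) blast
 note v1 = H10_H1[OF v]
 note lim = H1_tendstoD[OF test_H1[OF \<phi>(1)] v1 \<phi>(2)]
 note t = \<theta>_test[OF \<phi>(1)]
 show ?thesis
 proof (rule is_weak_grad_closed)
  show "(\<lambda>x. \<theta> (\<phi> n x)) \<in> L2 U" for n by (rule test_L2[OF t])
  show "(\<lambda>x. \<theta> (v x)) \<in> L2 U" by (rule comp_L2(1)[OF H1D(1)[OF v1]])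
  show "(\<lambda>x. \<theta>' (v x) *\<^sub>R weak_grad U v x) \<in> L2 U"
   by (rule mult_L2(1)[OF L2_D(1)[OF H1D(1)[OF v1]] H1D(3)[OF v1]])
  show gL: "(\<lambda>x. \<theta>' (\<phi> n x) *\<^sub>R weak_grad U (\<phi> n) x) \<in> L2 U" for n
   by (rule mult_L2(1)[OF L2_D(1)[OF test_L2[OF \<phi>(1)]] H1D(3)[OF test_H1[OF \<phi>(1)]]])
  have le: "norm (L2_norm U (\<lambda>x. \<theta> (\<phi> n x) - \<theta> (v x))) \<le> L2_norm U (\<lambda>x. \<phi> n x - v x)" for n
   using comp_L2_diff[OF test_L2[OF \<phi>(1)] H1D(1)[OF v1], of n] L2_norm_nonneg[of U "\<lambda>x. \<theta> (\<phi> n x) - \<theta> (v x)"] by simp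
  show "(\<lambda>n. L2_norm U (\<lambda>x. \<theta> (\<phi> n x) - \<theta> (v x))) \<longlonglongrightarrow> 0"
   by (rule Lim_null_comparison[OF always_eventually[OF allI[OF le]] lim(1)])
  show "(\<lambda>n. L2_norm U (\<lambda>x. \<theta>' (\<phi> n x) *\<^sub>R weak_grad U (\<phi> n) x - \<theta>' (v x) *\<^sub>R weak_grad U v x)) \<longlonglongrightarrow> 0"
   by (rule gradient_tendsto[OF test_L2[OF \<phi>(1)] H1D(1)[OF v1] H1D(3)[OF v1] H1D(3)[OF test_H1[OF \<phi>(1)]] lim])
  show "is_weak_grad U (\<lambda>x. \<theta> (\<phi> n x)) (\<lambda>x. \<theta>' (\<phi> n x) *\<^sub>R weak_grad U (\<phi> n) x)" for n
   unfolding is_weak_grad_def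
  proof (intro conjI allI impI ballI)
   fix K assume "compact K \<and> K \<subseteq> U"
   then show "(\<lambda>x. \<theta> (\<phi> n x)) absolutely_integrable_on K" "(\<lambda>x. \<theta>' (\<phi> n x) *\<^sub>R weak_grad U (\<phi> n) x) absolutely_integrable_on K"
    using L2_locally_integrable[OF test_L2[OF t[of n]]] L2_locally_integrable[OF gL] by auto
  next
   fix \<psi> and i :: 'a assume \<psi>: "\<psi> \<in> test_functions U" and i: "i \<in> Basis"
   note [measurable] = L2_D(1)[OF gL[of n]] test_measurable_U[OF \<psi>] L2_D(1)[OF test_weak_grad(2)[OF t[of n]]]
   have "(LINT x|\<mu>U. \<theta> (\<phi> n x) * partial_deriv \<psi> i x) = - (LINT x|\<mu>U. (grad (\<lambda>x. \<theta> (\<phi> n x)) x \<bullet> i) * \<psi> x)"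
    by (rule is_weak_gradD(4)[OF test_weak_grad(1)[OF t] \<psi> i])
   also have "(LINT x|\<mu>U. (grad (\<lambda>x. \<theta> (\<phi> n x)) x \<bullet> i) * \<psi> x) = (LINT x|\<mu>U. ((\<theta>' (\<phi> n x) *\<^sub>R weak_grad U (\<phi> n) x) \<bullet> i) * \<psi> x)"
   proof (rule integral_cong_AE)
    show "AE x in \<mu>U. (grad (\<lambda>x. \<theta> (\<phi> n x)) x \<bullet> i) * \<psi> x = ((\<theta>' (\<phi> n x) *\<^sub>R weak_grad U (\<phi> n) x) \<bullet> i) * \<psi> x"
     using weak_grad_eq[OF test_weak_grad(1)[OF \<phi>(1)], of n] by eventually_elim (simp add: test_chain[OF \<phi>(1)])
   qed measurable
   finally show "(LINT x|\<mu>U. \<theta> (\<phi> n x) * partial_deriv \<psi> i x) = - (LINT x|\<mu>U. ((\<theta>' (\<phi> n x) *\<^sub>R weak_grad U (\<phi> n) x) \<bullet> i) * \<psi> x)" .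
  qed
 qed
qed

lemma comp_H1:
 assumes v: "v \<in> H10 U"
 shows "(\<lambda>x. \<theta> (v x)) \<in> H1 U" "AE x in \<mu>U. weak_grad U (\<lambda>x. \<theta> (v x)) x = \<theta>' (v x) *\<^sub>R weak_grad U v x"
  "H1_norm U (\<lambda>x. \<theta> (v x)) \<le> H1_norm U v"
proof -
 note v1 = H10_H1[OF v]
 note L = comp_L2(1)[OF H1D(1)[OF v1]] mult_L2(1)[OF L2_D(1)[OF H1D(1)[OF v1]] H1D(3)[OF v1]]
 show "(\<lambda>x. \<theta> (v x)) \<in> H1 U" by (rule H1I[OF L chain_rule[OF v]])
 show "AE x in \<mu>U. weak_grad U (\<lambda>x. \<theta> (v x)) x = \<theta>' (v x) *\<^sub>R weak_grad U v x" by (rule weak_grad_eq[OF chain_rule[OF v]])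
 show "H1_norm U (\<lambda>x. \<theta> (v x)) \<le> H1_norm U v"
  unfolding H1_norm_eq[OF L chain_rule[OF v]] unfolding H1_norm_def
  by (intro real_sqrt_le_mono add_mono power_mono comp_L2(2) mult_L2(2) H1D[OF v1] L2_D(1)[OF H1D(1)[OF v1]] L2_norm_nonneg)
qed

text \<open>Continuity in H^1 serves twice: to stay in the closure of the test functions, and to
  transport simple approximations in time.\<close>

lemma comp_tendsto:
 assumes s: "\<And>n. s n \<in> H10 U" and v: "v \<in> H10 U" and lim: "(\<lambda>n. H1_norm U (\<lambda>x. s n x - v x)) \<longlonglongrightarrow> 0"
 shows "(\<lambda>n. H1_norm U (\<lambda>x. \<theta> (s n x) - \<theta> (v x))) \<longlonglongrightarrow> 0"
proof -
 note v1 = H10_H1[OF v] and s1 = H10_H1[OF s]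
 note l = H1_tendstoD[OF s1 v1 lim]
 have "(\<lambda>n. L2_norm U (\<lambda>x. s n x - v x) + L2_norm U (\<lambda>x. \<theta>' (s n x) *\<^sub>R weak_grad U (s n) x - \<theta>' (v x) *\<^sub>R weak_grad U v x)) \<longlonglongrightarrow> 0 + 0"
  by (intro tendsto_add l(1) gradient_tendsto[OF H1D(1)[OF s1] H1D(1)[OF v1] H1D(3)[OF v1] H1D(3)[OF s1] l])
 then have lim': "(\<lambda>n. L2_norm U (\<lambda>x. s n x - v x) + L2_norm U (\<lambda>x. \<theta>' (s n x) *\<^sub>R weak_grad U (s n) x - \<theta>' (v x) *\<^sub>R weak_grad U v x)) \<longlonglongrightarrow> 0" by simp
 have le: "norm (H1_norm U (\<lambda>x. \<theta> (s n x) - \<theta> (v x))) \<le> L2_norm U (\<lambda>x. s n x - v x) + L2_norm U (\<lambda>x. \<theta>' (s n x) *\<^sub>R weak_grad U (s n) x - \<theta>' (v x) *\<^sub>R weak_grad U v x)" for n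
 proof -
  have g: "is_weak_grad U (\<lambda>x. \<theta> (s n x) - \<theta> (v x)) (\<lambda>x. \<theta>' (s n x) *\<^sub>R weak_grad U (s n) x - \<theta>' (v x) *\<^sub>R weak_grad U v x)"
   using is_weak_grad_lin[OF chain_rule[OF s[of n]] chain_rule[OF v], of "-1"] by simp
  have "H1_norm U (\<lambda>x. \<theta> (s n x) - \<theta> (v x)) \<le> L2_norm U (\<lambda>x. \<theta> (s n x) - \<theta> (v x)) + L2_norm U (\<lambda>x. \<theta>' (s n x) *\<^sub>R weak_grad U (s n) x - \<theta>' (v x) *\<^sub>R weak_grad U v x)"
   by (rule H1_norm_le[OF _ _ g])
     (intro L2_diff comp_L2 mult_L2 H1D[OF v1] H1D[OF s1] L2_D(1)[OF H1D(1)[OF v1]] L2_D(1)[OF H1D(1)[OF s1]])+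
  then show ?thesis
   using comp_L2_diff[OF H1D(1)[OF s1] H1D(1)[OF v1], of n] H1_norm_ge(3)[of "\<lambda>x. \<theta> (s n x) - \<theta> (v x)"] by simp
 qed
 show ?thesis by (rule Lim_null_comparison[OF always_eventually[OF allI[OF le]] lim'])
qed

lemma comp_H10:
 assumes v: "v \<in> H10 U" shows "(\<lambda>x. \<theta> (v x)) \<in> H10 U"
proof (rule H10I[OF comp_H1(1)[OF v]])
 fix e :: real assume e: "e > 0"
 obtain \<phi> where \<phi>: "\<And>n::nat. \<phi> n \<in> test_functions U" "(\<lambda>n. H1_norm U (\<lambda>x. \<phi> n x - v x)) \<longlonglongrightarrow> 0"
  by (rule H10_seq[OF v]) blast
 have "(\<lambda>n. H1_norm U (\<lambda>x. \<theta> (\<phi> n x) - \<theta> (v x))) \<longlonglongrightarrow> 0"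
  by (rule comp_tendsto[OF test_H10[OF \<phi>(1)] v \<phi>(2)])
 then have "eventually (\<lambda>n. H1_norm U (\<lambda>x. \<theta> (\<phi> n x) - \<theta> (v x)) < e) sequentially"
  using e by (rule order_tendstoD(2))
 then obtain n where n: "H1_norm U (\<lambda>x. \<theta> (\<phi> n x) - \<theta> (v x)) < e"
  using eventually_happens'[OF sequentially_bot] by blast
 have "H1_norm U (\<lambda>x. \<theta> (v x) - \<theta> (\<phi> n x)) = H1_norm U (\<lambda>x. \<theta> (\<phi> n x) - \<theta> (v x))"
  using H1_mult(3)[OF H1_diff[OF test_H1[OF \<theta>_test[OF \<phi>(1)]] comp_H1(1)[OF v]], of "-1" n] by simp
 then show "\<exists>\<phi>\<in>test_functions U. H1_norm U (\<lambda>x. \<theta> (v x) - \<phi> x) < e"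
  using n by (intro bexI[OF _ \<theta>_test[OF \<phi>(1)[of n]]]) simp
qed

lemma comp_X:
 assumes u: "u \<in> X_space T U" shows "(\<lambda>t x. \<theta> (u t x)) \<in> X_space T U"
 unfolding X_space_def
 by (rule H.bochner_compose[OF u[unfolded X_space_def], of "\<lambda>v x. \<theta> (v x)" 1])
   (use comp_H10 comp_H1(3) comp_tendsto in auto)

end

lemma (in bounded_domain) nfun_chain:
 assumes "\<delta> > 0" shows "lipschitz_chain U (nfun \<delta>) (nder \<delta>) (128 / \<delta>)"
proof
 fix \<phi> assume \<phi>: "\<phi> \<in> test_functions U"
 obtain K where K: "compact K" "K \<subseteq> U" "\<And>x. x \<notin> K \<Longrightarrow> \<phi> x = 0"
  by (rule test_functionsE[OF \<phi>]) blast
 show "(\<lambda>x. nfun \<delta> (\<phi> x)) \<in> test_functions U"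
  by (rule test_functionsI[OF _ K(1,2)]) (use K(3) Ck_nfun_compose[OF assms test_functions_Ck[OF \<phi>]] nfun_0 in auto)
qed (use nfun_derivative[OF assms] nder_bounds[OF assms] nder_lipschitz[OF assms] nfun_0 in auto)

section \<open>The energy identity\<close>

lemma compact_in_interval:
 assumes "compact K" "K \<subseteq> {0<..<T::real}" "T > 0"
 obtains a b where "0 < a" "a < b" "b < T" "K \<subseteq> {a..b}"
proof (cases "K = {}")
 case True
 then show ?thesis using that[of "T / 3" "T / 2"] assms by simp
next
 case False
 obtain l u where lu: "l \<in> K" "u \<in> K" "\<And>x. x \<in> K \<Longrightarrow> l \<le> x \<and> x \<le> u"
  using compact_attains_inf[OF assms(1) False] compact_attains_sup[OF assms(1) False] by metis
 then have "0 < l" "u < T" "l \<le> u" using assms(2) by auto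
 then show ?thesis using lu(3) that[of "l/2" "(u+T)/2"] by (force simp: field_simps)
qed

lemma AE_time_obtain:
 assumes "AE t in \<mu> T. P t" "0 \<le> a" "a < b" "b \<le> T"
 obtains t where "a < t" "t < b" "P t"
proof -
 have "\<exists>t. a < t \<and> t < b \<and> P t"
 proof (rule ccontr)
  assume n: "\<not> (\<exists>t. a < t \<and> t < b \<and> P t)"
  have "AE t in lebesgue. \<not> (t \<in> {a<..<b})"
   using assms(1) unfolding AE_time_measure
  proof eventually_elim
   case (elim t)
   then show ?case using n assms(2-4) by auto
  qed
  then have "{a<..<b} \<in> null_sets lebesgue"
   by (subst (asm) AE_iff_null_sets[symmetric]) auto
  then show False using assms(3) by (auto simp: null_sets_def)
 qed
 then show ?thesis using that by blast
qed

text \<open>A null set contains no interval, so the points of agreement accumulate at every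
  \<open>t\<close>, the ends included.\<close>

lemma continuous_AE_eq:
 fixes f g :: "real \<Rightarrow> real"
 assumes f: "continuous_on {0..T} f" and g: "continuous_on {0..T} g" and T: "T > 0"
  and ae: "AE t in \<mu> T. f t = g t" and t: "t \<in> {0..T}"
 shows "f t = g t"
proof -
 have "\<exists>s. 0 < s \<and> s < T \<and> \<bar>s - t\<bar> < 1 / real (Suc n) \<and> f s = g s" for n
 proof -
  define p where "p = 1 / real (Suc n)"
  define a where "a = max 0 (t - p)"
  define b where "b = min T (t + p)"
  have p: "p > 0" by (simp add: p_def)
  have ab: "0 \<le> a" "a < b" "b \<le> T" "t - p \<le> a" "b \<le> t + p"
   using t T p unfolding a_def b_def by (auto simp: max_def min_def)
  obtain s where "a < s" "s < b" "f s = g s" by (rule AE_time_obtain[OF ae ab(1-3)])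
  then show ?thesis unfolding p_def[symmetric] using ab by (intro exI[of _ s]) (auto simp: abs_less_iff)
 qed
 then obtain s where s: "\<And>n. 0 < s n" "\<And>n. s n < T" "\<And>n. \<bar>s n - t\<bar> < 1 / real (Suc n)" "\<And>n. f (s n) = g (s n)"
  by metis
 have st: "s \<longlonglongrightarrow> t"
 proof (rule LIM_zero_cancel, rule Lim_null_comparison[OF _ LIMSEQ_Suc[OF lim_1_over_n]])
  show "\<forall>\<^sub>F n in sequentially. norm (s n - t) \<le> 1 / real (Suc n)"
   using s(3) by (intro always_eventually allI) (auto intro: less_imp_le)
 qed
 have in_T: "\<And>n. s n \<in> {0..T}" using s(1,2) by (simp add: less_imp_le)
 have "(\<lambda>n. f (s n)) \<longlonglongrightarrow> f t" "(\<lambda>n. g (s n)) \<longlonglongrightarrow> g t"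
  using continuous_on_tendsto_compose[OF f st t] continuous_on_tendsto_compose[OF g st t] in_T by auto
 then show ?thesis using s(4) by (auto intro: LIMSEQ_unique)
qed

text \<open>The steps may have either sign, for increments in both directions of time; the bound on
  the derivative of \<eta> dominates the quotients.\<close>

lemma difference_quotient_tendsto:
 assumes \<eta>: "\<eta> \<in> test_functions {0<..<T::real}" and y: "integrable (\<mu> T) y"
  and c: "\<And>n. c n \<noteq> 0" "c \<longlonglongrightarrow> 0"
 shows "(\<lambda>n. (LINT t|\<mu> T. (\<eta> t - \<eta> (t - c n)) * y t) / c n) \<longlonglongrightarrow> (LINT t|\<mu> T. deriv \<eta> t * y t)"
proof -
 note d = test_functions_deriv[OF \<eta>]
 obtain C where C: "\<And>x. \<bar>deriv \<eta> x\<bar> \<le> C" "C > 0" by (rule test_functions_bounded[OF d(2)]) blast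
 have lip: "\<bar>\<eta> a - \<eta> b\<bar> \<le> C * \<bar>a - b\<bar>" for a b
  using field_differentiable_bound[of UNIV \<eta> "deriv \<eta>" C a b] d(1) C(1) by simp
 have [measurable]: "\<eta> \<in> borel_measurable borel" "deriv \<eta> \<in> borel_measurable borel" "y \<in> borel_measurable (\<mu> T)"
  using test_functions_measurable[OF \<eta>] test_functions_measurable[OF d(2)] y by auto
 have "(\<lambda>n. LINT t|\<mu> T. (\<eta> t - \<eta> (t - c n)) / c n * y t) \<longlonglongrightarrow> (LINT t|\<mu> T. deriv \<eta> t * y t)"
 proof (rule integral_dominated_convergence[where w = "\<lambda>t. C * \<bar>y t\<bar>"])
  show "AE t in \<mu> T. (\<lambda>n. (\<eta> t - \<eta> (t - c n)) / c n * y t) \<longlonglongrightarrow> deriv \<eta> t * y t"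
  proof (rule AE_I2)
   fix t
   have "((\<lambda>h. (\<eta> (t + h) - \<eta> t) / h) \<longlongrightarrow> deriv \<eta> t) (at 0)" using d(1)[of t] by (simp add: DERIV_def)
   moreover have "filterlim (\<lambda>n. - c n) (at 0) sequentially"
    using c tendsto_minus[OF c(2)] by (intro filterlim_atI) auto
   ultimately have "(\<lambda>n. (\<eta> (t + - c n) - \<eta> t) / - c n) \<longlonglongrightarrow> deriv \<eta> t" by (rule filterlim_compose)
   moreover have "(\<eta> (t + - c n) - \<eta> t) / - c n = (\<eta> t - \<eta> (t - c n)) / c n" for n
    using c(1)[of n] by (simp add: field_simps)
   ultimately show "(\<lambda>n. (\<eta> t - \<eta> (t - c n)) / c n * y t) \<longlonglongrightarrow> deriv \<eta> t * y t"
    by (intro tendsto_mult tendsto_const) simp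
  qed
  show "AE t in \<mu> T. norm ((\<eta> t - \<eta> (t - c n)) / c n * y t) \<le> C * \<bar>y t\<bar>" for n
  proof (rule AE_I2)
   fix t
   have "\<bar>\<eta> t - \<eta> (t - c n)\<bar> / \<bar>c n\<bar> \<le> C"
    using lip[of t "t - c n"] c(1)[of n] by (simp add: field_simps)
   then show "norm ((\<eta> t - \<eta> (t - c n)) / c n * y t) \<le> C * \<bar>y t\<bar>"
    unfolding norm_mult using C(2) by (intro mult_mono) auto
  qed
 qed (use y in auto)
 then show ?thesis by simp
qed

context bounded_domain begin

text \<open>The equation dw/dt = l in integrated form, one scalar primitive for each
  \<open>v\<close>. Constant and null set may depend on \<open>v\<close>, which is what the
  distributional formulation yields.\<close>

definition evolves :: "real \<Rightarrow> (real \<Rightarrow> 'a \<Rightarrow> real) \<Rightarrow> (real \<Rightarrow> ('a \<Rightarrow> real) \<Rightarrow> real) \<Rightarrow> (real \<Rightarrow> real) \<Rightarrow> bool" where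
 "evolves T w l k \<longleftrightarrow> T > 0 \<and> w \<in> X_space T U \<and> X_functional T l k \<and>
   (\<forall>v\<in>H10 U. \<exists>c. AE t in \<mu> T. L2_inner U (w t) v = c + prim T (\<lambda>s. l s v) t)"

lemma evolvesD:
 assumes "evolves T w l k"
 shows "T > 0" "w \<in> X_space T U" "w \<in> bochner_L2 T (H10 U) (H1_norm U)" "X_functional T l k"
  "AE t in \<mu> T. w t \<in> H10 U" "AE t in \<mu> T. w t \<in> L2 U"
  "\<And>v. v \<in> H10 U \<Longrightarrow> \<exists>c. AE t in \<mu> T. L2_inner U (w t) v = c + prim T (\<lambda>s. l s v) t"
proof -
 show "T > 0" and w: "w \<in> X_space T U" and "X_functional T l k"
  and "\<And>v. v \<in> H10 U \<Longrightarrow> \<exists>c. AE t in \<mu> T. L2_inner U (w t) v = c + prim T (\<lambda>s. l s v) t"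
  using assms by (auto simp: evolves_def)
 show w': "w \<in> bochner_L2 T (H10 U) (H1_norm U)" using w by (simp add: X_space_def)
 show "AE t in \<mu> T. w t \<in> H10 U" by (rule H.bochnerD(1)[OF w'])
 then show "AE t in \<mu> T. w t \<in> L2 U" by eventually_elim (rule H1D(1)[OF H10_H1])
qed

lemma prim_bdd_linear:
 assumes "X_functional T l k"
 shows "\<exists>\<kappa>. H10_linear \<kappa> (\<lambda>v. prim T (\<lambda>s. l s v) t)"
 unfolding prim_def using H.functional_prim[OF assms, of "{..t}"] by auto

text \<open>Subtracting the formulas at two times removes the constants \<open>c z\<close>, for
  which no bound is available; what remains is bounded on \<open>H10\<close> and extends from
  \<open>D\<close> to its limits.\<close>

lemma increment_extend:
 assumes l: "X_functional T l k" and a: "a \<in> L2 U" and b: "b \<in> L2 U" and v: "v \<in> H10 U"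
  and d: "\<And>n. d n \<in> D" "D \<subseteq> H10 U" "(\<lambda>n. H1_norm U (\<lambda>x. d n x - v x)) \<longlonglongrightarrow> 0"
  and eqa: "\<And>z. z \<in> D \<Longrightarrow> L2_inner U a z = c z + prim T (\<lambda>s. l s z) t"
  and eqb: "\<And>z. z \<in> D \<Longrightarrow> L2_inner U b z = c z + prim T (\<lambda>s. l s z) r"
 shows "L2_inner U (\<lambda>x. a x - b x) v = prim T (\<lambda>s. l s v) t - prim T (\<lambda>s. l s v) r"
proof -
 obtain \<kappa> where \<kappa>: "H10_linear \<kappa> (\<lambda>v. prim T (\<lambda>s. l s v) t)"
  using prim_bdd_linear[OF l] by blast
 obtain \<kappa>' where \<kappa>': "H10_linear \<kappa>' (\<lambda>v. prim T (\<lambda>s. l s v) r)"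
  using prim_bdd_linear[OF l] by blast
 have "L2_inner U (\<lambda>x. a x - b x) v = prim T (\<lambda>s. l s v) t + (- 1) * prim T (\<lambda>s. l s v) r"
 proof (rule H.bdd_linear_eq_extend[OF L2_bdd_linear[OF L2_diff[OF a b]] bdd_linear_comb[OF \<kappa> \<kappa>', of "-1"] v d])
  fix z assume z: "z \<in> D"
  then have "z \<in> L2 U" using d(2) H1D(1)[OF H10_H1] by blast
  then show "L2_inner U (\<lambda>x. a x - b x) z = prim T (\<lambda>s. l s z) t + (- 1) * prim T (\<lambda>s. l s z) r"
   using L2_inner_diff(2)[OF a b] eqa[OF z] eqb[OF z] by simp
 qed
 then show ?thesis by simp
qed

text \<open>Collects in one null set the exceptions of countably many scalar primitives; off it, the
  values of \<open>u\<close> are limits from \<open>D\<close> and the formula holds on all of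
  \<open>D\<close> at once.\<close>

lemma evolves_good:
 assumes w: "evolves T w l k" and u: "u \<in> X_space T U"
 obtains D c where "D \<subseteq> H10 U"
  "AE t in \<mu> T. u t \<in> H10 U \<and> w t \<in> L2 U \<and> (\<exists>d. (\<forall>n. d n \<in> D) \<and> (\<lambda>n. H1_norm U (\<lambda>x. d n x - u t x)) \<longlonglongrightarrow> 0)
   \<and> (\<forall>z\<in>D. L2_inner U (w t) z = c z + prim T (\<lambda>s. l s z) t)"
proof -
 note e = evolvesD[OF w]
 note u' = u[unfolded X_space_def]
 obtain D where D: "countable D" "D \<subseteq> H10 U"
  "AE t in \<mu> T. \<exists>d. (\<forall>n. d n \<in> D) \<and> (\<lambda>n. H1_norm U (\<lambda>x. d n x - u t x)) \<longlonglongrightarrow> 0"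
  by (rule H.separable_values[OF u']) blast
 obtain c where c: "\<And>v. v \<in> H10 U \<Longrightarrow> AE t in \<mu> T. L2_inner U (w t) v = c v + prim T (\<lambda>s. l s v) t"
  using e(7) by metis
 have "AE t in \<mu> T. \<forall>z\<in>D. L2_inner U (w t) z = c z + prim T (\<lambda>s. l s z) t"
  by (subst AE_ball_countable[OF D(1)]) (use D(2) c in blast)
 then have "AE t in \<mu> T. u t \<in> H10 U \<and> w t \<in> L2 U \<and> (\<exists>d. (\<forall>n. d n \<in> D) \<and> (\<lambda>n. H1_norm U (\<lambda>x. d n x - u t x)) \<longlonglongrightarrow> 0)
   \<and> (\<forall>z\<in>D. L2_inner U (w t) z = c z + prim T (\<lambda>s. l s z) t)"
  using D(3) H.bochnerD(1)[OF u'] e(6) by eventually_elim blast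
 then show ?thesis by (rule that[OF D(2)])
qed

text \<open>For each \<open>t\<close> the element \<open>u t\<close> is kept fixed while
  \<open>w\<close> moves, so a time-dependent test function is allowed.\<close>

lemma increment:
 assumes w: "evolves T w l k" and u: "u \<in> X_space T U"
 shows "AE t in \<mu> T. 0 < t + c \<longrightarrow> t + c < T \<longrightarrow>
  w (t + c) \<in> L2 U \<and> L2_inner U (\<lambda>x. w t x - w (t + c) x) (u t) = prim T (\<lambda>s. l s (u t)) t - prim T (\<lambda>s. l s (u t)) (t + c)"
proof -
 obtain D \<gamma> where D: "D \<subseteq> H10 U" and ae:
  "AE t in \<mu> T. u t \<in> H10 U \<and> w t \<in> L2 U \<and> (\<exists>d. (\<forall>n. d n \<in> D) \<and> (\<lambda>n. H1_norm U (\<lambda>x. d n x - u t x)) \<longlonglongrightarrow> 0)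
   \<and> (\<forall>z\<in>D. L2_inner U (w t) z = \<gamma> z + prim T (\<lambda>s. l s z) t)"
  by (rule evolves_good[OF w u])
 show ?thesis
  using ae AE_time_shift[OF ae, of c]
 proof eventually_elim
  case (elim t)
  show ?case
  proof (intro impI conjI)
   assume t: "0 < t + c" "t + c < T"
   show b: "w (t + c) \<in> L2 U" using elim(2) t by blast
   obtain d where d: "\<And>n. d n \<in> D" "(\<lambda>n. H1_norm U (\<lambda>x. d n x - u t x)) \<longlonglongrightarrow> 0" using elim(1) by blast
   have ut: "u t \<in> H10 U" and wt: "w t \<in> L2 U" using elim(1) by blast+
   show "L2_inner U (\<lambda>x. w t x - w (t + c) x) (u t) = prim T (\<lambda>s. l s (u t)) t - prim T (\<lambda>s. l s (u t)) (t + c)"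
    by (rule increment_extend[OF evolvesD(4)[OF w] wt b ut d(1) D d(2), of \<gamma>]) (use elim t in blast)+
  qed
 qed
qed

end

text \<open>\<open>tangent\<close> is convexity in subgradient form. The instances are
  \<open>s\<^sup>2 / 2\<close> and \<open>npot \<delta>\<close>.\<close>

locale potential =
 fixes \<Phi> \<phi> :: "real \<Rightarrow> real"
 assumes tangent: "\<Phi> b - \<Phi> a \<le> \<phi> b * (b - a)" and \<phi>_le: "\<bar>\<phi> s\<bar> \<le> \<bar>s\<bar>" and \<Phi>_0: "\<Phi> 0 = 0"
  and \<Phi>_measurable [measurable]: "\<Phi> \<in> borel_measurable borel" and \<phi>_measurable [measurable]: "\<phi> \<in> borel_measurable borel"
begin

lemma \<Phi>_diff: "\<bar>\<Phi> a - \<Phi> b\<bar> \<le> (\<bar>a\<bar> + \<bar>b\<bar>) * \<bar>a - b\<bar>"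
proof -
 have 1: "\<phi> c * d \<le> (\<bar>a\<bar> + \<bar>b\<bar>) * \<bar>a - b\<bar>" if "c = a \<or> c = b" "\<bar>d\<bar> = \<bar>a - b\<bar>" for c d
 proof -
  have "\<phi> c * d \<le> \<bar>\<phi> c\<bar> * \<bar>d\<bar>" by (metis abs_ge_self abs_mult)
  also have "\<dots> \<le> (\<bar>a\<bar> + \<bar>b\<bar>) * \<bar>a - b\<bar>"
   unfolding that(2) using \<phi>_le[of c] that(1) by (intro mult_right_mono) auto
  finally show ?thesis .
 qed
 show ?thesis
  using tangent[of a b] tangent[of b a] 1[of a "a - b"] 1[of b "b - a"] by (simp add: abs_le_iff abs_minus_commute)
qed

lemma \<Phi>_integrable:
 assumes a: "a \<in> L2 U" shows "integrable (lebesgue_on U) (\<lambda>x. \<Phi> (a x))"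
proof (rule Bochner_Integration.integrable_bound)
 note [measurable] = L2_D(1)[OF a]
 show "integrable (lebesgue_on U) (\<lambda>x. (norm (a x))\<^sup>2)" by (rule L2_D(2)[OF a])
 show "(\<lambda>x. \<Phi> (a x)) \<in> borel_measurable (lebesgue_on U)" by measurable
 show "AE x in lebesgue_on U. norm (\<Phi> (a x)) \<le> norm ((norm (a x))\<^sup>2)"
 proof (rule AE_I2)
  fix x show "norm (\<Phi> (a x)) \<le> norm ((norm (a x))\<^sup>2)"
   using \<Phi>_diff[of "a x" 0] by (simp add: \<Phi>_0 power2_eq_square)
 qed
qed

lemma \<Phi>_integral_diff:
 assumes a: "a \<in> L2 U" and b: "b \<in> L2 U"
 shows "\<bar>(LINT x|lebesgue_on U. \<Phi> (a x)) - (LINT x|lebesgue_on U. \<Phi> (b x))\<bar> \<le> (L2_norm U a + L2_norm U b) * L2_norm U (\<lambda>x. a x - b x)"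
proof -
 note i = \<Phi>_integrable[OF a] \<Phi>_integrable[OF b]
 have d: "(\<lambda>x. a x - b x) \<in> L2 U" by (rule L2_diff[OF a b])
 note n = L2_inner_integrable(2)[OF a d] L2_inner_integrable(2)[OF b d]
 have "\<bar>(LINT x|lebesgue_on U. \<Phi> (a x)) - (LINT x|lebesgue_on U. \<Phi> (b x))\<bar> = \<bar>LINT x|lebesgue_on U. \<Phi> (a x) - \<Phi> (b x)\<bar>"
  using i by simp
 also have "\<dots> \<le> (LINT x|lebesgue_on U. \<bar>\<Phi> (a x) - \<Phi> (b x)\<bar>)" by (rule integral_abs_bound)
 also have "\<dots> \<le> (LINT x|lebesgue_on U. norm (a x) * norm (a x - b x) + norm (b x) * norm (a x - b x))"
  using i n \<Phi>_diff by (intro integral_mono) (auto simp: distrib_right)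
 also have "\<dots> = (LINT x|lebesgue_on U. norm (a x) * norm (a x - b x)) + (LINT x|lebesgue_on U. norm (b x) * norm (a x - b x))"
  using n by (rule Bochner_Integration.integral_add)
 also have "\<dots> \<le> L2_norm U a * L2_norm U (\<lambda>x. a x - b x) + L2_norm U b * L2_norm U (\<lambda>x. a x - b x)"
  by (intro add_mono L2_Cauchy_Schwarz_norm a b d)
 finally show ?thesis by (simp add: distrib_right)
qed

lemma \<Phi>_integral_tendsto:
 assumes s: "\<And>n. s n \<in> L2 U" and v: "v \<in> L2 U" and lim: "(\<lambda>n. L2_norm U (\<lambda>x. s n x - v x)) \<longlonglongrightarrow> 0"
 shows "(\<lambda>n. LINT x|lebesgue_on U. \<Phi> (s n x)) \<longlonglongrightarrow> (LINT x|lebesgue_on U. \<Phi> (v x))"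
proof -
 have "(\<lambda>n. (L2_norm U (\<lambda>x. s n x - v x) + 2 * L2_norm U v) * L2_norm U (\<lambda>x. s n x - v x)) \<longlonglongrightarrow> (0 + 2 * L2_norm U v) * 0"
  by (intro tendsto_intros lim)
 then have lim': "(\<lambda>n. (L2_norm U (\<lambda>x. s n x - v x) + 2 * L2_norm U v) * L2_norm U (\<lambda>x. s n x - v x)) \<longlonglongrightarrow> 0" by simp
 have le: "norm ((LINT x|lebesgue_on U. \<Phi> (s n x)) - (LINT x|lebesgue_on U. \<Phi> (v x)))
  \<le> (L2_norm U (\<lambda>x. s n x - v x) + 2 * L2_norm U v) * L2_norm U (\<lambda>x. s n x - v x)" for n
 proof -
  have "L2_norm U (s n) \<le> L2_norm U (\<lambda>x. s n x - v x) + L2_norm U v"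
   using L2_norm_triangle[OF L2_diff[OF s v] v, of n] by simp
  then have "(L2_norm U (s n) + L2_norm U v) * L2_norm U (\<lambda>x. s n x - v x)
    \<le> (L2_norm U (\<lambda>x. s n x - v x) + 2 * L2_norm U v) * L2_norm U (\<lambda>x. s n x - v x)"
   using L2_norm_nonneg by (intro mult_right_mono) auto
  then show ?thesis using \<Phi>_integral_diff[OF s v, of n] by simp
 qed
 show ?thesis by (rule LIM_zero_cancel[OF Lim_null_comparison[OF always_eventually[OF allI[OF le]] lim']])
qed

lemma \<Phi>_integral_tangent:
 assumes a: "a \<in> L2 U" and b: "b \<in> L2 U"
 shows "(LINT x|lebesgue_on U. \<Phi> (b x)) - (LINT x|lebesgue_on U. \<Phi> (a x)) \<le> L2_inner U (\<lambda>x. b x - a x) (\<lambda>x. \<phi> (b x))"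
proof -
 note [measurable] = L2_D(1)[OF b]
 have pL: "(\<lambda>x. \<phi> (b x)) \<in> L2 U"
 proof (rule L2_bound(1)[OF b, of _ 1])
  show "(\<lambda>x. \<phi> (b x)) \<in> borel_measurable (lebesgue_on U)" by measurable
 qed (use \<phi>_le in auto)
 have "(LINT x|lebesgue_on U. \<Phi> (b x) - \<Phi> (a x)) \<le> (LINT x|lebesgue_on U. (b x - a x) \<bullet> \<phi> (b x))"
  using \<Phi>_integrable[OF a] \<Phi>_integrable[OF b] L2_inner_integrable(1)[OF L2_diff[OF b a] pL] tangent
  by (intro integral_mono) (auto simp: mult.commute)
 then show ?thesis using \<Phi>_integrable[OF a] \<Phi>_integrable[OF b] by (simp add: L2_inner_def)
qed

end

context bounded_domain begin

lemma potential_integrable: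
 assumes pot: "potential \<Phi> \<phi>" and w: "w \<in> X_space T U"
 shows "integrable (\<mu> T) (\<lambda>t. LINT x|\<mu>U. \<Phi> (w t x))"
proof -
 interpret potential \<Phi> \<phi> by (rule pot)
 note w' = X_L2_L2[OF w, unfolded L2_L2_def]
 obtain s where s: "\<And>n. simple_function (\<mu> T) (s n)" "\<And>n t. t \<in> {0<..<T} \<Longrightarrow> s n t \<in> L2 U"
  "AE t in \<mu> T. (\<lambda>n. L2_norm U (\<lambda>x. s n t x - w t x)) \<longlonglongrightarrow> 0"
  by (rule L.bochnerE[OF w']) blast
 have meas: "(\<lambda>t. LINT x|\<mu>U. \<Phi> (s n t x)) \<in> borel_measurable (\<mu> T)" for n
  by (rule borel_measurable_simple_function[OF simple_function_compose1[OF s(1)]])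
 have tends: "AE t in \<mu> T. (\<lambda>n. LINT x|\<mu>U. \<Phi> (s n t x)) \<longlonglongrightarrow> (LINT x|\<mu>U. \<Phi> (w t x))"
  using s(3) L.bochnerD(1)[OF w'] AE_space
 proof eventually_elim
  case (elim t)
  then show ?case using s(2)[of t] by (intro \<Phi>_integral_tendsto) auto
 qed
 show ?thesis
 proof (rule Bochner_Integration.integrable_bound)
  show "integrable (\<mu> T) (\<lambda>t. (L2_norm U (w t))\<^sup>2)" by (rule L.bochnerD(2)[OF w'])
  show "(\<lambda>t. LINT x|\<mu>U. \<Phi> (w t x)) \<in> borel_measurable (\<mu> T)"
   by (rule borel_measurable_AE_limit[OF meas _ tends]) simp
  show "AE t in \<mu> T. norm (LINT x|\<mu>U. \<Phi> (w t x)) \<le> norm ((L2_norm U (w t))\<^sup>2)"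
   using L.bochnerD(1)[OF w']
  proof eventually_elim
   case (elim t)
   have "L2_norm U (\<lambda>_. 0 :: real) = 0" by (simp add: L2_norm_def L2_inner_def)
   then show ?case using \<Phi>_integral_diff[OF elim L2_zero] by (simp add: \<Phi>_0 power2_eq_square)
  qed
 qed
qed

text \<open>Convexity bounds the drop of the potential from \<open>t\<close> to \<open>t + c\<close>
  by the pairing of the increment with \<open>\<phi> (w t)\<close>, and the increment is an average
  of \<open>l\<close> over the window in between, with its argument at the unshifted time.\<close>

lemma energy_step:
 assumes w: "evolves T w l k" and pot: "potential \<Phi> \<phi>" and u: "(\<lambda>t x. \<phi> (w t x)) \<in> X_space T U"
  and \<eta>: "\<eta> \<in> test_functions {0<..<T}" "\<And>t. 0 \<le> \<eta> t"
  and ab: "\<And>t. \<eta> t \<noteq> 0 \<Longrightarrow> 0 < t \<and> t < T \<and> 0 < t + c \<and> t + c < T"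
  and h: "h > 0" and hc: "(c = - h \<and> a = 1) \<or> (c = h \<and> a = 0)"
 shows "(LINT t|\<mu> T. (\<eta> t - \<eta> (t - c)) * (LINT x|\<mu>U. \<Phi> (w t x)))
  \<le> - c * (LINT t|\<mu> T. (LINT s|\<mu> T. kern a h t s * l s (\<lambda>x. \<eta> t * \<phi> (w t x))))"
proof -
 interpret potential \<Phi> \<phi> by (rule pot)
 note e = evolvesD[OF w]
 define y where "y t = (LINT x|\<mu>U. \<Phi> (w t x))" for t
 have yi: "integrable (\<mu> T) y" unfolding y_def by (rule potential_integrable[OF pot e(2)])
 obtain C where C: "\<And>x. \<bar>\<eta> x\<bar> \<le> C" "C > 0" by (rule test_functions_bounded[OF \<eta>(1)]) blast
 have [measurable]: "\<eta> \<in> borel_measurable borel" by (rule test_functions_measurable[OF \<eta>(1)])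
 have [measurable]: "y \<in> borel_measurable (\<mu> T)" using yi by simp
 have bi: "integrable (\<mu> T) (\<lambda>t. \<eta> (t - r) * y t)" for r
 proof (rule Bochner_Integration.integrable_bound)
  show "integrable (\<mu> T) (\<lambda>t. C * y t)" using yi by simp
  show "AE t in \<mu> T. norm (\<eta> (t - r) * y t) \<le> norm (C * y t)"
   unfolding norm_mult using C by (intro AE_I2 mult_right_mono) auto
 qed measurable
 define f where "f t = \<eta> (t - c) * y t" for t
 have f1: "\<And>t. f t \<noteq> 0 \<Longrightarrow> 0 < t \<and> t < T" using ab[of "_ - c"] by (force simp: f_def)
 have f2: "\<And>t. f t \<noteq> 0 \<Longrightarrow> 0 < t + - c \<and> t + - c < T" using ab[of "_ - c"] by (force simp: f_def)
 have fi: "integrable (\<mu> T) f" unfolding f_def by (rule bi)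
 \<comment> \<open>Discrete integration by parts: the shift moves from the energy to \<eta>.\<close>
 have sh: "(LINT t|\<mu> T. \<eta> t * y (t + c)) = (LINT t|\<mu> T. \<eta> (t - c) * y t)" "integrable (\<mu> T) (\<lambda>t. \<eta> t * y (t + c))"
  using integral_time_shift[of f T "- c", OF f1 f2] fi by (simp_all add: f_def)
 have ukX: "(\<lambda>t x. \<eta> t * \<phi> (w t x)) \<in> bochner_L2 T (H10 U) (H1_norm U)"
  by (rule H.bochner_mult[OF u[unfolded X_space_def], of _ C]) (use C in auto)
 note st = H.steklov_functional(1)[OF e(4) h, of a]
 have "(LINT t|\<mu> T. (\<eta> t - \<eta> (t - c)) * y t) = (LINT t|\<mu> T. \<eta> t * y t) - (LINT t|\<mu> T. \<eta> (t - c) * y t)"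
  using bi[of 0] bi[of c] by (simp add: left_diff_distrib)
 also have "\<dots> = (LINT t|\<mu> T. \<eta> t * y t - \<eta> t * y (t + c))"
  using bi[of 0] sh by simp
 also have "\<dots> \<le> (LINT t|\<mu> T. - c * (LINT s|\<mu> T. kern a h t s * l s (\<lambda>x. \<eta> t * \<phi> (w t x))))"
 proof (rule integral_mono_AE)
  show "integrable (\<mu> T) (\<lambda>t. \<eta> t * y t - \<eta> t * y (t + c))" using bi[of 0] sh(2) by simp
  show "integrable (\<mu> T) (\<lambda>t. - c * (LINT s|\<mu> T. kern a h t s * l s (\<lambda>x. \<eta> t * \<phi> (w t x))))"
   using H.pairing_integrable(1)[OF st ukX] by simp
  show "AE t in \<mu> T. \<eta> t * y t - \<eta> t * y (t + c) \<le> - c * (LINT s|\<mu> T. kern a h t s * l s (\<lambda>x. \<eta> t * \<phi> (w t x)))"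
   using increment[OF w u, of c] e(6) H.bochnerD(1)[OF u[unfolded X_space_def]] H.L2_functionalD(4)[OF st]
  proof eventually_elim
   case (elim t)
   have lin: "(LINT s|\<mu> T. kern a h t s * l s (\<lambda>x. \<eta> t * \<phi> (w t x))) = \<eta> t * (LINT s|\<mu> T. kern a h t s * l s (\<lambda>x. \<phi> (w t x)))"
    by (rule H.bdd_linear_simps(3)[OF elim(4,3)])
   show ?case
   proof (cases "\<eta> t = 0")
    case True
    then show ?thesis using lin by simp
   next
    case False
    note t = ab[OF False]
    \<comment> \<open>The window is \<open>(t - h, t)\<close> for \<open>a = 1\<close> and
      \<open>(t, t + h)\<close> for \<open>a = 0\<close>, so \<open>prim_kern\<close> expresses the
      increment by the average in both cases.\<close>
    have inc: "L2_inner U (\<lambda>x. w t x - w (t + c) x) (\<lambda>x. \<phi> (w t x)) = - c * (LINT s|\<mu> T. kern a h t s * l s (\<lambda>x. \<phi> (w t x)))"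
     using elim(1) t hc prim_kern[OF H.functional_integrable[OF e(4) elim(3)] h, of t a] by auto
    have "y t - y (t + c) \<le> - c * (LINT s|\<mu> T. kern a h t s * l s (\<lambda>x. \<phi> (w t x)))"
     unfolding y_def inc[symmetric] by (rule \<Phi>_integral_tangent) (use elim t in blast)+
    then have "\<eta> t * (y t - y (t + c)) \<le> \<eta> t * (- c * (LINT s|\<mu> T. kern a h t s * l s (\<lambda>x. \<phi> (w t x))))"
     using \<eta>(2) by (intro mult_left_mono)
    then show ?thesis unfolding lin by (simp add: algebra_simps)
   qed
  qed
 qed
 finally show ?thesis by (simp add: y_def)
qed

text \<open>Divided by the step, the left side of \<open>energy_step\<close> tends to the integral
  with the derivative of \<eta> and the right side, by \<open>steklov_tendsto\<close>, to the
  pairing with \<open>l\<close>; the two directions of time give the two inequalities.\<close>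

lemma energy_test_nonneg:
 assumes w: "evolves T w l k" and pot: "potential \<Phi> \<phi>" and u: "(\<lambda>t x. \<phi> (w t x)) \<in> X_space T U"
  and \<eta>: "\<eta> \<in> test_functions {0<..<T}" "\<And>t. 0 \<le> \<eta> t"
 shows "(LINT t|\<mu> T. deriv \<eta> t * (LINT x|\<mu>U. \<Phi> (w t x))) = - (LINT t|\<mu> T. \<eta> t * l t (\<lambda>x. \<phi> (w t x)))"
proof -
 note e = evolvesD[OF w]
 define y where "y t = (LINT x|\<mu>U. \<Phi> (w t x))" for t
 have yi: "integrable (\<mu> T) y" unfolding y_def by (rule potential_integrable[OF pot e(2)])
 obtain K where K: "compact K" "K \<subseteq> {0<..<T}" "\<And>x. x \<notin> K \<Longrightarrow> \<eta> x = 0"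
  by (rule test_functionsE[OF \<eta>(1)]) blast
 obtain a b where ab: "0 < a" "a < b" "b < T" "K \<subseteq> {a..b}" by (rule compact_in_interval[OF K(1,2) e(1)])
 have supp: "a \<le> t \<and> t \<le> b" if "\<eta> t \<noteq> 0" for t
 proof -
  have "t \<in> K" using K(3)[of t] that by blast
  then have "t \<in> {a..b}" using ab(4) by blast
  then show ?thesis by simp
 qed
 obtain C where C: "\<And>x. \<bar>\<eta> x\<bar> \<le> C" "C > 0" by (rule test_functions_bounded[OF \<eta>(1)]) blast
 have [measurable]: "\<eta> \<in> borel_measurable borel" by (rule test_functions_measurable[OF \<eta>(1)])
 \<comment> \<open>The distance of \<open>{a..b}\<close>, which contains the support of \<eta>, from
   the ends of the interval; smaller steps keep all shifted points inside.\<close>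
 define d where "d = min a (T - b)"
 have d: "d > 0" "d \<le> a" "d \<le> T - b" using ab by (auto simp: d_def)
 define h where "h n = d / 2 * (1 / real (Suc n))" for n
 have h: "\<And>n. h n > 0" "\<And>n. h n < d"
 proof -
  fix n
  show "h n > 0" using d by (simp add: h_def)
  have "d / 2 * (1 / real (Suc n)) \<le> d / 2 * 1" using d by (intro mult_left_mono) auto
  then show "h n < d" unfolding h_def using d(1) by linarith
 qed
 have h0: "h \<longlonglongrightarrow> 0"
 proof -
  have "(\<lambda>n. d / 2 * (1 / real (Suc n))) \<longlonglongrightarrow> d / 2 * 0"
   by (intro tendsto_mult tendsto_const LIMSEQ_Suc[OF lim_1_over_n])
  then show ?thesis unfolding h_def by simp
 qed
 have ukX: "(\<lambda>t x. \<eta> t * \<phi> (w t x)) \<in> bochner_L2 T (H10 U) (H1_norm U)"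
  by (rule H.bochner_mult[OF u[unfolded X_space_def], of _ C]) (use C in auto)
 define R where "R = (LINT t|\<mu> T. \<eta> t * l t (\<lambda>x. \<phi> (w t x)))"
 have R: "(LINT t|\<mu> T. l t (\<lambda>x. \<eta> t * \<phi> (w t x))) = R"
  unfolding R_def
 proof (rule integral_cong_AE)
  show "AE t in \<mu> T. l t (\<lambda>x. \<eta> t * \<phi> (w t x)) = \<eta> t * l t (\<lambda>x. \<phi> (w t x))"
   using H.L2_functionalD(4)[OF e(4)] H.bochnerD(1)[OF u[unfolded X_space_def]]
   by eventually_elim (rule H.bdd_linear_simps(3))
  show "(\<lambda>t. l t (\<lambda>x. \<eta> t * \<phi> (w t x))) \<in> borel_measurable (\<mu> T)" by (rule H.pairing_measurable[OF e(4) ukX])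
  show "(\<lambda>t. \<eta> t * l t (\<lambda>x. \<phi> (w t x))) \<in> borel_measurable (\<mu> T)"
   using H.pairing_measurable[OF e(4) u[unfolded X_space_def]] by measurable
 qed
 have rng: "0 < t \<and> t < T \<and> 0 < t + c \<and> t + c < T" if "\<eta> t \<noteq> 0" "c = h n \<or> c = - h n" for t c n
  using supp[OF that(1)] that(2) h(1)[of n] h(2)[of n] d ab by auto
 \<comment> \<open>Increments with \<open>c = h n\<close>: division by the positive step keeps the
   inequality.\<close>
 have "(LINT t|\<mu> T. deriv \<eta> t * y t) \<le> - R"
 proof (rule LIMSEQ_le)
  have "(\<lambda>n. LINT t|\<mu> T. (LINT s|\<mu> T. kern 0 (h n) t s * l s (\<lambda>x. \<eta> t * \<phi> (w t x)))) \<longlonglongrightarrow> R"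
   unfolding R[symmetric] by (rule H.steklov_tendsto[OF e(4) ukX _ _ h(1) h0]) auto
  then show "(\<lambda>n. - (LINT t|\<mu> T. (LINT s|\<mu> T. kern 0 (h n) t s * l s (\<lambda>x. \<eta> t * \<phi> (w t x))))) \<longlonglongrightarrow> - R"
   by (rule tendsto_minus)
  show "(\<lambda>n. (LINT t|\<mu> T. (\<eta> t - \<eta> (t - h n)) * y t) / h n) \<longlonglongrightarrow> (LINT t|\<mu> T. deriv \<eta> t * y t)"
   by (rule difference_quotient_tendsto[OF \<eta>(1) yi _ h0]) (use h(1) in \<open>metis less_irrefl\<close>)
  show "\<exists>N. \<forall>n\<ge>N. (LINT t|\<mu> T. (\<eta> t - \<eta> (t - h n)) * y t) / h n \<le> - (LINT t|\<mu> T. (LINT s|\<mu> T. kern 0 (h n) t s * l s (\<lambda>x. \<eta> t * \<phi> (w t x))))"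
  proof (intro exI[of _ 0] allI impI)
   fix n
   show "(LINT t|\<mu> T. (\<eta> t - \<eta> (t - h n)) * y t) / h n \<le> - (LINT t|\<mu> T. (LINT s|\<mu> T. kern 0 (h n) t s * l s (\<lambda>x. \<eta> t * \<phi> (w t x))))"
   proof -
    have r: "0 < t \<and> t < T \<and> 0 < t + h n \<and> t + h n < T" if "\<eta> t \<noteq> 0" for t using rng[OF that, of "h n" n] by simp
    have "(LINT t|\<mu> T. (\<eta> t - \<eta> (t - h n)) * y t) \<le> - h n * (LINT t|\<mu> T. (LINT s|\<mu> T. kern 0 (h n) t s * l s (\<lambda>x. \<eta> t * \<phi> (w t x))))"
     unfolding y_def by (rule energy_step[OF w pot u \<eta> r h(1)]) simp_all
    then show ?thesis using h(1)[of n] by (simp add: divide_le_eq mult.commute)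
   qed
  qed
 qed
 \<comment> \<open>Increments with \<open>c = - h n\<close>: division by the negative step reverses
   the inequality.\<close>
 moreover have "- R \<le> (LINT t|\<mu> T. deriv \<eta> t * y t)"
 proof (rule LIMSEQ_le)
  have "(\<lambda>n. LINT t|\<mu> T. (LINT s|\<mu> T. kern 1 (h n) t s * l s (\<lambda>x. \<eta> t * \<phi> (w t x)))) \<longlonglongrightarrow> R"
   unfolding R[symmetric] by (rule H.steklov_tendsto[OF e(4) ukX _ _ h(1) h0]) auto
  then show "(\<lambda>n. - (LINT t|\<mu> T. (LINT s|\<mu> T. kern 1 (h n) t s * l s (\<lambda>x. \<eta> t * \<phi> (w t x))))) \<longlonglongrightarrow> - R"
   by (rule tendsto_minus)
  have h0': "(\<lambda>n. - h n) \<longlonglongrightarrow> 0" using tendsto_minus[OF h0] by simp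
  show "(\<lambda>n. (LINT t|\<mu> T. (\<eta> t - \<eta> (t - - h n)) * y t) / - h n) \<longlonglongrightarrow> (LINT t|\<mu> T. deriv \<eta> t * y t)"
   by (rule difference_quotient_tendsto[OF \<eta>(1) yi _ h0']) (use h(1) in \<open>metis less_irrefl neg_equal_0_iff_equal\<close>)
  show "\<exists>N. \<forall>n\<ge>N. - (LINT t|\<mu> T. (LINT s|\<mu> T. kern 1 (h n) t s * l s (\<lambda>x. \<eta> t * \<phi> (w t x)))) \<le> (LINT t|\<mu> T. (\<eta> t - \<eta> (t - - h n)) * y t) / - h n"
  proof (intro exI[of _ 0] allI impI)
   fix n
   show "- (LINT t|\<mu> T. (LINT s|\<mu> T. kern 1 (h n) t s * l s (\<lambda>x. \<eta> t * \<phi> (w t x)))) \<le> (LINT t|\<mu> T. (\<eta> t - \<eta> (t - - h n)) * y t) / - h n"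
   proof -
    have r: "0 < t \<and> t < T \<and> 0 < t + - h n \<and> t + - h n < T" if "\<eta> t \<noteq> 0" for t using rng[OF that, of "- h n" n] by simp
    have "(LINT t|\<mu> T. (\<eta> t - \<eta> (t - - h n)) * y t) \<le> - (- h n) * (LINT t|\<mu> T. (LINT s|\<mu> T. kern 1 (h n) t s * l s (\<lambda>x. \<eta> t * \<phi> (w t x))))"
     unfolding y_def by (rule energy_step[OF w pot u \<eta> r h(1)]) simp_all
    then show ?thesis using h(1)[of n] by (simp add: divide_le_eq mult.commute)
   qed
  qed
 qed
 ultimately show ?thesis by (simp add: y_def R_def)
qed

text \<open>Removes the sign condition by writing \<eta> as the difference of the nonnegative test
  functions \<zeta> and \<zeta> - \<eta>, where \<zeta> is a multiple of a bump. The weak derivative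
  found is then integrated by \<open>weak_deriv_primitive\<close>.\<close>

lemma energy_identity:
 assumes w: "evolves T w l k" and pot: "potential \<Phi> \<phi>" and u: "(\<lambda>t x. \<phi> (w t x)) \<in> X_space T U"
 obtains c where "AE t in \<mu> T. (LINT x|\<mu>U. \<Phi> (w t x)) = c + prim T (\<lambda>s. l s (\<lambda>x. \<phi> (w s x))) t"
proof -
 note e = evolvesD[OF w]
 define y where "y t = (LINT x|\<mu>U. \<Phi> (w t x))" for t
 have yi: "integrable (\<mu> T) y" unfolding y_def by (rule potential_integrable[OF pot e(2)])
 define g where "g t = l t (\<lambda>x. \<phi> (w t x))" for t
 have gi: "integrable (\<mu> T) g" unfolding g_def by (rule H.pairing_integrable(1)[OF e(4) u[unfolded X_space_def]])
 have main: "(LINT t|\<mu> T. deriv \<eta> t * y t) = - (LINT t|\<mu> T. \<eta> t * g t)" if \<eta>: "\<eta> \<in> test_functions {0<..<T}" for \<eta>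
 proof -
  obtain K where K: "compact K" "K \<subseteq> {0<..<T}" "\<And>x. x \<notin> K \<Longrightarrow> \<eta> x = 0"
   by (rule test_functionsE[OF \<eta>]) blast
  obtain a b where ab: "0 < a" "a < b" "b < T" "K \<subseteq> {a..b}" by (rule compact_in_interval[OF K(1,2) e(1)])
  obtain C where C: "\<And>x. \<bar>\<eta> x\<bar> \<le> C" "C > 0" by (rule test_functions_bounded[OF \<eta>]) blast
  obtain B :: "real \<Rightarrow> real" where B: "\<And>k. Ck k B" "\<And>x. x \<in> box (a/2) ((b+T)/2) \<Longrightarrow> B x > 0" "\<And>x. x \<notin> box (a/2) ((b+T)/2) \<Longrightarrow> B x = 0"
   using bump_exists[of "a/2" "(b+T)/2"] by blast
  have Bt: "B \<in> test_functions {0<..<T}"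
   using B(1,3) ab by (intro test_functionsI[of _ "{a/2..(b+T)/2}"]) (auto simp: box_real field_simps)
  have Bnn: "B x \<ge> 0" for x using B(2)[of x] B(3)[of x] by (cases "x \<in> box (a/2) ((b+T)/2)") auto
  obtain z where z: "z \<in> {a..b}" "\<And>x. x \<in> {a..b} \<Longrightarrow> B z \<le> B x"
   using continuous_attains_inf[of "{a..b}" B] ab test_functions_continuous[OF Bt] by auto
  have Bz: "B z > 0" using B(2)[of z] z(1) ab by (auto simp: box_real field_simps)
  \<comment> \<open>\<open>B z\<close> is the minimum of the bump on \<open>{a..b}\<close>, so
    \<open>r * B\<close> dominates the bound \<open>C\<close> of \<eta> there.\<close>
  define r where "r = C / B z"
  have r: "r \<ge> 0" using C Bz by (simp add: r_def)
  define \<zeta> where "\<zeta> x = r * B x" for x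
  have \<zeta>: "\<zeta> \<in> test_functions {0<..<T}" unfolding \<zeta>_def by (rule test_functions_cmult[OF Bt])
  have \<zeta>nn: "0 \<le> \<zeta> x" for x using Bnn r by (simp add: \<zeta>_def)
  have diff: "(\<lambda>x. \<zeta> x - \<eta> x) \<in> test_functions {0<..<T}" by (rule test_functions_diff[OF \<zeta> \<eta>])
  have dnn: "0 \<le> \<zeta> x - \<eta> x" for x
  proof (cases "x \<in> {a..b}")
   case True
   have "\<eta> x \<le> C" using C(1)[of x] by simp
   also have "C = r * B z" using Bz by (simp add: r_def)
   also have "\<dots> \<le> r * B x" using z(2)[OF True] r by (intro mult_left_mono)
   finally show ?thesis by (simp add: \<zeta>_def)
  next
   case False
   then have "\<eta> x = 0" using K(3) ab(4) by blast
   then show ?thesis using \<zeta>nn by simp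
  qed
  note 1 = energy_test_nonneg[OF w pot u \<zeta> \<zeta>nn, folded y_def g_def]
  note 2 = energy_test_nonneg[OF w pot u diff dnn, folded y_def g_def]
  have dd: "deriv (\<lambda>x. \<zeta> x - \<eta> x) t = deriv \<zeta> t - deriv \<eta> t" for t
   by (rule DERIV_imp_deriv) (intro derivative_intros test_functions_deriv(1)[OF \<zeta>] test_functions_deriv(1)[OF \<eta>])
  have bi: "integrable (\<mu> T) (\<lambda>t. f t * q t)" if f: "f \<in> test_functions {0<..<T}" and q: "integrable (\<mu> T) q" for f q
  proof -
   obtain C' where C': "\<And>x. \<bar>f x\<bar> \<le> C'" "C' > 0" by (rule test_functions_bounded[OF f]) blast
   note [measurable] = test_functions_measurable[OF f]
   show ?thesis
   proof (rule Bochner_Integration.integrable_bound)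
    show "integrable (\<mu> T) (\<lambda>t. C' * q t)" using q by simp
    show "AE t in \<mu> T. norm (f t * q t) \<le> norm (C' * q t)"
     unfolding norm_mult using C' by (intro AE_I2 mult_right_mono) auto
   qed (use q in measurable)
  qed
  note i = bi[OF test_functions_deriv(2)[OF \<zeta>] yi] bi[OF test_functions_deriv(2)[OF \<eta>] yi] bi[OF \<zeta> gi] bi[OF \<eta> gi]
  have "(LINT t|\<mu> T. deriv \<zeta> t * y t) - (LINT t|\<mu> T. deriv \<eta> t * y t) = - ((LINT t|\<mu> T. \<zeta> t * g t) - (LINT t|\<mu> T. \<eta> t * g t))"
   using 2 i unfolding dd by (simp add: left_diff_distrib)
  then show ?thesis using 1 by simp
 qed
 obtain c where "AE t in \<mu> T. y t = c + prim T g t"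
  by (rule weak_deriv_primitive[OF e(1) yi gi main])
 then show ?thesis using that unfolding y_def g_def by blast
qed

end

section \<open>The continuous representative\<close>

lemma potential_square: "potential (\<lambda>s. s\<^sup>2 / 2) (\<lambda>s. s)"
proof
 show "b\<^sup>2 / 2 - a\<^sup>2 / 2 \<le> b * (b - a)" for a b :: real
  using sum_squares_bound[of a b] by (simp add: power2_eq_square algebra_simps)
qed auto

lemma integral_interval_le:
 assumes f: "integrable (\<mu> T) f" and g: "integrable (\<mu> T) g" and le: "AE t in \<mu> T. \<bar>f t\<bar> \<le> g t" and "r \<le> t"
 shows "\<bar>prim T f t - prim T f r\<bar> \<le> prim T g t - prim T g r"
proof -
 have "\<bar>prim T f t - prim T f r\<bar> \<le> (LINT s|\<mu> T. \<bar>indicator {r<..<t} s * f s\<bar>)"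
  unfolding prim_diff[OF f assms(4)] by (rule integral_abs_bound)
 also have "\<dots> \<le> (LINT s|\<mu> T. indicator {r<..<t} s * g s)"
 proof (rule integral_mono_AE)
  show "AE s in \<mu> T. \<bar>indicator {r<..<t} s * f s\<bar> \<le> indicator {r<..<t} s * g s"
   using le by eventually_elim (simp add: indicator_def)
 qed (use prim_integrable[OF f] prim_integrable[OF g] in auto)
 finally show ?thesis unfolding prim_diff[OF g assms(4)] .
qed

lemma prim_const:
 assumes "0 \<le> r" "r \<le> t" "t \<le> T"
 shows "prim T (\<lambda>_. c) t - prim T (\<lambda>_. c) r = c * (t - r)"
proof -
 have "{r<..<t} \<subseteq> {0<..<T}" using assms by auto
 then have "(LINT s|\<mu> T. indicator {r<..<t} s) = t - r" by (rule integral_box_indicator_le(2)[OF assms(2)])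
 then show ?thesis using prim_diff[of T "\<lambda>_. c" r t] assms(2) by (simp del: Bochner_Integration.integral_indicator)
qed

text \<open>A mean value selection: if \<open>(t - r) * f s\<close> exceeded the integral of
  \<open>g\<close> almost everywhere, the integral of \<open>f\<close> would be at least that of
  \<open>g\<close>. The \<open>+ 1\<close> makes it strictly smaller, so weak inequalities suffice
  for the contradiction.\<close>

lemma exists_small:
 assumes f: "integrable (\<mu> T) f" and g: "integrable (\<mu> T) g" and fg: "AE t in \<mu> T. f t + 1 \<le> g t"
  and P: "AE t in \<mu> T. P t" and rt: "0 \<le> r" "r < t" "t \<le> T"
 obtains s where "r < s" "s < t" "P s" "(t - r) * f s \<le> prim T g t - prim T g r"
proof -
 define J where "J = prim T g t - prim T g r"
 have "\<exists>s. r < s \<and> s < t \<and> P s \<and> (t - r) * f s \<le> J"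
 proof (rule ccontr)
  assume n: "\<not> (\<exists>s. r < s \<and> s < t \<and> P s \<and> (t - r) * f s \<le> J)"
  have 1: "(t - r) * (prim T f t - prim T f r) \<ge> (t - r) * J"
  proof -
   have "(LINT s|\<mu> T. indicator {r<..<t} s * (J / (t - r))) \<le> (LINT s|\<mu> T. indicator {r<..<t} s * f s)"
   proof (rule integral_mono_AE)
    show "AE s in \<mu> T. indicator {r<..<t} s * (J / (t - r)) \<le> indicator {r<..<t} s * f s"
     using P
    proof eventually_elim
     case (elim s)
     show ?case
     proof (cases "s \<in> {r<..<t}")
      case True
      then have "J < (t - r) * f s" using n elim by (meson greaterThanLessThan_iff not_le)
      then show ?thesis using True rt by (simp add: field_simps)
     qed simp
    qed
   qed (use prim_integrable[OF f] prim_integrable[of T "\<lambda>_. J / (t - r)"] in auto)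
   then have "J / (t - r) * (t - r) \<le> prim T f t - prim T f r"
    using prim_diff[OF f, of r t] prim_diff[of T "\<lambda>_. J / (t - r)" r t] prim_const[of r t T "J / (t - r)"] rt by simp
   then show ?thesis using rt by (intro mult_left_mono) auto
  qed
  have "prim T (\<lambda>s. f s + 1) t - prim T (\<lambda>s. f s + 1) r \<le> J"
  proof -
   have fi: "integrable (\<mu> T) (\<lambda>s. f s + 1)" using f by simp
   have "(LINT s|\<mu> T. indicator {r<..<t} s * (f s + 1)) \<le> (LINT s|\<mu> T. indicator {r<..<t} s * g s)"
   proof (rule integral_mono_AE)
    show "AE s in \<mu> T. indicator {r<..<t} s * (f s + 1) \<le> indicator {r<..<t} s * g s"
     using fg by eventually_elim (simp add: indicator_def)
   qed (use prim_integrable[OF fi] prim_integrable[OF g] in auto)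
   then show ?thesis unfolding J_def using prim_diff[OF fi, of r t] prim_diff[OF g, of r t] rt by simp
  qed
  moreover have "prim T (\<lambda>s. f s + 1) t - prim T (\<lambda>s. f s + 1) r = prim T f t - prim T f r + (t - r)"
  proof -
   have "(LINT s|\<mu> T. indicator {r<..<t} s * (f s + 1)) = (LINT s|\<mu> T. indicator {r<..<t} s * f s + indicator {r<..<t} s * 1)"
    by (simp add: distrib_left)
   also have "\<dots> = (LINT s|\<mu> T. indicator {r<..<t} s * f s) + (LINT s|\<mu> T. indicator {r<..<t} s * 1)"
    using prim_integrable[OF f, of "{r<..<t}"] prim_integrable[of T "\<lambda>_. 1" "{r<..<t}"] by (intro Bochner_Integration.integral_add) auto
   finally show ?thesis
    using prim_diff[of T "\<lambda>s. f s + 1" r t] prim_diff[OF f, of r t] prim_diff[of T "\<lambda>_. 1" r t] prim_const[of r t T 1] f rt by simp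
  qed
  moreover have "prim T f t - prim T f r \<ge> J" using 1 rt by (simp add: mult_le_cancel_left)
  ultimately show False using rt by simp
 qed
 then show ?thesis using that unfolding J_def by blast
qed

context bounded_domain begin

text \<open>The squared increment is bounded through the primitive of
  \<open>1 + (k t)\<^sup>2 + N2 t\<close>, up to a term with the H^1 norm at one of the two times,
  which has no pointwise control. Both times are therefore compared with an intermediate one where
  this norm is small.\<close>

lemma evolves_modulus:
 assumes w: "evolves T w l k"
 obtains m G where "integrable (\<mu> T) m" "AE t in \<mu> T. 0 \<le> m t" "AE t in \<mu> T. t \<in> G" "\<And>t. t \<in> G \<Longrightarrow> w t \<in> L2 U"
  "\<And>s t. s \<in> G \<Longrightarrow> t \<in> G \<Longrightarrow> 0 < s \<Longrightarrow> s \<le> t \<Longrightarrow> t < T \<Longrightarrow>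
   (L2_norm U (\<lambda>x. w t x - w s x))\<^sup>2 \<le> 12 * (prim T m t - prim T m s)"
proof -
 note e = evolvesD[OF w]
 define N2 where "N2 t = (H1_norm U (w t))\<^sup>2" for t
 define m where "m t = 1 + (k t)\<^sup>2 + N2 t" for t
 have Ni: "integrable (\<mu> T) N2" unfolding N2_def by (rule H.bochnerD(2)[OF e(3)])
 have ki: "integrable (\<mu> T) (\<lambda>t. (k t)\<^sup>2)" by (rule H.L2_functionalD(3)[OF e(4)])
 have mi: "integrable (\<mu> T) m" unfolding m_def using Ni ki by simp
 have mnn: "AE t in \<mu> T. 0 \<le> m t" by (intro AE_I2) (simp add: m_def N2_def)
 define p where "p t = l t (w t)" for t
 have pi: "integrable (\<mu> T) p" unfolding p_def by (rule H.pairing_integrable(1)[OF e(4,3)])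
 obtain c0 where c0: "AE t in \<mu> T. (LINT x|\<mu>U. (w t x)\<^sup>2 / 2) = c0 + prim T p t"
  unfolding p_def by (rule energy_identity[OF w potential_square]) (use e(2) in simp_all)
 obtain D \<gamma> where D: "D \<subseteq> H10 U" and ae:
  "AE t in \<mu> T. w t \<in> H10 U \<and> w t \<in> L2 U \<and> (\<exists>d. (\<forall>n. d n \<in> D) \<and> (\<lambda>n. H1_norm U (\<lambda>x. d n x - w t x)) \<longlonglongrightarrow> 0)
   \<and> (\<forall>z\<in>D. L2_inner U (w t) z = \<gamma> z + prim T (\<lambda>s. l s z) t)"
  by (rule evolves_good[OF w e(2)])
 define G where "G = {t. w t \<in> H10 U \<and> w t \<in> L2 U \<and> (\<exists>d. (\<forall>n. d n \<in> D) \<and> (\<lambda>n. H1_norm U (\<lambda>x. d n x - w t x)) \<longlonglongrightarrow> 0)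
   \<and> (\<forall>z\<in>D. L2_inner U (w t) z = \<gamma> z + prim T (\<lambda>s. l s z) t) \<and> (LINT x|\<mu>U. (w t x)\<^sup>2 / 2) = c0 + prim T p t}"
 have G: "AE t in \<mu> T. t \<in> G" using ae c0 by eventually_elim (auto simp: G_def)
 have GL: "w t \<in> L2 U" "w t \<in> H10 U" if "t \<in> G" for t using that by (auto simp: G_def)
 have en: "L2_inner U (w t) (w t) = 2 * c0 + 2 * prim T p t" if "t \<in> G" for t
 proof -
  have "(LINT x|\<mu>U. (w t x)\<^sup>2 / 2) = c0 + prim T p t" using that by (simp add: G_def)
  then show ?thesis by (simp add: L2_inner_def power2_eq_square)
 qed
 have inc: "L2_inner U (\<lambda>x. w t x - w r x) (w r) = prim T (\<lambda>s. l s (w r)) t - prim T (\<lambda>s. l s (w r)) r"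
  if t: "t \<in> G" and r: "r \<in> G" for t r
 proof -
  obtain d where d: "\<And>n. d n \<in> D" "(\<lambda>n. H1_norm U (\<lambda>x. d n x - w r x)) \<longlonglongrightarrow> 0" using r unfolding G_def by blast
  show ?thesis
   by (rule increment_extend[OF e(4) GL(1)[OF t] GL(1)[OF r] GL(2)[OF r] d(1) D d(2), of \<gamma>]) (use t r in \<open>simp_all add: G_def\<close>)
 qed
 text \<open>Polarisation turns the energy identity into
  \<open>|w t - w r|\<^sup>2 = 2 \<integral>\<^sub>r\<^sup>t l\<^sub>s (w s - w r) ds\<close>.\<close>
 have near: "(L2_norm U (\<lambda>x. w t x - w r x))\<^sup>2 \<le> 3 * (prim T m b - prim T m a)"
  if t: "t \<in> G" and r: "r \<in> G" and ab: "0 < a" "b < T" "a \<le> t" "t \<le> b" "a \<le> r" "r \<le> b"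
   and small: "(b - a) * N2 r \<le> prim T m b - prim T m a" for t r a b
 proof -
  define q where "q s = l s (w r)" for s
  have qi: "integrable (\<mu> T) q" unfolding q_def by (rule H.functional_integrable[OF e(4) GL(2)[OF r]])
  have L: "w t \<in> L2 U" "w r \<in> L2 U" using GL t r by auto
  have "(L2_norm U (\<lambda>x. w t x - w r x))\<^sup>2 = L2_inner U (w t) (w t) - L2_inner U (w r) (w r) - 2 * L2_inner U (\<lambda>x. w t x - w r x) (w r)"
   unfolding L2_norm_square using L L2_inner_commute[of U "w t" "w r"] by (simp add: L2_inner_diff L2_diff)
  also have "\<dots> = 2 * (prim T p t - prim T p r) - 2 * (prim T q t - prim T q r)"
   using en[OF t] en[OF r] inc[OF t r] by (simp add: q_def[abs_def])
  finally have eq: "(L2_norm U (\<lambda>x. w t x - w r x))\<^sup>2 = 2 * (prim T p t - prim T p r) - 2 * (prim T q t - prim T q r)" .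
  have p_le: "AE s in \<mu> T. \<bar>p s\<bar> \<le> m s / 2"
   using H.pairing_bound[OF e(4,3)]
  proof eventually_elim
   case (elim s)
   then show ?case using sum_squares_bound[of "k s" "H1_norm U (w s)"] by (simp add: p_def m_def N2_def)
  qed
  define gq where "gq s = (m s + N2 r) / 2" for s
  have gi: "integrable (\<mu> T) gq" unfolding gq_def using mi by simp
  have q_le: "AE s in \<mu> T. \<bar>q s\<bar> \<le> gq s"
   using H.L2_functionalD(4)[OF e(4)]
  proof eventually_elim
   case (elim s)
   have "\<bar>q s\<bar> \<le> k s * H1_norm U (w r)" unfolding q_def by (rule H.bdd_linear_simps(4)[OF elim GL(2)[OF r]])
   moreover have "0 \<le> N2 s" by (simp add: N2_def)
   ultimately show ?case using sum_squares_bound[of "k s" "H1_norm U (w r)"] by (simp add: gq_def m_def N2_def[of r])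
  qed
  define t1 where "t1 = min t r"
  define t2 where "t2 = max t r"
  have t12: "a \<le> t1" "t1 \<le> t2" "t2 \<le> b" using ab by (auto simp: t1_def t2_def)
  have m2i: "integrable (\<mu> T) (\<lambda>s. m s / 2)" using mi by simp
  have P: "\<bar>prim T p t - prim T p r\<bar> \<le> prim T (\<lambda>s. m s / 2) t2 - prim T (\<lambda>s. m s / 2) t1"
   using integral_interval_le[OF pi m2i p_le t12(2)] by (auto simp: t1_def t2_def min_def max_def abs_minus_commute split: if_splits)
  have Q: "\<bar>prim T q t - prim T q r\<bar> \<le> prim T gq t2 - prim T gq t1"
   using integral_interval_le[OF qi gi q_le t12(2)] by (auto simp: t1_def t2_def min_def max_def abs_minus_commute split: if_splits)
  have mono: "prim T f t2 - prim T f t1 \<le> prim T f b - prim T f a" if f: "integrable (\<mu> T) f" "AE s in \<mu> T. 0 \<le> f s" for f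
  proof -
   have ae: "AE s in \<mu> T. \<bar>f s\<bar> \<le> f s" using f(2) by eventually_elim simp
   show ?thesis
    using integral_interval_le[OF f(1) f(1) ae t12(1)] integral_interval_le[OF f(1) f(1) ae t12(3)] by linarith
  qed
  have Pb: "prim T (\<lambda>s. m s / 2) t2 - prim T (\<lambda>s. m s / 2) t1 \<le> (prim T m b - prim T m a) / 2"
   using mono[OF mi mnn] by (simp add: prim_def diff_divide_distrib)
  have Qb: "prim T gq b - prim T gq a = (prim T m b - prim T m a) / 2 + N2 r * (b - a) / 2"
  proof -
   have 1: "prim T gq s = prim T m s / 2 + prim T (\<lambda>_. N2 r) s / 2" for s
   proof -
    have "prim T gq s = (LINT x|\<mu> T. indicator {..s} x * m x / 2 + indicator {..s} x * N2 r / 2)"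
     unfolding prim_def gq_def by (simp add: algebra_simps add_divide_distrib)
    also have "\<dots> = (LINT x|\<mu> T. indicator {..s} x * m x / 2) + (LINT x|\<mu> T. indicator {..s} x * N2 r / 2)"
     using prim_integrable[OF mi, of "{..s}"] prim_integrable[of T "\<lambda>_. N2 r" "{..s}"]
     by (intro Bochner_Integration.integral_add) auto
    finally show ?thesis unfolding prim_def by simp
   qed
   show ?thesis unfolding 1 using prim_const[of a b T "N2 r"] ab by (simp add: field_simps)
  qed
  have gnn: "AE s in \<mu> T. 0 \<le> gq s" using mnn by eventually_elim (simp add: gq_def N2_def)
  have "(L2_norm U (\<lambda>x. w t x - w r x))\<^sup>2 \<le> 2 * \<bar>prim T p t - prim T p r\<bar> + 2 * \<bar>prim T q t - prim T q r\<bar>"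
  proof -
   have "2 * x - 2 * y \<le> 2 * \<bar>x\<bar> + 2 * \<bar>y\<bar>" for x y :: real by linarith
   then show ?thesis unfolding eq .
  qed
  also have "\<dots> \<le> (prim T m b - prim T m a) + (prim T m b - prim T m a) + N2 r * (b - a)"
  proof -
   have "2 * x + 2 * y \<le> M + M + n" if "x \<le> p" "p \<le> M / 2" "y \<le> q" "q \<le> r" "r = M / 2 + n / 2" for x y p q r M n :: real
    using that by linarith
   from this[OF P Pb Q mono[OF gi gnn] Qb] show ?thesis .
  qed
  also have "\<dots> \<le> 3 * (prim T m b - prim T m a)" using small by (simp add: mult.commute)
  finally show ?thesis .
 qed
 have "(L2_norm U (\<lambda>x. w t x - w s x))\<^sup>2 \<le> 12 * (prim T m t - prim T m s)"
  if st: "s \<in> G" "t \<in> G" "0 < s" "s \<le> t" "t < T" for s t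
 proof (cases "s = t")
  case True
  then show ?thesis by (simp add: L2_norm_def L2_inner_def)
 next
  case False
  have fg: "AE t in \<mu> T. N2 t + 1 \<le> m t" by (intro AE_I2) (simp add: m_def)
  \<comment> \<open>\<open>N2 r\<close> is at most the mean of \<open>m\<close> over the interval,
    as \<open>near\<close> requires. Two comparisons with constant 3 and the square of a sum of two
    terms give \<open>2 * (3 + 3) = 12\<close>.\<close>
  obtain r where r: "s < r" "r < t" "r \<in> G" "(t - s) * N2 r \<le> prim T m t - prim T m s"
   by (rule exists_small[OF Ni mi fg G, of s t]) (use st False in auto)
  have L: "w t \<in> L2 U" "w s \<in> L2 U" "w r \<in> L2 U" using GL st r by auto
  note n1 = near[OF st(2) r(3) st(3,5) st(4) order_refl less_imp_le[OF r(1)] less_imp_le[OF r(2)] r(4)]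
  note n2 = near[OF st(1) r(3) st(3,5) order_refl st(4) less_imp_le[OF r(1)] less_imp_le[OF r(2)] r(4)]
  define A where "A = L2_norm U (\<lambda>x. w t x - w r x)"
  define B where "B = L2_norm U (\<lambda>x. w s x - w r x)"
  have "L2_norm U (\<lambda>x. w t x - w s x) \<le> A + B"
   using L.N_triangle[OF L(1,3,2)] L.N_diff_commute[OF L(3,2)] by (simp add: A_def B_def)
  then have "(L2_norm U (\<lambda>x. w t x - w s x))\<^sup>2 \<le> (A + B)\<^sup>2" by (intro power_mono L2_norm_nonneg)
  also have "\<dots> \<le> 2 * A\<^sup>2 + 2 * B\<^sup>2" using sum_squares_bound[of A B] by (simp add: power2_sum)
  finally show ?thesis using n1 n2 unfolding A_def[symmetric] B_def[symmetric] by linarith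
 qed
 then show ?thesis using that[OF mi mnn G GL(1)] by blast
qed

text \<open>On a set of times of full measure \<open>w\<close> has the modulus of continuity \<rho>
  in L2; completeness extends it to the closed interval, ends included.\<close>

lemma continuous_rep_exists:
 assumes w: "evolves T w l k"
 obtains c where "continuous_rep T U w c"
proof -
 note e = evolvesD[OF w]
 obtain m G where m: "integrable (\<mu> T) m" "AE t in \<mu> T. 0 \<le> m t" "AE t in \<mu> T. t \<in> G" "\<And>t. t \<in> G \<Longrightarrow> w t \<in> L2 U"
  and mod: "\<And>s t. s \<in> G \<Longrightarrow> t \<in> G \<Longrightarrow> 0 < s \<Longrightarrow> s \<le> t \<Longrightarrow> t < T \<Longrightarrow>
   (L2_norm U (\<lambda>x. w t x - w s x))\<^sup>2 \<le> 12 * (prim T m t - prim T m s)"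
  by (rule evolves_modulus[OF w]) blast
 define M where "M = prim T m"
 define \<rho> where "\<rho> s t = sqrt (12 * \<bar>M t - M s\<bar>)" for s t
 have Mc: "continuous_on UNIV M" unfolding M_def by (rule prim_continuous[OF m(1)])
 have mod': "L2_norm U (\<lambda>x. w t x - w s x) \<le> \<rho> s t" if st: "s \<in> G" "t \<in> G" "0 < s" "s < T" "0 < t" "t < T" for s t
 proof -
  have 1: "(L2_norm U (\<lambda>x. w t x - w s x))\<^sup>2 \<le> 12 * \<bar>M t - M s\<bar>"
  proof (cases "s \<le> t")
   case True
   have "a \<le> 12 * \<bar>d\<bar>" if "a \<le> 12 * d" for a d :: real using that by linarith
   then show ?thesis using mod[OF st(1,2,3) True st(6)] unfolding M_def by blast
  next
   case False
   then have "(L2_norm U (\<lambda>x. w s x - w t x))\<^sup>2 \<le> 12 * (prim T m s - prim T m t)" using mod[OF st(2,1,5) _ st(4)] by simp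
   moreover have "a \<le> 12 * \<bar>d - d'\<bar>" if "a \<le> 12 * (d' - d)" for a d d' :: real using that by (auto simp: abs_if)
   ultimately show ?thesis unfolding M_def L2_norm_diff_commute[of U "w t" "w s"] by blast
  qed
  then show ?thesis unfolding \<rho>_def by (rule real_le_rsqrt)
 qed
 have \<rho>_lim: "(\<lambda>n. \<rho> (f n) t) \<longlonglongrightarrow> \<rho> s t" if "f \<longlonglongrightarrow> s" for f s t
  unfolding \<rho>_def using continuous_on_tendsto_compose[OF Mc that] by (intro tendsto_intros) auto
 have "\<exists>s. (\<forall>n. s n \<in> G \<and> 0 < s n \<and> s n < T) \<and> s \<longlonglongrightarrow> \<tau>" if \<tau>: "\<tau> \<in> {0..T}" for \<tau>
 proof -
  have "\<exists>s. s \<in> G \<and> 0 < s \<and> s < T \<and> \<bar>s - \<tau>\<bar> \<le> 1 / real (Suc n)" for n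
  proof -
   define p where "p = 1 / real (Suc n)"
   define a where "a = max 0 (\<tau> - p)"
   define b where "b = min T (\<tau> + p)"
   have p: "p > 0" by (simp add: p_def)
   have ab: "0 \<le> a" "a < b" "b \<le> T" "\<tau> - p \<le> a" "b \<le> \<tau> + p"
    using \<tau> e(1) p unfolding a_def b_def by (auto simp: max_def min_def)
   obtain s where "a < s" "s < b" "s \<in> G" by (rule AE_time_obtain[OF m(3) ab(1-3)])
   then show ?thesis unfolding p_def[symmetric] using ab by (intro exI[of _ s]) (auto simp: abs_le_iff)
  qed
  then obtain s where s: "\<And>n. s n \<in> G \<and> 0 < s n \<and> s n < T" "\<And>n. norm (s n - \<tau>) \<le> 1 / real (Suc n)"
   by (metis real_norm_def)
  have "s \<longlonglongrightarrow> \<tau>"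
   by (rule LIM_zero_cancel[OF Lim_null_comparison[OF always_eventually[OF allI[OF s(2)]] LIMSEQ_Suc[OF lim_1_over_n]]])
  then show ?thesis using s(1) by blast
 qed
 then obtain s where s: "\<And>\<tau> n. \<tau> \<in> {0..T} \<Longrightarrow> s \<tau> n \<in> G \<and> 0 < s \<tau> n \<and> s \<tau> n < T" "\<And>\<tau>. \<tau> \<in> {0..T} \<Longrightarrow> s \<tau> \<longlonglongrightarrow> \<tau>"
  by metis
 have "\<exists>z. z \<in> L2 U \<and> (\<lambda>n. L2_norm U (\<lambda>x. w (s \<tau> n) x - z x)) \<longlonglongrightarrow> 0" if \<tau>: "\<tau> \<in> {0..T}" for \<tau>
 proof -
  have cauchy: "\<exists>N. \<forall>i\<ge>N. \<forall>j\<ge>N. L2_norm U (\<lambda>x. w (s \<tau> i) x - w (s \<tau> j) x) < \<epsilon>" if \<epsilon>: "\<epsilon> > 0" for \<epsilon>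
  proof -
   have "(\<lambda>n. M (s \<tau> n)) \<longlonglongrightarrow> M \<tau>" using continuous_on_tendsto_compose[OF Mc s(2)[OF \<tau>]] by auto
   then have "Cauchy (\<lambda>n. M (s \<tau> n))" by (rule LIMSEQ_imp_Cauchy)
   moreover have "\<epsilon>\<^sup>2 / 12 > 0" using \<epsilon> by simp
   ultimately obtain N where N: "\<And>i j. i \<ge> N \<Longrightarrow> j \<ge> N \<Longrightarrow> \<bar>M (s \<tau> i) - M (s \<tau> j)\<bar> < \<epsilon>\<^sup>2 / 12"
    unfolding Cauchy_def dist_real_def by meson
   show ?thesis
   proof (intro exI[of _ N] allI impI)
    fix i j assume ij: "N \<le> i" "N \<le> j"
    have "\<rho> (s \<tau> j) (s \<tau> i) < sqrt (\<epsilon>\<^sup>2)" unfolding \<rho>_def using N[OF ij] by (intro real_sqrt_less_mono) simp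
    then show "L2_norm U (\<lambda>x. w (s \<tau> i) x - w (s \<tau> j) x) < \<epsilon>"
     using mod'[of "s \<tau> j" "s \<tau> i"] s(1)[OF \<tau>, of i] s(1)[OF \<tau>, of j] \<epsilon> by simp
   qed
  qed
  obtain z where "z \<in> L2 U" "(\<lambda>n. L2_norm U (\<lambda>x. w (s \<tau> n) x - z x)) \<longlonglongrightarrow> 0"
   by (rule L2_complete[OF m(4) lmeasurable_U cauchy]) (use s(1)[OF \<tau>] in auto)
  then show ?thesis by blast
 qed
 then obtain c where c: "\<And>\<tau>. \<tau> \<in> {0..T} \<Longrightarrow> c \<tau> \<in> L2 U" "\<And>\<tau>. \<tau> \<in> {0..T} \<Longrightarrow> (\<lambda>n. L2_norm U (\<lambda>x. w (s \<tau> n) x - c \<tau> x)) \<longlonglongrightarrow> 0"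
  by metis
 have dist_good: "L2_norm U (\<lambda>x. w t x - c \<tau> x) \<le> \<rho> \<tau> t" if t: "t \<in> G" "0 < t" "t < T" and \<tau>: "\<tau> \<in> {0..T}" for t \<tau>
 proof (rule LIMSEQ_le_const)
  have "(\<lambda>n. \<rho> (s \<tau> n) t + L2_norm U (\<lambda>x. w (s \<tau> n) x - c \<tau> x)) \<longlonglongrightarrow> \<rho> \<tau> t + 0"
   by (intro tendsto_add \<rho>_lim s(2) c(2) \<tau>)
  then show "(\<lambda>n. \<rho> (s \<tau> n) t + L2_norm U (\<lambda>x. w (s \<tau> n) x - c \<tau> x)) \<longlonglongrightarrow> \<rho> \<tau> t" by simp
  show "\<exists>N. \<forall>n\<ge>N. L2_norm U (\<lambda>x. w t x - c \<tau> x) \<le> \<rho> (s \<tau> n) t + L2_norm U (\<lambda>x. w (s \<tau> n) x - c \<tau> x)"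
  proof (intro exI[of _ 0] allI impI)
   fix n
   show "L2_norm U (\<lambda>x. w t x - c \<tau> x) \<le> \<rho> (s \<tau> n) t + L2_norm U (\<lambda>x. w (s \<tau> n) x - c \<tau> x)"
    using L.N_triangle[OF m(4)[OF t(1)] m(4) c(1)[OF \<tau>], of "s \<tau> n"] mod'[of "s \<tau> n" t] s(1)[OF \<tau>, of n] t by simp
  qed
 qed
 have dist_all: "L2_norm U (\<lambda>x. c \<sigma> x - c \<tau> x) \<le> \<rho> \<sigma> \<tau>" if \<sigma>: "\<sigma> \<in> {0..T}" and \<tau>: "\<tau> \<in> {0..T}" for \<sigma> \<tau>
 proof (rule LIMSEQ_le_const)
  have sym: "\<rho> \<tau> t = \<rho> t \<tau>" for t by (simp add: \<rho>_def abs_minus_commute)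
  have "(\<lambda>n. L2_norm U (\<lambda>x. w (s \<sigma> n) x - c \<sigma> x) + \<rho> (s \<sigma> n) \<tau>) \<longlonglongrightarrow> 0 + \<rho> \<sigma> \<tau>"
   by (intro tendsto_add \<rho>_lim s(2) c(2) \<sigma>)
  then show "(\<lambda>n. L2_norm U (\<lambda>x. w (s \<sigma> n) x - c \<sigma> x) + \<rho> (s \<sigma> n) \<tau>) \<longlonglongrightarrow> \<rho> \<sigma> \<tau>" by simp
  show "\<exists>N. \<forall>n\<ge>N. L2_norm U (\<lambda>x. c \<sigma> x - c \<tau> x) \<le> L2_norm U (\<lambda>x. w (s \<sigma> n) x - c \<sigma> x) + \<rho> (s \<sigma> n) \<tau>"
  proof (intro exI[of _ 0] allI impI)
   fix n
   have g: "s \<sigma> n \<in> G" "0 < s \<sigma> n" "s \<sigma> n < T" using s(1)[OF \<sigma>, of n] by auto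
   show "L2_norm U (\<lambda>x. c \<sigma> x - c \<tau> x) \<le> L2_norm U (\<lambda>x. w (s \<sigma> n) x - c \<sigma> x) + \<rho> (s \<sigma> n) \<tau>"
    using L.N_triangle[OF c(1)[OF \<sigma>] m(4)[OF g(1)] c(1)[OF \<tau>]] L.N_diff_commute[OF c(1)[OF \<sigma>] m(4)[OF g(1)]]
     dist_good[OF g \<tau>] sym[of "s \<sigma> n"] by simp
  qed
 qed
 have "continuous_rep T U w c"
  unfolding continuous_rep_def
 proof (intro conjI ballI)
  show "c t \<in> L2 U" if "t \<in> {0..T}" for t by (rule c(1)[OF that])
  fix t assume t: "t \<in> {0..T}"
  have "((\<lambda>s. \<rho> s t) \<longlongrightarrow> \<rho> t t) (at t within {0..T})"
   unfolding \<rho>_def using Mc t continuous_on_subset[OF Mc, of "{0..T}"]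
   by (intro tendsto_intros) (auto simp: continuous_on_def)
  then have l: "((\<lambda>s. \<rho> s t) \<longlongrightarrow> 0) (at t within {0..T})" by (simp add: \<rho>_def)
  show "((\<lambda>s. L2_norm U (c s - c t)) \<longlongrightarrow> 0) (at t within {0..T})"
  proof (rule Lim_null_comparison[OF _ l])
   show "\<forall>\<^sub>F s in at t within {0..T}. norm (L2_norm U (c s - c t)) \<le> \<rho> s t"
    unfolding eventually_at_filter using dist_all[OF _ t]
    by (intro always_eventually) (auto simp: fun_diff_def L2_norm_nonneg)
  qed
 next
  show "ae_eq T U w c"
   unfolding ae_eq_def using m(3) AE_space
  proof eventually_elim
   case (elim t)
   then have t: "t \<in> G" "0 < t" "t < T" "t \<in> {0..T}" by auto
   have "L2_norm U (\<lambda>x. w t x - c t x) \<le> 0" using dist_good[OF t] by (simp add: \<rho>_def)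
   then have "L2_norm U (\<lambda>x. w t x - c t x) = 0" using L2_norm_nonneg[of U "\<lambda>x. w t x - c t x"] by simp
   then have "AE x in \<mu>U. w t x - c t x = 0" using L2_norm_eq_0[OF L2_diff[OF m(4)[OF t(1)] c(1)[OF t(4)]]] by blast
   then show ?case by eventually_elim simp
  qed
 qed
 then show ?thesis by (rule that)
qed

end

section \<open>Time derivatives and traces\<close>

lemma AE_time_eq_0:
 assumes f: "integrable (\<mu> T) f"
  and 0: "\<And>\<phi>. \<phi> \<in> test_functions {0<..<T} \<Longrightarrow> (LINT t|\<mu> T. f t * \<phi> t) = 0"
 shows "AE t in \<mu> T. f t = (0::real)"
proof (rule AE_eq_0_if_test[OF _ _ 0])
 show "f absolutely_integrable_on K" if "compact K" "K \<subseteq> {0<..<T}" for K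
 proof -
  have "f absolutely_integrable_on {0<..<T}" using f by (simp add: integrable_lebesgue_on_iff)
  then show ?thesis using that lmeasurable_compact[of K] by (rule_tac set_integrable_subset) auto
 qed
qed auto

lemma test_times_integrable:
 assumes f: "f \<in> test_functions U" and q: "integrable (\<mu> T) q"
 shows "integrable (\<mu> T) (\<lambda>t. f t * q t)"
proof -
 obtain C where C: "\<And>x. \<bar>f x\<bar> \<le> C" "C > 0" by (rule test_functions_bounded[OF f]) blast
 note [measurable] = test_functions_measurable[OF f]
 show ?thesis
 proof (rule Bochner_Integration.integrable_bound)
  show "integrable (\<mu> T) (\<lambda>t. C * q t)" using q by simp
  show "AE t in \<mu> T. norm (f t * q t) \<le> norm (C * q t)"
   unfolding norm_mult using C by (intro AE_I2 mult_right_mono) auto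
 qed (use q in measurable)
qed

context bounded_domain begin

lemma Hm1_cong:
 assumes "\<And>v. v \<in> H10 U \<Longrightarrow> l v = l' v"
 shows "l \<in> Hm1 U \<longleftrightarrow> l' \<in> Hm1 U" "Hm1_norm U l = Hm1_norm U l'"
proof -
 have "H10_linear k l \<longleftrightarrow> H10_linear k l'" for k
  unfolding bdd_linear_def using assms H10_add H10_mult by (intro conj_cong ball_cong all_cong refl) auto
 then show "l \<in> Hm1 U \<longleftrightarrow> l' \<in> Hm1 U" by (simp add: Hm1_iff)
 show "Hm1_norm U l = Hm1_norm U l'"
  unfolding Hm1_norm_def using assms by (intro SUP_cong) auto
qed

text \<open>Identities such as splitting the inner product with a difference hold for almost every
  time and on \<open>H10\<close> only, which is all that membership depends on.\<close>

lemma L2_Hm1_cong: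
 assumes g: "g \<in> L2_Hm1 T U" and eq: "AE t in \<mu> T. \<forall>v\<in>H10 U. g' t v = g t v"
 shows "g' \<in> L2_Hm1 T U"
proof -
 note g' = g[unfolded L2_Hm1_def]
 obtain s where s: "\<And>n. simple_function (\<mu> T) (s n)" "\<And>n t. t \<in> {0<..<T} \<Longrightarrow> s n t \<in> Hm1 U"
  "AE t in \<mu> T. (\<lambda>n. Hm1_norm U (\<lambda>x. s n t x - g t x)) \<longlonglongrightarrow> 0"
  by (rule M.bochnerE[OF g']) blast
 show ?thesis
  unfolding L2_Hm1_def
 proof (rule M.bochnerI[OF _ s(1,2)])
  show "AE t in \<mu> T. g' t \<in> Hm1 U"
   using M.bochnerD(1)[OF g'] eq by eventually_elim (use Hm1_cong(1) in blast)
  show "AE t in \<mu> T. (\<lambda>n. Hm1_norm U (\<lambda>x. s n t x - g' t x)) \<longlonglongrightarrow> 0"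
   using s(3) eq
  proof eventually_elim
   case (elim t)
   have "Hm1_norm U (\<lambda>x. s n t x - g' t x) = Hm1_norm U (\<lambda>x. s n t x - g t x)" for n
    using elim(2) by (intro Hm1_cong(2)) simp
   then show ?case using elim(1) by simp
  qed
  show "AE t in \<mu> T. (Hm1_norm U (g' t))\<^sup>2 \<le> (Hm1_norm U (g t))\<^sup>2"
   using eq
  proof eventually_elim
   case (elim t)
   then have "Hm1_norm U (g' t) = Hm1_norm U (g t)" by (intro Hm1_cong(2)) simp
   then show ?case by simp
  qed
 qed (assumption | rule M.bochnerD(2)[OF g'])+
qed

lemma X_inner_integrable:
 assumes u: "u \<in> X_space T U" and v: "v \<in> L2 U"
 shows "integrable (\<mu> T) (\<lambda>t. L2_inner U (u t) v)"
 using H.pairing_integrable(1)[OF const_functional[OF L2_bdd_linear[OF v]] u[unfolded X_space_def]]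
 by (simp add: L2_inner_commute)

lemma X_spaceD:
 assumes u: "u \<in> X_space T U"
 shows "u \<in> bochner_L2 T (H10 U) (H1_norm U)" "AE t in \<mu> T. u t \<in> H10 U" "AE t in \<mu> T. u t \<in> H1 U" "AE t in \<mu> T. u t \<in> L2 U"
proof -
 show u': "u \<in> bochner_L2 T (H10 U) (H1_norm U)" using u by (simp add: X_space_def)
 show *: "AE t in \<mu> T. u t \<in> H10 U" by (rule H.bochnerD(1)[OF u'])
 then show "AE t in \<mu> T. u t \<in> H1 U" by eventually_elim (rule H10_H1)
 then show "AE t in \<mu> T. u t \<in> L2 U" by eventually_elim (rule H1D(1))
qed

lemma Y_spaceD:
 assumes "m \<in> Y_space T U"
 shows "m \<in> X_space T U" "(\<lambda>t. L2_inner U (m t)) \<in> L2_Hm1 T U" "time_deriv T U m \<in> L2_Hm1 T U"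
  "is_time_deriv T U (\<lambda>t. L2_inner U (m t)) (time_deriv T U m)"
proof -
 show "m \<in> X_space T U" "(\<lambda>t. L2_inner U (m t)) \<in> L2_Hm1 T U"
  using assms by (auto simp: Y_space_def H1_Hm1_def)
 have "\<exists>w. w \<in> L2_Hm1 T U \<and> is_time_deriv T U (\<lambda>t. L2_inner U (m t)) w"
  using assms by (auto simp: Y_space_def H1_Hm1_def)
 from someI_ex[OF this] show "time_deriv T U m \<in> L2_Hm1 T U"
  "is_time_deriv T U (\<lambda>t. L2_inner U (m t)) (time_deriv T U m)"
  unfolding time_deriv_def by blast+
qed

lemma evolvesI:
 assumes T: "T > 0" and w: "w \<in> X_space T U" and l: "X_functional T l k"
  and eq: "\<And>\<phi> v. \<phi> \<in> test_functions {0<..<T} \<Longrightarrow> v \<in> H10 U \<Longrightarrow>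
   (LINT t|\<mu> T. deriv \<phi> t * L2_inner U (w t) v) = - (LINT t|\<mu> T. \<phi> t * l t v)"
 shows "evolves T w l k"
 unfolding evolves_def
proof (intro conjI ballI T w l)
 fix v assume v: "v \<in> H10 U"
 obtain c where "AE t in \<mu> T. L2_inner U (w t) v = c + prim T (\<lambda>s. l s v) t"
  by (rule weak_deriv_primitive[OF T X_inner_integrable[OF w H1D(1)[OF H10_H1[OF v]]] H.functional_integrable[OF l v] eq[OF _ v]])
 then show "\<exists>c. AE t in \<mu> T. L2_inner U (w t) v = c + prim T (\<lambda>s. l s v) t" by blast
qed

lemma Y_evolves:
 assumes "T > 0" "m \<in> Y_space T U"
 shows "evolves T m (time_deriv T U m) (\<lambda>t. Hm1_norm U (time_deriv T U m t))"
proof (rule evolvesI[OF assms(1) Y_spaceD(1)[OF assms(2)] L2_Hm1_functional[OF Y_spaceD(3)[OF assms(2)]]])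
 show "(LINT t|\<mu> T. deriv \<phi> t * L2_inner U (m t) v) = - (LINT t|\<mu> T. \<phi> t * time_deriv T U m t v)"
  if "\<phi> \<in> test_functions {0<..<T}" "v \<in> H10 U" for \<phi> v
  using Y_spaceD(4)[OF assms(2)] that unfolding is_time_deriv_def by blast
qed

text \<open>\<open>time_deriv\<close> is a choice; this lets any other derivative replace it under a
  pairing. For fixed \<open>v\<close> the two agree by the fundamental lemma, and
  \<open>functional_eq_extend\<close> admits time-dependent arguments.\<close>

lemma time_deriv_eq:
 assumes m: "m \<in> Y_space T U" and g: "g \<in> L2_Hm1 T U" "is_time_deriv T U (\<lambda>t. L2_inner U (m t)) g"
  and u: "u \<in> X_space T U"
 shows "AE t in \<mu> T. time_deriv T U m t (u t) = g t (u t)"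
proof (rule H.functional_eq_extend(1)[OF L2_Hm1_functional[OF Y_spaceD(3)[OF m]] L2_Hm1_functional[OF g(1)] _ X_spaceD(1)[OF u]])
 fix v assume v: "v \<in> H10 U"
 note i = H.functional_integrable[OF L2_Hm1_functional[OF Y_spaceD(3)[OF m]] v] H.functional_integrable[OF L2_Hm1_functional[OF g(1)] v]
 have "AE t in \<mu> T. time_deriv T U m t v - g t v = 0"
 proof (rule AE_time_eq_0)
  show "integrable (\<mu> T) (\<lambda>t. time_deriv T U m t v - g t v)" using i by simp
  fix \<phi> assume \<phi>: "\<phi> \<in> test_functions {0<..<T}"
  have "(LINT t|\<mu> T. \<phi> t * time_deriv T U m t v) = (LINT t|\<mu> T. \<phi> t * g t v)"
   using Y_spaceD(4)[OF m, unfolded is_time_deriv_def, rule_format, OF \<phi> v] g(2)[unfolded is_time_deriv_def, rule_format, OF \<phi> v] by linarith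
  moreover have "(LINT t|\<mu> T. (time_deriv T U m t v - g t v) * \<phi> t)
    = (LINT t|\<mu> T. \<phi> t * time_deriv T U m t v - \<phi> t * g t v)"
   by (intro Bochner_Integration.integral_cong refl) (simp add: algebra_simps)
  ultimately show "(LINT t|\<mu> T. (time_deriv T U m t v - g t v) * \<phi> t) = 0"
   using test_times_integrable[OF \<phi> i(1)] test_times_integrable[OF \<phi> i(2)] by simp
 qed
 then show "AE t in \<mu> T. time_deriv T U m t v = g t v" by eventually_elim simp
qed

lemma Y_diff:
 assumes m1: "m1 \<in> Y_space T U" and m2: "m2 \<in> Y_space T U"
 shows "(\<lambda>t x. m1 t x - m2 t x) \<in> Y_space T U"
  "is_time_deriv T U (\<lambda>t. L2_inner U (\<lambda>x. m1 t x - m2 t x)) (\<lambda>t v. time_deriv T U m1 t v - time_deriv T U m2 t v)"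
  "(\<lambda>t v. time_deriv T U m1 t v - time_deriv T U m2 t v) \<in> L2_Hm1 T U"
proof -
 note y1 = Y_spaceD[OF m1] and y2 = Y_spaceD[OF m2]
 have X: "(\<lambda>t x. m1 t x - m2 t x) \<in> X_space T U"
  using H.bochner_diff y1(1) y2(1) by (simp add: X_space_def)
 have ae: "AE t in \<mu> T. \<forall>v\<in>L2 U. L2_inner U (\<lambda>x. m1 t x - m2 t x) v = L2_inner U (m1 t) v - L2_inner U (m2 t) v"
  using X_spaceD(4)[OF y1(1)] X_spaceD(4)[OF y2(1)] by eventually_elim (simp add: L2_inner_diff)
 have "(\<lambda>t. L2_inner U (\<lambda>x. m1 t x - m2 t x)) \<in> L2_Hm1 T U"
 proof (rule L2_Hm1_cong)
  show "(\<lambda>t v. L2_inner U (m1 t) v - L2_inner U (m2 t) v) \<in> L2_Hm1 T U"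
   using M.bochner_diff y1(2) y2(2) by (simp add: L2_Hm1_def)
  show "AE t in \<mu> T. \<forall>v\<in>H10 U. L2_inner U (\<lambda>x. m1 t x - m2 t x) v = L2_inner U (m1 t) v - L2_inner U (m2 t) v"
   using ae by eventually_elim (use H10_H1 H1D(1) in blast)
 qed
 moreover show g: "(\<lambda>t v. time_deriv T U m1 t v - time_deriv T U m2 t v) \<in> L2_Hm1 T U"
  using M.bochner_diff y1(3) y2(3) by (simp add: L2_Hm1_def)
 moreover show td: "is_time_deriv T U (\<lambda>t. L2_inner U (\<lambda>x. m1 t x - m2 t x)) (\<lambda>t v. time_deriv T U m1 t v - time_deriv T U m2 t v)"
  unfolding is_time_deriv_def
 proof (intro ballI)
  fix \<phi> v assume \<phi>: "\<phi> \<in> test_functions {0<..<T}" and v: "v \<in> H10 U"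
  note vL = H1D(1)[OF H10_H1[OF v]]
  note d = test_functions_deriv(2)[OF \<phi>]
  note i1 = test_times_integrable[OF d X_inner_integrable[OF y1(1) vL]] test_times_integrable[OF d X_inner_integrable[OF y2(1) vL]]
  note i2 = test_times_integrable[OF \<phi> H.functional_integrable[OF L2_Hm1_functional[OF y1(3)] v]]
   test_times_integrable[OF \<phi> H.functional_integrable[OF L2_Hm1_functional[OF y2(3)] v]]
  have "(LINT t|\<mu> T. deriv \<phi> t * L2_inner U (\<lambda>x. m1 t x - m2 t x) v) = (LINT t|\<mu> T. deriv \<phi> t * L2_inner U (m1 t) v - deriv \<phi> t * L2_inner U (m2 t) v)"
  proof (rule integral_cong_AE)
   show "AE t in \<mu> T. deriv \<phi> t * L2_inner U (\<lambda>x. m1 t x - m2 t x) v = deriv \<phi> t * L2_inner U (m1 t) v - deriv \<phi> t * L2_inner U (m2 t) v"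
    using ae by eventually_elim (use vL in \<open>simp add: right_diff_distrib\<close>)
  qed (use i1 test_times_integrable[OF d X_inner_integrable[OF X vL]] in auto)
  also have "\<dots> = - (LINT t|\<mu> T. \<phi> t * time_deriv T U m1 t v) + (LINT t|\<mu> T. \<phi> t * time_deriv T U m2 t v)"
   using i1 y1(4) y2(4) \<phi> v unfolding is_time_deriv_def by simp
  also have "\<dots> = - (LINT t|\<mu> T. \<phi> t * (time_deriv T U m1 t v - time_deriv T U m2 t v))"
   using i2 by (simp add: right_diff_distrib)
  finally show "(LINT t|\<mu> T. deriv \<phi> t * L2_inner U (\<lambda>x. m1 t x - m2 t x) v) = - (LINT t|\<mu> T. \<phi> t * (time_deriv T U m1 t v - time_deriv T U m2 t v))" .
 qed
 ultimately show "(\<lambda>t x. m1 t x - m2 t x) \<in> Y_space T U"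
  using X by (auto simp: Y_space_def H1_Hm1_def)
qed

lemma L2_tendsto_inner:
 fixes c :: "real \<Rightarrow> 'a \<Rightarrow> real"
 assumes c: "\<And>t. t \<in> S \<Longrightarrow> c t \<in> L2 U" and t: "t \<in> S"
  and lim: "((\<lambda>s. L2_norm U (c s - c t)) \<longlongrightarrow> 0) (at t within S)" and v: "v \<in> L2 U"
 shows "((\<lambda>s. L2_inner U (c s) v) \<longlongrightarrow> L2_inner U (c t) v) (at t within S)"
proof (rule LIM_zero_cancel, rule Lim_null_comparison)
 show "((\<lambda>s. L2_norm U (c s - c t) * L2_norm U v) \<longlongrightarrow> 0) (at t within S)"
  using tendsto_mult_right[OF lim, of "L2_norm U v"] tendsto_mult[OF lim tendsto_const[of "L2_norm U v"]] by simp
 show "\<forall>\<^sub>F s in at t within S. norm (L2_inner U (c s) v - L2_inner U (c t) v) \<le> L2_norm U (c s - c t) * L2_norm U v"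
  unfolding eventually_at_filter
 proof (intro always_eventually allI impI)
  fix s assume s: "s \<noteq> t" "s \<in> S"
  show "norm (L2_inner U (c s) v - L2_inner U (c t) v) \<le> L2_norm U (c s - c t) * L2_norm U v"
   using L2_Cauchy_Schwarz[OF L2_diff[OF c[OF s(2)] c[OF t]] v] L2_inner_diff(2)[OF c[OF s(2)] c[OF t] v] by (simp add: fun_diff_def)
 qed
qed

lemma continuous_repD:
 assumes "continuous_rep T U m c"
 shows "\<And>t. t \<in> {0..T} \<Longrightarrow> c t \<in> L2 U" "\<And>t. t \<in> {0..T} \<Longrightarrow> ((\<lambda>s. L2_norm U (c s - c t)) \<longlongrightarrow> 0) (at t within {0..T})"
  "AE t in \<mu> T. AE x in \<mu>U. m t x = c t x"
 using assms by (auto simp: continuous_rep_def ae_eq_def)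

lemma continuous_rep_inner:
 assumes c: "continuous_rep T U m c" and v: "v \<in> L2 U"
 shows "continuous_on {0..T} (\<lambda>t. L2_inner U (c t) v)"
 unfolding continuous_on_def
 by (intro ballI L2_tendsto_inner continuous_repD[OF c] v)

lemma continuous_rep_diff:
 assumes c: "continuous_rep T U m c" and c': "continuous_rep T U m' c'"
 shows "continuous_rep T U (\<lambda>t x. m t x - m' t x) (\<lambda>t x. c t x - c' t x)"
 unfolding continuous_rep_def
proof (intro conjI ballI)
 show "(\<lambda>x. c t x - c' t x) \<in> L2 U" if "t \<in> {0..T}" for t
  by (intro L2_diff continuous_repD(1)[OF c that] continuous_repD(1)[OF c' that])
 show "ae_eq T U (\<lambda>t x. m t x - m' t x) (\<lambda>t x. c t x - c' t x)"
  unfolding ae_eq_def using continuous_repD(3)[OF c] continuous_repD(3)[OF c']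
 proof eventually_elim
  case (elim t)
  then show ?case by eventually_elim simp
 qed
 fix t assume t: "t \<in> {0..T}"
 have "((\<lambda>s. L2_norm U (c s - c t) + L2_norm U (c' s - c' t)) \<longlongrightarrow> 0 + 0) (at t within {0..T})"
  by (intro tendsto_add continuous_repD(2)[OF c t] continuous_repD(2)[OF c' t])
 then have lim: "((\<lambda>s. L2_norm U (c s - c t) + L2_norm U (c' s - c' t)) \<longlongrightarrow> 0) (at t within {0..T})" by simp
 show "((\<lambda>s. L2_norm U ((\<lambda>x. c s x - c' s x) - (\<lambda>x. c t x - c' t x))) \<longlongrightarrow> 0) (at t within {0..T})"
 proof (rule Lim_null_comparison[OF _ lim])
  show "\<forall>\<^sub>F s in at t within {0..T}. norm (L2_norm U ((\<lambda>x. c s x - c' s x) - (\<lambda>x. c t x - c' t x))) \<le> L2_norm U (c s - c t) + L2_norm U (c' s - c' t)"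
   unfolding eventually_at_filter
  proof (intro always_eventually allI impI)
   fix s assume s: "s \<noteq> t" "s \<in> {0..T}"
   have eq: "(\<lambda>x. c s x - c' s x) - (\<lambda>x. c t x - c' t x) = (\<lambda>x. (c s x - c t x) - (c' s x - c' t x))"
    by (simp add: fun_eq_iff)
   show "norm (L2_norm U ((\<lambda>x. c s x - c' s x) - (\<lambda>x. c t x - c' t x))) \<le> L2_norm U (c s - c t) + L2_norm U (c' s - c' t)"
    unfolding eq fun_diff_def
    using L.N_diff_le[OF L2_diff[OF continuous_repD(1)[OF c s(2)] continuous_repD(1)[OF c t]] L2_diff[OF continuous_repD(1)[OF c' s(2)] continuous_repD(1)[OF c' t]]]
    by (simp add: L2_norm_nonneg)
  qed
 qed
qed

lemma continuous_rep_zero: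
 assumes c: "continuous_rep T U m c" and T: "T > 0" and m: "AE t in \<mu> T. AE x in \<mu>U. m t x = 0" and t: "t \<in> {0..T}"
 shows "AE x in \<mu>U. c t x = 0"
proof -
 have cont: "continuous_on {0..T} (\<lambda>t. L2_norm U (c t))"
  unfolding continuous_on_def
 proof
  fix t assume t: "t \<in> {0..T}"
  show "((\<lambda>t. L2_norm U (c t)) \<longlongrightarrow> L2_norm U (c t)) (at t within {0..T})"
  proof (rule LIM_zero_cancel, rule Lim_null_comparison[OF _ continuous_repD(2)[OF c t]])
   show "\<forall>\<^sub>F s in at t within {0..T}. norm (L2_norm U (c s) - L2_norm U (c t)) \<le> L2_norm U (c s - c t)"
    unfolding eventually_at_filter using L.N_abs_diff[OF continuous_repD(1)[OF c] continuous_repD(1)[OF c t]]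
    by (intro always_eventually) (auto simp: fun_diff_def)
  qed
 qed
 have "L2_norm U (c t) = 0"
 proof (rule continuous_AE_eq[OF cont continuous_on_const T _ t])
  show "AE t in \<mu> T. L2_norm U (c t) = 0"
   using m continuous_repD(3)[OF c] AE_space
  proof eventually_elim
   case (elim t)
   have "AE x in \<mu>U. c t x = 0" using elim(1,2) by eventually_elim simp
   moreover have "c t \<in> L2 U" using continuous_repD(1)[OF c, of t] elim(3) by simp
   ultimately show ?case using L2_norm_eq_0 by blast
  qed
 qed
 then show ?thesis using L2_norm_eq_0[OF continuous_repD(1)[OF c t]] by simp
qed

text \<open>Makes the choice in \<open>at_time\<close> harmless at every time, the ends
  included.\<close>

lemma continuous_rep_unique:
 assumes c: "continuous_rep T U m c" and c': "continuous_rep T U m' c'" and T: "T > 0"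
  and m: "ae_eq T U m m'" and t: "t \<in> {0..T}"
 shows "AE x in \<mu>U. c t x = c' t x"
proof -
 have "AE t in \<mu> T. AE x in \<mu>U. m t x - m' t x = 0"
  using m unfolding ae_eq_def
 proof eventually_elim
  case (elim t)
  then show ?case by eventually_elim simp
 qed
 then have "AE x in \<mu>U. c t x - c' t x = 0"
  by (rule continuous_rep_zero[OF continuous_rep_diff[OF c c'] T _ t])
 then show ?thesis by eventually_elim simp
qed

lemma ae_eq_refl: "ae_eq T U m m"
 by (simp add: ae_eq_def)

lemma at_time_rep:
 assumes "continuous_rep T U m c" shows "continuous_rep T U m (at_time T U m)"
 unfolding at_time_def by (rule someI[where P = "continuous_rep T U m", OF assms])

lemma Y_at_time:
 assumes "T > 0" "m \<in> Y_space T U" shows "continuous_rep T U m (at_time T U m)"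
 using continuous_rep_exists[OF Y_evolves[OF assms]] at_time_rep by metis

lemma at_time_diff:
 assumes T: "T > 0" and m1: "m1 \<in> Y_space T U" and m2: "m2 \<in> Y_space T U" and t: "t \<in> {0..T}"
 shows "AE x in \<mu>U. at_time T U (\<lambda>t x. m1 t x - m2 t x) t x = at_time T U m1 t x - at_time T U m2 t x"
 by (rule continuous_rep_unique[OF Y_at_time[OF T Y_diff(1)[OF m1 m2]] continuous_rep_diff[OF Y_at_time[OF T m1] Y_at_time[OF T m2]] T ae_eq_refl t])

lemma evolves_trace:
 assumes w: "evolves T w l k" and c: "continuous_rep T U w c" and v: "v \<in> H10 U"
  and eq: "AE t in \<mu> T. L2_inner U (w t) v = d + prim T (\<lambda>s. l s v) t" and t: "t \<in> {0..T}"
 shows "L2_inner U (c t) v = d + prim T (\<lambda>s. l s v) t"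
proof (rule continuous_AE_eq[OF continuous_rep_inner[OF c H1D(1)[OF H10_H1[OF v]]] _ evolvesD(1)[OF w] _ t])
 show "continuous_on {0..T} (\<lambda>t. d + prim T (\<lambda>s. l s v) t)"
  by (intro continuous_intros prim_continuous H.functional_integrable[OF evolvesD(4)[OF w] v])
 show "AE t in \<mu> T. L2_inner U (c t) v = d + prim T (\<lambda>s. l s v) t"
  using eq continuous_repD(3)[OF c] evolvesD(6)[OF w]
 proof eventually_elim
  case (elim t)
  have "L2_inner U (w t) v = L2_inner U (c t) v"
   by (rule L2_inner_cong[OF elim(2) _ L2_D(1)[OF elim(3)] L2_D(1)[OF H1D(1)[OF H10_H1[OF v]]] sets_U]) simp
  then show ?case using elim(1) by simp
 qed
qed

text \<open>For the continuous representative both sides are continuous, so the identity extends to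
  times 0 and \<open>T\<close>, where initial and final values enter.\<close>

lemma energy_trace:
 assumes w: "evolves T w l k" and pot: "potential \<Phi> \<phi>" and u: "(\<lambda>t x. \<phi> (w t x)) \<in> X_space T U"
  and c: "continuous_rep T U w c"
 obtains d where "\<And>t. t \<in> {0..T} \<Longrightarrow> (LINT x|\<mu>U. \<Phi> (c t x)) = d + prim T (\<lambda>s. l s (\<lambda>x. \<phi> (w s x))) t"
  "AE t in \<mu> T. (LINT x|\<mu>U. \<Phi> (w t x)) = d + prim T (\<lambda>s. l s (\<lambda>x. \<phi> (w s x))) t"
proof -
 interpret potential \<Phi> \<phi> by (rule pot)
 obtain d where d: "AE t in \<mu> T. (LINT x|\<mu>U. \<Phi> (w t x)) = d + prim T (\<lambda>s. l s (\<lambda>x. \<phi> (w s x))) t"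
  by (rule energy_identity[OF w pot u])
 have cont: "continuous_on {0..T} (\<lambda>t. LINT x|\<mu>U. \<Phi> (c t x))"
  unfolding continuous_on_sequentially comp_def
 proof (intro allI ballI impI)
  fix s t assume t: "t \<in> {0..T}" and s: "(\<forall>n. s n \<in> {0..T}) \<and> s \<longlonglongrightarrow> t"
  have st: "s n \<in> {0..T}" for n using s by blast
  have 1: "((\<lambda>s. L2_norm U (c s - c t)) \<longlongrightarrow> L2_norm U (c t - c t)) (at t within {0..T})"
   using continuous_repD(2)[OF c t] by (simp add: fun_diff_def L2_norm_def L2_inner_def)
  have "continuous (at t within {0..T}) (\<lambda>s. L2_norm U (c s - c t))" using 1 by (simp add: continuous_within)
  then have "(\<lambda>n. L2_norm U (c (s n) - c t)) \<longlonglongrightarrow> L2_norm U (c t - c t)"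
   using s unfolding continuous_within_sequentially comp_def by blast
  then have lim: "(\<lambda>n. L2_norm U (\<lambda>x. c (s n) x - c t x)) \<longlonglongrightarrow> 0" by (simp add: fun_diff_def L2_norm_def L2_inner_def)
  show "(\<lambda>n. LINT x|\<mu>U. \<Phi> (c (s n) x)) \<longlonglongrightarrow> (LINT x|\<mu>U. \<Phi> (c t x))"
   by (rule \<Phi>_integral_tendsto[OF continuous_repD(1)[OF c st] continuous_repD(1)[OF c t] lim])
 qed
 have "(LINT x|\<mu>U. \<Phi> (c t x)) = d + prim T (\<lambda>s. l s (\<lambda>x. \<phi> (w s x))) t" if t: "t \<in> {0..T}" for t
 proof (rule continuous_AE_eq[OF cont _ evolvesD(1)[OF w] _ t])
  show "continuous_on {0..T} (\<lambda>t. d + prim T (\<lambda>s. l s (\<lambda>x. \<phi> (w s x))) t)"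
   by (intro continuous_intros prim_continuous H.pairing_integrable(1)[OF evolvesD(4)[OF w] X_spaceD(1)[OF u]])
  show "AE t in \<mu> T. (LINT x|\<mu>U. \<Phi> (c t x)) = d + prim T (\<lambda>s. l s (\<lambda>x. \<phi> (w s x))) t"
   using d continuous_repD(3)[OF c] evolvesD(6)[OF w]
  proof eventually_elim
   case (elim t)
   note [measurable] = L2_D(1)[OF elim(3)] borel_measurable_lebesgue_on_AE[OF L2_D(1)[OF elim(3)] elim(2) sets_U]
   have "(LINT x|\<mu>U. \<Phi> (w t x)) = (LINT x|\<mu>U. \<Phi> (c t x))"
   proof (rule integral_cong_AE)
    show "AE x in \<mu>U. \<Phi> (w t x) = \<Phi> (c t x)" using elim(2) by eventually_elim simp
   qed measurable
   then show ?case using elim(1) by simp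
  qed
 qed
 then show ?thesis using that d by blast
qed

text \<open>Separated functions turn the Hamilton-Jacobi-Bellman equation into a scalar equation for
  each \<open>v\<close>; as \<open>a T\<close> is free, they also see the final value.\<close>

lemma product_test:
 assumes T: "T > 0" and a: "\<And>k. Ck k (a :: real \<Rightarrow> real)" and a0: "a 0 = 0" and v: "v \<in> H10 U"
 shows "(\<lambda>t x. a t * v x) \<in> Y0_space T U"
  "\<And>u. u \<in> X_space T U \<Longrightarrow> AE t in \<mu> T. time_deriv T U (\<lambda>t x. a t * v x) t (u t) = deriv a t * L2_inner U v (u t)"
proof -
 have da: "(a has_real_derivative deriv a t) (at t)" for t
  using a[of "Suc 0"] by (intro partial_deriv_real(2)) simp
 have pa: "partial_deriv a 1 = deriv a" using a[of "Suc 0"] by (auto simp: fun_eq_iff intro!: partial_deriv_real(1))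
 have a': "Ck k (deriv a)" for k using a[of "Suc k"] pa by simp
 have ac: "continuous_on S a" "continuous_on S (deriv a)" for S using a[of 0] a'[of 0] continuous_on_subset by auto
 have bnd: "\<exists>B. \<forall>t\<in>{0<..<T}. \<bar>f t\<bar> \<le> B" if f: "continuous_on {0..T} f" for f :: "real \<Rightarrow> real"
 proof -
  have "bounded (f ` {0..T})" by (intro compact_imp_bounded compact_continuous_image f compact_Icc)
  then obtain B where "\<forall>t\<in>{0..T}. \<bar>f t\<bar> \<le> B" unfolding bounded_iff by auto
  then show ?thesis by (intro exI[of _ B]) auto
 qed
 obtain B where B: "\<And>t. t \<in> {0<..<T} \<Longrightarrow> \<bar>a t\<bar> \<le> B" using bnd[OF ac(1)] by blast
 obtain B' where B': "\<And>t. t \<in> {0<..<T} \<Longrightarrow> \<bar>deriv a t\<bar> \<le> B'" using bnd[OF ac(2)] by blast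
 have am: "a \<in> borel_measurable (\<mu> T)" "deriv a \<in> borel_measurable (\<mu> T)"
  using ac by (auto intro!: continuous_imp_measurable_on_sets_lebesgue)
 note vL = H1D(1)[OF H10_H1[OF v]]
 have cv: "(\<lambda>_. v) \<in> bochner_L2 T (H10 U) (H1_norm U)" by (rule H.bochner_simple) (simp_all add: v)
 have X: "(\<lambda>t x. a t * v x) \<in> X_space T U"
  unfolding X_space_def by (rule H.bochner_mult[OF cv am(1) B])
 have vH: "L2_inner U v \<in> Hm1 U" using L2_bdd_linear[OF vL] Hm1_iff by blast
 have cv': "(\<lambda>_. L2_inner U v) \<in> bochner_L2 T (Hm1 U) (Hm1_norm U)" by (rule M.bochner_simple) (simp_all add: vH)
 have z: "(\<lambda>t. L2_inner U (\<lambda>x. a t * v x)) \<in> L2_Hm1 T U"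
  unfolding L2_Hm1_def using M.bochner_mult[OF cv' am(1) B] by (simp add: L2_inner_mult[abs_def])
 have g: "(\<lambda>t z. deriv a t * L2_inner U v z) \<in> L2_Hm1 T U"
  unfolding L2_Hm1_def using M.bochner_mult[OF cv' am(2) B'] by simp
 have td: "is_time_deriv T U (\<lambda>t. L2_inner U (\<lambda>x. a t * v x)) (\<lambda>t z. deriv a t * L2_inner U v z)"
  unfolding is_time_deriv_def
 proof (intro ballI)
  fix \<phi> z assume \<phi>: "\<phi> \<in> test_functions {0<..<T}" and z: "z \<in> H10 U"
  note t = test_functions_mult[OF \<phi> a]
  have d: "deriv (\<lambda>t. \<phi> t * a t) t = deriv \<phi> t * a t + \<phi> t * deriv a t" for t
   by (rule DERIV_imp_deriv) (use DERIV_mult[OF test_functions_deriv(1)[OF \<phi>] da] in \<open>simp add: mult.commute\<close>)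
  note p = test_functions_mult[OF test_functions_deriv(2)[OF \<phi>] a] test_functions_mult[OF \<phi> a']
  \<comment> \<open>Integration by parts: the product with \<phi> is a test function even when
    \<open>a\<close> is not.\<close>
  have "(LINT t|\<mu> T. deriv (\<lambda>t. \<phi> t * a t) t) = 0"
   using test_functions_lebesgue_on(2)[OF test_functions_deriv(2)[OF t]] integral_partial_deriv_eq_0[OF t, of 1] test_functions_deriv(3)[OF t] by simp
  then have "(LINT t|\<mu> T. deriv \<phi> t * a t) + (LINT t|\<mu> T. \<phi> t * deriv a t) = 0"
   unfolding d using test_functions_lebesgue_on(1)[OF p(1)] test_functions_lebesgue_on(1)[OF p(2)] by simp
  then have e: "(LINT t|\<mu> T. deriv \<phi> t * a t) = - (LINT t|\<mu> T. \<phi> t * deriv a t)" by simp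
  show "(LINT t|\<mu> T. deriv \<phi> t * L2_inner U (\<lambda>x. a t * v x) z) = - (LINT t|\<mu> T. \<phi> t * (deriv a t * L2_inner U v z))"
   using e by (simp add: L2_inner_mult mult.assoc[symmetric])
 qed
 have Y: "(\<lambda>t x. a t * v x) \<in> Y_space T U"
  using X z g td by (auto simp: Y_space_def H1_Hm1_def)
 have rep: "continuous_rep T U (\<lambda>t x. a t * v x) (\<lambda>t x. a t * v x)"
  unfolding continuous_rep_def
 proof (intro conjI ballI ae_eq_refl)
  show "(\<lambda>x. a t * v x) \<in> L2 U" for t by (rule L2_mult[OF vL])
  fix t assume t: "t \<in> {0..T}"
  have "((\<lambda>s. \<bar>a s - a t\<bar> * L2_norm U v) \<longlongrightarrow> \<bar>a t - a t\<bar> * L2_norm U v) (at t within {0..T})"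
   using ac(1)[of "{0..T}"] t by (intro tendsto_intros) (simp add: continuous_on_def)
  moreover have "L2_norm U ((\<lambda>x. a s * v x) - (\<lambda>x. a t * v x)) = \<bar>a s - a t\<bar> * L2_norm U v" for s
   using L2_norm_mult[of U "a s - a t" v] by (simp add: fun_diff_def left_diff_distrib)
  ultimately show "((\<lambda>s. L2_norm U ((\<lambda>x. a s * v x) - (\<lambda>x. a t * v x))) \<longlongrightarrow> 0) (at t within {0..T})" by simp
 qed
 have "AE x in \<mu>U. at_time T U (\<lambda>t x. a t * v x) 0 x = a 0 * v x"
  by (rule continuous_rep_unique[OF at_time_rep[OF rep] rep T ae_eq_refl]) (use T in simp)
 then show "(\<lambda>t x. a t * v x) \<in> Y0_space T U"
  using Y a0 by (simp add: Y0_space_def)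
 show "AE t in \<mu> T. time_deriv T U (\<lambda>t x. a t * v x) t (u t) = deriv a t * L2_inner U v (u t)" if "u \<in> X_space T U" for u
  by (rule time_deriv_eq[OF Y g td that])
qed

end

section \<open>Functions of space and time\<close>

text \<open>Passes to \<open>lborel\<close>, which is a product measure, since Lebesgue measure on
  the product space is only its completion.\<close>

lemma AE_product_sections:
 fixes S :: "real set" and U :: "'a::euclidean_space set"
 assumes S: "open S" and U: "open U" and ae: "AE z in lebesgue_on (S \<times> U). P z"
 shows "AE t in lebesgue_on S. AE x in lebesgue_on U. P (t, x)"
proof -
 have "open (S \<times> U)" by (rule open_Times[OF S U])
 then have [measurable]: "S \<in> sets lebesgue" "U \<in> sets lebesgue" "S \<times> U \<in> sets lebesgue"
  using S U by simp_all
 have "AE z in lborel \<Otimes>\<^sub>M lborel. z \<in> S \<times> U \<longrightarrow> P z"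
  using ae unfolding lborel_prod by (simp add: AE_restrict_space_iff AE_completion_iff)
 then have "AE t in lborel. AE x in lborel. (t, x) \<in> S \<times> U \<longrightarrow> P (t, x)" by (rule lborel_pair.AE_pair)
 then have "AE t in lborel. t \<in> S \<longrightarrow> (AE x in lborel. x \<in> U \<longrightarrow> P (t, x))"
 proof eventually_elim
  case (elim t)
  show ?case
  proof
   assume "t \<in> S"
   with elim show "AE x in lborel. x \<in> U \<longrightarrow> P (t, x)" by simp
  qed
 qed
 then show ?thesis by (simp add: AE_restrict_space_iff AE_completion_iff)
qed

text \<open>Completion provides a Borel function for each coordinate; the finitely many null sets
  are merged.\<close>

lemma borel_representative:
 fixes f :: "'z::euclidean_space \<Rightarrow> 'b::euclidean_space"
 assumes f: "f \<in> borel_measurable (lebesgue_on Q)" and Q: "Q \<in> sets lebesgue"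
 obtains g where "g \<in> borel_measurable borel" "AE z in lebesgue_on Q. f z = g z"
proof -
 define F where "F z = (if z \<in> Q then f z else 0)" for z
 have F: "F \<in> borel_measurable lebesgue"
  unfolding F_def using borel_measurable_if[OF Q] f by blast
 have "\<exists>h\<in>borel_measurable borel. AE z in lborel. F z \<bullet> i = h z" for i
 proof -
  have "(\<lambda>z. F z \<bullet> i) \<in> borel_measurable lebesgue" using F by measurable
  from completion_ex_borel_measurable_real[OF this] show ?thesis by auto
 qed
 then obtain h where h: "\<And>i. h i \<in> borel_measurable borel" "\<And>i. AE z in lborel. F z \<bullet> i = h i z" by metis
 show ?thesis
 proof (rule that)
  show "(\<lambda>z. \<Sum>i\<in>Basis. h i z *\<^sub>R i) \<in> borel_measurable borel" using h(1) by measurable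
  have "AE z in lborel. \<forall>i\<in>(Basis :: 'b set). F z \<bullet> i = h i z"
   using h(2) by (subst AE_ball_countable) (auto simp: countable_finite)
  then have "AE z in lebesgue. z \<in> Q \<longrightarrow> f z = (\<Sum>i\<in>Basis. h i z *\<^sub>R i)"
   unfolding AE_completion_iff
  proof eventually_elim
   case (elim z)
   show ?case
   proof
    assume "z \<in> Q"
    then have "f z = (\<Sum>i\<in>Basis. (F z \<bullet> i) *\<^sub>R i)" by (simp add: F_def euclidean_representation)
    then show "f z = (\<Sum>i\<in>Basis. h i z *\<^sub>R i)" using elim by simp
   qed
  qed
  then show "AE z in lebesgue_on Q. f z = (\<Sum>i\<in>Basis. h i z *\<^sub>R i)"
   using Q by (simp add: AE_restrict_space_iff)
 qed
qed

context bounded_domain begin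

abbreviation "drift_form \<nu> m \<beta> t v \<equiv>
 L2_inner U (\<lambda>x. m t x *\<^sub>R \<beta> (t, x)) (weak_grad U v) + \<nu> * L2_inner U (weak_grad U (m t)) (weak_grad U v)"

text \<open>A Lebesgue measurable function has measurable sections for almost every \<open>t\<close>
  in general. Those of a Borel representative are measurable throughout, and completeness transfers
  this off a null set of times.\<close>

lemma cylinder_sections:
 fixes f :: "real \<times> 'a \<Rightarrow> 'b::euclidean_space"
 assumes f: "f \<in> borel_measurable (lebesgue_on ({0<..<T} \<times> U))"
 shows "AE t in \<mu> T. (\<lambda>x. f (t, x)) \<in> borel_measurable \<mu>U"
  "q \<in> borel_measurable \<mu>U \<Longrightarrow> (\<lambda>t. LINT x|\<mu>U. f (t, x) \<bullet> q x) \<in> borel_measurable (\<mu> T)"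
proof -
 have "open ({0<..<T} \<times> U)" by (intro open_Times open_U) simp
 then have Q: "{0<..<T} \<times> U \<in> sets lebesgue" by simp
 obtain g where g [measurable]: "g \<in> borel_measurable borel" and fg: "AE z in lebesgue_on ({0<..<T} \<times> U). f z = g z"
  by (rule borel_representative[OF f Q])
 have ae: "AE t in \<mu> T. AE x in \<mu>U. f (t, x) = g (t, x)"
  by (rule AE_product_sections[OF _ open_U fg]) simp
 have id: "(\<lambda>x. x) \<in> \<mu>U \<rightarrow>\<^sub>M borel" "(\<lambda>t. t) \<in> \<mu> T \<rightarrow>\<^sub>M borel"
  by (auto intro!: measurable_restrict_space1 measurable_completion)
 have gm: "g \<in> borel_measurable (borel \<Otimes>\<^sub>M borel)" using g by (simp add: borel_prod)
 have gs [measurable]: "(\<lambda>x. g (t, x)) \<in> borel_measurable \<mu>U" for t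
  by (rule measurable_compose[OF measurable_Pair[OF measurable_const id(1)] gm]) simp
 show "AE t in \<mu> T. (\<lambda>x. f (t, x)) \<in> borel_measurable \<mu>U"
  using ae
 proof eventually_elim
  case (elim t)
  show ?case by (rule borel_measurable_lebesgue_on_AE[OF gs _ sets_U, of t]) (use elim in \<open>eventually_elim, simp\<close>)
 qed
 then have ae': "AE t in \<mu> T. (LINT x|\<mu>U. g (t, x) \<bullet> q x) = (LINT x|\<mu>U. f (t, x) \<bullet> q x)" if [measurable]: "q \<in> borel_measurable \<mu>U"
  using ae
 proof eventually_elim
  case (elim t)
  note [measurable] = elim(1)
  show ?case
  proof (rule integral_cong_AE)
   show "AE x in \<mu>U. g (t, x) \<bullet> q x = f (t, x) \<bullet> q x" using elim(2) by eventually_elim simp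
  qed measurable
 qed
 show "(\<lambda>t. LINT x|\<mu>U. f (t, x) \<bullet> q x) \<in> borel_measurable (\<mu> T)" if q [measurable]: "q \<in> borel_measurable \<mu>U"
 proof (rule borel_measurable_lebesgue_on_AE[OF _ ae'[OF q]])
  have "(\<lambda>z. g (fst z, snd z)) \<in> borel_measurable (\<mu> T \<Otimes>\<^sub>M \<mu>U)"
   by (rule measurable_compose[OF measurable_Pair[OF measurable_compose[OF measurable_fst id(2)] measurable_compose[OF measurable_snd id(1)]] gm])
  then have "(\<lambda>z. g z \<bullet> q (snd z)) \<in> borel_measurable (\<mu> T \<Otimes>\<^sub>M \<mu>U)" by simp
  then show "(\<lambda>t. LINT x|\<mu>U. g (t, x) \<bullet> q x) \<in> borel_measurable (\<mu> T)"
   by (intro space.borel_measurable_lebesgue_integral) (simp add: case_prod_beta)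
 qed simp
qed

lemma bdd_linear_mono: "bdd_linear V N k l \<Longrightarrow> k \<le> k' \<Longrightarrow> (\<And>v. v \<in> V \<Longrightarrow> 0 \<le> N v) \<Longrightarrow> bdd_linear V N k' l"
 unfolding bdd_linear_def using mult_right_mono by (meson order_trans)

lemma kernel_functional:
 assumes g: "AE t in \<mu> T. g t \<in> L2 U \<and> L2_norm U (g t) \<le> \<kappa> t"
  and \<kappa>: "\<kappa> \<in> borel_measurable (\<mu> T)" "integrable (\<mu> T) (\<lambda>t. (\<kappa> t)\<^sup>2)"
  and meas: "\<And>v. v \<in> H10 U \<Longrightarrow> (\<lambda>t. L2_inner U (g t) v) \<in> borel_measurable (\<mu> T)"
 shows "X_functional T (\<lambda>t. L2_inner U (g t)) \<kappa>"
 unfolding L2_functional_def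
proof (intro conjI ballI meas \<kappa>)
 show "AE t in \<mu> T. H10_linear (\<kappa> t) (L2_inner U (g t))"
  using g by eventually_elim (use L2_bdd_linear bdd_linear_mono H1_norm_ge(3) in blast)
qed

lemma gradient_kernel_functional:
 assumes g: "AE t in \<mu> T. g t \<in> L2 U \<and> L2_norm U (g t) \<le> \<kappa> t"
  and \<kappa>: "\<kappa> \<in> borel_measurable (\<mu> T)" "integrable (\<mu> T) (\<lambda>t. (\<kappa> t)\<^sup>2)"
  and meas: "\<And>v. v \<in> H10 U \<Longrightarrow> (\<lambda>t. L2_inner U (g t) (weak_grad U v)) \<in> borel_measurable (\<mu> T)"
 shows "X_functional T (\<lambda>t v. L2_inner U (g t) (weak_grad U v)) \<kappa>"
 unfolding L2_functional_def
proof (intro conjI ballI meas \<kappa>)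
 show "AE t in \<mu> T. H10_linear (\<kappa> t) (\<lambda>v. L2_inner U (g t) (weak_grad U v))"
  using g by eventually_elim (use grad_bdd_linear bdd_linear_mono H1_norm_ge(3) in blast)
qed

text \<open>Measurability in time comes from exchanging the two gradients: for fixed
  \<open>v\<close> the form is a constant functional evaluated at the Bochner function
  \<open>u\<close>.\<close>

lemma diffusion_functional:
 assumes u: "u \<in> X_space T U"
 shows "X_functional T (\<lambda>t v. L2_inner U (weak_grad U (u t)) (weak_grad U v)) (\<lambda>t. H1_norm U (u t))"
proof (rule gradient_kernel_functional)
 note u' = X_spaceD(1)[OF u]
 show "AE t in \<mu> T. weak_grad U (u t) \<in> L2 U \<and> L2_norm U (weak_grad U (u t)) \<le> H1_norm U (u t)"
  using X_spaceD(3)[OF u] by eventually_elim (simp add: H1D(3) H1_norm_ge)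
 show "(\<lambda>t. H1_norm U (u t)) \<in> borel_measurable (\<mu> T)" by (rule H.bochner_norm_measurable[OF u'])
 show "integrable (\<mu> T) (\<lambda>t. (H1_norm U (u t))\<^sup>2)" by (rule H.bochnerD(2)[OF u'])
 show "(\<lambda>t. L2_inner U (weak_grad U (u t)) (weak_grad U v)) \<in> borel_measurable (\<mu> T)" if v: "v \<in> H10 U" for v
  using H.pairing_measurable[OF const_functional[OF grad_bdd_linear[OF H1D(3)[OF H10_H1[OF v]]]] u'] by (simp add: L2_inner_commute)
qed

lemma LinfE:
 assumes "\<beta> \<in> Linf ({0<..<T} \<times> U)"
 obtains C where "C \<ge> 0" "AE t in \<mu> T. (\<lambda>x. \<beta> (t, x)) \<in> borel_measurable \<mu>U \<and> (AE x in \<mu>U. norm (\<beta> (t, x)) \<le> C)"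
proof -
 obtain C where m: "\<beta> \<in> borel_measurable (lebesgue_on ({0<..<T} \<times> U))" and C: "AE z in lebesgue_on ({0<..<T} \<times> U). norm (\<beta> z) \<le> C"
  using assms by (auto simp: Linf_def)
 have "AE t in \<mu> T. AE x in \<mu>U. norm (\<beta> (t, x)) \<le> C"
  by (rule AE_product_sections[OF _ open_U C]) simp
 with cylinder_sections(1)[OF m]
 have "AE t in \<mu> T. (\<lambda>x. \<beta> (t, x)) \<in> borel_measurable \<mu>U \<and> (AE x in \<mu>U. norm (\<beta> (t, x)) \<le> \<bar>C\<bar>)"
 proof eventually_elim
  case (elim t)
  then show ?case by (auto elim!: eventually_mono)
 qed
 then show ?thesis using that[of "\<bar>C\<bar>"] by simp
qed

text \<open>The norm bound comes from the essential bound of \<beta>. Measurability is the harder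
  part, because \<open>m\<close> is given as a Bochner function of time and not as a jointly
  measurable function.\<close>

lemma drift_functional:
 fixes \<beta> :: "real \<times> 'a \<Rightarrow> 'a"
 assumes m: "m \<in> X_space T U" and \<beta>: "\<beta> \<in> Linf ({0<..<T} \<times> U)"
 obtains \<kappa> where "X_functional T (\<lambda>t v. L2_inner U (\<lambda>x. m t x *\<^sub>R \<beta> (t, x)) (weak_grad U v)) \<kappa>"
  "AE t in \<mu> T. (\<lambda>x. m t x *\<^sub>R \<beta> (t, x)) \<in> L2 U"
proof -
 obtain C where C: "C \<ge> 0" "AE t in \<mu> T. (\<lambda>x. \<beta> (t, x)) \<in> borel_measurable \<mu>U \<and> (AE x in \<mu>U. norm (\<beta> (t, x)) \<le> C)"
  by (rule LinfE[OF \<beta>])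
 note m' = X_spaceD(1)[OF m]
 have \<beta>m: "\<beta> \<in> borel_measurable (lebesgue_on ({0<..<T} \<times> U))" using \<beta> by (simp add: Linf_def)
 have g: "AE t in \<mu> T. (\<lambda>x. m t x *\<^sub>R \<beta> (t, x)) \<in> L2 U \<and> L2_norm U (\<lambda>x. m t x *\<^sub>R \<beta> (t, x)) \<le> C * H1_norm U (m t)"
  using C(2) X_spaceD(4)[OF m]
 proof eventually_elim
  case (elim t)
  note [measurable] = conjunct1[OF elim(1)] L2_D(1)[OF elim(2)]
  have "AE x in \<mu>U. norm (m t x *\<^sub>R \<beta> (t, x)) \<le> C * norm (m t x)"
   using conjunct2[OF elim(1)]
  proof eventually_elim
   case (elim x)
   then show ?case using mult_left_mono[OF elim, of "\<bar>m t x\<bar>"] by (simp add: mult.commute)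
  qed
  note b = L2_bound[OF elim(2) _ C(1) this]
  have "L2_norm U (\<lambda>x. m t x *\<^sub>R \<beta> (t, x)) \<le> C * L2_norm U (m t)" by (rule b) measurable
  also have "\<dots> \<le> C * H1_norm U (m t)" by (intro mult_left_mono H1_norm_ge C(1))
  finally show ?case using b(1) by simp
 qed
 have "X_functional T (\<lambda>t v. L2_inner U (\<lambda>x. m t x *\<^sub>R \<beta> (t, x)) (weak_grad U v)) (\<lambda>t. C * H1_norm U (m t))"
 proof (rule gradient_kernel_functional[OF g])
  show "(\<lambda>t. C * H1_norm U (m t)) \<in> borel_measurable (\<mu> T)" using H.bochner_norm_measurable[OF m'] by simp
  show "integrable (\<mu> T) (\<lambda>t. (C * H1_norm U (m t))\<^sup>2)" using H.bochnerD(2)[OF m'] by (simp add: power_mult_distrib)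
  fix v assume v: "v \<in> H10 U"
  note vg = H1D(3)[OF H10_H1[OF v]]
  \<comment> \<open>For fixed \<open>v\<close> the drift term is read as the functional with kernel
    \<beta> times the gradient of \<open>v\<close>, evaluated at \<open>m t\<close>, so that
    \<open>pairing_measurable\<close> applies.\<close>
  have "X_functional T (\<lambda>t. L2_inner U (\<lambda>x. \<beta> (t, x) \<bullet> weak_grad U v x)) (\<lambda>t. C * L2_norm U (weak_grad U v))"
  proof (rule kernel_functional)
   show "AE t in \<mu> T. (\<lambda>x. \<beta> (t, x) \<bullet> weak_grad U v x) \<in> L2 U \<and> L2_norm U (\<lambda>x. \<beta> (t, x) \<bullet> weak_grad U v x) \<le> C * L2_norm U (weak_grad U v)"
    using C(2)
   proof eventually_elim
    case (elim t)
    note [measurable] = conjunct1[OF elim] L2_D(1)[OF vg]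
    have "AE x in \<mu>U. norm (\<beta> (t, x) \<bullet> weak_grad U v x) \<le> C * norm (weak_grad U v x)"
     using conjunct2[OF elim]
    proof eventually_elim
     case (elim x)
     have "norm (\<beta> (t, x) \<bullet> weak_grad U v x) \<le> norm (\<beta> (t, x)) * norm (weak_grad U v x)"
      using Cauchy_Schwarz_ineq2 by simp
     then show ?case using mult_right_mono[OF elim, of "norm (weak_grad U v x)"] by simp
    qed
    note b = L2_bound[OF vg _ C(1) this]
    show ?case using b by simp
   qed
   show "(\<lambda>t. L2_inner U (\<lambda>x. \<beta> (t, x) \<bullet> weak_grad U v x) z) \<in> borel_measurable (\<mu> T)" if z: "z \<in> H10 U" for z
   proof -
    note [measurable] = L2_D(1)[OF vg] L2_D(1)[OF H1D(1)[OF H10_H1[OF z]]]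
    have "(\<lambda>x. z x *\<^sub>R weak_grad U v x) \<in> borel_measurable \<mu>U" by measurable
    from cylinder_sections(2)[OF \<beta>m this] show ?thesis by (simp add: L2_inner_def mult.commute)
   qed
  qed auto
  from H.pairing_measurable[OF this m']
  show "(\<lambda>t. L2_inner U (\<lambda>x. m t x *\<^sub>R \<beta> (t, x)) (weak_grad U v)) \<in> borel_measurable (\<mu> T)"
   by (simp add: L2_inner_def mult.commute)
 qed
 then show ?thesis using that g by (auto elim!: eventually_mono)
qed

end

section \<open>The Hamiltonian\<close>

lemma abs_SUP_diff_le:
 fixes F G :: "'c \<Rightarrow> real"
 assumes A: "A \<noteq> {}" "bdd_above (F ` A)" "bdd_above (G ` A)" and le: "\<And>a. a \<in> A \<Longrightarrow> \<bar>F a - G a\<bar> \<le> e"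
 shows "\<bar>(SUP a\<in>A. F a) - (SUP a\<in>A. G a)\<bar> \<le> e"
proof -
 have "(SUP a\<in>A. F a) \<le> (SUP a\<in>A. G a) + e"
  using le cSUP_upper[OF _ A(3)] by (intro cSUP_least A(1)) (smt (verit, best))
 moreover have "(SUP a\<in>A. G a) \<le> (SUP a\<in>A. F a) + e"
  using le cSUP_upper[OF _ A(2)] by (intro cSUP_least A(1)) (smt (verit, best))
 ultimately show ?thesis by linarith
qed

locale control_problem = bounded_domain U
 for U :: "'a::euclidean_space set" +
 fixes T :: real and A :: "'c::metric_space set"
  and b :: "real \<times> 'a \<times> 'c \<Rightarrow> 'a" and f :: "real \<times> 'a \<times> 'c \<Rightarrow> real"
 assumes T: "T > 0" and compact_A: "compact A" and A_nonempty: "A \<noteq> {}"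
  and b_uc: "uniformly_continuous_on ({0..T} \<times> closure U \<times> A) b"
  and f_uc: "uniformly_continuous_on ({0..T} \<times> closure U \<times> A) f"
begin

abbreviation "Ham \<equiv> hamiltonian A b f"

abbreviation "ham_form \<nu> u t v \<equiv>
 L2_inner U (H_grad U Ham u t) v + \<nu> * L2_inner U (weak_grad U (u t)) (weak_grad U v)"

lemma data_bounded:
 obtains B where "B > 0" "\<And>t x a. t \<in> {0..T} \<Longrightarrow> x \<in> closure U \<Longrightarrow> a \<in> A \<Longrightarrow> norm (b (t, x, a)) \<le> B \<and> \<bar>f (t, x, a)\<bar> \<le> B"
proof -
 let ?K = "{0..T} \<times> closure U \<times> A"
 have K: "compact ?K" using bounded_U compact_A by (intro compact_Times) auto
 have "bounded (b ` ?K)" "bounded (f ` ?K)"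
  using b_uc f_uc K by (auto intro!: compact_imp_bounded compact_continuous_image uniformly_continuous_imp_continuous)
 then obtain B1 B2 where "\<And>z. z \<in> ?K \<Longrightarrow> norm (b z) \<le> B1" "\<And>z. z \<in> ?K \<Longrightarrow> \<bar>f z\<bar> \<le> B2"
  unfolding bounded_iff by (metis image_eqI real_norm_def)
 then show ?thesis by (intro that[of "max 1 (max B1 B2)"]) (force simp: le_max_iff_disj)+
qed

lemma Ham_bdd:
 assumes "t \<in> {0..T}" "x \<in> closure U"
 shows "bdd_above ((\<lambda>a. b (t, x, a) \<bullet> p - f (t, x, a)) ` A)"
proof -
 obtain B where "B > 0" and B: "\<And>t x a. t \<in> {0..T} \<Longrightarrow> x \<in> closure U \<Longrightarrow> a \<in> A \<Longrightarrow> norm (b (t, x, a)) \<le> B \<and> \<bar>f (t, x, a)\<bar> \<le> B"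
  by (rule data_bounded) blast
 show ?thesis
 proof (rule bdd_aboveI2)
  fix a assume "a \<in> A"
  note * = B[OF assms this]
  have "b (t, x, a) \<bullet> p \<le> B * norm p"
   using norm_cauchy_schwarz[of "b (t, x, a)" p] mult_right_mono[OF conjunct1[OF *], of "norm p"] by simp
  then show "b (t, x, a) \<bullet> p - f (t, x, a) \<le> B * norm p + B" using * by linarith
 qed
qed

lemma Ham_bounds:
 obtains B where "B > 0"
  "\<And>t x p q. t \<in> {0..T} \<Longrightarrow> x \<in> closure U \<Longrightarrow> \<bar>Ham t x p - Ham t x q\<bar> \<le> B * norm (p - q)"
  "\<And>t x p. t \<in> {0..T} \<Longrightarrow> x \<in> closure U \<Longrightarrow> \<bar>Ham t x p\<bar> \<le> B * norm p + B"
proof -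
 obtain B where B: "B > 0" "\<And>t x a. t \<in> {0..T} \<Longrightarrow> x \<in> closure U \<Longrightarrow> a \<in> A \<Longrightarrow> norm (b (t, x, a)) \<le> B \<and> \<bar>f (t, x, a)\<bar> \<le> B"
  by (rule data_bounded) blast
 have ip: "\<bar>b (t, x, a) \<bullet> p\<bar> \<le> B * norm p" if "t \<in> {0..T}" "x \<in> closure U" "a \<in> A" for t x a p
  using Cauchy_Schwarz_ineq2[of "b (t, x, a)" p] mult_right_mono[OF conjunct1[OF B(2)[OF that]], of "norm p"] by simp
 have lip: "\<bar>Ham t x p - Ham t x q\<bar> \<le> B * norm (p - q)" if tx: "t \<in> {0..T}" "x \<in> closure U" for t x p q
  unfolding hamiltonian_def
 proof (rule abs_SUP_diff_le[OF A_nonempty Ham_bdd[OF tx] Ham_bdd[OF tx]])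
  fix a assume "a \<in> A"
  then show "\<bar>(b (t, x, a) \<bullet> p - f (t, x, a)) - (b (t, x, a) \<bullet> q - f (t, x, a))\<bar> \<le> B * norm (p - q)"
   using ip[OF tx, of a "p - q"] by (simp add: inner_diff_right)
 qed
 moreover have "\<bar>Ham t x p\<bar> \<le> B * norm p + B" if tx: "t \<in> {0..T}" "x \<in> closure U" for t x p
 proof -
  \<comment> \<open>Growth follows by comparing the supremum with that of the zero family.\<close>
  have "\<bar>Ham t x p - (SUP a\<in>A. 0)\<bar> \<le> B * norm p + B"
   unfolding hamiltonian_def
  proof (rule abs_SUP_diff_le[OF A_nonempty Ham_bdd[OF tx]])
   show "\<bar>(b (t, x, a) \<bullet> p - f (t, x, a)) - 0\<bar> \<le> B * norm p + B" if "a \<in> A" for a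
    using ip[OF tx that, of p] B(2)[OF tx that] by linarith
  qed auto
  then show ?thesis using A_nonempty by simp
 qed
 ultimately show ?thesis using that B(1) by blast
qed

text \<open>The gradient variable is moved first, by the Lipschitz bound; then \<open>t\<close> and
  \<open>x\<close> with the control fixed, where uniform continuity gives a modulus common to all
  controls, which survives the supremum.\<close>

lemma Ham_continuous: "continuous_on ({0..T} \<times> closure U \<times> UNIV) (\<lambda>(t, x, p). Ham t x p)"
 unfolding continuous_on_iff
proof (intro ballI allI impI)
 obtain B where B: "B > 0"
  "\<And>t x p q. t \<in> {0..T} \<Longrightarrow> x \<in> closure U \<Longrightarrow> \<bar>Ham t x p - Ham t x q\<bar> \<le> B * norm (p - q)"
  by (rule Ham_bounds) blast
 fix z :: "real \<times> 'a \<times> 'a" and e :: real assume z: "z \<in> {0..T} \<times> closure U \<times> UNIV" and e: "e > 0"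
 obtain t x p where zz: "z = (t, x, p)" and tx: "t \<in> {0..T}" "x \<in> closure U" using z by (cases z) auto
 \<comment> \<open>The change of \<open>b\<close> is multiplied by \<open>norm p\<close> and that of
   \<open>f\<close> by 1, so together they cost at most
   \<open>e' * (norm p + 1) = e / 4\<close>.\<close>
 define e' where "e' = e / (4 * (norm p + 1))"
 have e': "e' > 0" "e' * (norm p + 1) = e / 4"
  using e add_nonneg_pos[OF norm_ge_zero zero_less_one, of p] unfolding e'_def by (auto simp: field_simps)
 obtain d1 where d1: "d1 > 0" "\<And>z z'. z \<in> {0..T} \<times> closure U \<times> A \<Longrightarrow> z' \<in> {0..T} \<times> closure U \<times> A \<Longrightarrow> dist z' z < d1 \<Longrightarrow> dist (b z') (b z) < e'"
  using b_uc e'(1) unfolding uniformly_continuous_on_def by metis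
 obtain d2 where d2: "d2 > 0" "\<And>z z'. z \<in> {0..T} \<times> closure U \<times> A \<Longrightarrow> z' \<in> {0..T} \<times> closure U \<times> A \<Longrightarrow> dist z' z < d2 \<Longrightarrow> dist (f z') (f z) < e'"
  using f_uc e'(1) unfolding uniformly_continuous_on_def by metis
 define d where "d = min (min d1 d2) (e / (4 * B))"
 have d: "d > 0" "d \<le> d1" "d \<le> d2" "d \<le> e / (4 * B)" using d1 d2 e B by (auto simp: d_def)
 show "\<exists>d>0. \<forall>z'\<in>{0..T} \<times> closure U \<times> UNIV. dist z' z < d \<longrightarrow> dist (case z' of (t, x, p) \<Rightarrow> Ham t x p) (case z of (t, x, p) \<Rightarrow> Ham t x p) < e"
 proof (rule exI[of _ d], intro conjI ballI impI)
  show "d > 0" by (rule d(1))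
 next
  fix z' assume z': "z' \<in> {0..T} \<times> closure U \<times> UNIV" and dz: "dist z' z < d"
  obtain s y q where zz': "z' = (s, y, q)" and sy: "s \<in> {0..T}" "y \<in> closure U" using z' by (cases z') auto
  have "dist q p \<le> dist z' z"
   unfolding zz zz' by (rule order_trans[OF _ dist_snd_le]) (use dist_snd_le[of "(y, q)" "(x, p)"] in simp)
  then have "B * norm (q - p) \<le> e / 4"
   using dz d(4) B(1) by (simp add: dist_norm field_simps) (smt (verit) mult_left_mono)
  then have 1: "\<bar>Ham s y q - Ham s y p\<bar> \<le> e / 4" using B(2)[OF sy, of q p] by linarith
  have 2: "\<bar>Ham s y p - Ham t x p\<bar> \<le> e / 4"
   unfolding hamiltonian_def
  proof (rule abs_SUP_diff_le[OF A_nonempty Ham_bdd[OF sy] Ham_bdd[OF tx]])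
   fix a assume a: "a \<in> A"
   have "dist (s, y, a) (t, x, a) \<le> dist z' z" unfolding zz zz' dist_Pair_Pair by simp
   then have *: "dist (b (s, y, a)) (b (t, x, a)) < e'" "dist (f (s, y, a)) (f (t, x, a)) < e'"
    using d1(2)[of "(t, x, a)" "(s, y, a)"] d2(2)[of "(t, x, a)" "(s, y, a)"] dz d tx sy a by auto
   have "\<bar>(b (s, y, a) - b (t, x, a)) \<bullet> p\<bar> \<le> norm (b (s, y, a) - b (t, x, a)) * norm p" by (rule Cauchy_Schwarz_ineq2)
   also have "\<dots> \<le> e' * norm p" using *(1) by (intro mult_right_mono) (auto simp: dist_norm)
   finally have "\<bar>(b (s, y, a) - b (t, x, a)) \<bullet> p\<bar> + \<bar>f (s, y, a) - f (t, x, a)\<bar> \<le> e' * (norm p + 1)"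
    using *(2) by (simp add: dist_real_def distrib_left)
   then show "\<bar>(b (s, y, a) \<bullet> p - f (s, y, a)) - (b (t, x, a) \<bullet> p - f (t, x, a))\<bar> \<le> e / 4"
    unfolding e'(2) inner_diff_left by linarith
  qed
  show "dist (case z' of (t, x, p) \<Rightarrow> Ham t x p) (case z of (t, x, p) \<Rightarrow> Ham t x p) < e"
   using 1 2 e unfolding zz zz' prod.case dist_real_def by linarith
 qed
qed

text \<open>Continuity is available over the closed cylinder; cutting off by the indicator of this
  closed set gives a Borel function, unchanged on the open cylinder.\<close>

lemma Ham_measurable:
 assumes g: "g \<in> borel_measurable (lebesgue_on ({0<..<T} \<times> U))"
 shows "(\<lambda>z. Ham (fst z) (snd z) (g z)) \<in> borel_measurable (lebesgue_on ({0<..<T} \<times> U))"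
proof -
 let ?S = "{0..T} \<times> closure U \<times> (UNIV :: 'a set)"
 have "?S \<in> sets borel" by (intro borel_closed closed_Times) auto
 then have c: "(\<lambda>z. indicator ?S z *\<^sub>R (case z of (t, x, p) \<Rightarrow> Ham t x p)) \<in> borel_measurable borel"
  using Ham_continuous by (intro borel_measurable_continuous_on_indicator) auto
 have fs: "fst \<in> borel_measurable (lebesgue_on ({0<..<T} \<times> U))" "snd \<in> borel_measurable (lebesgue_on ({0<..<T} \<times> U))"
  by (auto intro!: measurable_restrict_space1 measurable_completion borel_measurable_continuous_onI continuous_intros)
 have "(\<lambda>z. (fst z, snd z, g z)) \<in> borel_measurable (lebesgue_on ({0<..<T} \<times> U))"
  unfolding borel_prod[symmetric] using fs g by measurable
 from measurable_compose[OF this c]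
 have "(\<lambda>z. indicator ?S (fst z, snd z, g z) *\<^sub>R Ham (fst z) (snd z) (g z)) \<in> borel_measurable (lebesgue_on ({0<..<T} \<times> U))" by simp
 moreover have "indicator ?S (fst z, snd z, g z) *\<^sub>R Ham (fst z) (snd z) (g z) = Ham (fst z) (snd z) (g z)" if "z \<in> {0<..<T} \<times> U" for z
  using that closure_subset[of U] by (auto simp: indicator_def)
 ultimately show ?thesis by (subst measurable_cong[where g = "\<lambda>z. indicator ?S (fst z, snd z, g z) *\<^sub>R Ham (fst z) (snd z) (g z)"]) (auto simp: space_restrict_space)
qed

text \<open>Sections of the jointly measurable gradient \<open>g\<close> are measurable; this is
  carried over to \<open>weak_grad\<close>, which agrees with \<open>g\<close> almost everywhere.
  Linear growth of the Hamiltonian supplies the square integrable bound.\<close>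

lemma DpHE:
 assumes u: "u \<in> X_space T U" and \<beta>: "\<beta> \<in> DpH T U Ham u"
 obtains \<kappa> where "\<beta> \<in> Linf ({0<..<T} \<times> U)"
  "AE t in \<mu> T. AE x in \<mu>U. \<beta> (t, x) \<in> subdiff Ham t x (weak_grad U (u t) x)"
  "AE t in \<mu> T. H_grad U Ham u t \<in> L2 U"
  "X_functional T (\<lambda>t. L2_inner U (H_grad U Ham u t)) \<kappa>"
proof -
 obtain g where \<beta>L: "\<beta> \<in> Linf ({0<..<T} \<times> U)" and g: "g \<in> borel_measurable (lebesgue_on ({0<..<T} \<times> U))"
  "AE t in \<mu> T. AE x in \<mu>U. g (t, x) = weak_grad U (u t) x"
  "AE (t, x) in lebesgue_on ({0<..<T} \<times> U). \<beta> (t, x) \<in> subdiff Ham t x (g (t, x))"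
  using \<beta> unfolding DpH_def by blast
 have "AE t in \<mu> T. AE x in \<mu>U. \<beta> (t, x) \<in> subdiff Ham t x (g (t, x))"
  using AE_product_sections[OF _ open_U g(3)] by simp
 then have sub: "AE t in \<mu> T. AE x in \<mu>U. \<beta> (t, x) \<in> subdiff Ham t x (weak_grad U (u t) x)"
  using g(2)
 proof eventually_elim
  case (elim t)
  then show ?case by eventually_elim simp
 qed
 obtain B where B: "B > 0" "\<And>t x p. t \<in> {0..T} \<Longrightarrow> x \<in> closure U \<Longrightarrow> \<bar>Ham t x p\<bar> \<le> B * norm p + B"
  by (rule Ham_bounds) blast
 note Hm = Ham_measurable[OF g(1)]
 have eq: "AE t in \<mu> T. AE x in \<mu>U. Ham t x (g (t, x)) = H_grad U Ham u t x"
  using g(2)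
 proof eventually_elim
  case (elim t)
  then show ?case by eventually_elim (simp add: H_grad_def)
 qed
 have meas: "AE t in \<mu> T. H_grad U Ham u t \<in> borel_measurable \<mu>U"
  using cylinder_sections(1)[OF Hm] eq
 proof eventually_elim
  case (elim t)
  show ?case by (rule borel_measurable_lebesgue_on_AE[OF elim(1) _ sets_U]) (use elim(2) in simp)
 qed
 define D where "D = L2_norm U (\<lambda>_::'a. B)"
 have BL: "(\<lambda>_::'a. B) \<in> L2 U" by (rule bounded_L2[where B = B]) (use B in auto)
 have HL: "AE t in \<mu> T. H_grad U Ham u t \<in> L2 U \<and> L2_norm U (H_grad U Ham u t) \<le> B * H1_norm U (u t) + D"
  using meas X_spaceD(3)[OF u] AE_space
 proof eventually_elim
  case (elim t)
  let ?h = "\<lambda>x. B * norm (weak_grad U (u t) x)"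
  have n: "(\<lambda>x. norm (weak_grad U (u t) x)) \<in> L2 U" "L2_norm U (\<lambda>x. norm (weak_grad U (u t) x)) \<le> 1 * L2_norm U (weak_grad U (u t))"
   by (rule L2_bound[OF H1D(3)[OF elim(2)], of _ 1]; use L2_D(1)[OF H1D(3)[OF elim(2)]] in simp)+
  note h = L2_mult[OF n(1), of B]
  have "norm (H_grad U Ham u t x) \<le> 1 * norm (?h x + B)" if "x \<in> U" for x
   using B(2)[of t x "weak_grad U (u t) x"] B(1) that closure_subset[of U] elim(3) by (auto simp: H_grad_def)
  then have "AE x in \<mu>U. norm (H_grad U Ham u t x) \<le> 1 * norm (?h x + B)" by (intro AE_I2) (simp add: space_restrict_space)
  note b = L2_bound[OF L2_add[OF h BL] elim(1) zero_le_one this]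
  have "L2_norm U (\<lambda>x. ?h x + B) \<le> L2_norm U ?h + D" unfolding D_def by (rule L2_norm_triangle[OF h BL])
  moreover have "L2_norm U ?h \<le> B * H1_norm U (u t)"
   using n(2) H1_norm_ge(2)[of "u t"] B(1) by (simp add: L2_norm_mult)
  ultimately show ?case using b by simp
 qed
 have "X_functional T (\<lambda>t. L2_inner U (H_grad U Ham u t)) (\<lambda>t. B * H1_norm U (u t) + D)"
 proof (rule kernel_functional[OF HL])
  note n = H.bochner_norm_measurable[OF X_spaceD(1)[OF u]]
  show "(\<lambda>t. B * H1_norm U (u t) + D) \<in> borel_measurable (\<mu> T)" using n by simp
  show "integrable (\<mu> T) (\<lambda>t. (B * H1_norm U (u t) + D)\<^sup>2)"
  proof (rule Bochner_Integration.integrable_bound)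
   show "integrable (\<mu> T) (\<lambda>t. 2 * (B\<^sup>2 * (H1_norm U (u t))\<^sup>2) + 2 * D\<^sup>2)"
    using H.bochnerD(2)[OF X_spaceD(1)[OF u]] by simp
   have "(p + q)\<^sup>2 \<le> 2 * p\<^sup>2 + 2 * q\<^sup>2" for p q :: real using sum_squares_bound[of p q] by (simp add: power2_eq_square algebra_simps)
   then show "AE t in \<mu> T. norm ((B * H1_norm U (u t) + D)\<^sup>2) \<le> norm (2 * (B\<^sup>2 * (H1_norm U (u t))\<^sup>2) + 2 * D\<^sup>2)"
    by (intro AE_I2) (simp add: power_mult_distrib[symmetric])
  qed (use n in measurable)
  show "(\<lambda>t. L2_inner U (H_grad U Ham u t) v) \<in> borel_measurable (\<mu> T)" if v: "v \<in> H10 U" for v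
  proof (rule borel_measurable_lebesgue_on_AE)
   note vm = L2_D(1)[OF H1D(1)[OF H10_H1[OF v]]]
   show "(\<lambda>t. LINT x|\<mu>U. Ham t x (g (t, x)) \<bullet> v x) \<in> borel_measurable (\<mu> T)"
    using cylinder_sections(2)[OF Hm vm] by simp
   show "AE t in \<mu> T. (LINT x|\<mu>U. Ham t x (g (t, x)) \<bullet> v x) = L2_inner U (H_grad U Ham u t) v"
    using cylinder_sections(1)[OF Hm] meas eq
   proof eventually_elim
    case (elim t)
    show ?case using L2_inner_cong[OF elim(3) _ _ vm sets_U, of v] elim(1) by (simp add: L2_inner_def)
   qed
  qed simp
 qed
 moreover have "AE t in \<mu> T. H_grad U Ham u t \<in> L2 U" using HL by eventually_elim simp
 ultimately show ?thesis using that \<beta>L sub by blast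
qed

end

section \<open>Nonnegativity of the density\<close>

lemma young_lower:
 fixes \<nu> C r s :: real
 assumes "\<nu> > 0" shows "- (C\<^sup>2 / (4 * \<nu>) * s\<^sup>2) \<le> \<nu> * r\<^sup>2 - C * s * r"
proof -
 have "0 \<le> (2 * \<nu> * r - C * s)\<^sup>2 / (4 * \<nu>)" using assms by simp
 also have "\<dots> = \<nu> * r\<^sup>2 - C * s * r + C\<^sup>2 / (4 * \<nu>) * s\<^sup>2"
  using assms by (simp add: field_simps power2_eq_square)
 finally show ?thesis by simp
qed

lemma npot_nonneg_arg: "s \<ge> 0 \<Longrightarrow> npot \<delta> s = 0"
 by (simp add: npot_def flat_def)

lemma prim_mono:
 assumes w: "integrable (\<mu> T) w" and w': "integrable (\<mu> T) w'" and le: "AE s in \<mu> T. w s \<le> w' s"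
 shows "prim T w t \<le> prim T w' t"
 unfolding prim_def
proof (rule integral_mono_AE)
 show "AE s in \<mu> T. indicator {..t} s * w s \<le> indicator {..t} s * w' s"
  using le by eventually_elim (simp add: indicator_def)
qed (use w w' in \<open>auto intro!: prim_integrable\<close>)

context bounded_domain begin

lemma npot_potential:
 assumes "\<delta> > 0" shows "potential (npot \<delta>) (nfun \<delta>)"
proof -
 interpret N: lipschitz_chain U "nfun \<delta>" "nder \<delta>" "128 / \<delta>" by (rule nfun_chain[OF assms])
 show ?thesis
 proof
  show "npot \<delta> \<in> borel_measurable borel"
   by (rule borel_measurable_continuous_onI) (simp add: continuous_at_imp_continuous_on DERIV_isCont[OF npot_derivative[OF assms]])
 qed (rule npot_tangent[OF assms] N.\<theta>_le nfun_0 N.\<theta>_measurable)+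
qed

text \<open>The gradient of the test function is \<open>nder \<delta> (m x)\<close> times that of
  \<open>m\<close>, so drift and diffusion carry the same nonnegative weight. Young's inequality
  absorbs the drift up to \<open>C1\<close> times \<open>s\<^sup>2 * nder \<delta> s\<close>, which
  \<open>square_nder_le\<close> bounds by the potential.\<close>

lemma drift_diffusion_lower:
 fixes \<beta> :: "'a \<Rightarrow> 'a"
 assumes \<delta>: "\<delta> > 0" and \<nu>: "\<nu> > 0" and C: "C > 0" and m: "m \<in> H10 U"
  and \<beta>: "AE x in \<mu>U. norm (\<beta> x) \<le> C" and mb: "(\<lambda>x. m x *\<^sub>R \<beta> x) \<in> L2 U"
 defines "C1 \<equiv> C\<^sup>2 / (4 * \<nu>)"
 shows "- (3 * C1 * (LINT x|\<mu>U. npot \<delta> (m x)) + C1 * \<delta>\<^sup>2 * measure lebesgue U)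
  \<le> L2_inner U (\<lambda>x. m x *\<^sub>R \<beta> x) (weak_grad U (\<lambda>x. nfun \<delta> (m x)))
   + \<nu> * L2_inner U (weak_grad U m) (weak_grad U (\<lambda>x. nfun \<delta> (m x)))"
proof -
 interpret N: lipschitz_chain U "nfun \<delta>" "nder \<delta>" "128 / \<delta>" by (rule nfun_chain[OF \<delta>])
 interpret P: potential "npot \<delta>" "nfun \<delta>" by (rule npot_potential[OF \<delta>])
 let ?g = "weak_grad U m" and ?gv = "weak_grad U (\<lambda>x. nfun \<delta> (m x))"
 note mH = H10_H1[OF m]
 note gv = H1D(3)[OF N.comp_H1(1)[OF m]]
 note i = L2_inner_integrable(1)[OF H1D(3)[OF mH] gv] L2_inner_integrable(1)[OF mb gv]
 have C1: "C1 > 0" using C \<nu> by (simp add: C1_def)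
 have pointwise: "- (3 * C1 * p + C1 * \<delta>\<^sup>2) \<le> \<nu> * (g \<bullet> (n *\<^sub>R g)) + (s *\<^sub>R b) \<bullet> (n *\<^sub>R g)"
  if n: "0 \<le> n" "s\<^sup>2 * n \<le> 3 * p + \<delta>\<^sup>2" and b: "norm b \<le> C" for p s n and g b :: 'a
 proof -
  have "\<bar>s * (b \<bullet> g)\<bar> \<le> \<bar>s\<bar> * (C * norm g)"
   unfolding abs_mult using Cauchy_Schwarz_ineq2[of b g] mult_right_mono[OF b, of "norm g"] by (intro mult_left_mono) auto
  then have "- (C1 * s\<^sup>2) \<le> \<nu> * (norm g)\<^sup>2 + s * (b \<bullet> g)"
   using young_lower[OF \<nu>, of C "\<bar>s\<bar>" "norm g"] by (simp add: C1_def abs_le_iff algebra_simps)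
  from mult_left_mono[OF this n(1)]
  have "- (C1 * (s\<^sup>2 * n)) \<le> n * (\<nu> * (norm g)\<^sup>2 + s * (b \<bullet> g))" by (simp add: algebra_simps)
  moreover have "C1 * (s\<^sup>2 * n) \<le> C1 * (3 * p + \<delta>\<^sup>2)" using n(2) C1 by (intro mult_left_mono) auto
  ultimately show ?thesis by (simp add: power2_norm_eq_inner algebra_simps)
 qed
 have "(LINT x|\<mu>U. - (3 * C1 * npot \<delta> (m x) + C1 * \<delta>\<^sup>2)) \<le> (LINT x|\<mu>U. \<nu> * (?g x \<bullet> ?gv x) + (m x *\<^sub>R \<beta> x) \<bullet> ?gv x)"
 proof (rule integral_mono_AE)
  show "AE x in \<mu>U. - (3 * C1 * npot \<delta> (m x) + C1 * \<delta>\<^sup>2) \<le> \<nu> * (?g x \<bullet> ?gv x) + (m x *\<^sub>R \<beta> x) \<bullet> ?gv x"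
   using N.comp_H1(2)[OF m] \<beta>
  proof eventually_elim
   case (elim x)
   show ?case
    unfolding elim(1) by (rule pointwise[OF nder_bounds(1)[OF \<delta>] square_nder_le[OF \<delta>] elim(2)])
  qed
 qed (use i P.\<Phi>_integrable[OF H1D(1)[OF mH]] in auto)
 then show ?thesis
  using i P.\<Phi>_integrable[OF H1D(1)[OF mH]]
  by (simp add: L2_inner_def measure_restrict_space sets_U mult.assoc algebra_simps)
qed

text \<open>\<open>nfun \<delta>\<close> is nonpositive, so the source term has the favourable sign;
  the potential starts from 0 because \<open>npot \<delta>\<close> vanishes at nonnegative
  arguments. Gronwall then bounds its time integral by a constant times \<delta> squared.\<close>

lemma density_nonneg:
 fixes \<beta> :: "real \<times> 'a \<Rightarrow> 'a"
 assumes T: "T > 0" and \<nu>: "\<nu> > 0" and m: "m \<in> Y_space T U" and \<beta>: "\<beta> \<in> Linf ({0<..<T} \<times> U)"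
  and m0: "AE x in \<mu>U. at_time T U m 0 x \<ge> 0" and G: "G \<in> L2_Hm1 T U" "nonneg_distribution T U G"
  and kfp: "\<And>\<phi>. \<phi> \<in> X_space T U \<Longrightarrow>
   (LINT t|\<mu> T. time_deriv T U m t (\<phi> t)) + (LINT t|\<mu> T. drift_form \<nu> m \<beta> t (\<phi> t)) = (LINT t|\<mu> T. G t (\<phi> t))"
 shows "AE t in \<mu> T. AE x in \<mu>U. m t x \<ge> 0"
proof -
 note X = Y_spaceD(1)[OF m]
 obtain C0 where C0: "C0 \<ge> 0" "AE t in \<mu> T. (\<lambda>x. \<beta> (t, x)) \<in> borel_measurable \<mu>U \<and> (AE x in \<mu>U. norm (\<beta> (t, x)) \<le> C0)"
  by (rule LinfE[OF \<beta>]) blast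
 \<comment> \<open>The \<open>+ 1\<close> keeps the constant positive when the bound
   \<open>C0\<close> is 0; \<open>4 * \<nu>\<close> comes from absorbing the drift into the
   diffusion.\<close>
 define C1 where "C1 = (C0 + 1)\<^sup>2 / (4 * \<nu>)"
 have C1: "C1 > 0" using C0(1) \<nu> by (simp add: C1_def)
 obtain \<kappa> where drift: "X_functional T (\<lambda>t v. L2_inner U (\<lambda>x. m t x *\<^sub>R \<beta> (t, x)) (weak_grad U v)) \<kappa>"
  "AE t in \<mu> T. (\<lambda>x. m t x *\<^sub>R \<beta> (t, x)) \<in> L2 U"
  by (rule drift_functional[OF X \<beta>])
 define l where "l = time_deriv T U m"
 define R where "R t v = drift_form \<nu> m \<beta> t v" for t v
 note lf = L2_Hm1_functional[OF Y_spaceD(3)[OF m], folded l_def]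
 note Rf = H.L2_functional_lin[OF drift(1) diffusion_functional[OF X], of \<nu>, folded R_def[abs_def]]
 \<comment> \<open>The constant of \<open>gronwall_forward\<close> with \<delta> squared taken out;
   \<open>3 * C1\<close> carries the 3 of \<open>square_nder_le\<close>.\<close>
 define K where "K = 2 * (C1 * measure lebesgue U * T) * T * exp (2 * (3 * C1) * T)"
 have est: "(LINT t|\<mu> T. LINT x|\<mu>U. npot \<delta> (m t x)) \<le> K * \<delta>\<^sup>2" if \<delta>: "\<delta> > 0" for \<delta>
 proof -
  interpret N: lipschitz_chain U "nfun \<delta>" "nder \<delta>" "128 / \<delta>" by (rule nfun_chain[OF \<delta>])
  note pot = npot_potential[OF \<delta>]
  define v where "v t x = nfun \<delta> (m t x)" for t x
  define y where "y t = (LINT x|\<mu>U. npot \<delta> (m t x))" for t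
  have vX: "v \<in> X_space T U" unfolding v_def[abs_def] by (rule N.comp_X[OF X])
  note vB = X_spaceD(1)[OF vX]
  note li = H.pairing_integrable(1)[OF lf vB] and Ri = H.pairing_integrable(1)[OF Rf vB]
  have yi: "integrable (\<mu> T) y" unfolding y_def by (rule potential_integrable[OF pot X])
  obtain d where d: "\<And>t. t \<in> {0..T} \<Longrightarrow> (LINT x|\<mu>U. npot \<delta> (at_time T U m t x)) = d + prim T (\<lambda>s. l s (v s)) t"
   "AE t in \<mu> T. y t = d + prim T (\<lambda>s. l s (v s)) t"
   unfolding v_def y_def l_def
   by (rule energy_trace[OF Y_evolves[OF T m] pot vX[unfolded v_def[abs_def]] Y_at_time[OF T m]]) blast
  have "(LINT x|\<mu>U. npot \<delta> (at_time T U m 0 x)) = 0"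
   using m0 by (intro integral_eq_zero_AE) (auto elim!: eventually_mono simp: npot_nonneg_arg)
  then have d0: "d = 0" using d(1)[of 0] T by (simp add: prim_0)
  have le: "prim T (\<lambda>s. l s (v s)) t + prim T (\<lambda>s. R s (v s)) t \<le> 0" for t
  proof -
   \<comment> \<open>Cutting off after time \<open>t\<close> stays within X and localises the
     equation to the times before \<open>t\<close>; the negative of this function is nonnegative and
     hence admissible in the sign condition on \<open>G\<close>.\<close>
   define \<phi> where "\<phi> s x = indicator {..t} s * v s x" for s x
   have ind: "(\<lambda>s. indicator {..t} s) \<in> borel_measurable (\<mu> T)" by (auto intro!: measurable_restrict_space1 measurable_completion)
   have \<phi>B: "\<phi> \<in> bochner_L2 T (H10 U) (H1_norm U)"
    unfolding \<phi>_def[abs_def] by (rule H.bochner_mult[OF vB ind, of 1]) (simp add: indicator_def)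
   have nB: "(\<lambda>s x. - 1 * \<phi> s x) \<in> X_space T U" unfolding X_space_def by (rule H.bochner_scale[OF \<phi>B])
   have "AE s in \<mu> T. AE x in \<mu>U. - 1 * \<phi> s x \<ge> 0"
    using nfun_nonpos[OF \<delta>] by (intro AE_I2) (simp add: \<phi>_def v_def indicator_def)
   then have G0: "0 \<le> (LINT s|\<mu> T. G s (\<lambda>x. - 1 * \<phi> s x))"
    by (rule G(2)[unfolded nonneg_distribution_def, rule_format, OF nB])
   note Gf = L2_Hm1_functional[OF G(1)]
   have "(LINT s|\<mu> T. G s (\<lambda>x. - 1 * \<phi> s x)) = (LINT s|\<mu> T. - G s (\<phi> s))"
   proof (rule integral_cong_AE)
    show "AE s in \<mu> T. G s (\<lambda>x. - 1 * \<phi> s x) = - G s (\<phi> s)"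
     using H.L2_functionalD(4)[OF Gf] H.bochnerD(1)[OF \<phi>B] by eventually_elim (subst H.bdd_linear_simps(3), auto)
   qed (use H.pairing_measurable[OF Gf nB[unfolded X_space_def]] H.pairing_measurable[OF Gf \<phi>B] in auto)
   then have G1: "(LINT s|\<mu> T. G s (\<phi> s)) \<le> 0" using G0 by simp
   have "(LINT s|\<mu> T. indicator {..t} s * l s (v s) + indicator {..t} s * R s (v s)) = (LINT s|\<mu> T. l s (\<phi> s) + R s (\<phi> s))"
   proof (rule integral_cong_AE)
    show "AE s in \<mu> T. indicator {..t} s * l s (v s) + indicator {..t} s * R s (v s) = l s (\<phi> s) + R s (\<phi> s)"
     using H.L2_functionalD(4)[OF lf] H.L2_functionalD(4)[OF Rf] H.bochnerD(1)[OF vB]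
     unfolding \<phi>_def by eventually_elim (simp add: H.bdd_linear_simps(3))
   qed (use prim_integrable[OF li] prim_integrable[OF Ri] H.pairing_measurable[OF lf \<phi>B] H.pairing_measurable[OF Rf \<phi>B] in auto)
   also have "\<dots> = (LINT s|\<mu> T. l s (\<phi> s)) + (LINT s|\<mu> T. R s (\<phi> s))"
    by (rule Bochner_Integration.integral_add[OF H.pairing_integrable(1)[OF lf \<phi>B] H.pairing_integrable(1)[OF Rf \<phi>B]])
   also have "\<dots> = (LINT s|\<mu> T. G s (\<phi> s))"
    unfolding R_def l_def by (rule kfp) (simp add: X_space_def \<phi>B)
   finally show ?thesis using G1 prim_integrable[OF li] prim_integrable[OF Ri] by (simp add: prim_def)
  qed
  have Rlow: "AE s in \<mu> T. - (3 * C1 * y s + C1 * \<delta>\<^sup>2 * measure lebesgue U) \<le> R s (v s)"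
   using C0(2) drift(2) X_spaceD(2)[OF X]
  proof eventually_elim
   case (elim s)
   have "AE x in \<mu>U. norm (\<beta> (s, x)) \<le> C0 + 1" using conjunct2[OF elim(1)] by eventually_elim simp
   then show ?case
    unfolding y_def R_def v_def C1_def using C0(1) by (intro drift_diffusion_lower[OF \<delta> \<nu> _ elim(3) _ elim(2)]) auto
  qed
  define e where "e = C1 * \<delta>\<^sup>2 * measure lebesgue U * T"
  have "(LINT t|\<mu> T. y t) \<le> 2 * e * T * exp (2 * (3 * C1) * T)"
  proof (rule gronwall_forward[OF yi _ _ T])
   show "AE t in \<mu> T. 0 \<le> y t" unfolding y_def using npot_nonneg by (intro AE_I2 integral_nonneg_AE) auto
   show "AE t in \<mu> T. y t \<le> e + 3 * C1 * prim T y t"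
    using d(2) AE_space
   proof eventually_elim
    case (elim t)
    have t: "0 \<le> t" "t \<le> T" using elim(2) by auto
    have "prim T (\<lambda>s. - (3 * C1 * y s + C1 * \<delta>\<^sup>2 * measure lebesgue U)) t \<le> prim T (\<lambda>s. R s (v s)) t"
     by (rule prim_mono[OF _ Ri Rlow]) (use yi in simp)
    moreover have "prim T (\<lambda>s. - (3 * C1 * y s + C1 * \<delta>\<^sup>2 * measure lebesgue U)) t
      = - (3 * C1 * prim T y t + prim T (\<lambda>_. C1 * \<delta>\<^sup>2 * measure lebesgue U) t)"
    proof -
     have "prim T (\<lambda>s. - (3 * C1 * y s + C1 * \<delta>\<^sup>2 * measure lebesgue U)) t
      = (LINT s|\<mu> T. - (3 * C1 * (indicator {..t} s * y s)) - indicator {..t} s * (C1 * \<delta>\<^sup>2 * measure lebesgue U))"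
      unfolding prim_def by (intro Bochner_Integration.integral_cong refl) (simp add: algebra_simps)
     also have "\<dots> = - (3 * C1 * prim T y t + prim T (\<lambda>_. C1 * \<delta>\<^sup>2 * measure lebesgue U) t)"
      unfolding prim_def using prim_integrable[OF yi, of "{..t}"] prim_integrable[of T "\<lambda>_. C1 * \<delta>\<^sup>2 * measure lebesgue U" "{..t}"]
      by (subst Bochner_Integration.integral_diff) auto
     finally show ?thesis .
    qed
    moreover have "prim T (\<lambda>_. C1 * \<delta>\<^sup>2 * measure lebesgue U) t = C1 * \<delta>\<^sup>2 * measure lebesgue U * t"
     using prim_const[of 0 t T "C1 * \<delta>\<^sup>2 * measure lebesgue U"] t by (simp add: prim_0)
    moreover have "C1 * \<delta>\<^sup>2 * measure lebesgue U * t \<le> e" unfolding e_def using t C1 by (intro mult_left_mono) auto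
    ultimately show ?case using elim(1) d0 le[of t] by linarith
   qed
  qed (use C1 T in \<open>auto simp: e_def\<close>)
  then show ?thesis by (simp add: y_def e_def K_def algebra_simps)
 qed
 \<comment> \<open>A fixed potential on the left, so that \<delta> can tend to 0 on the
   right.\<close>
 define Z where "Z t = (LINT x|\<mu>U. npot 1 (m t x))" for t
 have Zi: "integrable (\<mu> T) Z" unfolding Z_def by (rule potential_integrable[OF npot_potential[OF zero_less_one] X])
 have Z0: "Z t \<ge> 0" for t unfolding Z_def using npot_nonneg by (intro integral_nonneg_AE) auto
 have "(LINT t|\<mu> T. Z t) \<le> K * (1 / real (Suc n))\<^sup>2" for n
 proof -
  define \<delta> where "\<delta> = 1 / real (Suc n)"
  have \<delta>: "0 < \<delta>" "\<delta> \<le> 1" by (auto simp: \<delta>_def)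
  have "(LINT t|\<mu> T. Z t) \<le> (LINT t|\<mu> T. LINT x|\<mu>U. npot \<delta> (m t x))"
  proof (rule integral_mono_AE[OF Zi potential_integrable[OF npot_potential[OF \<delta>(1)] X]])
   show "AE t in \<mu> T. Z t \<le> (LINT x|\<mu>U. npot \<delta> (m t x))"
    using X_spaceD(4)[OF X]
   proof eventually_elim
    case (elim t)
    show ?case
     unfolding Z_def using npot_antimono[OF \<delta>]
     by (intro integral_mono potential.\<Phi>_integrable[OF npot_potential elim] \<delta>) auto
   qed
  qed
  then show ?thesis using est[OF \<delta>(1)] unfolding \<delta>_def by linarith
 qed
 moreover have "(\<lambda>n. K * (1 / real (Suc n))\<^sup>2) \<longlonglongrightarrow> K * 0\<^sup>2"
  by (intro tendsto_intros LIMSEQ_Suc[OF lim_1_over_n])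
 ultimately have "(LINT t|\<mu> T. Z t) \<le> K * 0\<^sup>2" by (intro LIMSEQ_le_const) auto
 moreover have "(LINT t|\<mu> T. Z t) \<ge> 0" using Z0 by (intro integral_nonneg_AE) auto
 ultimately have "(LINT t|\<mu> T. Z t) = 0" by simp
 then have "AE t in \<mu> T. Z t = 0" using integral_nonneg_eq_0_iff_AE[OF Zi] Z0 by simp
 then show ?thesis
  using X_spaceD(4)[OF X]
 proof eventually_elim
  case (elim t)
  have "AE x in \<mu>U. npot 1 (m t x) = 0"
   using integral_nonneg_eq_0_iff_AE[OF potential.\<Phi>_integrable[OF npot_potential[OF zero_less_one] elim(2)]] npot_nonneg elim(1)
   unfolding Z_def by simp
  then show ?case by eventually_elim (rule npot_eq_0_imp)
 qed
qed

end

section \<open>Uniqueness\<close>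

lemma integral_time_cong:
 fixes f g :: "real \<Rightarrow> real"
 assumes ae: "AE t in \<mu> T. f t = g t" and g: "g \<in> borel_measurable (\<mu> T)"
 shows "(LINT t|\<mu> T. f t) = (LINT t|\<mu> T. g t)"
proof (rule integral_cong_AE[OF _ g ae])
 show "f \<in> borel_measurable (\<mu> T)"
  by (rule borel_measurable_lebesgue_on_AE[OF g]) (use ae in \<open>auto elim: eventually_mono\<close>)
qed

context bounded_domain begin

lemma weak_grad_diff:
 assumes "v \<in> H1 U" "w \<in> H1 U"
 shows "AE x in \<mu>U. weak_grad U (\<lambda>x. v x - w x) x = weak_grad U v x - weak_grad U w x"
 using H1_lin(2)[OF assms, of "-1"] by simp

lemma grad_inner_diff:
 assumes v: "v \<in> H1 U" and w: "w \<in> H1 U" and k: "k \<in> L2 U"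
 shows "L2_inner U (weak_grad U (\<lambda>x. v x - w x)) k = L2_inner U (weak_grad U v) k - L2_inner U (weak_grad U w) k"
proof -
 have "L2_inner U (weak_grad U (\<lambda>x. v x - w x)) k = L2_inner U (\<lambda>x. weak_grad U v x - weak_grad U w x) k"
  by (rule L2_inner_cong[OF weak_grad_diff[OF v w] _ L2_D(1)[OF H1D(3)[OF H1_diff[OF v w]]] L2_D(1)[OF k] sets_U]) simp
 then show ?thesis by (simp add: L2_inner_diff(2)[OF H1D(3)[OF v] H1D(3)[OF w] k])
qed

text \<open>Both diffusion differences equal \<nu> times the inner product of the gradients of the
  two differences, so they cancel; what remains is \<open>le\<close>, integrated.\<close>

lemma cross_test_le:
 fixes p\<^sub>1 p\<^sub>2 :: "'a \<Rightarrow> 'a"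
 assumes u: "u\<^sub>1 \<in> H1 U" "u\<^sub>2 \<in> H1 U" and m: "m\<^sub>1 \<in> H1 U" "m\<^sub>2 \<in> H1 U"
  and h: "h\<^sub>1 \<in> L2 U" "h\<^sub>2 \<in> L2 U" and p: "p\<^sub>1 \<in> L2 U" "p\<^sub>2 \<in> L2 U"
  and le: "AE x in \<mu>U. (h\<^sub>1 x - h\<^sub>2 x) * (m\<^sub>1 x - m\<^sub>2 x) \<le> (p\<^sub>1 x - p\<^sub>2 x) \<bullet> (weak_grad U u\<^sub>1 x - weak_grad U u\<^sub>2 x)"
 defines "\<psi> \<equiv> \<lambda>x. m\<^sub>1 x - m\<^sub>2 x" and "\<phi> \<equiv> \<lambda>x. u\<^sub>1 x - u\<^sub>2 x"
 shows "(L2_inner U h\<^sub>1 \<psi> + \<nu> * L2_inner U (weak_grad U u\<^sub>1) (weak_grad U \<psi>)) - (L2_inner U h\<^sub>2 \<psi> + \<nu> * L2_inner U (weak_grad U u\<^sub>2) (weak_grad U \<psi>))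
  \<le> (L2_inner U p\<^sub>1 (weak_grad U \<phi>) + \<nu> * L2_inner U (weak_grad U m\<^sub>1) (weak_grad U \<phi>)) - (L2_inner U p\<^sub>2 (weak_grad U \<phi>) + \<nu> * L2_inner U (weak_grad U m\<^sub>2) (weak_grad U \<phi>))"
proof -
 have \<psi>: "\<psi> \<in> H1 U" and \<phi>: "\<phi> \<in> H1 U" unfolding \<psi>_def \<phi>_def by (intro H1_diff u m)+
 note g\<psi> = H1D(3)[OF \<psi>] and g\<phi> = H1D(3)[OF \<phi>]
 have "L2_inner U (\<lambda>x. h\<^sub>1 x - h\<^sub>2 x) \<psi> \<le> L2_inner U (\<lambda>x. p\<^sub>1 x - p\<^sub>2 x) (weak_grad U \<phi>)"
  unfolding L2_inner_def
 proof (rule integral_mono_AE[OF L2_inner_integrable(1)[OF L2_diff[OF h] H1D(1)[OF \<psi>]] L2_inner_integrable(1)[OF L2_diff[OF p] g\<phi>]])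
  show "AE x in \<mu>U. (h\<^sub>1 x - h\<^sub>2 x) \<bullet> \<psi> x \<le> (p\<^sub>1 x - p\<^sub>2 x) \<bullet> weak_grad U \<phi> x"
   using le weak_grad_diff[OF u] by eventually_elim (simp add: \<psi>_def \<phi>_def)
 qed
 then have "L2_inner U h\<^sub>1 \<psi> - L2_inner U h\<^sub>2 \<psi> \<le> L2_inner U p\<^sub>1 (weak_grad U \<phi>) - L2_inner U p\<^sub>2 (weak_grad U \<phi>)"
  by (simp add: L2_inner_diff(2)[OF h H1D(1)[OF \<psi>]] L2_inner_diff(2)[OF p g\<phi>])
 moreover have "L2_inner U (weak_grad U u\<^sub>1) (weak_grad U \<psi>) - L2_inner U (weak_grad U u\<^sub>2) (weak_grad U \<psi>)
   = L2_inner U (weak_grad U m\<^sub>1) (weak_grad U \<phi>) - L2_inner U (weak_grad U m\<^sub>2) (weak_grad U \<phi>)"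
  using grad_inner_diff[OF u g\<psi>] grad_inner_diff[OF m g\<phi>] by (simp add: \<psi>_def \<phi>_def L2_inner_commute)
 then have "\<nu> * L2_inner U (weak_grad U u\<^sub>1) (weak_grad U \<psi>) - \<nu> * L2_inner U (weak_grad U u\<^sub>2) (weak_grad U \<psi>)
   = \<nu> * L2_inner U (weak_grad U m\<^sub>1) (weak_grad U \<phi>) - \<nu> * L2_inner U (weak_grad U m\<^sub>2) (weak_grad U \<phi>)"
  by (simp add: right_diff_distrib[of \<nu>, symmetric] del: right_diff_distrib)
 ultimately show ?thesis by linarith
qed

text \<open>Since \<open>a T\<close> is free, \<open>eq\<close> contains the final condition besides
  the equation. Functions with compact support in time give \<open>evolves\<close>;
  \<open>a t = t\<close> then gives a zero trace at \<open>T\<close>, and the energy identity is run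
  backward from there.\<close>

lemma backward_zero:
 assumes T: "T > 0" and w: "w \<in> X_space T U" and l: "X_functional T l \<kappa>" and C: "C > 0"
  and eq: "\<And>a v. (\<And>k. Ck k a) \<Longrightarrow> a 0 = 0 \<Longrightarrow> v \<in> H10 U \<Longrightarrow>
   (LINT t|\<mu> T. deriv a t * L2_inner U (w t) v) = - (LINT t|\<mu> T. a t * l t v)"
  and low: "AE t in \<mu> T. - (C * L2_inner U (w t) (w t)) \<le> l t (w t)"
 shows "AE t in \<mu> T. AE x in \<mu>U. w t x = 0"
proof -
 have ev: "evolves T w l \<kappa>"
 proof (rule evolvesI[OF T w l])
  fix \<phi> v assume \<phi>: "\<phi> \<in> test_functions {0<..<T}" and v: "v \<in> H10 U"
  obtain K where "K \<subseteq> {0<..<T}" "\<And>x. x \<notin> K \<Longrightarrow> \<phi> x = 0" by (rule test_functionsE[OF \<phi>]) blast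
  then have "\<phi> 0 = 0" by force
  then show "(LINT t|\<mu> T. deriv \<phi> t * L2_inner U (w t) v) = - (LINT t|\<mu> T. \<phi> t * l t v)"
   using \<phi> v by (intro eq) (auto simp: test_functions_def)
 qed
 obtain c where c: "continuous_rep T U w c" by (rule continuous_rep_exists[OF ev])
 have cT: "c T \<in> L2 U" using continuous_repD(1)[OF c] T by simp
 have trace: "L2_inner U (c T) v = 0" if v: "v \<in> H10 U" for v
 proof -
  obtain d where d: "AE t in \<mu> T. L2_inner U (w t) v = d + prim T (\<lambda>s. l s v) t" using evolvesD(7)[OF ev v] by blast
  define q where "q s = l s v" for s
  have qi: "integrable (\<mu> T) q" unfolding q_def[abs_def] by (rule H.functional_integrable[OF l v])
  note wi = X_inner_integrable[OF w H1D(1)[OF H10_H1[OF v]]]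
  have ind: "(\<lambda>(t, s). indicator {..t} s :: real) \<in> borel_measurable (\<mu> T \<Otimes>\<^sub>M \<mu> T)"
  proof -
   have id: "(\<lambda>t. t) \<in> \<mu> T \<rightarrow>\<^sub>M borel" by (auto intro!: measurable_restrict_space1 measurable_completion)
   note [measurable] = measurable_compose[OF measurable_fst id] measurable_compose[OF measurable_snd id]
   have "(\<lambda>z. if snd z \<le> fst z then 1 else 0 :: real) \<in> borel_measurable (\<mu> T \<Otimes>\<^sub>M \<mu> T)" by measurable
   then show ?thesis by (simp add: case_prod_beta indicator_def)
  qed
  have one: "integrable (\<mu> T) (\<lambda>_. 1 :: real)" by simp
  note F = Fubini_kernel[OF one qi ind, of 1, simplified]
  have len: "(LINT t|\<mu> T. indicator {..t} s) = T - s" if s: "s \<in> {0<..<T}" for s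
  proof -
   have "(LINT t|\<mu> T. indicator {..t} s) = (LINT t|\<mu> T. indicator {s<..<T} t :: real)"
   proof (rule integral_cong_AE)
    show "AE t in \<mu> T. indicator {..t} s = (indicator {s<..<T} t :: real)"
     using AE_neq_time_measure[of s T] AE_space by eventually_elim (auto simp: indicator_def)
    have id: "(\<lambda>t. t) \<in> \<mu> T \<rightarrow>\<^sub>M borel" by (auto intro!: measurable_restrict_space1 measurable_completion)
    have "(\<lambda>t. if s \<le> t then 1 else 0 :: real) \<in> borel_measurable (\<mu> T)" using id by measurable
    then show "(\<lambda>t. indicator {..t} s :: real) \<in> borel_measurable (\<mu> T)" by (simp add: indicator_def)
    show "(\<lambda>t. indicator {s<..<T} t :: real) \<in> borel_measurable (\<mu> T)" using id by measurable
   qed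
   also have "\<dots> = T - s" by (rule integral_box_indicator_le(2)) (use s in auto)
   finally show ?thesis .
  qed
  have tq: "integrable (\<mu> T) (\<lambda>t. t * q t)"
  proof (rule Bochner_Integration.integrable_bound)
   show "integrable (\<mu> T) (\<lambda>t. T * q t)" using qi by simp
   have "(\<lambda>t. t) \<in> \<mu> T \<rightarrow>\<^sub>M borel" by (auto intro!: measurable_restrict_space1 measurable_completion)
   then show "(\<lambda>t. t * q t) \<in> borel_measurable (\<mu> T)" using qi by measurable
   show "AE t in \<mu> T. norm (t * q t) \<le> norm (T * q t)"
    unfolding norm_mult by (rule AE_I2) (auto intro!: mult_right_mono)
  qed
  \<comment> \<open>By Fubini the value \<open>q s\<close> is counted for all later times, a set of
    length \<open>T - s\<close>.\<close>
  have "(LINT t|\<mu> T. prim T q t) = (LINT s|\<mu> T. q s * (T - s))"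
   unfolding prim_def F(1) by (rule Bochner_Integration.integral_cong[OF refl]) (use len in simp)
  also have "\<dots> = (LINT s|\<mu> T. T * q s - s * q s)" by (simp add: algebra_simps)
  also have "\<dots> = T * prim T q T - (LINT s|\<mu> T. s * q s)" using qi tq by (simp add: prim_T)
  finally have 1: "(LINT t|\<mu> T. prim T q t) = T * prim T q T - (LINT s|\<mu> T. s * q s)" .
  have pi: "integrable (\<mu> T) (prim T q)" unfolding prim_def[abs_def] using F(2) by simp
  have one_int: "(LINT t|\<mu> T. d) = d * T" using prim_const[of 0 T T d] T by (simp add: prim_0 prim_T)
  have "(LINT t|\<mu> T. L2_inner U (w t) v) = (LINT t|\<mu> T. d + prim T q t)"
   by (rule integral_cong_AE) (use wi pi d in \<open>auto simp: q_def[abs_def]\<close>)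
  then have 2: "(LINT t|\<mu> T. L2_inner U (w t) v) = d * T + (LINT t|\<mu> T. prim T q t)" using pi one_int by simp
  \<comment> \<open>The choice \<open>a t = t\<close>; compared with the integrated primitive
    formula it leaves \<open>T\<close> times the trace at the final time.\<close>
  have "(LINT t|\<mu> T. L2_inner U (w t) v) = - (LINT t|\<mu> T. t * q t)"
   using eq[of "\<lambda>t. t", OF _ _ v] Ck_inner[of _ "1::real"] by (simp add: q_def)
  then have "(d + prim T q T) * T = 0" using 1 2 by (simp add: algebra_simps)
  then have "d + prim T q T = 0" using T by simp
  then show ?thesis using evolves_trace[OF ev c v d, of T] T by (simp add: q_def[abs_def])
 qed
 have "AE x in \<mu>U. c T x = 0"
 proof (rule AE_eq_0_if_test[OF open_U L2_locally_integrable[OF cT]])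
  show "(LINT x|\<mu>U. c T x * \<phi> x) = 0" if "\<phi> \<in> test_functions U" for \<phi>
   using trace[OF test_H10[OF that]] by (simp add: L2_inner_def)
 qed
 then have c0: "(LINT x|\<mu>U. (c T x)\<^sup>2 / 2) = 0" by (intro integral_eq_zero_AE) (auto elim: eventually_mono)
 define p where "p s = l s (w s)" for s
 define y where "y t = (LINT x|\<mu>U. (w t x)\<^sup>2 / 2)" for t
 have yw: "L2_inner U (w t) (w t) = 2 * y t" for t unfolding y_def L2_inner_def by (simp add: power2_eq_square)
 have pint: "integrable (\<mu> T) p" unfolding p_def[abs_def] by (rule H.pairing_integrable(1)[OF l X_spaceD(1)[OF w]])
 have yi: "integrable (\<mu> T) y" unfolding y_def[abs_def] by (rule potential_integrable[OF potential_square w])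
 obtain d where d: "\<And>t. t \<in> {0..T} \<Longrightarrow> (LINT x|\<mu>U. (c t x)\<^sup>2 / 2) = d + prim T p t" "AE t in \<mu> T. y t = d + prim T p t"
  unfolding p_def[abs_def] y_def by (rule energy_trace[OF ev potential_square _ c]) (use w in auto)
 have dT: "d + prim T p T = 0" using d(1)[of T] c0 T by simp
 have "AE t in \<mu> T. y t = 0"
 proof (rule gronwall_backward[OF yi])
  show "AE t in \<mu> T. 0 \<le> y t" unfolding y_def by (intro AE_I2 integral_nonneg_AE) auto
  show "2 * C > 0" using C by simp
  show "AE t in \<mu> T. y t \<le> 2 * C * (LINT s|\<mu> T. indicator {t..} s * y s)"
   using d(2) AE_space
  proof eventually_elim
   case (elim t)
   \<comment> \<open>The energy is 0 at time \<open>T\<close>, so its value at \<open>t\<close> is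
     minus the integral of \<open>p\<close> over the remaining times.\<close>
   have "(LINT s|\<mu> T. - (indicator {t<..<T} s * p s)) \<le> (LINT s|\<mu> T. 2 * C * (indicator {t..} s * y s))"
   proof (rule integral_mono_AE)
    show "AE s in \<mu> T. - (indicator {t<..<T} s * p s) \<le> 2 * C * (indicator {t..} s * y s)"
     using low AE_space
    proof eventually_elim
     case (elim s)
     have "y s \<ge> 0" unfolding y_def by (intro integral_nonneg_AE) auto
     then show ?case using elim C by (auto simp: indicator_def p_def yw)
    qed
   qed (use prim_integrable[OF pint, of "{t<..<T}"] prim_integrable[OF yi, of "{t..}"] in auto)
   then have "- (prim T p T - prim T p t) \<le> 2 * C * (LINT s|\<mu> T. indicator {t..} s * y s)"
    using elim(2) by (subst prim_diff[OF pint]) auto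
   then show ?case using elim(1) dT by linarith
  qed
 qed
 then show ?thesis
  using X_spaceD(4)[OF w]
 proof eventually_elim
  case (elim t)
  have "L2_norm U (w t) = 0" using elim(1) by (simp add: L2_norm_def yw)
  then show ?case using L2_norm_eq_0[OF elim(2)] by simp
 qed
qed

end

text \<open>The two subgradient inequalities, each scaled by its nonnegative factor, are added. This
  is where the sign of the densities enters.\<close>

lemma subdiff_cross_le:
 assumes z1: "z\<^sub>1 \<in> subdiff H t x p\<^sub>1" and z2: "z\<^sub>2 \<in> subdiff H t x p\<^sub>2" and s: "s\<^sub>1 \<ge> 0" "s\<^sub>2 \<ge> 0"
 shows "(H t x p\<^sub>1 - H t x p\<^sub>2) * (s\<^sub>1 - s\<^sub>2) \<le> (s\<^sub>1 *\<^sub>R z\<^sub>1 - s\<^sub>2 *\<^sub>R z\<^sub>2) \<bullet> (p\<^sub>1 - p\<^sub>2)"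
proof -
 have "H t x p\<^sub>1 - H t x p\<^sub>2 \<le> z\<^sub>1 \<bullet> (p\<^sub>1 - p\<^sub>2)" "z\<^sub>2 \<bullet> (p\<^sub>1 - p\<^sub>2) \<le> H t x p\<^sub>1 - H t x p\<^sub>2"
  using z1[unfolded subdiff_def mem_Collect_eq, rule_format, of p\<^sub>2] z2[unfolded subdiff_def mem_Collect_eq, rule_format, of p\<^sub>1]
  by (auto simp: inner_diff_right)
 from mult_left_mono[OF this(1) s(1)] mult_left_mono[OF this(2) s(2)]
 show ?thesis by (simp add: inner_diff_left algebra_simps)
qed

section \<open>Weak solutions and uniqueness for the Hamilton-Jacobi-Bellman equation\<close>

context control_problem begin

text \<open>Integrability of each pairing allows the integrals to be split into a time derivative
  and a form, and inserting zero for one test function decouples the two equations.\<close>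

lemma weak_solutionE:
 assumes sol: "weak_solution T U \<nu> Ham F S G m\<^sub>0 u m"
 obtains \<beta> \<kappa> \<kappa>' where "u \<in> X_space T U" "m \<in> Y_space T U" "AE x in \<mu>U. at_time T U m 0 x = m\<^sub>0 x"
  "\<beta> \<in> Linf ({0<..<T} \<times> U)" "AE t in \<mu> T. AE x in \<mu>U. \<beta> (t, x) \<in> subdiff Ham t x (weak_grad U (u t) x)"
  "AE t in \<mu> T. H_grad U Ham u t \<in> L2 U" "AE t in \<mu> T. (\<lambda>x. m t x *\<^sub>R \<beta> (t, x)) \<in> L2 U"
  "X_functional T (ham_form \<nu> u) \<kappa>"
  "X_functional T (drift_form \<nu> m \<beta>) \<kappa>'"
  "\<And>\<phi>. \<phi> \<in> X_space T U \<Longrightarrow>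
   (LINT t|\<mu> T. time_deriv T U m t (\<phi> t)) + (LINT t|\<mu> T. drift_form \<nu> m \<beta> t (\<phi> t))
    = (LINT t|\<mu> T. G t (\<phi> t))"
  "\<And>\<psi>. \<psi> \<in> Y0_space T U \<Longrightarrow>
   (LINT t|\<mu> T. time_deriv T U \<psi> t (u t)) + (LINT t|\<mu> T. ham_form \<nu> u t (\<psi> t))
    = (LINT t|\<mu> T. F m t (\<psi> t)) + L2_inner U (S (at_time T U m T)) (at_time T U \<psi> T)"
proof -
 obtain \<beta> where u: "u \<in> X_space T U" and m: "m \<in> Y_space T U" and m0: "AE x in \<mu>U. at_time T U m 0 x = m\<^sub>0 x"
  and \<beta>: "\<beta> \<in> DpH T U Ham u" and eqs: "\<forall>\<psi>\<in>Y0_space T U. \<forall>\<phi>\<in>X_space T U.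
     (LINT t|\<mu> T. time_deriv T U \<psi> t (u t) + \<nu> * L2_inner U (weak_grad U (u t)) (weak_grad U (\<psi> t)) + L2_inner U (H_grad U Ham u t) (\<psi> t))
     = (LINT t|\<mu> T. F m t (\<psi> t)) + L2_inner U (S (at_time T U m T)) (at_time T U \<psi> T) \<and>
     (LINT t|\<mu> T. time_deriv T U m t (\<phi> t) + \<nu> * L2_inner U (weak_grad U (m t)) (weak_grad U (\<phi> t)) + L2_inner U (\<lambda>x. m t x *\<^sub>R \<beta> (t, x)) (weak_grad U (\<phi> t)))
     = (LINT t|\<mu> T. G t (\<phi> t))"
  using sol unfolding weak_solution_def by blast
 obtain \<kappa> where h: "\<beta> \<in> Linf ({0<..<T} \<times> U)" "AE t in \<mu> T. AE x in \<mu>U. \<beta> (t, x) \<in> subdiff Ham t x (weak_grad U (u t) x)"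
  "AE t in \<mu> T. H_grad U Ham u t \<in> L2 U"
  "X_functional T (\<lambda>t. L2_inner U (H_grad U Ham u t)) \<kappa>"
  by (rule DpHE[OF u \<beta>])
 note X = Y_spaceD(1)[OF m]
 obtain \<kappa>' where dr: "X_functional T (\<lambda>t v. L2_inner U (\<lambda>x. m t x *\<^sub>R \<beta> (t, x)) (weak_grad U v)) \<kappa>'"
  "AE t in \<mu> T. (\<lambda>x. m t x *\<^sub>R \<beta> (t, x)) \<in> L2 U"
  by (rule drift_functional[OF X h(1)])
 note K = H.L2_functional_lin[OF h(4) diffusion_functional[OF u], of \<nu>]
 note J = H.L2_functional_lin[OF dr(1) diffusion_functional[OF X], of \<nu>]
 have X0: "(\<lambda>_ _. 0) \<in> X_space T U" unfolding X_space_def by (rule H.bochner_simple) (simp_all add: H.zero)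
 \<comment> \<open>The zero function as an element of \<open>Y0_space\<close>, obtained as a
   separated test function.\<close>
 note \<psi>0 = product_test(1)[OF T Ck_const[of _ 0] refl H.zero]
 show ?thesis
 proof (rule that[OF u m m0 h(1-3) dr(2) K J])
  show "(LINT t|\<mu> T. time_deriv T U m t (\<phi> t)) + (LINT t|\<mu> T. drift_form \<nu> m \<beta> t (\<phi> t))
    = (LINT t|\<mu> T. G t (\<phi> t))" if \<phi>: "\<phi> \<in> X_space T U" for \<phi>
   unfolding conjunct2[OF eqs[rule_format, OF \<psi>0 \<phi>], symmetric]
   using H.pairing_integrable(1)[OF L2_Hm1_functional[OF Y_spaceD(3)[OF m]] X_spaceD(1)[OF \<phi>]] H.pairing_integrable(1)[OF J X_spaceD(1)[OF \<phi>]]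
   by (subst Bochner_Integration.integral_add[symmetric]) (auto simp: ac_simps)
  show "(LINT t|\<mu> T. time_deriv T U \<psi> t (u t)) + (LINT t|\<mu> T. ham_form \<nu> u t (\<psi> t))
    = (LINT t|\<mu> T. F m t (\<psi> t)) + L2_inner U (S (at_time T U m T)) (at_time T U \<psi> T)" if \<psi>: "\<psi> \<in> Y0_space T U" for \<psi>
  proof -
   have Y: "\<psi> \<in> Y_space T U" using \<psi> by (simp add: Y0_space_def)
   show ?thesis
    unfolding conjunct1[OF eqs[rule_format, OF \<psi> X0], symmetric]
    using H.pairing_integrable(1)[OF L2_Hm1_functional[OF Y_spaceD(3)[OF Y]] X_spaceD(1)[OF u]] H.pairing_integrable(1)[OF K X_spaceD(1)[OF Y_spaceD(1)[OF Y]]]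
    by (subst Bochner_Integration.integral_add[symmetric]) (auto simp: ac_simps)
  qed
 qed
qed

text \<open>The Hamiltonian is Lipschitz in the gradient, so Young's inequality absorbs the
  difference of the nonlinear terms into the diffusion, at the cost
  \<open>B\<^sup>2 / (4 * \<nu>)\<close>. Separated test functions supply the equation for
  \<open>backward_zero\<close>.\<close>

lemma hamilton_jacobi_unique:
 assumes \<nu>: "\<nu> > 0" and u1: "u\<^sub>1 \<in> X_space T U" and u2: "u\<^sub>2 \<in> X_space T U"
  and h1: "AE t in \<mu> T. H_grad U Ham u\<^sub>1 t \<in> L2 U" and h2: "AE t in \<mu> T. H_grad U Ham u\<^sub>2 t \<in> L2 U"
 defines "K u t v \<equiv> ham_form \<nu> u t v"
 assumes K1: "X_functional T (K u\<^sub>1) \<kappa>\<^sub>1" and K2: "X_functional T (K u\<^sub>2) \<kappa>\<^sub>2"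
  and eq: "\<And>\<psi>. \<psi> \<in> Y0_space T U \<Longrightarrow>
   (LINT t|\<mu> T. time_deriv T U \<psi> t (u\<^sub>1 t)) + (LINT t|\<mu> T. K u\<^sub>1 t (\<psi> t)) = (LINT t|\<mu> T. time_deriv T U \<psi> t (u\<^sub>2 t)) + (LINT t|\<mu> T. K u\<^sub>2 t (\<psi> t))"
 shows "ae_eq T U u\<^sub>1 u\<^sub>2"
proof -
 define w where "w t x = u\<^sub>1 t x - u\<^sub>2 t x" for t x
 have w: "w \<in> X_space T U" unfolding w_def[abs_def] using H.bochner_diff u1 u2 by (simp add: X_space_def)
 obtain B where B: "B > 0" "\<And>t x p q. t \<in> {0..T} \<Longrightarrow> x \<in> closure U \<Longrightarrow> \<bar>Ham t x p - Ham t x q\<bar> \<le> B * norm (p - q)"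
  by (rule Ham_bounds) blast
 have "AE t in \<mu> T. AE x in \<mu>U. w t x = 0"
 proof (rule backward_zero[OF T w H.L2_functional_lin[OF K1 K2, of "-1"]])
  show "B\<^sup>2 / (4 * \<nu>) > 0" using B(1) \<nu> by simp
  show "(LINT t|\<mu> T. deriv a t * L2_inner U (w t) v) = - (LINT t|\<mu> T. a t * (K u\<^sub>1 t v + - 1 * K u\<^sub>2 t v))"
   if a: "\<And>k. Ck k a" "a 0 = 0" and v: "v \<in> H10 U" for a v
  proof -
   define \<psi> where "\<psi> t x = a t * v x" for t x
   have \<psi>: "\<psi> \<in> Y0_space T U" unfolding \<psi>_def[abs_def] by (rule product_test(1)[OF T a v])
   have Y: "\<psi> \<in> Y_space T U" using \<psi> by (simp add: Y0_space_def)
   note \<psi>X = X_spaceD(1)[OF Y_spaceD(1)[OF Y]]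
   note tf = L2_Hm1_functional[OF Y_spaceD(3)[OF Y]]
   note p1 = H.pairing_integrable(1)[OF tf X_spaceD(1)[OF u1]] and p2 = H.pairing_integrable(1)[OF tf X_spaceD(1)[OF u2]]
   note q1 = H.pairing_integrable(1)[OF K1 \<psi>X] and q2 = H.pairing_integrable(1)[OF K2 \<psi>X]
   have "AE t in \<mu> T. deriv a t * L2_inner U (w t) v = time_deriv T U \<psi> t (u\<^sub>1 t) - time_deriv T U \<psi> t (u\<^sub>2 t)"
    using product_test(2)[OF T a v u1] product_test(2)[OF T a v u2] X_spaceD(4)[OF u1] X_spaceD(4)[OF u2]
    unfolding \<psi>_def w_def by eventually_elim (simp add: L2_inner_diff(2) H1D(1)[OF H10_H1[OF v]] L2_inner_commute[of _ v] right_diff_distrib)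
   then have 1: "(LINT t|\<mu> T. deriv a t * L2_inner U (w t) v) = (LINT t|\<mu> T. time_deriv T U \<psi> t (u\<^sub>1 t) - time_deriv T U \<psi> t (u\<^sub>2 t))"
    by (rule integral_time_cong) (use p1 p2 in auto)
   have "AE t in \<mu> T. a t * (K u\<^sub>1 t v + - 1 * K u\<^sub>2 t v) = K u\<^sub>1 t (\<psi> t) - K u\<^sub>2 t (\<psi> t)"
    using H.L2_functionalD(4)[OF K1] H.L2_functionalD(4)[OF K2]
    unfolding \<psi>_def by eventually_elim (simp add: H.bdd_linear_simps(3) v right_diff_distrib)
   then have 2: "(LINT t|\<mu> T. a t * (K u\<^sub>1 t v + - 1 * K u\<^sub>2 t v)) = (LINT t|\<mu> T. K u\<^sub>1 t (\<psi> t) - K u\<^sub>2 t (\<psi> t))"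
    by (rule integral_time_cong) (use q1 q2 in auto)
   show ?thesis using eq[OF \<psi>] p1 p2 q1 q2 unfolding 1 2 by simp
  qed
  show "AE t in \<mu> T. - (B\<^sup>2 / (4 * \<nu>) * L2_inner U (w t) (w t)) \<le> K u\<^sub>1 t (w t) + - 1 * K u\<^sub>2 t (w t)"
   using h1 h2 X_spaceD(3)[OF u1] X_spaceD(3)[OF u2] AE_space
  proof eventually_elim
   case (elim t)
   note h = elim(1,2) and u = elim(3,4)
   have wH: "w t \<in> H1 U" unfolding w_def by (rule H1_diff[OF u])
   note wL = H1D(1)[OF wH] and gw = H1D(3)[OF wH]
   let ?d = "\<lambda>x. H_grad U Ham u\<^sub>1 t x - H_grad U Ham u\<^sub>2 t x" and ?g = "weak_grad U (w t)"
   note i = L2_inner_integrable(1)[OF wL wL] L2_inner_integrable(1)[OF L2_diff[OF h] wL] L2_inner_integrable(1)[OF gw gw]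
   have "(LINT x|\<mu>U. - (B\<^sup>2 / (4 * \<nu>) * (w t x \<bullet> w t x))) \<le> (LINT x|\<mu>U. ?d x \<bullet> w t x + \<nu> * (?g x \<bullet> ?g x))"
   proof (rule integral_mono_AE)
    show "AE x in \<mu>U. - (B\<^sup>2 / (4 * \<nu>) * (w t x \<bullet> w t x)) \<le> ?d x \<bullet> w t x + \<nu> * (?g x \<bullet> ?g x)"
     using weak_grad_diff[OF u] AE_space
    proof eventually_elim
     case (elim x)
     have "\<bar>?d x\<bar> \<le> B * norm (?g x)"
      using B(2)[of t x "weak_grad U (u\<^sub>1 t) x" "weak_grad U (u\<^sub>2 t) x"] elim \<open>t \<in> space (\<mu> T)\<close> closure_subset[of U]
      by (auto simp: H_grad_def w_def[abs_def])
     then have "\<bar>?d x * w t x\<bar> \<le> B * norm (?g x) * \<bar>w t x\<bar>" unfolding abs_mult by (rule mult_right_mono) simp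
     moreover have "- (B\<^sup>2 / (4 * \<nu>) * (w t x)\<^sup>2) \<le> \<nu> * (norm (?g x))\<^sup>2 - B * norm (?g x) * \<bar>w t x\<bar>"
      using young_lower[OF \<nu>, of B "\<bar>w t x\<bar>" "norm (?g x)"] by (simp add: mult.commute mult.left_commute)
     ultimately show ?case unfolding power2_norm_eq_inner by (simp add: power2_eq_square abs_le_iff)
    qed
   qed (use i in auto)
   then have "- (B\<^sup>2 / (4 * \<nu>) * L2_inner U (w t) (w t)) \<le> L2_inner U ?d (w t) + \<nu> * L2_inner U ?g ?g"
    using i by (simp add: L2_inner_def)
   moreover have "L2_inner U ?g ?g = L2_inner U (weak_grad U (u\<^sub>1 t)) ?g - L2_inner U (weak_grad U (u\<^sub>2 t)) ?g"
    using grad_inner_diff[OF u gw] by (simp add: w_def[abs_def])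
   ultimately show ?case unfolding K_def L2_inner_diff(2)[OF h wL] by (simp add: algebra_simps)
  qed
 qed
 then show ?thesis
  unfolding ae_eq_def w_def[abs_def] by simp
qed

end

section \<open>Compatibility of the data operators with equality almost everywhere\<close>

lemma nonpos_if_less_all: "x \<le> 0" if "\<And>e. e > 0 \<Longrightarrow> x < e" for x :: real
 using that[of x] by (rule_tac ccontr) simp

text \<open>Seminorm distance 0 lies below every \<delta>, so continuity alone makes the images
  indistinguishable.\<close>

lemma continuous_operator_eq:
 assumes P: "continuous_operator V N W M P" and v: "v \<in> V" "w \<in> V" and N: "N (w - v) \<le> 0"
 shows "M (P w - P v) \<le> 0"
proof (rule nonpos_if_less_all)
 fix e :: real assume "e > 0"
 then obtain d where "d > 0" "\<forall>w\<in>V. N (w - v) < d \<longrightarrow> M (P w - P v) < e"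
  using P v(1) unfolding continuous_operator_def by blast
 then show "M (P w - P v) < e" using v(2) N by force
qed

context bounded_domain begin

lemma L2_operator_cong:
 assumes S: "continuous_operator (L2 U) (L2_norm U) (L2 U) (L2_norm U) S"
  and v: "v \<in> L2 U" and w: "w \<in> L2 U" and eq: "AE x in \<mu>U. w x = v x" and z: "z \<in> L2 U"
 shows "L2_inner U (S w) z = L2_inner U (S v) z"
proof -
 have SL: "S w \<in> L2 U" "S v \<in> L2 U" using S v w unfolding continuous_operator_def by blast+
 have "AE x in \<mu>U. w x - v x = 0" using eq by eventually_elim simp
 then have "L2_norm U (w - v) \<le> 0" using L2_norm_eq_0[OF L2_diff[OF w v]] by (simp add: fun_diff_def)
 from continuous_operator_eq[where N = "L2_norm U" and M = "L2_norm U", OF S v w this]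
 have "L2_norm U (\<lambda>x. S w x - S v x) = 0" using L2_norm_nonneg[of U "S w - S v"] by (simp add: fun_diff_def)
 then have "L2_inner U (\<lambda>x. S w x - S v x) z = 0" using L2_Cauchy_Schwarz[OF L2_diff[OF SL] z] by simp
 then show ?thesis by (simp add: L2_inner_diff(2)[OF SL z])
qed

lemma source_cong:
 assumes F: "continuous_operator (L2_L2 T U) (bochner_norm T (L2_norm U)) (L2_Hm1 T U) (bochner_norm T (Hm1_norm U)) F"
  and v: "v \<in> X_space T U" and w: "w \<in> X_space T U" and eq: "ae_eq T U w v" and z: "z \<in> X_space T U"
 shows "(LINT t|\<mu> T. F w t (z t)) = (LINT t|\<mu> T. F v t (z t))"
proof -
 note vL = X_L2_L2[OF v] and wL = X_L2_L2[OF w]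
 have FL: "F w \<in> L2_Hm1 T U" "F v \<in> L2_Hm1 T U" using F vL wL unfolding continuous_operator_def by blast+
 have "AE t in \<mu> T. L2_norm U (\<lambda>x. w t x - v t x) = 0"
  using eq[unfolded ae_eq_def] X_spaceD(4)[OF v] X_spaceD(4)[OF w]
 proof eventually_elim
  case (elim t)
  have "AE x in \<mu>U. w t x - v t x = 0" using elim(1) by eventually_elim simp
  then show ?case using L2_norm_eq_0[OF L2_diff[OF elim(3,2)]] by simp
 qed
 then have "(LINT t|\<mu> T. (L2_norm U (\<lambda>x. w t x - v t x))\<^sup>2) = 0" by (intro integral_eq_zero_AE) (auto elim: eventually_mono)
 then have "bochner_norm T (L2_norm U) (w - v) \<le> 0" by (simp add: bochner_norm_def fun_diff_def)
 from continuous_operator_eq[where N = "bochner_norm T (L2_norm U)" and M = "bochner_norm T (Hm1_norm U)", OF F vL wL this]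
 have le: "(LINT t|\<mu> T. (Hm1_norm U (\<lambda>z. F w t z - F v t z))\<^sup>2) \<le> 0" by (simp add: bochner_norm_def fun_diff_def)
 have d: "(\<lambda>t z. F w t z - F v t z) \<in> L2_Hm1 T U" using M.bochner_diff FL by (simp add: L2_Hm1_def)
 note df = L2_Hm1_functional[OF d]
 have "(LINT t|\<mu> T. (Hm1_norm U (\<lambda>z. F w t z - F v t z))\<^sup>2) = 0"
  by (rule antisym[OF le Bochner_Integration.integral_nonneg]) simp
 then have "AE t in \<mu> T. (Hm1_norm U (\<lambda>z. F w t z - F v t z))\<^sup>2 = 0"
  using integral_nonneg_eq_0_iff_AE[OF H.L2_functionalD(3)[OF df]] by simp
 then have "AE t in \<mu> T. F w t (z t) = F v t (z t)"
  using H.pairing_bound[OF df X_spaceD(1)[OF z]] by eventually_elim simp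
 then show ?thesis
  by (rule integral_time_cong) (rule H.pairing_measurable[OF L2_Hm1_functional[OF FL(2)] X_spaceD(1)[OF z]])
qed

end

theorem theorem3p2:
 fixes \<Omega> :: "'a::euclidean_space set"
  and T \<nu> :: real
  and A :: "'c::metric_space set"
  and b :: "real \<times> 'a \<times> 'c \<Rightarrow> 'a"
  and f :: "real \<times> 'a \<times> 'c \<Rightarrow> real"
  and G :: "real \<Rightarrow> ('a \<Rightarrow> real) \<Rightarrow> real"
  and m\<^sub>0 :: "'a \<Rightarrow> real"
  and F :: "(real \<Rightarrow> 'a \<Rightarrow> real) \<Rightarrow> real \<Rightarrow> ('a \<Rightarrow> real) \<Rightarrow> real"
  and S :: "('a \<Rightarrow> real) \<Rightarrow> 'a \<Rightarrow> real"
  and u\<^sub>1 m\<^sub>1 u\<^sub>2 m\<^sub>2 :: "real \<Rightarrow> 'a \<Rightarrow> real"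
 assumes "DIM('a) \<ge> 2"
  and "bounded \<Omega>" "open \<Omega>" "connected \<Omega>" "lipschitz_boundary \<Omega>"
  and "T > 0" "\<nu> > 0"
  and "compact A" "A \<noteq> {}"
  and "uniformly_continuous_on ({0..T} \<times> closure \<Omega> \<times> A) b"
  and "uniformly_continuous_on ({0..T} \<times> closure \<Omega> \<times> A) f"
  and "G \<in> L2_Hm1 T \<Omega>" "m\<^sub>0 \<in> L2 \<Omega>"
  and "continuous_operator (L2_L2 T \<Omega>) (bochner_norm T (L2_norm \<Omega>))
      (L2_Hm1 T \<Omega>) (bochner_norm T (Hm1_norm \<Omega>)) F"
  and "\<exists>C\<^sub>F>0. \<forall>v\<in>L2_L2 T \<Omega>.
      bochner_norm T (Hm1_norm \<Omega>) (F v) \<le> C\<^sub>F * (bochner_norm T (L2_norm \<Omega>) v + 1)"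
  and "continuous_operator (L2 \<Omega>) (L2_norm \<Omega>) (L2 \<Omega>) (L2_norm \<Omega>) S"
  and "\<exists>C\<^sub>S\<ge>0. \<forall>v\<in>L2 \<Omega>. L2_norm \<Omega> (S v) \<le> C\<^sub>S * (L2_norm \<Omega> v + 1)"
  and "AE x in lebesgue_on \<Omega>. m\<^sub>0 x \<ge> 0"
  and "nonneg_distribution T \<Omega> G"
  and "strictly_monotone_on_X T \<Omega> F"
  and "monotone_on_L2 \<Omega> S"
  and "weak_solution T \<Omega> \<nu> (hamiltonian A b f) F S G m\<^sub>0 u\<^sub>1 m\<^sub>1"
  and "weak_solution T \<Omega> \<nu> (hamiltonian A b f) F S G m\<^sub>0 u\<^sub>2 m\<^sub>2"
 shows "ae_eq T \<Omega> u\<^sub>1 u\<^sub>2 \<and> ae_eq T \<Omega> m\<^sub>1 m\<^sub>2"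
proof -
 interpret control_problem \<Omega> T A b f by unfold_locales (use assms in auto)
 note F = assms(14) and S = assms(16) and mF = assms(20) and mS = assms(21)
 obtain \<beta>\<^sub>1 \<kappa>\<^sub>1 \<kappa>\<^sub>1' where s1: "u\<^sub>1 \<in> X_space T \<Omega>" "m\<^sub>1 \<in> Y_space T \<Omega>" "AE x in \<mu>U. at_time T \<Omega> m\<^sub>1 0 x = m\<^sub>0 x"
  "\<beta>\<^sub>1 \<in> Linf ({0<..<T} \<times> \<Omega>)" "AE t in \<mu> T. AE x in \<mu>U. \<beta>\<^sub>1 (t, x) \<in> subdiff Ham t x (weak_grad \<Omega> (u\<^sub>1 t) x)"
  "AE t in \<mu> T. H_grad \<Omega> Ham u\<^sub>1 t \<in> L2 \<Omega>" "AE t in \<mu> T. (\<lambda>x. m\<^sub>1 t x *\<^sub>R \<beta>\<^sub>1 (t, x)) \<in> L2 \<Omega>"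
  and K1: "X_functional T (ham_form \<nu> u\<^sub>1) \<kappa>\<^sub>1"
  and J1: "X_functional T (drift_form \<nu> m\<^sub>1 \<beta>\<^sub>1) \<kappa>\<^sub>1'"
  and kfp1: "\<And>\<phi>. \<phi> \<in> X_space T \<Omega> \<Longrightarrow>
   (LINT t|\<mu> T. time_deriv T \<Omega> m\<^sub>1 t (\<phi> t)) + (LINT t|\<mu> T. drift_form \<nu> m\<^sub>1 \<beta>\<^sub>1 t (\<phi> t))
    = (LINT t|\<mu> T. G t (\<phi> t))"
  and hj1: "\<And>\<psi>. \<psi> \<in> Y0_space T \<Omega> \<Longrightarrow>
   (LINT t|\<mu> T. time_deriv T \<Omega> \<psi> t (u\<^sub>1 t)) + (LINT t|\<mu> T. ham_form \<nu> u\<^sub>1 t (\<psi> t))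
    = (LINT t|\<mu> T. F m\<^sub>1 t (\<psi> t)) + L2_inner \<Omega> (S (at_time T \<Omega> m\<^sub>1 T)) (at_time T \<Omega> \<psi> T)"
  by (rule weak_solutionE[OF assms(22)]) blast
 obtain \<beta>\<^sub>2 \<kappa>\<^sub>2 \<kappa>\<^sub>2' where s2: "u\<^sub>2 \<in> X_space T \<Omega>" "m\<^sub>2 \<in> Y_space T \<Omega>" "AE x in \<mu>U. at_time T \<Omega> m\<^sub>2 0 x = m\<^sub>0 x"
  "\<beta>\<^sub>2 \<in> Linf ({0<..<T} \<times> \<Omega>)" "AE t in \<mu> T. AE x in \<mu>U. \<beta>\<^sub>2 (t, x) \<in> subdiff Ham t x (weak_grad \<Omega> (u\<^sub>2 t) x)"
  "AE t in \<mu> T. H_grad \<Omega> Ham u\<^sub>2 t \<in> L2 \<Omega>" "AE t in \<mu> T. (\<lambda>x. m\<^sub>2 t x *\<^sub>R \<beta>\<^sub>2 (t, x)) \<in> L2 \<Omega>"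
  and K2: "X_functional T (ham_form \<nu> u\<^sub>2) \<kappa>\<^sub>2"
  and J2: "X_functional T (drift_form \<nu> m\<^sub>2 \<beta>\<^sub>2) \<kappa>\<^sub>2'"
  and kfp2: "\<And>\<phi>. \<phi> \<in> X_space T \<Omega> \<Longrightarrow>
   (LINT t|\<mu> T. time_deriv T \<Omega> m\<^sub>2 t (\<phi> t)) + (LINT t|\<mu> T. drift_form \<nu> m\<^sub>2 \<beta>\<^sub>2 t (\<phi> t))
    = (LINT t|\<mu> T. G t (\<phi> t))"
  and hj2: "\<And>\<psi>. \<psi> \<in> Y0_space T \<Omega> \<Longrightarrow>
   (LINT t|\<mu> T. time_deriv T \<Omega> \<psi> t (u\<^sub>2 t)) + (LINT t|\<mu> T. ham_form \<nu> u\<^sub>2 t (\<psi> t))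
    = (LINT t|\<mu> T. F m\<^sub>2 t (\<psi> t)) + L2_inner \<Omega> (S (at_time T \<Omega> m\<^sub>2 T)) (at_time T \<Omega> \<psi> T)"
  by (rule weak_solutionE[OF assms(23)]) blast
 have "AE x in \<mu>U. at_time T \<Omega> m\<^sub>1 0 x \<ge> 0" "AE x in \<mu>U. at_time T \<Omega> m\<^sub>2 0 x \<ge> 0"
  using s1(3) s2(3) assms(18) by (eventually_elim, simp)+
 then have m_nonneg: "AE t in \<mu> T. AE x in \<mu>U. m\<^sub>1 t x \<ge> 0" "AE t in \<mu> T. AE x in \<mu>U. m\<^sub>2 t x \<ge> 0"
  using kfp1 kfp2 by (auto intro!: density_nonneg[OF T assms(7) s1(2) s1(4) _ assms(12,19)] density_nonneg[OF T assms(7) s2(2) s2(4) _ assms(12,19)])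
 note X1 = Y_spaceD(1)[OF s1(2)] and X2 = Y_spaceD(1)[OF s2(2)]
 note c1 = Y_at_time[OF T s1(2)] and c2 = Y_at_time[OF T s2(2)]
 have T0: "0 \<in> {0..T}" "T \<in> {0..T}" using T by auto
 note S1 = continuous_repD(1)[OF c1 T0(2)] and S2 = continuous_repD(1)[OF c2 T0(2)]
 have SL: "S (at_time T \<Omega> m\<^sub>1 T) \<in> L2 \<Omega>" "S (at_time T \<Omega> m\<^sub>2 T) \<in> L2 \<Omega>"
  using S S1 S2 unfolding continuous_operator_def by blast+
 have FL: "F m\<^sub>1 \<in> L2_Hm1 T \<Omega>" "F m\<^sub>2 \<in> L2_Hm1 T \<Omega>"
  using F X_L2_L2[OF X1] X_L2_L2[OF X2] unfolding continuous_operator_def by blast+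
 define \<psi> where "\<psi> t x = m\<^sub>1 t x - m\<^sub>2 t x" for t x
 define \<phi> where "\<phi> t x = u\<^sub>1 t x - u\<^sub>2 t x" for t x
 define D where "D t v = time_deriv T \<Omega> m\<^sub>1 t v - time_deriv T \<Omega> m\<^sub>2 t v" for t v
 note \<psi>Y = Y_diff(1)[OF s1(2) s2(2), folded \<psi>_def[abs_def]]
 note DL = Y_diff(3)[OF s1(2) s2(2), folded D_def[abs_def]]
 have Dt: "is_time_deriv T \<Omega> (\<lambda>t. L2_inner \<Omega> (\<psi> t)) D"
  using Y_diff(2)[OF s1(2) s2(2)] by (simp add: \<psi>_def[abs_def] D_def[abs_def])
 note \<psi>X = Y_spaceD(1)[OF \<psi>Y]
 have \<phi>X: "\<phi> \<in> X_space T \<Omega>" unfolding \<phi>_def[abs_def] using H.bochner_diff s1(1) s2(1) by (simp add: X_space_def)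
 have \<psi>T: "AE x in \<mu>U. at_time T \<Omega> \<psi> t x = at_time T \<Omega> m\<^sub>1 t x - at_time T \<Omega> m\<^sub>2 t x" if "t \<in> {0..T}" for t
  unfolding \<psi>_def[abs_def] by (rule at_time_diff[OF T s1(2) s2(2) that])
 have "AE x in \<mu>U. at_time T \<Omega> \<psi> 0 x = 0" using \<psi>T[OF T0(1)] s1(3) s2(3) by eventually_elim simp
 then have \<psi>0: "\<psi> \<in> Y0_space T \<Omega>" using \<psi>Y by (simp add: Y0_space_def)
 note \<phi>B = X_spaceD(1)[OF \<phi>X] and \<psi>B = X_spaceD(1)[OF \<psi>X]

 \<comment> \<open>\<open>time_deriv\<close> of \<psi> is chosen independently of those of the two
   densities; paired with elements of X it agrees with their difference \<open>D\<close>, which is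
   then expanded in either slot.\<close>
 have dt: "(LINT t|\<mu> T. time_deriv T \<Omega> \<psi> t (u\<^sub>1 t)) - (LINT t|\<mu> T. time_deriv T \<Omega> \<psi> t (u\<^sub>2 t))
   = (LINT t|\<mu> T. time_deriv T \<Omega> m\<^sub>1 t (\<phi> t)) - (LINT t|\<mu> T. time_deriv T \<Omega> m\<^sub>2 t (\<phi> t))"
 proof -
  note Df = L2_Hm1_functional[OF DL]
  have "(LINT t|\<mu> T. time_deriv T \<Omega> \<psi> t (u t)) = (LINT t|\<mu> T. D t (u t))" if u: "u \<in> X_space T \<Omega>" for u
   by (rule integral_time_cong[OF time_deriv_eq[OF \<psi>Y DL Dt u]]) (rule H.pairing_measurable[OF Df X_spaceD(1)[OF u]])
  note this[OF s1(1)] this[OF s2(1)]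
  moreover have "(LINT t|\<mu> T. D t (\<phi> t)) = (LINT t|\<mu> T. D t (u\<^sub>1 t)) - (LINT t|\<mu> T. D t (u\<^sub>2 t))"
   unfolding \<phi>_def[abs_def] by (rule H.pairing_diff(2)[OF Df X_spaceD(1)[OF s1(1)] X_spaceD(1)[OF s2(1)]])
  moreover have "(LINT t|\<mu> T. D t (\<phi> t)) = (LINT t|\<mu> T. time_deriv T \<Omega> m\<^sub>1 t (\<phi> t)) - (LINT t|\<mu> T. time_deriv T \<Omega> m\<^sub>2 t (\<phi> t))"
   unfolding D_def
   by (rule Bochner_Integration.integral_diff[OF H.pairing_integrable(1)[OF L2_Hm1_functional[OF Y_spaceD(3)[OF s1(2)]] \<phi>B] H.pairing_integrable(1)[OF L2_Hm1_functional[OF Y_spaceD(3)[OF s2(2)]] \<phi>B]])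
  ultimately show ?thesis by simp
 qed

 note k1 = H.pairing_integrable(1)[OF K1 \<psi>B] and k2 = H.pairing_integrable(1)[OF K2 \<psi>B]
  and j1 = H.pairing_integrable(1)[OF J1 \<phi>B] and j2 = H.pairing_integrable(1)[OF J2 \<phi>B]
 have cross: "(LINT t|\<mu> T. ham_form \<nu> u\<^sub>1 t (\<psi> t))
   - (LINT t|\<mu> T. ham_form \<nu> u\<^sub>2 t (\<psi> t))
  \<le> (LINT t|\<mu> T. drift_form \<nu> m\<^sub>1 \<beta>\<^sub>1 t (\<phi> t))
   - (LINT t|\<mu> T. drift_form \<nu> m\<^sub>2 \<beta>\<^sub>2 t (\<phi> t))"
  unfolding Bochner_Integration.integral_diff[OF k1 k2, symmetric] Bochner_Integration.integral_diff[OF j1 j2, symmetric]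
 proof (rule integral_mono_AE[OF Bochner_Integration.integrable_diff[OF k1 k2] Bochner_Integration.integrable_diff[OF j1 j2]])
  have "AE t in \<mu> T. AE x in \<mu>U. (H_grad \<Omega> Ham u\<^sub>1 t x - H_grad \<Omega> Ham u\<^sub>2 t x) * (m\<^sub>1 t x - m\<^sub>2 t x)
    \<le> (m\<^sub>1 t x *\<^sub>R \<beta>\<^sub>1 (t, x) - m\<^sub>2 t x *\<^sub>R \<beta>\<^sub>2 (t, x)) \<bullet> (weak_grad \<Omega> (u\<^sub>1 t) x - weak_grad \<Omega> (u\<^sub>2 t) x)"
   using s1(5) s2(5) m_nonneg
  proof eventually_elim
   case (elim t)
   then show ?case unfolding H_grad_def by eventually_elim (rule subdiff_cross_le)
  qed
  with s1(6,7) s2(6,7) X_spaceD(3)[OF s1(1)] X_spaceD(3)[OF s2(1)] X_spaceD(3)[OF X1] X_spaceD(3)[OF X2]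
  show "AE t in \<mu> T. (ham_form \<nu> u\<^sub>1 t (\<psi> t))
    - (ham_form \<nu> u\<^sub>2 t (\<psi> t))
   \<le> (drift_form \<nu> m\<^sub>1 \<beta>\<^sub>1 t (\<phi> t))
    - (drift_form \<nu> m\<^sub>2 \<beta>\<^sub>2 t (\<phi> t))"
   unfolding \<psi>_def[abs_def] \<phi>_def[abs_def]
  proof eventually_elim
   case (elim t)
   show ?case by (rule cross_test_le[OF elim(5-8) elim(1,3) elim(2,4) elim(9)])
  qed
 qed

 have "L2_inner \<Omega> (S (at_time T \<Omega> m\<^sub>1 T) - S (at_time T \<Omega> m\<^sub>2 T)) (at_time T \<Omega> m\<^sub>1 T - at_time T \<Omega> m\<^sub>2 T) \<ge> 0"
  using mS S1 S2 unfolding monotone_on_L2_def by blast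
 also have "L2_inner \<Omega> (S (at_time T \<Omega> m\<^sub>1 T) - S (at_time T \<Omega> m\<^sub>2 T)) (at_time T \<Omega> m\<^sub>1 T - at_time T \<Omega> m\<^sub>2 T)
   = L2_inner \<Omega> (\<lambda>x. S (at_time T \<Omega> m\<^sub>1 T) x - S (at_time T \<Omega> m\<^sub>2 T) x) (at_time T \<Omega> \<psi> T)"
  unfolding fun_diff_def
  by (rule L2_inner_cong[OF _ _ L2_D(1)[OF L2_diff[OF SL]] L2_D(1)[OF L2_diff[OF S1 S2]] sets_U])
   (use \<psi>T[OF T0(2)] in \<open>auto elim: eventually_mono\<close>)
 finally have Spos: "0 \<le> L2_inner \<Omega> (S (at_time T \<Omega> m\<^sub>1 T)) (at_time T \<Omega> \<psi> T) - L2_inner \<Omega> (S (at_time T \<Omega> m\<^sub>2 T)) (at_time T \<Omega> \<psi> T)"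
  unfolding L2_inner_diff(2)[OF SL continuous_repD(1)[OF Y_at_time[OF T \<psi>Y] T0(2)]] .
 have "(LINT t|\<mu> T. F m\<^sub>1 t (\<psi> t) - F m\<^sub>2 t (\<psi> t)) = (LINT t|\<mu> T. F m\<^sub>1 t (\<psi> t)) - (LINT t|\<mu> T. F m\<^sub>2 t (\<psi> t))"
  by (rule Bochner_Integration.integral_diff[OF H.pairing_integrable(1)[OF L2_Hm1_functional[OF FL(1)] \<psi>B] H.pairing_integrable(1)[OF L2_Hm1_functional[OF FL(2)] \<psi>B]])
 \<comment> \<open>Subtracting the Fokker-Planck equations cancels \<open>G\<close>. By
   \<open>dt\<close> and \<open>cross\<close> the left sides of the Hamilton-Jacobi-Bellman
   equations then differ by a nonpositive number, which equals the \<open>F\<close> term plus the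
   nonnegative \<open>S\<close> term.\<close>
 also have "\<dots> \<le> 0"
  using hj1[OF \<psi>0] hj2[OF \<psi>0] kfp1[OF \<phi>X] kfp2[OF \<phi>X] dt cross Spos by linarith
 finally have "(LINT t|\<mu> T. (F m\<^sub>1 t - F m\<^sub>2 t) (m\<^sub>1 t - m\<^sub>2 t)) \<le> 0"
  by (simp add: fun_diff_def \<psi>_def[abs_def])
 then have meq: "ae_eq T \<Omega> m\<^sub>1 m\<^sub>2" using mF X1 X2 unfolding strictly_monotone_on_X_def by blast

 \<comment> \<open>The right sides of the two Hamilton-Jacobi-Bellman equations now coincide,
   because \<open>F\<close> and \<open>S\<close> respect equality almost everywhere.\<close>
 have "ae_eq T \<Omega> u\<^sub>1 u\<^sub>2"
 proof (rule hamilton_jacobi_unique[OF assms(7) s1(1) s2(1) s1(6) s2(6) K1 K2])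
  fix \<eta> assume \<eta>: "\<eta> \<in> Y0_space T \<Omega>"
  then have Y: "\<eta> \<in> Y_space T \<Omega>" by (simp add: Y0_space_def)
  have "L2_inner \<Omega> (S (at_time T \<Omega> m\<^sub>1 T)) (at_time T \<Omega> \<eta> T) = L2_inner \<Omega> (S (at_time T \<Omega> m\<^sub>2 T)) (at_time T \<Omega> \<eta> T)"
   by (rule L2_operator_cong[OF S S2 S1 continuous_rep_unique[OF c1 c2 T meq T0(2)] continuous_repD(1)[OF Y_at_time[OF T Y] T0(2)]])
  moreover have "(LINT t|\<mu> T. F m\<^sub>1 t (\<eta> t)) = (LINT t|\<mu> T. F m\<^sub>2 t (\<eta> t))"
   by (rule source_cong[OF F X2 X1 meq Y_spaceD(1)[OF Y]])
  ultimately show "(LINT t|\<mu> T. time_deriv T \<Omega> \<eta> t (u\<^sub>1 t)) + (LINT t|\<mu> T. ham_form \<nu> u\<^sub>1 t (\<eta> t))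
    = (LINT t|\<mu> T. time_deriv T \<Omega> \<eta> t (u\<^sub>2 t)) + (LINT t|\<mu> T. ham_form \<nu> u\<^sub>2 t (\<eta> t))"
   using hj1[OF \<eta>] hj2[OF \<eta>] by simp
 qed
 with meq show ?thesis by simp
qed

end
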